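(* Let $N\ge2$, $1<p\le N$, $q>p-1$, $q_*=\frac{q}{q+1-p}$, let $\Omega\subset\mathbb{R}^N$ be a domain, let $F\subset\Omega$ be a relatively closed set such that $C_{1,q_*}(F)=0$, and let $\mu\in\mathfrak{M}^{q_*}(\Omega)$. (i) Let $p-1<q\le p$ and let $u$ be a locally renormalized solution of $-\Delta_p u+|\nabla u|^q=\mu$ in $\Omega\setminus F$. Then $u$ is a locally renormalized solution of $-\Delta_p u+|\nabla u|^q=\mu$ in $\Omega$. (ii) Let $q>p$ and let $u$ be a weak solution of $-\Delta_p u+|\nabla u|^q=\mu$ in $\Omega\setminus F$. Then $u$ is a weak solution of $-\Delta_p u+|\nabla u|^q=\mu$ in $\Omega$.
   Context: $\Delta_p u=\operatorname{div}(|\nabla u|^{p-2}\nabla u)$. $\mathfrak{M}(G)$ is the set of (signed) Radon measures in an open set $G$. Capacity: for $r>1$ and $K\subset\mathbb{R}^N$ compact, $C_{1,r}(K)=\inf\{\|\psi\|_{W^{1,r}(\mathbb{R}^N)}^r:\psi\in C_c^\infty(\mathbb{R}^N),\ \chi_K\le\psi\le1\}$, extended to capacitable sets in the classical way (in particular a relatively closed set has zero capacity iff all its compact subsets do). $\mathfrak{M}^r(G)=\{\mu\in\mathfrak{M}(G):\mu(K)=0\text{ for every compact }K\subset G\text{ with }C_{1,r}(K)=0\}$. Every $\mu\in\mathfrak{M}(G)$ decomposes uniquely as $\mu=\mu_0+\mu_s^+-\mu_s^-$ with $\mu_0\in\mathfrak{M}^p(G)$ and $\mu_s^\pm\ge0$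 concentrated on sets of zero $C_{1,p}$ capacity. Truncation: $T_k(s)=\max\{-k,\min\{k,s\}\}$. If $u$ is measurable, finite a.e., and $T_k(u)\in W^{1,p}_{loc}(G)$ for all $k>0$, then $\nabla u$ is defined a.e. by $\nabla T_k(u)=\chi_{\{|u|\le k\}}\nabla u$ for every $k>0$. Let $u$ be measurable and finite a.e. in $G$. Weak solution of $-\Delta_pu+|\nabla u|^q=\mu$ in $G$: $T_k(u)\in W^{1,p}_{loc}(G)$ for all $k>0$, $|\nabla u|^q\in L^1_{loc}(G)$, and the equation holds in the sense of distributions in $G$. Locally renormalized solution of $-\Delta_pu+|\nabla u|^q=\mu$ in $G$: $T_k(u)\in W^{1,p}_{loc}(G)$ for all $k>0$, $|\nabla u|^q\in L^1_{loc}(G)$, $|u|^{p-1}\in L^\sigma_{loc}(G)$ for all $\sigma\in[1,\frac{N}{N-p})$ (with $\frac{N}{N-p}=\infty$ if $p=N$), $|\nabla u|^{p-1}\in L^\tau_{loc}(G)$ for all $\tau\in[1,\frac{N}{N-1})$, and for every $h\in W^{1,\infty}(\mathbb{R})$ such that $h'$ has compact support (with limits $h(\pm\infty)$ at $\pm\infty$) and every $\varphi\in W^{1,m}(G)$, for some $m>N$, with compact support in $G$ and such that $h(u)\varphi\in W^{1,p}(G)$, $$\int_G\Big(|\nabla u|^{p-2}\nabla u\cdot\nabla(h(u)\varphi)+|\nabla u|^qh(u)\varphi\Big)dx=\int_G h(u)\varphi\,d\mu_0+h(\infty)\int_G\varphi\,d\mu_s^+-h(-\infty)\int_G\varphi\,d\mu_s^-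 ,$$ where in the integral against $\mu_0$ the $C_{1,p}$-quasicontinuous representative of $u$ is used. In $\Omega\setminus F$ the measure $\mu$ is replaced by its restriction. A set with zero $C_{1,q_*}$ capacity has zero Lebesgue measure, so $u$ is defined a.e. in $\Omega$ whatever values it is given on $F$. *)

theory Defs
  imports "HOL-Analysis.Analysis"
begin

text \<open>The space \<open>\<real>\<^sup>N\<close> is an arbitrary type \<open>'a\<close> of class \<open>euclidean_space\<close>, with \<open>N = DIM('a)\<close>.\<close>

subsection \<open>Smooth functions with compact support\<close>

primrec C_k :: "nat \<Rightarrow> ('a::euclidean_space \<Rightarrow> real) \<Rightarrow> bool" where
  "C_k 0 f \<longleftrightarrow> continuous_on UNIV f"
| "C_k (Suc k) f \<longleftrightarrow> (\<forall>x. f differentiable at x) \<and>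
     (\<forall>b\<in>Basis. C_k k (\<lambda>x. frechet_derivative f (at x) b))"

definition supp :: "('a::topological_space \<Rightarrow> real) \<Rightarrow> 'a set" where
  "supp f = closure {x. f x \<noteq> 0}"

text \<open>Elements of \<open>C\<^sub>c\<^sup>\<infinity>(G)\<close> are regarded as functions on the whole space, extended by zero.\<close>

definition test_fun :: "'a set \<Rightarrow> ('a::euclidean_space \<Rightarrow> real) \<Rightarrow> bool" where
  "test_fun G \<phi> \<longleftrightarrow> (\<forall>k. C_k k \<phi>) \<and> compact (supp \<phi>) \<and> supp \<phi> \<subseteq> G"

definition grad :: "('a::euclidean_space \<Rightarrow> real) \<Rightarrow> 'a \<Rightarrow> 'a" where
  "grad f x = (THE D. GDERIV f x :> D)"

subsection \<open>Lebesgue and Sobolev spaces\<close>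

definition in_Lp :: "real \<Rightarrow> 'a::euclidean_space set \<Rightarrow> ('a \<Rightarrow> 'b::euclidean_space) \<Rightarrow> bool" where
  "in_Lp r G f \<longleftrightarrow> f \<in> borel_measurable (lebesgue_on G) \<and>
     integrable (lebesgue_on G) (\<lambda>x. norm (f x) powr r)"

definition in_Lp_loc :: "real \<Rightarrow> 'a::euclidean_space set \<Rightarrow> ('a \<Rightarrow> 'b::euclidean_space) \<Rightarrow> bool" where
  "in_Lp_loc r G f \<longleftrightarrow> (\<forall>K. compact K \<and> K \<subseteq> G \<longrightarrow> in_Lp r K f)"

definition in_Linf :: "'a::euclidean_space set \<Rightarrow> ('a \<Rightarrow> 'b::euclidean_space) \<Rightarrow> bool" where
  "in_Linf G f \<longleftrightarrow> f \<in> borel_measurable (lebesgue_on G) \<and>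
     (\<exists>C. AE x in lebesgue_on G. norm (f x) \<le> C)"

definition weak_gradient ::
    "'a::euclidean_space set \<Rightarrow> ('a \<Rightarrow> real) \<Rightarrow> ('a \<Rightarrow> 'a) \<Rightarrow> bool" where
  "weak_gradient G f g \<longleftrightarrow> in_Lp_loc 1 G f \<and> in_Lp_loc 1 G g \<and>
     (\<forall>\<psi>. test_fun G \<psi> \<longrightarrow>
        (\<integral>x. f x *\<^sub>R grad \<psi> x \<partial>lebesgue_on G) = - (\<integral>x. \<psi> x *\<^sub>R g x \<partial>lebesgue_on G))"

definition in_W1p :: "real \<Rightarrow> 'a::euclidean_space set \<Rightarrow> ('a \<Rightarrow> real) \<Rightarrow> bool" where
  "in_W1p r G f \<longleftrightarrow> in_Lp r G f \<and> (\<exists>g. weak_gradient G f g \<and> in_Lp r G g)"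

definition in_W1p_loc :: "real \<Rightarrow> 'a::euclidean_space set \<Rightarrow> ('a \<Rightarrow> real) \<Rightarrow> bool" where
  "in_W1p_loc r G f \<longleftrightarrow> in_Lp_loc r G f \<and> (\<exists>g. weak_gradient G f g \<and> in_Lp_loc r G g)"

subsection \<open>Capacity\<close>

definition cap_compact :: "real \<Rightarrow> 'a::euclidean_space set \<Rightarrow> ennreal" where
  "cap_compact r K =
     (INF \<psi> \<in> {\<psi>. test_fun UNIV \<psi> \<and> (\<forall>x. indicator K x \<le> \<psi> x \<and> \<psi> x \<le> 1)}.
        \<integral>\<^sup>+x. ennreal (\<bar>\<psi> x\<bar> powr r + norm (grad \<psi> x) powr r) \<partial>lborel)"

text \<open>The classical extension: from compact sets to open sets by inner approximation, then to
  arbitrary sets by outer approximation. It agrees with \<open>cap_compact\<close> on compact sets.\<close>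

definition cap :: "real \<Rightarrow> 'a::euclidean_space set \<Rightarrow> ennreal" where
  "cap r E = (INF U \<in> {U. open U \<and> E \<subseteq> U}. SUP K \<in> {K. compact K \<and> K \<subseteq> U}. cap_compact r K)"

subsection \<open>Radon measures\<close>

text \<open>Locally finite Borel measures on an open subset of \<open>\<real>\<^sup>N\<close> are automatically regular.\<close>

definition pos_radon :: "'a::euclidean_space set \<Rightarrow> 'a measure \<Rightarrow> bool" where
  "pos_radon G M \<longleftrightarrow> sets M = sets (restrict_space borel G) \<and>
     (\<forall>K. compact K \<and> K \<subseteq> G \<longrightarrow> emeasure M K < \<infinity>)"

definition mutually_singular :: "'a measure \<Rightarrow> 'a measure \<Rightarrow> bool" where
  "mutually_singular M N \<longleftrightarrow>
     (\<exists>A\<in>sets M. emeasure M (space M - A) = 0 \<and> emeasure N A = 0)"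

text \<open>A signed Radon measure \<open>\<mu>\<close> need not be defined on sets that are not relatively compact, since
  both \<open>\<mu>\<^sup>+\<close> and \<open>\<mu>\<^sup>-\<close> may be infinite there. It is represented by its Jordan decomposition, the
  unique pair \<open>(\<mu>\<^sup>+, \<mu>\<^sup>-)\<close> of mutually singular positive Radon measures with \<open>\<mu> = \<mu>\<^sup>+ - \<mu>\<^sup>-\<close>.\<close>

type_synonym 'a signed = "'a measure \<times> 'a measure"

definition signed_radon :: "'a::euclidean_space set \<Rightarrow> 'a signed \<Rightarrow> bool" where
  "signed_radon G \<mu> \<longleftrightarrow>
     pos_radon G (fst \<mu>) \<and> pos_radon G (snd \<mu>) \<and> mutually_singular (fst \<mu>) (snd \<mu>)"

definition sval :: "'a signed \<Rightarrow> 'a set \<Rightarrow> real" where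
  "sval \<mu> B = measure (fst \<mu>) B - measure (snd \<mu>) B"

definition sintegral :: "'a signed \<Rightarrow> ('a \<Rightarrow> real) \<Rightarrow> real" where
  "sintegral \<mu> f = (\<integral>x. f x \<partial>fst \<mu>) - (\<integral>x. f x \<partial>snd \<mu>)"

definition srestrict :: "'a signed \<Rightarrow> 'a set \<Rightarrow> 'a signed" where
  "srestrict \<mu> A = (restrict_space (fst \<mu>) A, restrict_space (snd \<mu>) A)"

definition radon_cap :: "real \<Rightarrow> 'a::euclidean_space set \<Rightarrow> 'a signed \<Rightarrow> bool" where
  "radon_cap r G \<mu> \<longleftrightarrow> signed_radon G \<mu> \<and>
     (\<forall>K. compact K \<and> K \<subseteq> G \<and> cap_compact r K = 0 \<longrightarrow> sval \<mu> K = 0)"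

definition concentrated_on_null_cap :: "real \<Rightarrow> 'a::euclidean_space set \<Rightarrow> 'a measure \<Rightarrow> bool" where
  "concentrated_on_null_cap r G \<sigma> \<longleftrightarrow>
     (\<exists>E\<in>sets borel. E \<subseteq> G \<and> cap r E = 0 \<and> emeasure \<sigma> (G - E) = 0)"

text \<open>\<open>\<mu> = \<mu>\<^sub>0 + \<sigma>\<^sup>+ - \<sigma>\<^sup>-\<close>, where \<open>\<sigma>\<^sup>+\<close> and \<open>\<sigma>\<^sup>-\<close> are the positive and the negative part of the
  singular part; without their mutual singularity they would not be determined by \<open>\<mu>\<close>.\<close>

definition cap_decomposition ::
    "real \<Rightarrow> 'a::euclidean_space set \<Rightarrow> 'a signed \<Rightarrow> 'a signed \<Rightarrow> 'a measure \<Rightarrow> 'a measure \<Rightarrow> bool" where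
  "cap_decomposition p G \<mu> \<mu>0 \<sigma>p \<sigma>m \<longleftrightarrow> radon_cap p G \<mu>0 \<and>
     pos_radon G \<sigma>p \<and> concentrated_on_null_cap p G \<sigma>p \<and>
     pos_radon G \<sigma>m \<and> concentrated_on_null_cap p G \<sigma>m \<and> mutually_singular \<sigma>p \<sigma>m \<and>
     (\<forall>B\<in>sets borel. compact (closure B) \<and> closure B \<subseteq> G \<longrightarrow>
        sval \<mu> B = sval \<mu>0 B + measure \<sigma>p B - measure \<sigma>m B)"

subsection \<open>Truncations and the gradient of a function with Sobolev truncations\<close>

definition trunc :: "real \<Rightarrow> ereal \<Rightarrow> real" where
  "trunc k s = real_of_ereal (max (- ereal k) (min (ereal k) s))"

definition meas_finite_ae :: "'a::euclidean_space set \<Rightarrow> ('a \<Rightarrow> ereal) \<Rightarrow> bool" where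
  "meas_finite_ae G u \<longleftrightarrow> u \<in> borel_measurable (lebesgue_on G) \<and>
     (AE x in lebesgue_on G. \<bar>u x\<bar> \<noteq> \<infinity>)"

text \<open>The function \<open>g\<close> is (a version of) \<open>\<nabla>u\<close>; it is determined almost everywhere.\<close>

definition trunc_gradient ::
    "'a::euclidean_space set \<Rightarrow> ('a \<Rightarrow> ereal) \<Rightarrow> ('a \<Rightarrow> 'a) \<Rightarrow> bool" where
  "trunc_gradient G u g \<longleftrightarrow> g \<in> borel_measurable (lebesgue_on G) \<and>
     (\<forall>k>0. weak_gradient G (\<lambda>x. trunc k (u x)) (\<lambda>x. if \<bar>u x\<bar> \<le> ereal k then g x else 0))"

text \<open>Knowing only that the truncations are Sobolev functions, the quasicontinuous representative may
  a priori be infinite on a set of positive capacity, so it takes values in the extended reals.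
  It is determined up to sets of zero capacity; requiring it to be Borel restricts it only on such a
  set, and makes its Bochner integrals against Borel measures meaningful.\<close>

definition quasicont_rep ::
    "real \<Rightarrow> 'a::euclidean_space set \<Rightarrow> ('a \<Rightarrow> ereal) \<Rightarrow> ('a \<Rightarrow> ereal) \<Rightarrow> bool" where
  "quasicont_rep p G u v \<longleftrightarrow> v \<in> borel_measurable (restrict_space borel G) \<and>
     (AE x in lebesgue_on G. v x = u x) \<and>
     (\<forall>\<epsilon>>0. \<exists>U. open U \<and> U \<subseteq> G \<and> cap p U < \<epsilon> \<and> continuous_on (G - U) v)"

subsection \<open>Solutions\<close>

definition weak_solution ::
    "real \<Rightarrow> real \<Rightarrow> 'a::euclidean_space set \<Rightarrow> 'a signed \<Rightarrow> ('a \<Rightarrow> ereal) \<Rightarrow> bool" where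
  "weak_solution p q G \<mu> u \<longleftrightarrow> meas_finite_ae G u \<and>
     (\<forall>k>0. in_W1p_loc p G (\<lambda>x. trunc k (u x))) \<and>
     (\<exists>g. trunc_gradient G u g \<and>
        in_Lp_loc 1 G (\<lambda>x. norm (g x) powr q) \<and>
        (\<forall>\<phi>. test_fun G \<phi> \<longrightarrow>
           (\<integral>x. norm (g x) powr (p - 2) * (g x \<bullet> grad \<phi> x) + norm (g x) powr q * \<phi> x
              \<partial>lebesgue_on G) = sintegral \<mu> \<phi>))"

text \<open>Functions in \<open>W\<^sup>1\<^sup>,\<^sup>\<infinity>(\<real>)\<close> whose derivative has compact support. The continuous representative
  is taken, as \<open>h\<close> is composed with functions defined up to sets of zero capacity.\<close>

definition renorm_fun :: "(real \<Rightarrow> real) \<Rightarrow> bool" where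
  "renorm_fun h \<longleftrightarrow> continuous_on UNIV h \<and> in_Linf UNIV h \<and>
     (\<exists>h'. weak_gradient UNIV h h' \<and> in_Linf UNIV h' \<and>
        (\<exists>K. compact K \<and> (AE t in lebesgue. t \<notin> K \<longrightarrow> h' t = 0)))"

definition ext_fun :: "(real \<Rightarrow> real) \<Rightarrow> ereal \<Rightarrow> real" where
  "ext_fun h s = (case s of ereal t \<Rightarrow> h t | PInfty \<Rightarrow> Lim at_top h | MInfty \<Rightarrow> Lim at_bot h)"

text \<open>Since \<open>m > N\<close>, the test functions \<open>\<phi> \<in> W\<^sup>1\<^sup>,\<^sup>m(G)\<close> have a continuous representative, which is
  the one to be integrated against the measures. The function \<open>w\<close> is \<open>\<nabla>(h(u)\<phi>)\<close>.\<close>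

definition locally_renormalized_solution ::
    "real \<Rightarrow> real \<Rightarrow> 'a::euclidean_space set \<Rightarrow> 'a signed \<Rightarrow> ('a \<Rightarrow> ereal) \<Rightarrow> bool" where
  "locally_renormalized_solution p q G \<mu> u \<longleftrightarrow> meas_finite_ae G u \<and>
     (\<forall>k>0. in_W1p_loc p G (\<lambda>x. trunc k (u x))) \<and>
     (\<forall>s\<ge>1. (p < real DIM('a) \<longrightarrow> s < real DIM('a) / (real DIM('a) - p)) \<longrightarrow>
        in_Lp_loc s G (\<lambda>x. real_of_ereal \<bar>u x\<bar> powr (p - 1))) \<and>
     (\<exists>g v \<mu>0 \<sigma>p \<sigma>m. trunc_gradient G u g \<and> quasicont_rep p G u v \<and>
        cap_decomposition p G \<mu> \<mu>0 \<sigma>p \<sigma>m \<and>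
        in_Lp_loc 1 G (\<lambda>x. norm (g x) powr q) \<and>
        (\<forall>t\<ge>1. t < real DIM('a) / (real DIM('a) - 1) \<longrightarrow>
           in_Lp_loc t G (\<lambda>x. norm (g x) powr (p - 1))) \<and>
        (\<forall>h \<phi> m w.
           renorm_fun h \<and> real DIM('a) < m \<and>
           continuous_on UNIV \<phi> \<and> compact (supp \<phi>) \<and> supp \<phi> \<subseteq> G \<and> in_W1p m G \<phi> \<and>
           in_W1p p G (\<lambda>x. ext_fun h (u x) * \<phi> x) \<and>
           weak_gradient G (\<lambda>x. ext_fun h (u x) * \<phi> x) w \<longrightarrow>
           (\<integral>x. norm (g x) powr (p - 2) * (g x \<bullet> w x)
                + norm (g x) powr q * (ext_fun h (u x) * \<phi> x) \<partial>lebesgue_on G)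
           = sintegral \<mu>0 (\<lambda>x. ext_fun h (v x) * \<phi> x)
             + ext_fun h \<infinity> * (\<integral>x. \<phi> x \<partial>\<sigma>p) - ext_fun h (-\<infinity>) * (\<integral>x. \<phi> x \<partial>\<sigma>m)))"

end

theory Submission
  imports "HOL-Computational_Algebra.Polynomial" Defs
begin

text \<open>A set \<open>F\<close> of zero \<open>C\<^sub>1\<^sub>,\<^sub>q\<^sub>*\<close> capacity admits smooth functions \<open>\<eta>\<^sub>n\<close> equal to 1 near \<open>F\<close>, tending to 0
off \<open>F\<close>, with \<open>\<integral> \<bar>\<nabla>\<eta>\<^sub>n\<bar>\<^sup>q\<^sup>* \<rightarrow> 0\<close>. Testing the equation with powers of \<open>\<zeta> (1 - \<eta>\<^sub>n)\<close> and
absorbing the \<open>p\<close>-Laplacian by Young's inequality shows that \<open>\<bar>\<nabla>u\<bar>\<^sup>q\<close> is integrable up to \<open>F\<close>.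
Since \<open>q / (p - 1)\<close> and \<open>q\<^sub>*\<close> are conjugate, the error term that \<open>\<nabla>\<eta>\<^sub>n\<close> causes in the equation for
\<open>\<phi> (1 - \<eta>\<^sub>n)\<close> then tends to zero; on the other side \<open>\<mu>\<close> and the parts of its decomposition do not charge \<open>F\<close>.

For renormalized solutions the test \<open>T\<^sub>k(u) \<zeta> (1 - \<eta>\<^sub>n)\<close> moreover bounds the energy of \<open>T\<^sub>k(u)\<close> by a multiple of
\<open>k\<close>. A Sobolev inequality on balls turns this into the decay of the level sets of \<open>u\<close> and \<open>\<nabla>u\<close>, hence into
the integrability of their powers. The gradient \<open>w\<close> of \<open>h(u) \<phi>\<close> is never computed: it suffices that it is
bounded by a multiple of \<open>\<bar>\<nabla>T\<^sub>R(u)\<bar> + \<bar>\<nabla>\<phi>\<bar>\<close>, which is read off the increments of \<open>h(u) \<phi>\<close>.\<close>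


text \<open>Nothing is known about \<open>u\<close> near \<open>F\<close>, so each estimate uses
  test functions vanishing near \<open>F\<close> and must be uniform in \<open>n\<close>; Fatou's
  lemma then removes the cutoffs, since a set of zero capacity is Lebesgue null. The threshold
  \<open>q = p\<close> enters twice. If \<open>q \<le> p\<close>, then \<open>p \<le> qs\<close>, so
  \<open>F\<close> has zero \<open>p\<close>-capacity too and a quasicontinuous representative off
  \<open>F\<close> remains one on \<open>\<Omega>\<close>. If \<open>q > p\<close>, the
  \<open>p\<close>-th power of the gradient is locally integrable because the \<open>q\<close>-th
  is; for \<open>q \<le> p\<close> only the energy of truncations is controlled, and the bound must
  come from the renormalized equation. Truncations cross \<open>F\<close> as Sobolev functions
  because they are bounded: their product with \<open>grad (\<eta> n)\<close> tends to 0 in the mean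
  on compact sets. The integrability of the powers of \<open>u\<close> and of its gradient is not
  inherited from the smaller set; it is derived anew from the energy on balls of
  \<open>\<Omega>\<close>. As \<open>u\<close> may take any values on \<open>F\<close>, both notions
  of solution are shown to depend on \<open>u\<close> only up to null sets, and \<open>u\<close> and
  its gradient are set to 0 on \<open>F\<close> to be measurable on the whole space.\<close>

abbreviation lebesgue_integral (binder "Leb " 10) where "lebesgue_integral f \<equiv> integral\<^sup>L lebesgue f"
abbreviation lebesgue_nn_integral (binder "Leb+ " 10) where "lebesgue_nn_integral f \<equiv> nn_integral lebesgue f"
abbreviation borel_integral (binder "Bor " 10) where "borel_integral f \<equiv> integral\<^sup>L lborel f"
abbreviation borel_nn_integral (binder "Bor+ " 10) where "borel_nn_integral f \<equiv> nn_integral lborel f"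
text \<open>The exceptional set is taken in the whole space, so that statements on different sets
  \<open>G\<close> combine without a change of measure.\<close>

abbreviation "ae_on G P \<equiv> AE x in lebesgue. x \<in> G \<longrightarrow> P x"
text \<open>The integral of \<open>\<gamma>\<close> along the segment from \<open>x\<close> to
  \<open>x + z\<close>. It is extended-real valued because for fixed \<open>z\<close> it may be
  infinite at some points \<open>x\<close>, which are only later seen to be negligible.\<close>

abbreviation "segint \<gamma> x z \<equiv> Bor+ s. indicator {0..1::real} s * ennreal (\<gamma> (x + s *\<^sub>R z))"
abbreviation "lmeas \<equiv> borel_measurable lebesgue"
abbreviation "bmeas \<equiv> borel_measurable borel"

lemmas integrable_le = Bochner_Integration.integrable_bound

section \<open>Smooth functions\<close>

definition smooth :: "('a::euclidean_space \<Rightarrow> real) \<Rightarrow> bool" where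
 "smooth f \<longleftrightarrow> (\<forall>k. C_k k f)"

lemma C_k_SucI:
 assumes "\<And>x. (f has_derivative f' x) (at x)" "\<And>b. b \<in> Basis \<Longrightarrow> C_k k (\<lambda>x. f' x b)"
 shows "C_k (Suc k) f"
proof -
 have "frechet_derivative f (at x) = f' x" for x
  using frechet_derivative_at[OF assms(1)] by metis
 then show ?thesis
  using assms by (auto simp: differentiable_def) 
qed

lemma C_k_SucD:
 assumes "C_k (Suc k) f"
 shows "(f has_derivative frechet_derivative f (at x)) (at x)"
  "b \<in> Basis \<Longrightarrow> C_k k (\<lambda>x. frechet_derivative f (at x) b)"
 using assms by (auto simp: frechet_derivative_works[symmetric])

declare C_k.simps(2)[simp del]

lemma C_k_pred: "C_k (Suc k) f \<Longrightarrow> C_k k f"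
proof (induction k arbitrary: f)
 case 0
 then have "f differentiable at x" for x
  by (auto simp: C_k.simps)
 then show ?case
  by (simp add: continuous_at_imp_continuous_on differentiable_imp_continuous_within)
next
 case (Suc k)
 then show ?case
  by (subst C_k.simps) (auto simp: C_k.simps(2)[of "Suc k"])
qed

lemma C_k_const: "C_k k (\<lambda>x. c)"
proof (induction k arbitrary: c)
 case (Suc k)
 show ?case by (rule C_k_SucI[where f'="\<lambda>x h. 0"]) (auto intro: Suc)
qed auto

lemma C_k_add: "C_k k f \<Longrightarrow> C_k k g \<Longrightarrow> C_k k (\<lambda>x. f x + g x)"
proof (induction k arbitrary: f g)
 case (Suc k)
 show ?case
  by (rule C_k_SucI[where f'="\<lambda>x h. frechet_derivative f (at x) h + frechet_derivative g (at x) h"])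
   (auto intro!: has_derivative_add Suc.IH C_k_SucD Suc.prems)
qed (auto intro: continuous_intros)

lemma C_k_mult: "C_k k f \<Longrightarrow> C_k k g \<Longrightarrow> C_k k (\<lambda>x. f x * g x)"
proof (induction k arbitrary: f g)
 case (Suc k)
 show ?case
  by (rule C_k_SucI[where f'="\<lambda>x h. f x * frechet_derivative g (at x) h + frechet_derivative f (at x) h * g x"])
   (auto intro!: has_derivative_mult C_k_add Suc.IH C_k_SucD Suc.prems C_k_pred[OF Suc.prems(1)]
     C_k_pred[OF Suc.prems(2)])
qed (auto intro: continuous_intros)

text \<open>A sequence closed under differentiation replaces the higher chain rule: differentiating
  \<open>F n\<close> after \<open>f\<close> gives \<open>F (Suc n)\<close> after \<open>f\<close>
  times a derivative of \<open>f\<close>, and the induction hypothesis covers every index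
  \<open>n\<close>.\<close>

lemma C_k_compose:
 assumes F: "\<And>n t. (F n has_real_derivative F (Suc n) t) (at t)"
 shows "C_k k f \<Longrightarrow> C_k k (\<lambda>x. F n (f x))"
proof (induction k arbitrary: f n)
 case 0
 have "continuous_on UNIV (F n)"
  using F by (auto intro!: continuous_at_imp_continuous_on DERIV_isCont)
 then show ?case using 0
  by (auto intro: continuous_on_compose2)
next
 case (Suc k)
 show ?case
 proof (rule C_k_SucI[where f'="\<lambda>x h. F (Suc n) (f x) * frechet_derivative f (at x) h"])
  show "((\<lambda>x. F n (f x)) has_derivative (\<lambda>h. F (Suc n) (f x) * frechet_derivative f (at x) h)) (at x)" for x
   using has_derivative_compose[OF C_k_SucD(1)[OF Suc.prems] F[unfolded has_field_derivative_def], where x=x]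
   by (simp add: mult.commute)
  show "C_k k (\<lambda>x. F (Suc n) (f x) * frechet_derivative f (at x) b)" if "b \<in> Basis" for b
   using Suc that by (intro C_k_mult Suc.IH C_k_SucD(2)) (auto intro: C_k_pred)
 qed
qed

lemma smooth_const: "smooth (\<lambda>x. c)"
 and smooth_add: "smooth f \<Longrightarrow> smooth g \<Longrightarrow> smooth (\<lambda>x. f x + g x)"
 and smooth_mult: "smooth f \<Longrightarrow> smooth g \<Longrightarrow> smooth (\<lambda>x. f x * g x)"
 by (auto simp: smooth_def C_k_const C_k_add C_k_mult)

lemma smooth_minus: "smooth f \<Longrightarrow> smooth (\<lambda>x. - f x)"
 using smooth_mult[OF smooth_const[of "-1"]] by auto

lemma smooth_diff: "smooth f \<Longrightarrow> smooth g \<Longrightarrow> smooth (\<lambda>x. f x - g x)"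
 using smooth_add[OF _ smooth_minus] by auto

lemma smooth_power: "smooth f \<Longrightarrow> smooth (\<lambda>x. f x ^ n)"
 by (induction n) (auto intro: smooth_const smooth_mult)

lemma smooth_sum: "(\<And>i. i \<in> I \<Longrightarrow> smooth (f i)) \<Longrightarrow> smooth (\<lambda>x. \<Sum>i\<in>I. f i x)"
 by (induction I rule: infinite_finite_induct) (auto intro: smooth_const smooth_add)

lemma smooth_prod: "(\<And>i. i \<in> I \<Longrightarrow> smooth (f i)) \<Longrightarrow> smooth (\<lambda>x. \<Prod>i\<in>I. f i x)"
 by (induction I rule: infinite_finite_induct) (auto intro: smooth_const smooth_mult)

lemma smooth_inner: "smooth (\<lambda>x. x \<bullet> c)"
proof -
 have "C_k k (\<lambda>x. x \<bullet> c)" for k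
 proof (cases k)
  case (Suc k)
  show ?thesis unfolding Suc
   by (rule C_k_SucI[where f'="\<lambda>x h. h \<bullet> c"]) (auto intro: C_k_const derivative_eq_intros)
 qed (auto intro: continuous_intros)
 then show ?thesis by (auto simp: smooth_def)
qed

lemma smooth_norm_square: "smooth (\<lambda>x::'a::euclidean_space. (norm (x - a))\<^sup>2)"
proof -
 have "(norm (x - a))\<^sup>2 = (\<Sum>b\<in>Basis. (x \<bullet> b - a \<bullet> b) ^ 2)" for x
  unfolding power2_norm_eq_inner
  by (subst euclidean_inner) (simp add: inner_diff_left power2_eq_square)
 then show ?thesis
  by (auto intro!: smooth_sum smooth_power smooth_diff smooth_inner smooth_const)
qed

lemma smooth_differentiable: "smooth f \<Longrightarrow> f differentiable at x"
 unfolding smooth_def by (metis C_k.simps(2))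

text \<open>\<open>grad\<close> is a definite description, so both existence and uniqueness have to
  be shown; the gradient is assembled from the values of the derivative on the basis.\<close>

lemma smooth_gderiv:
 fixes f :: "'a::euclidean_space \<Rightarrow> real"
 assumes "smooth f"
 shows "GDERIV f x :> grad f x"
proof -
 let ?f' = "frechet_derivative f (at x)"
 define D where "D = (\<Sum>b\<in>Basis. ?f' b *\<^sub>R b)"
 have d: "(f has_derivative ?f') (at x)"
  using smooth_differentiable[OF assms] frechet_derivative_works by blast
 have "?f' h = h \<bullet> D" for h
 proof -
  have "?f' h = ?f' (\<Sum>b\<in>Basis. (h \<bullet> b) *\<^sub>R b)" by (simp add: euclidean_representation)
  also have "\<dots> = (\<Sum>b\<in>Basis. (h \<bullet> b) * ?f' b)"
   using has_derivative_linear[OF d] by (simp add: linear_sum linear_scale)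
  finally show ?thesis by (simp add: D_def inner_sum_right mult.commute)
 qed
 then have "?f' = (\<lambda>h. h \<bullet> D)" by blast
 then have D: "GDERIV f x :> D" using d by (simp add: gderiv_def)
 have "D' = D" if "GDERIV f x :> D'" for D'
 proof -
  have "(\<lambda>h. h \<bullet> D') = (\<lambda>h. h \<bullet> D)"
   using that D unfolding gderiv_def by (rule has_derivative_unique)
  then have "h \<bullet> D' = h \<bullet> D" for h by (rule fun_cong)
  then show ?thesis by (metis inner_commute vector_eq_rdot)
 qed
 with D show ?thesis unfolding grad_def by (metis theI)
qed

lemma grad_eqI: 
 assumes "GDERIV f x :> D"
 shows "grad f x = D"
 unfolding grad_def
proof (rule the_equality, rule assms)
 fix D' assume "GDERIV f x :> D'"
 then have "(\<lambda>h. h \<bullet> D') = (\<lambda>h. h \<bullet> D)"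
  using assms unfolding gderiv_def by (rule has_derivative_unique)
 then have "h \<bullet> D' = h \<bullet> D" for h by (rule fun_cong)
 then show "D' = D" by (metis inner_commute vector_eq_rdot)
qed

lemma smooth_continuous: "smooth f \<Longrightarrow> continuous_on UNIV f"
 by (meson C_k.simps(1) smooth_def)

lemma grad_inner_frechet:
 assumes "smooth f"
 shows "grad f x \<bullet> h = frechet_derivative f (at x) h"
 using smooth_gderiv[OF assms, of x] frechet_derivative_at unfolding gderiv_def
 by (metis inner_commute)

lemma smooth_grad_component:
 assumes "smooth f" "b \<in> Basis"
 shows "smooth (\<lambda>x. grad f x \<bullet> b)"
 using assms unfolding smooth_def grad_inner_frechet[OF assms(1)] by (metis C_k.simps(2))

lemma smooth_grad_continuous:
 assumes "smooth f"
 shows "continuous_on UNIV (grad f)"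
proof -
 have eq: "(\<lambda>x. \<Sum>b\<in>Basis. (grad f x \<bullet> b) *\<^sub>R b) = grad f"
  by (simp add: euclidean_representation)
 have "continuous_on UNIV (\<lambda>x. \<Sum>b\<in>Basis. (grad f x \<bullet> b) *\<^sub>R b)"
  using smooth_grad_component[OF assms] by (auto intro!: continuous_intros smooth_continuous)
 then show ?thesis unfolding eq .
qed

lemma grad_mult:
 "smooth f \<Longrightarrow> smooth g \<Longrightarrow> grad (\<lambda>x. f x * g x) x = f x *\<^sub>R grad g x + g x *\<^sub>R grad f x"
 by (intro grad_eqI GDERIV_mult smooth_gderiv)

lemma grad_diff:
 "smooth f \<Longrightarrow> smooth g \<Longrightarrow> grad (\<lambda>x. f x - g x) x = grad f x - grad g x"
 by (intro grad_eqI GDERIV_diff smooth_gderiv)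

lemma grad_const: "grad (\<lambda>x. c) x = 0"
 by (intro grad_eqI GDERIV_const)

lemma grad_power:
 assumes "smooth f"
 shows "grad (\<lambda>x. f x ^ n) x = (real n * f x ^ (n - 1)) *\<^sub>R grad f x"
proof -
 have "DERIV (\<lambda>t. t ^ n) (f x) :> real n * f x ^ (n - 1)"
  using DERIV_pow[of n "f x"] by simp
 then show ?thesis
  by (intro grad_eqI GDERIV_DERIV_compose smooth_gderiv assms)
qed

lemma grad_zero_outside:
 assumes "x \<notin> supp f"
 shows "grad f x = 0"
proof (rule grad_eqI)
 have "open (- supp f)" by (auto simp: supp_def)
 moreover have "f y = 0" if "y \<in> - supp f" for y
  using that closure_subset[of "{x. f x \<noteq> 0}"] by (auto simp: supp_def)
 ultimately have "((\<lambda>x. 0) has_derivative (\<lambda>h. h \<bullet> 0)) (at x) \<Longrightarrow> (f has_derivative (\<lambda>h. h \<bullet> 0)) (at x)"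
  using assms by (intro has_derivative_transform_within_open[of "\<lambda>x. 0" _ x _ "- supp f" f]) auto
 then show "GDERIV f x :> 0"
  unfolding gderiv_def by simp
qed

lemma supp_mem: "f x \<noteq> 0 \<Longrightarrow> x \<in> supp f"
 using closure_subset[of "{x. f x \<noteq> 0}"] by (auto simp: supp_def)

lemma supp_subsetI:
 assumes "closed S" "\<And>x. f x \<noteq> 0 \<Longrightarrow> x \<in> S"
 shows "supp f \<subseteq> S"
 using assms unfolding supp_def by (intro closure_minimal) auto

lemma closed_supp: "closed (supp f)" by (simp add: supp_def)

lemma compact_supp_subset: "compact K \<Longrightarrow> supp f \<subseteq> K \<Longrightarrow> compact (supp f)"
 by (metis closed_supp compact_Int_closed inf.absorb_iff2)

lemma test_fun_smooth: "test_fun G f \<Longrightarrow> smooth f"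
 by (auto simp: test_fun_def smooth_def)

lemma test_fun_iff: "test_fun G f \<longleftrightarrow> smooth f \<and> compact (supp f) \<and> supp f \<subseteq> G"
 by (auto simp: test_fun_def smooth_def)

lemma compact_supp_mult:
 assumes "compact (supp f)"
 shows "compact (supp (\<lambda>x. f x * g x))" "supp (\<lambda>x. f x * g x) \<subseteq> supp f"
proof -
 show "supp (\<lambda>x. f x * g x) \<subseteq> supp f" by (rule supp_subsetI[OF closed_supp]) (auto intro: supp_mem)
 then show "compact (supp (\<lambda>x. f x * g x))"
  by (rule compact_supp_subset[OF assms(1)])
qed

lemma test_fun_mult:
 assumes "test_fun G f" "smooth g"
 shows "test_fun G (\<lambda>x. f x * g x)" "test_fun G (\<lambda>x. g x * f x)"
proof -
 show "test_fun G (\<lambda>x. f x * g x)"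
  using assms compact_supp_mult[of f g] by (auto simp: test_fun_iff intro: smooth_mult)
 then show "test_fun G (\<lambda>x. g x * f x)" by (simp add: mult.commute)
qed

lemma test_fun_mono: "test_fun G f \<Longrightarrow> G \<subseteq> G' \<Longrightarrow> test_fun G' f"
 by (auto simp: test_fun_def)

lemma bounded_on_supp:
 assumes "continuous_on UNIV (g :: 'a::euclidean_space \<Rightarrow> 'b::real_normed_vector)" "compact K"
  "\<And>x. x \<notin> K \<Longrightarrow> g x = 0"
 obtains B where "B > 0" "\<And>x. norm (g x) \<le> B"
proof -
 have "compact (g ` K)" using assms compact_continuous_image continuous_on_subset by blast
 then obtain B where "B>0" "\<forall>x\<in>g`K. norm x \<le> B"
  using bounded_pos compact_imp_bounded by blast
 then show ?thesis using assms(3) by (metis imageI less_imp_le norm_zero that)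
qed

lemma test_fun_bounds:
 assumes "test_fun G \<psi>"
 obtains B where "B > 0" "\<And>x. \<bar>\<psi> x\<bar> \<le> B" "\<And>x. norm (grad \<psi> x) \<le> B"
proof -
 have s: "smooth \<psi>" "compact (supp \<psi>)" using assms by (auto simp: test_fun_iff)
 obtain B1 where "B1 > 0" "\<And>x. norm (\<psi> x) \<le> B1"
  using bounded_on_supp[OF smooth_continuous[OF s(1)] s(2)] supp_mem by metis
 moreover obtain B2 where "B2 > 0" "\<And>x. norm (grad \<psi> x) \<le> B2"
  using bounded_on_supp[OF smooth_grad_continuous[OF s(1)] s(2)] grad_zero_outside by metis
 ultimately show ?thesis by (intro that[of "max B1 B2"]) (auto simp: le_max_iff_disj)
qed

lemma smooth_translate:
 assumes "smooth f"
 shows "smooth (\<lambda>x. f (x + a))"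
proof -
 have "C_k k f \<Longrightarrow> C_k k (\<lambda>x. f (x + a))" for k and f :: "'a \<Rightarrow> real"
 proof (induction k arbitrary: f)
  case 0
  then show ?case by (auto intro!: continuous_intros elim!: continuous_on_compose2)
 next
  case (Suc k)
  show ?case
  proof (rule C_k_SucI[where f'="\<lambda>x. frechet_derivative f (at (x + a))"])
   show "((\<lambda>x. f (x + a)) has_derivative frechet_derivative f (at (x + a))) (at x)" for x
    by (rule has_derivative_compose[of "\<lambda>x. x + a" "\<lambda>h. h" x UNIV f, OF _ C_k_SucD(1)[OF Suc.prems]])
     (auto intro!: derivative_eq_intros)
  qed (use Suc C_k_SucD(2) in blast)
 qed
 then show ?thesis using assms by (auto simp: smooth_def)
qed

lemma grad_translate:
 assumes "smooth f"
 shows "grad (\<lambda>x. f (x + a)) x = grad f (x + a)"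
 by (rule grad_eqI) (use smooth_gderiv[OF assms, of "x+a"] in \<open>auto simp: gderiv_def
  intro!: has_derivative_compose[of "\<lambda>x. x + a" "\<lambda>h. h" x UNIV f] derivative_eq_intros\<close>)

text \<open>All derivatives of \<open>exp (-1/t)\<close> have the form \<open>P (1/t) * exp (-1/t)\<close> with a polynomial \<open>P\<close>.\<close>

primrec flat_poly :: "nat \<Rightarrow> real poly" where
 "flat_poly 0 = 1"
| "flat_poly (Suc n) = [:0, 0, 1:] * (flat_poly n - pderiv (flat_poly n))"

definition flat :: "nat \<Rightarrow> real \<Rightarrow> real" where
 "flat n t = (if t > 0 then poly (flat_poly n) (1 / t) * exp (- 1 / t) else 0)"

lemma poly_exp_tendsto_0: "((\<lambda>y::real. poly P y * exp (- y)) \<longlongrightarrow> 0) at_top"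
proof -
 have "((\<lambda>y. \<Sum>i\<le>degree P. coeff P i * (y ^ i / exp y)) \<longlongrightarrow> (\<Sum>i\<le>degree P. coeff P i * 0)) at_top"
  by (intro tendsto_intros tendsto_power_div_exp_0)
 moreover have "(\<Sum>i\<le>degree P. coeff P i * (y ^ i / exp y)) = poly P y * exp (- y)" for y
  by (simp add: poly_altdef sum_distrib_right exp_minus divide_inverse mult.assoc)
 ultimately show ?thesis by simp
qed

text \<open>As \<open>y = 1 / t\<close> has derivative \<open>- y^2\<close>, the derivative of
  \<open>P(y) exp (- y)\<close> is \<open>y^2 (P(y) - P'(y)) exp (- y)\<close>, which is the
  recursion of \<open>flat_poly\<close>. At 0 the quotient from the right is
  \<open>y P(y) exp (- y)\<close> with \<open>y\<close> tending to infinity.\<close>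

lemma flat_deriv: "(flat n has_real_derivative flat (Suc n) t) (at t)"
proof -
 consider "t < 0" | "t = 0" | "t > 0" by linarith
 then show ?thesis
 proof cases
  case 1
  have "((\<lambda>t. 0) has_real_derivative flat (Suc n) t) (at t)"
   using 1 by (auto simp: flat_def)
  then show ?thesis
   by (rule has_field_derivative_transform_within_open[where S="{..<0}"]) (use 1 in \<open>auto simp: flat_def\<close>)
 next
  case 3
  have "((\<lambda>t. poly (flat_poly n) (1 / t) * exp (- 1 / t)) has_real_derivative flat (Suc n) t) (at t)"
   using 3 by (auto intro!: derivative_eq_intros DERIV_chain2[where f="poly (flat_poly n)"] poly_DERIV
    simp: flat_def field_simps power2_eq_square)
  then show ?thesis
   by (rule has_field_derivative_transform_within_open[where S="{0<..}"]) (use 3 in \<open>auto simp: flat_def\<close>)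
 next
  case 2
  have "((\<lambda>h. poly (pCons 0 (flat_poly n)) (inverse h) * exp (- inverse h)) \<longlongrightarrow> 0) (at_right 0)"
   by (rule filterlim_compose[OF poly_exp_tendsto_0 filterlim_inverse_at_top_right])
  then have r: "((\<lambda>h. flat n h / h) \<longlongrightarrow> 0) (at_right 0)"
   by (rule Lim_transform_eventually)
    (auto simp: flat_def eventually_at_filter field_simps)
  have l: "((\<lambda>h. flat n h / h) \<longlongrightarrow> 0) (at_left 0)"
   by (rule Lim_transform_eventually[OF tendsto_const]) (auto simp: flat_def eventually_at_filter)
  have "((\<lambda>h. flat n h / h) \<longlongrightarrow> 0) (at 0)"
   using l r by (rule filterlim_split_at)
  then show ?thesis using 2 by (simp add: DERIV_def flat_def)
 qed
qed

text \<open>With \<open>E(s) = exp (1 - 1 / s)\<close> for \<open>s > 0\<close> and 0 otherwise,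
  this is \<open>E (1 - E (1 - t))\<close>. The inner value is 0 for \<open>t \<ge> 1\<close> and at
  least 1 for \<open>t \<le> 0\<close>, so the outer one is \<open>E 1 = 1\<close> or 0
  respectively. Being a composition of flat functions, it is smooth by
  \<open>C_k_compose\<close>.\<close>

definition step :: "real \<Rightarrow> real" where
 "step t = exp 1 * flat 0 (1 - exp 1 * flat 0 (1 - t))"

lemma flat_0: "flat 0 t = (if t > 0 then exp (- 1 / t) else 0)"
 by (simp add: flat_def)

lemma smooth_step:
 assumes "smooth f"
 shows "smooth (\<lambda>x. step (f x))"
proof -
 have fl: "smooth (\<lambda>x. flat 0 (g x))" if "smooth g" for g :: "'a \<Rightarrow> real"
  using C_k_compose[of flat, OF flat_deriv] that by (auto simp: smooth_def)
 show ?thesis unfolding step_def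
  by (intro smooth_mult smooth_const fl smooth_diff assms)
qed

lemma step_bounds: "0 \<le> step t" "step t \<le> 1"
proof -
 have nn: "0 \<le> flat 0 s" for s by (simp add: flat_0)
 then show "0 \<le> step t" by (simp add: step_def)
 have "flat 0 s \<le> exp (- 1)" if "s \<le> 1" for s
  using that by (auto simp: flat_0 field_simps)
 from this[of "1 - exp 1 * flat 0 (1 - t)"] nn have "flat 0 (1 - exp 1 * flat 0 (1 - t)) \<le> exp (-1)"
  by simp
 then have "exp 1 * flat 0 (1 - exp 1 * flat 0 (1 - t)) \<le> exp 1 * exp (-1)" by simp
 then show "step t \<le> 1" by (simp add: step_def mult_exp_exp)
qed

lemma step_eq_1: "t \<ge> 1 \<Longrightarrow> step t = 1"
 by (simp add: step_def flat_0 mult_exp_exp)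

lemma step_eq_0:
 assumes "t \<le> 0"
 shows "step t = 0"
proof -
 have "exp (-1) \<le> exp (- 1 / (1 - t))" using assms by (simp add: field_simps)
 then have "exp 1 * exp (-1) \<le> exp 1 * flat 0 (1 - t)" using assms by (simp add: flat_0)
 then show ?thesis by (simp add: step_def flat_0[of "1 - _"] mult_exp_exp)
qed

section \<open>Smooth cutoff functions\<close>

lemma smooth_cutoff_ball:
 fixes a :: "'a::euclidean_space"
 assumes "r > 0"
 obtains \<psi> where "smooth \<psi>" "\<And>x. 0 \<le> \<psi> x" "\<And>x. \<psi> x \<le> 1" "\<And>x. x \<in> ball a r \<Longrightarrow> \<psi> x = 1"
  "\<And>x. x \<notin> cball a (2 * r) \<Longrightarrow> \<psi> x = 0"
proof
 \<comment> \<open>The argument of \<open>step\<close> is at least 1 when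
   \<open>norm (x - a) \<le> r\<close> and at most 0 when \<open>norm (x - a) \<ge> 2 * r\<close>;
   the squares keep it smooth at \<open>a\<close>.\<close>
 let ?\<psi> = "\<lambda>x. step ((4 * r^2 - (norm (x - a))^2) * (1 / (3 * r^2)))"
 show "smooth ?\<psi>" by (intro smooth_step smooth_mult smooth_const smooth_diff smooth_norm_square)
 show "0 \<le> ?\<psi> x" "?\<psi> x \<le> 1" for x by (auto simp: step_bounds)
 show "?\<psi> x = 1" if "x \<in> ball a r" for x
 proof (rule step_eq_1)
  have "(norm (x - a))^2 \<le> r^2" using that by (intro power_mono) (auto simp: dist_norm norm_minus_commute)
  then show "1 \<le> (4 * r^2 - (norm (x - a))^2) * (1 / (3 * r^2))" using assms by (simp add: field_simps)
 qed
 show "?\<psi> x = 0" if "x \<notin> cball a (2 * r)" for x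
 proof (rule step_eq_0)
  have "(2*r)^2 \<le> (norm (x - a))^2" using that assms by (intro power_mono) (auto simp: dist_norm norm_minus_commute)
  then show "(4 * r^2 - (norm (x - a))^2) * (1 / (3 * r^2)) \<le> 0" using assms
   by (intro mult_nonpos_nonneg) (auto simp: power_mult_distrib)
 qed
qed

lemma smooth_cutoff:
 fixes C U :: "'a::euclidean_space set"
 assumes "compact C" "open U" "C \<subseteq> U"
 obtains \<psi> V where "test_fun U \<psi>" "\<And>x. 0 \<le> \<psi> x" "\<And>x. \<psi> x \<le> 1" "open V" "C \<subseteq> V" "V \<subseteq> U"
  "\<And>x. x \<in> V \<Longrightarrow> \<psi> x = 1"
proof -
 have "\<exists>r>0. cball a (2 * r) \<subseteq> U" if "a \<in> C" for a
 proof -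
  have "a \<in> U" using assms that by auto
  then obtain e where "e > 0" "cball a e \<subseteq> U"
   using open_contains_cball[THEN iffD1, OF assms(2)] by blast
  then show ?thesis by (intro exI[of _ "e/2"]) simp
 qed
 then obtain r where r: "\<And>a. a \<in> C \<Longrightarrow> r a > 0 \<and> cball a (2 * r a) \<subseteq> U" by metis
 have cov: "C \<subseteq> (\<Union>a\<in>C. ball a (r a))"
 proof
  fix a assume "a \<in> C"
  then show "a \<in> (\<Union>a\<in>C. ball a (r a))" using r[of a] by (intro UN_I[of a]) simp_all
 qed
 obtain T where T: "T \<subseteq> C" "finite T" "C \<subseteq> (\<Union>a\<in>T. ball a (r a))"
  by (rule compactE_image[OF assms(1) _ cov]) simp_all
 have "\<forall>a\<in>C. \<exists>\<psi>. smooth \<psi> \<and> (\<forall>x. 0 \<le> \<psi> x) \<and> (\<forall>x. \<psi> x \<le> 1) \<and> (\<forall>x\<in>ball a (r a). \<psi> x = 1)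
  \<and> (\<forall>x. x \<notin> cball a (2 * r a) \<longrightarrow> \<psi> x = 0)"
  using smooth_cutoff_ball r by metis
 from bchoice[OF this] obtain \<psi> where \<psi>0: "\<forall>a\<in>C. smooth (\<psi> a) \<and> (\<forall>x. 0 \<le> \<psi> a x) \<and> (\<forall>x. \<psi> a x \<le> 1)
  \<and> (\<forall>x\<in>ball a (r a). \<psi> a x = 1) \<and> (\<forall>x. x \<notin> cball a (2 * r a) \<longrightarrow> \<psi> a x = 0)" ..
 have \<psi>: "\<And>a. a \<in> C \<Longrightarrow> smooth (\<psi> a)" "\<And>a x. a \<in> C \<Longrightarrow> 0 \<le> \<psi> a x"
  "\<And>a x. a \<in> C \<Longrightarrow> \<psi> a x \<le> 1" "\<And>a x. a \<in> C \<Longrightarrow> x \<in> ball a (r a) \<Longrightarrow> \<psi> a x = 1"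
  "\<And>a x. a \<in> C \<Longrightarrow> x \<notin> cball a (2 * r a) \<Longrightarrow> \<psi> a x = 0"
  using \<psi>0 by blast+
 \<comment> \<open>This combination stays between 0 and 1, equals 1 wherever one of the
   \<open>\<psi> a\<close> does, and vanishes where all of them do, so finitely many balls can be
   merged.\<close>
 define \<phi> where "\<phi> x = 1 - (\<Prod>a\<in>T. 1 - \<psi> a x)" for x
 define K where "K = (\<Union>a\<in>T. cball a (2 * r a))"
 have K: "compact K" "K \<subseteq> U" using T r by (auto simp: K_def)
 have z: "x \<in> K" if "\<phi> x \<noteq> 0" for x
 proof (rule ccontr)
  assume "x \<notin> K"
  then have "\<psi> a x = 0" if "a \<in> T" for a using that T \<psi>(5)[of a x] unfolding K_def by blast
  then have "\<phi> x = 0" by (simp add: \<phi>_def)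
  with that show False by simp
 qed
 have s: "supp \<phi> \<subseteq> K" by (rule supp_subsetI) (use z K in \<open>auto simp: compact_imp_closed\<close>)
 have pr: "0 \<le> (\<Prod>a\<in>T. 1 - \<psi> a x)" "(\<Prod>a\<in>T. 1 - \<psi> a x) \<le> 1" for x
  using \<psi> T by (auto intro!: prod_nonneg prod_le_1)
 show ?thesis
 proof (rule that[of \<phi> "\<Union>a\<in>T. ball a (r a)"])
  show "test_fun U \<phi>"
   unfolding test_fun_iff
  proof (intro conjI)
   show "smooth \<phi>" unfolding \<phi>_def by (intro smooth_diff smooth_const smooth_prod \<psi>) (use T in auto)
   show "compact (supp \<phi>)" by (rule compact_supp_subset[OF K(1) s])
   show "supp \<phi> \<subseteq> U" using s K by auto
  qed
  show "(\<Union>a\<in>T. ball a (r a)) \<subseteq> U"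
  proof
   fix x assume "x \<in> (\<Union>a\<in>T. ball a (r a))"
   then obtain a where a: "a \<in> T" "x \<in> ball a (r a)" by auto
   with T r[of a] have "x \<in> cball a (2 * r a)" by auto
   then have "x \<in> K" using a K_def by blast
   then show "x \<in> U" using K(2) by auto
  qed
  show "\<phi> x = 1" if "x \<in> (\<Union>a\<in>T. ball a (r a))" for x
  proof -
   obtain a where a: "a \<in> T" "x \<in> ball a (r a)" using \<open>x \<in> _\<close> by auto
   then have "1 - \<psi> a x = 0" using \<psi>(4)[of a x] T by auto
   with a T have "(\<Prod>a\<in>T. 1 - \<psi> a x) = 0" by auto
   then show ?thesis by (simp add: \<phi>_def)
  qed
 qed (use pr T in \<open>auto simp: \<phi>_def\<close>)
qed


section \<open>Weak gradients\<close>

text \<open>Equivalent to \<open>in_Lp_loc 1\<close> by \<open>in_Lp_loc_1_iff\<close>, but with all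
  integrals over the whole space, which is the form in which translations and limits are
  handled.\<close>

definition loc_int :: "'a::euclidean_space set \<Rightarrow> ('a \<Rightarrow> 'b::euclidean_space) \<Rightarrow> bool" where
 "loc_int G f \<longleftrightarrow> (\<forall>K. compact K \<and> K \<subseteq> G \<longrightarrow> set_integrable lebesgue K f)"

lemma compact_sets_lebesgue: "compact K \<Longrightarrow> K \<in> sets lebesgue"
 and open_sets_lebesgue: "open G \<Longrightarrow> G \<in> sets lebesgue"
 using sets_completionI_sets[of _ lborel] by (simp_all add: borel_compact)

lemma in_Lp_iff:
 assumes "S \<in> sets lebesgue"
 shows "in_Lp r S f \<longleftrightarrow> (\<lambda>x. indicator S x *\<^sub>R f x) \<in> lmeas \<and>
   integrable lebesgue (\<lambda>x. indicator S x *\<^sub>R norm (f x) powr r)"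
 using assms unfolding in_Lp_def
 by (subst borel_measurable_restrict_space_iff, simp)
   (subst integrable_restrict_space, simp_all)

lemma in_Lp_1_iff:
 assumes "S \<in> sets lebesgue"
 shows "in_Lp 1 S f \<longleftrightarrow> set_integrable lebesgue S f"
proof -
 have "indicator S x *\<^sub>R norm (f x) powr 1 = norm (indicator S x *\<^sub>R f x)" for x
  by (simp add: indicator_def)
 then show ?thesis unfolding in_Lp_iff[OF assms] set_integrable_def
  using integrable_norm_cancel[of lebesgue "\<lambda>x. indicator S x *\<^sub>R f x"] integrable_norm
   borel_measurable_integrable by (auto simp del: norm_scaleR)
qed

lemma in_Lp_loc_1_iff: "in_Lp_loc 1 G f \<longleftrightarrow> loc_int G f"
 by (auto simp: in_Lp_loc_def loc_int_def in_Lp_1_iff compact_sets_lebesgue)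

lemma loc_int_mono: "loc_int G f \<Longrightarrow> G' \<subseteq> G \<Longrightarrow> loc_int G' f"
 by (auto simp: loc_int_def)

lemma loc_int_norm: "loc_int G f \<Longrightarrow> loc_int G (\<lambda>x. norm (f x))"
 unfolding loc_int_def by (metis set_integrable_norm)

lemma loc_int_add: "loc_int G f \<Longrightarrow> loc_int G g \<Longrightarrow> loc_int G (\<lambda>x. f x + g x)"
 and loc_int_diff: "loc_int G f \<Longrightarrow> loc_int G g \<Longrightarrow> loc_int G (\<lambda>x. f x - g x)"
 and loc_int_scale: "loc_int G f \<Longrightarrow> loc_int G (\<lambda>x. c *\<^sub>R f x)"
 by (auto simp: loc_int_def set_integral_add set_integral_diff intro!: set_integrable_scaleR_right)

lemma loc_int_inner: "loc_int G f \<Longrightarrow> loc_int G (\<lambda>x. f x \<bullet> e)"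
 unfolding loc_int_def set_integrable_def
 using integrable_inner_left[of e lebesgue "\<lambda>x. indicator K x *\<^sub>R f x" for K] by simp

lemma loc_int_test:
 fixes f :: "'a::euclidean_space \<Rightarrow> 'b::euclidean_space"
 assumes f: "set_integrable lebesgue K f"
  and h: "h \<in> bmeas" "\<And>x. \<bar>h x\<bar> \<le> B" "\<And>x. x \<notin> K \<Longrightarrow> h x = 0"
 shows "integrable lebesgue (\<lambda>x. h x *\<^sub>R f x)"
proof (rule integrable_le)
 \<comment> \<open>\<open>f\<close> need not be measurable off \<open>K\<close>. As \<open>h\<close>
   vanishes there, \<open>f\<close> may be replaced by its restriction, which is integrable.\<close>
 let ?f = "\<lambda>x. indicator K x *\<^sub>R f x"
 have i: "integrable lebesgue ?f" using f by (simp add: set_integrable_def)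
 then show "integrable lebesgue (\<lambda>x. B *\<^sub>R ?f x)" by (rule integrable_scaleR_right)
 have eq: "h x *\<^sub>R f x = h x *\<^sub>R ?f x" for x using h(3) by (cases "x \<in> K") auto
 have "(\<lambda>x. h x *\<^sub>R ?f x) \<in> lmeas"
  by (intro borel_measurable_scaleR borel_measurable_integrable[OF i] measurable_completion) (simp add: h(1))
 then show "(\<lambda>x. h x *\<^sub>R f x) \<in> lmeas" unfolding eq .
 show "AE x in lebesgue. norm (h x *\<^sub>R f x) \<le> norm (B *\<^sub>R ?f x)"
 proof (rule AE_I2)
  fix x
  have "\<bar>h x\<bar> \<le> \<bar>B\<bar>" using h(2)[of x] by linarith
  then show "norm (h x *\<^sub>R f x) \<le> norm (B *\<^sub>R ?f x)"
   unfolding eq norm_scaleR by (intro mult_right_mono) auto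
 qed
qed

lemma loc_int_test_vec:
 fixes f :: "'a::euclidean_space \<Rightarrow> real" and h :: "'a \<Rightarrow> 'b::euclidean_space"
 assumes f: "set_integrable lebesgue K f"
  and h: "h \<in> bmeas" "\<And>x. norm (h x) \<le> B" "\<And>x. x \<notin> K \<Longrightarrow> h x = 0"
 shows "integrable lebesgue (\<lambda>x. f x *\<^sub>R h x)"
proof (rule integrable_le)
 let ?f = "\<lambda>x. indicator K x *\<^sub>R f x"
 have i: "integrable lebesgue ?f" using f by (simp add: set_integrable_def)
 then show "integrable lebesgue (\<lambda>x. B *\<^sub>R ?f x)" by (rule integrable_scaleR_right)
 have eq: "f x *\<^sub>R h x = ?f x *\<^sub>R h x" for x using h(3) by (cases "x \<in> K") auto
 have "(\<lambda>x. ?f x *\<^sub>R h x) \<in> lmeas"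
  by (intro borel_measurable_scaleR borel_measurable_integrable[OF i] measurable_completion) (simp add: h(1))
 then show "(\<lambda>x. f x *\<^sub>R h x) \<in> lmeas" unfolding eq .
 show "AE x in lebesgue. norm (f x *\<^sub>R h x) \<le> norm (B *\<^sub>R ?f x)"
 proof (rule AE_I2)
  fix x
  have "norm (h x) \<le> \<bar>B\<bar>" using h(2)[of x] by linarith
  then show "norm (f x *\<^sub>R h x) \<le> norm (B *\<^sub>R ?f x)"
   using h(3)[of x] mult_left_mono[of "norm (h x)" "\<bar>B\<bar>" "\<bar>f x\<bar>"]
   by (cases "x \<in> K") (auto simp: abs_mult mult.commute)
 qed
qed

lemma loc_int_mult_cont:
 fixes f :: "'a::euclidean_space \<Rightarrow> 'b::euclidean_space"
 assumes "loc_int G f" "continuous_on UNIV (h :: 'a \<Rightarrow> real)"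
 shows "loc_int G (\<lambda>x. h x *\<^sub>R f x)"
 unfolding loc_int_def
proof clarify
 fix K assume K: "compact K" "K \<subseteq> G"
 then have f: "set_integrable lebesgue K f" using assms by (auto simp: loc_int_def)
 have "compact (h ` K)" using assms K compact_continuous_image continuous_on_subset by blast
 then obtain B where B: "\<And>x. x \<in> K \<Longrightarrow> \<bar>h x\<bar> \<le> B" "B > 0"
  using bounded_pos compact_imp_bounded by (metis imageI real_norm_def)
 have m: "(\<lambda>x. indicator K x * h x) \<in> bmeas"
  by (intro borel_measurable_times borel_measurable_indicator borel_measurable_continuous_onI assms)
   (simp add: borel_compact[OF K(1)])
 have "integrable lebesgue (\<lambda>x. (indicator K x * h x) *\<^sub>R f x)"
  using K B by (intro loc_int_test[OF f m, of B]) (auto simp: indicator_def)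
 then show "set_integrable lebesgue K (\<lambda>x. h x *\<^sub>R f x)" by (simp add: set_integrable_def)
qed

lemma loc_int_mult_cont_vec:
 fixes f :: "'a::euclidean_space \<Rightarrow> real"
 assumes "loc_int G f" "continuous_on UNIV (h :: 'a \<Rightarrow> 'b::euclidean_space)"
 shows "loc_int G (\<lambda>x. f x *\<^sub>R h x)"
 unfolding loc_int_def
proof clarify
 fix K assume K: "compact K" "K \<subseteq> G"
 then have f: "set_integrable lebesgue K f" using assms by (auto simp: loc_int_def)
 have "compact (h ` K)" using assms K compact_continuous_image continuous_on_subset by blast
 then obtain B where B: "\<And>x. x \<in> K \<Longrightarrow> norm (h x) \<le> B" "B > 0"
  using bounded_pos compact_imp_bounded by (metis imageI)
 have m: "(\<lambda>x. indicator K x *\<^sub>R h x) \<in> bmeas"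
  by (intro borel_measurable_scaleR borel_measurable_indicator borel_measurable_continuous_onI assms)
   (simp add: borel_compact[OF K(1)])
 have "integrable lebesgue (\<lambda>x. f x *\<^sub>R (indicator K x *\<^sub>R h x))"
  using K B by (intro loc_int_test_vec[OF f m, of B]) (auto simp: indicator_def)
 then show "set_integrable lebesgue K (\<lambda>x. f x *\<^sub>R h x)" by (simp add: set_integrable_def mult.commute)
qed

lemma test_fun_borel:
 assumes "test_fun G \<psi>"
 shows "\<psi> \<in> bmeas" "grad \<psi> \<in> bmeas"
 using assms by (auto intro!: borel_measurable_continuous_onI smooth_continuous smooth_grad_continuous
  dest: test_fun_smooth)

lemma test_fun_integrable:
 assumes "test_fun G \<psi>" "loc_int G (f :: 'a::euclidean_space \<Rightarrow> 'b::euclidean_space)"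
 shows "integrable lebesgue (\<lambda>x. \<psi> x *\<^sub>R f x)"
proof -
 obtain B where "\<And>x. \<bar>\<psi> x\<bar> \<le> B" using test_fun_bounds[OF assms(1)] by metis
 then show ?thesis
  using assms by (intro loc_int_test[of "supp \<psi>" f \<psi> B] test_fun_borel)
   (auto simp: loc_int_def test_fun_def intro: supp_mem)
qed

lemma test_fun_integrable_grad:
 assumes "test_fun G \<psi>" "loc_int G (f :: 'a::euclidean_space \<Rightarrow> real)"
 shows "integrable lebesgue (\<lambda>x. f x *\<^sub>R grad \<psi> x)"
proof -
 obtain B where "\<And>x. norm (grad \<psi> x) \<le> B" using test_fun_bounds[OF assms(1)] by metis
 then show ?thesis
  using assms by (intro loc_int_test_vec[of "supp \<psi>" f "grad \<psi>" B] test_fun_borel grad_zero_outside)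
   (auto simp: loc_int_def test_fun_def)
qed

lemma test_fun_zero_outside: "test_fun G \<psi> \<Longrightarrow> x \<notin> G \<Longrightarrow> \<psi> x = 0 \<and> grad \<psi> x = 0"
 by (metis grad_zero_outside subsetD supp_mem test_fun_def)

lemma weak_gradient_iff:
 fixes f :: "'a::euclidean_space \<Rightarrow> real"
 assumes "open G"
 shows "weak_gradient G f g \<longleftrightarrow> loc_int G f \<and> loc_int G g \<and> (\<forall>\<psi>. test_fun G \<psi> \<longrightarrow>
  (Leb x. f x *\<^sub>R grad \<psi> x) = - (Leb x. \<psi> x *\<^sub>R g x))"
proof -
 have r: "(\<integral>x. h x \<partial>lebesgue_on G) = (Leb x. h x)" if "\<And>x. x \<notin> G \<Longrightarrow> h x = 0" for h :: "'a \<Rightarrow> 'a"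
  using open_sets_lebesgue[OF assms] that
  by (subst integral_restrict_space) (auto intro!: Bochner_Integration.integral_cong simp: indicator_def)
 have "(\<integral>x. f x *\<^sub>R grad \<psi> x \<partial>lebesgue_on G) = (Leb x. f x *\<^sub>R grad \<psi> x)"
  "(\<integral>x. \<psi> x *\<^sub>R g x \<partial>lebesgue_on G) = (Leb x. \<psi> x *\<^sub>R g x)" if "test_fun G \<psi>" for \<psi>
  using test_fun_zero_outside[OF that] by (auto intro!: r)
 then show ?thesis unfolding weak_gradient_def in_Lp_loc_1_iff by auto
qed

lemma weak_gradient_inner:
 assumes "open G" "weak_gradient G f g" "test_fun G \<psi>"
 shows "(Leb x. f x * (grad \<psi> x \<bullet> e)) = - (Leb x. \<psi> x * (g x \<bullet> e))"
proof -
 have w: "loc_int G f" "loc_int G g"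
  "(Leb x. f x *\<^sub>R grad \<psi> x) = - (Leb x. \<psi> x *\<^sub>R g x)"
  using assms by (auto simp: weak_gradient_iff)
 have "(Leb x. (f x *\<^sub>R grad \<psi> x) \<bullet> e) = (Leb x. f x *\<^sub>R grad \<psi> x) \<bullet> e"
  using test_fun_integrable_grad[OF assms(3) w(1)] by (intro integral_inner_left)
 moreover have "(Leb x. (\<psi> x *\<^sub>R g x) \<bullet> e) = (Leb x. \<psi> x *\<^sub>R g x) \<bullet> e"
  using test_fun_integrable[OF assms(3) w(2)] by (intro integral_inner_left)
 ultimately show ?thesis using w(3) by simp
qed

lemma weak_gradientI:
 assumes "open G" "loc_int G f" "loc_int G g"
  "\<And>\<psi> b. test_fun G \<psi> \<Longrightarrow> b \<in> Basis \<Longrightarrow>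
   (Leb x. f x * (grad \<psi> x \<bullet> b)) = - (Leb x. \<psi> x * (g x \<bullet> b))"
 shows "weak_gradient G f g"
 unfolding weak_gradient_iff[OF assms(1)]
proof (intro conjI allI impI)
 fix \<psi> assume \<psi>: "test_fun G \<psi>"
 show "(Leb x. f x *\<^sub>R grad \<psi> x) = - (Leb x. \<psi> x *\<^sub>R g x)"
 proof (rule euclidean_eqI)
 fix b :: 'a assume b: "b \<in> Basis"
 have "(Leb x. (f x *\<^sub>R grad \<psi> x) \<bullet> b) = (Leb x. f x *\<^sub>R grad \<psi> x) \<bullet> b"
  using test_fun_integrable_grad[OF \<psi> assms(2)] by (intro integral_inner_left)
 moreover have "(Leb x. (\<psi> x *\<^sub>R g x) \<bullet> b) = (Leb x. \<psi> x *\<^sub>R g x) \<bullet> b"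
  using test_fun_integrable[OF \<psi> assms(3)] by (intro integral_inner_left)
 ultimately show "(Leb x. f x *\<^sub>R grad \<psi> x) \<bullet> b = (- (Leb x. \<psi> x *\<^sub>R g x)) \<bullet> b"
  using assms(4)[OF \<psi> b] by simp
 qed
qed (use assms in auto)

lemma weak_gradient_loc_int:
 "open G \<Longrightarrow> weak_gradient G f g \<Longrightarrow> loc_int G f" "open G \<Longrightarrow> weak_gradient G f g \<Longrightarrow> loc_int G g"
 by (auto simp: weak_gradient_iff)

lemma weak_gradient_mono:
 assumes "open G" "open G'" "G' \<subseteq> G" "weak_gradient G f g"
 shows "weak_gradient G' f g"
 using assms(4) loc_int_mono[of G f, OF _ assms(3)] loc_int_mono[of G g, OF _ assms(3)] test_fun_mono[OF _ assms(3)]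
 unfolding weak_gradient_iff[OF assms(1)] weak_gradient_iff[OF assms(2)] by auto

lemma weak_gradient_diff:
 assumes "open G" "weak_gradient G f g" "weak_gradient G f' g'"
 shows "weak_gradient G (\<lambda>x. f x - f' x) (\<lambda>x. g x - g' x)"
proof -
 note l = weak_gradient_loc_int[OF assms(1,2)] weak_gradient_loc_int[OF assms(1,3)]
 have "(Leb x. (f x - f' x) *\<^sub>R grad \<psi> x) = - (Leb x. \<psi> x *\<^sub>R (g x - g' x))"
  if t: "test_fun G \<psi>" for \<psi>
  unfolding scaleR_diff_left scaleR_diff_right
  using assms t Bochner_Integration.integral_diff[OF test_fun_integrable[OF t l(2)] test_fun_integrable[OF t l(4)]]
   Bochner_Integration.integral_diff[OF test_fun_integrable_grad[OF t l(1)] test_fun_integrable_grad[OF t l(3)]]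
  by (simp add: weak_gradient_iff)
 then show ?thesis using l by (auto simp: weak_gradient_iff[OF assms(1)] intro: loc_int_diff)
qed

text \<open>The product rule is moved to the test function: \<open>\<eta> * \<psi>\<close> is again
  a test function, and the identity for \<open>f\<close> tested with \<open>\<eta> * \<psi>\<close>
  is the claim after the product rule for smooth functions.\<close>

lemma weak_gradient_mult_smooth:
 assumes "open G" "weak_gradient G f g" "smooth \<eta>"
 shows "weak_gradient G (\<lambda>x. f x * \<eta> x) (\<lambda>x. \<eta> x *\<^sub>R g x + f x *\<^sub>R grad \<eta> x)"
proof -
 note l = weak_gradient_loc_int[OF assms(1,2)]
 have l1: "loc_int G (\<lambda>x. \<eta> x *\<^sub>R g x)" "loc_int G (\<lambda>x. \<eta> x *\<^sub>R f x)" "loc_int G (\<lambda>x. f x *\<^sub>R grad \<eta> x)"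
  by (rule loc_int_mult_cont[OF l(2) smooth_continuous[OF assms(3)]]
   loc_int_mult_cont[OF l(1) smooth_continuous[OF assms(3)]]
   loc_int_mult_cont_vec[OF l(1) smooth_grad_continuous[OF assms(3)]])+
 have "(Leb x. (f x * \<eta> x) *\<^sub>R grad \<psi> x)
   = - (Leb x. \<psi> x *\<^sub>R (\<eta> x *\<^sub>R g x + f x *\<^sub>R grad \<eta> x))" if t: "test_fun G \<psi>" for \<psi>
 proof -
  have t': "test_fun G (\<lambda>x. \<eta> x * \<psi> x)" using t assms(3) by (intro test_fun_mult)
  have "(Leb x. (f x * \<eta> x) *\<^sub>R grad \<psi> x)
   = (Leb x. f x *\<^sub>R grad (\<lambda>x. \<eta> x * \<psi> x) x - \<psi> x *\<^sub>R (f x *\<^sub>R grad \<eta> x))"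
   using test_fun_smooth[OF t] assms(3) by (intro Bochner_Integration.integral_cong)
    (auto simp: grad_mult algebra_simps)
  also have "\<dots> = (Leb x. f x *\<^sub>R grad (\<lambda>x. \<eta> x * \<psi> x) x) - (Leb x. \<psi> x *\<^sub>R (f x *\<^sub>R grad \<eta> x))"
   by (intro Bochner_Integration.integral_diff test_fun_integrable_grad[OF t'] test_fun_integrable[OF t] l l1)
  also have "(Leb x. f x *\<^sub>R grad (\<lambda>x. \<eta> x * \<psi> x) x) = - (Leb x. \<psi> x *\<^sub>R (\<eta> x *\<^sub>R g x))"
   using assms t' by (simp add: weak_gradient_iff mult.commute)
  also have "- (Leb x. \<psi> x *\<^sub>R (\<eta> x *\<^sub>R g x)) - (Leb x. \<psi> x *\<^sub>R (f x *\<^sub>R grad \<eta> x))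
    = - (Leb x. \<psi> x *\<^sub>R (\<eta> x *\<^sub>R g x) + \<psi> x *\<^sub>R (f x *\<^sub>R grad \<eta> x))"
   by (subst Bochner_Integration.integral_add) (intro test_fun_integrable[OF t] l l1, intro test_fun_integrable[OF t] l l1, simp)
  finally show ?thesis by (simp add: scaleR_add_right)
 qed
 then show ?thesis using l1 by (auto simp: weak_gradient_iff[OF assms(1)] mult.commute intro!: loc_int_add)
qed

section \<open>Approximation of compact sets and the fundamental lemma of the calculus of
  variations\<close>

lemma cutoff_sequence:
 fixes C V :: "'a::euclidean_space set"
 assumes "compact C" "open V" "C \<subseteq> V"
 obtains \<psi> :: "nat \<Rightarrow> 'a \<Rightarrow> real" and K where "compact K" "K \<subseteq> V"
  "\<And>n. test_fun V (\<psi> n)" "\<And>n x. 0 \<le> \<psi> n x" "\<And>n x. \<psi> n x \<le> 1"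
  "\<And>n. supp (\<psi> n) \<subseteq> K" "\<And>n. \<exists>W. open W \<and> C \<subseteq> W \<and> W \<subseteq> V \<and> (\<forall>x\<in>W. \<psi> n x = 1)"
  "\<And>x. x \<notin> C \<Longrightarrow> \<forall>\<^sub>F n in sequentially. \<psi> n x = 0"
proof -
 show ?thesis
 \<comment> \<open>\<open>infdist\<close> to the empty set is 0 by convention, so the neighbourhoods
   \<open>U n\<close> below would not shrink for empty \<open>C\<close>.\<close>
 proof (cases "C = {}")
  case True
  have "test_fun V (\<lambda>x. 0)" by (auto simp: test_fun_iff supp_def smooth_const)
  with True show ?thesis by (intro that[of "{}" "\<lambda>n x. 0"]) (auto simp: supp_def)
 next
  case False
 \<comment> \<open>One fixed cutoff supplies the compact set containing all supports, as dominated
   convergence will require; the shrinking neighbourhoods \<open>U n\<close> supply the convergence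
   to 0 off \<open>C\<close>.\<close>
 obtain \<psi>0 V0 where 0: "test_fun V \<psi>0" "open V0" "C \<subseteq> V0" "V0 \<subseteq> V" "\<And>x. x \<in> V0 \<Longrightarrow> \<psi>0 x = 1"
  using smooth_cutoff[OF assms] by metis
 define U where "U n = V0 \<inter> {x. infdist x C < 1 / real (Suc n)}" for n
 have U: "open (U n)" "U n \<subseteq> V" for n
  unfolding U_def using 0 by (auto intro!: open_Int open_Collect_less continuous_intros)
 have CU: "C \<subseteq> U n" for n using 0 by (auto simp: U_def)
 have "\<exists>\<psi> W. test_fun (U n) \<psi> \<and> (\<forall>x. 0 \<le> \<psi> x) \<and> (\<forall>x. \<psi> x \<le> 1) \<and> open W \<and> C \<subseteq> W \<and> W \<subseteq> U n
   \<and> (\<forall>x\<in>W. \<psi> x = 1)" for n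
  using smooth_cutoff[OF assms(1) U(1) CU] by metis
 then obtain \<psi> W where \<psi>: "\<And>n. test_fun (U n) (\<psi> n)" "\<And>n x. 0 \<le> \<psi> n x" "\<And>n x. \<psi> n x \<le> 1"
  and W: "\<And>n. open (W n)" "\<And>n. C \<subseteq> W n" "\<And>n. W n \<subseteq> U n" "\<And>n x. x \<in> W n \<Longrightarrow> \<psi> n x = 1"
  by metis
 show ?thesis
 proof (rule that[of "supp \<psi>0" \<psi>])
  show "compact (supp \<psi>0)" "supp \<psi>0 \<subseteq> V" using 0 by (auto simp: test_fun_def)
  show "test_fun V (\<psi> n)" for n using test_fun_mono[OF \<psi>(1) U(2)] .
  show "supp (\<psi> n) \<subseteq> supp \<psi>0" for n
  proof -
   have "V0 \<subseteq> supp \<psi>0" using 0(5) by (force intro: supp_mem)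
   then show ?thesis using \<psi>(1)[of n] by (auto simp: test_fun_def U_def)
  qed
  show "\<exists>W. open W \<and> C \<subseteq> W \<and> W \<subseteq> V \<and> (\<forall>x\<in>W. \<psi> n x = 1)" for n
   using W U by (intro exI[of _ "W n"]) (metis order_trans)
  show "\<forall>\<^sub>F n in sequentially. \<psi> n x = 0" if "x \<notin> C" for x
  proof -
   have "infdist x C > 0"
    using that False assms(1) by (metis compact_imp_closed in_closed_iff_infdist_zero infdist_nonneg less_eq_real_def)
   then obtain N where N: "inverse (real (Suc N)) < infdist x C" using reals_Archimedean by blast
   have "\<psi> n x = 0" if "n \<ge> N" for n
   proof -
    have "1 / real (Suc n) \<le> inverse (real (Suc N))" using that by (simp add: field_simps)
    then have "x \<notin> U n" using N by (auto simp: U_def)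
    then show ?thesis using test_fun_zero_outside[OF \<psi>(1)] by blast
   qed
   then show ?thesis by (auto simp: eventually_sequentially)
  qed
 qed (use \<psi> in auto)
 qed
qed


lemma open_exhaustion:
 fixes G :: "'a::euclidean_space set"
 assumes "open G"
 shows "\<exists>K :: nat \<Rightarrow> 'a set. (\<forall>n. compact (K n)) \<and> G = (\<Union>n. K n) \<and> (\<forall>m n. m \<le> n \<longrightarrow> K m \<subseteq> K n)"
proof -
 obtain D where D: "countable D" "D \<subseteq> Pow G" "\<And>X. X \<in> D \<Longrightarrow> \<exists>a b. X = cbox a b" "\<Union>D = G"
  using open_countable_Union_open_cbox[OF assms] by metis
 define L where "L = from_nat_into (insert {} D)"
 have rL: "range L = insert {} D" unfolding L_def using D(1) by (intro range_from_nat_into) auto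
 have L: "L n \<in> insert {} D" for n using rL by blast
 have "compact (L n)" for n
  using L[of n] D(3)[of "L n"] by auto
 moreover have "G = (\<Union>n. \<Union>i\<le>n. L i)"
 proof -
  have "(\<Union>n. \<Union>i\<le>n. L i) = \<Union>(range L)" using order_refl by blast
  then show ?thesis using D(4) rL by simp
 qed
 moreover have "(\<Union>i\<le>m. L i) \<subseteq> (\<Union>i\<le>n. L i)" if "m \<le> n" for m n using that by force
 ultimately show ?thesis
  by (intro exI[of _ "\<lambda>n. \<Union>i\<le>n. L i"] conjI allI impI compact_UN) auto
qed

text \<open>Local integrability gives measurability on compact sets, and an open set is a countable
  increasing union of them.\<close>

lemma loc_int_measurable:
 assumes "open G" "loc_int G f"
 shows "(\<lambda>x. indicator G x *\<^sub>R f x) \<in> lmeas"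
proof -
 obtain K :: "nat \<Rightarrow> 'a set" where K': "\<forall>n. compact (K n)" "G = (\<Union>n. K n)" "\<forall>m n. m \<le> n \<longrightarrow> K m \<subseteq> K n"
  using open_exhaustion[OF assms(1)] by blast
 then have K: "\<And>n. compact (K n)" "G = (\<Union>n. K n)" "\<And>m n. m \<le> n \<Longrightarrow> K m \<subseteq> K n" by blast+
 show ?thesis
 proof (rule borel_measurable_LIMSEQ_metric)
  show "(\<lambda>x. indicator (K n) x *\<^sub>R f x) \<in> lmeas" for n
   using assms(2) K unfolding loc_int_def set_integrable_def by (auto dest!: spec[of _ "K n"])
  show "(\<lambda>n. indicator (K n) x *\<^sub>R f x) \<longlonglongrightarrow> indicator G x *\<^sub>R f x" for x
  proof (rule tendsto_eventually)
   show "\<forall>\<^sub>F n in sequentially. indicator (K n) x *\<^sub>R f x = indicator G x *\<^sub>R f x"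
   proof (cases "x \<in> G")
    case True
    then obtain N where "x \<in> K N" using K(2) by auto
    then have "x \<in> K n" if "n \<ge> N" for n using K(3)[OF that] by auto
    then show ?thesis using True by (auto simp: eventually_sequentially intro!: exI[of _ N])
   qed (use K(2) in auto)
  qed
 qed
qed

text \<open>Later \<open>f (x + s *\<^sub>R z)\<close> is integrated in \<open>x\<close> and
  \<open>s\<close> jointly. A Borel \<open>f\<close> makes this composite measurable for the product
  sigma-algebra, hence the passage to a Borel representative.\<close>

lemma loc_int_borel:
 fixes f :: "'a::euclidean_space \<Rightarrow> real"
 assumes "open G" "loc_int G f"
 obtains f' where "f' \<in> bmeas" "ae_on G (\<lambda>x. f x = f' x)"
proof -
 obtain f' where f': "f' \<in> borel_measurable lborel" "AE x in lborel. indicator G x *\<^sub>R f x = f' x"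
  using completion_ex_borel_measurable_real[OF loc_int_measurable[OF assms]] by auto
 from AE_completion[OF f'(2)] have "ae_on G (\<lambda>x. f x = f' x)"
  by eventually_elim (auto simp: indicator_def)
 with f'(1) show ?thesis by (intro that[of f']) auto
qed

lemma set_integrable_cong_AE_lebesgue:
 fixes f f' :: "'a::euclidean_space \<Rightarrow> 'b::euclidean_space"
 assumes "set_integrable lebesgue K f" "ae_on K (\<lambda>x. f x = f' x)"
 shows "set_integrable lebesgue K f'"
proof -
 have ae: "AE x in lebesgue. indicator K x *\<^sub>R f x = indicator K x *\<^sub>R f' x"
  using assms(2) by eventually_elim (auto simp: indicator_def)
 have i: "integrable lebesgue (\<lambda>x. indicator K x *\<^sub>R f x)" using assms(1) by (simp add: set_integrable_def)
 have "(\<lambda>x. indicator K x *\<^sub>R f' x) \<in> lmeas"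
  using borel_measurable_AE[OF borel_measurable_integrable[OF i] ae] .
 then show ?thesis
  unfolding set_integrable_def by (intro integrable_cong_AE_imp[OF i _ ae])
qed

lemma loc_int_cong_AE:
 assumes "loc_int G f" "ae_on G (\<lambda>x. f x = f' x)"
 shows "loc_int G f'"
 unfolding loc_int_def
proof clarify
 fix K assume "compact K" "K \<subseteq> G"
 then show "set_integrable lebesgue K f'"
  using assms(1) assms(2) by (intro set_integrable_cong_AE_lebesgue[of K f f']) (auto simp: loc_int_def elim!: AE_mp)
qed

lemma weak_gradient_cong_AE:
 assumes "open G" "weak_gradient G f g" "ae_on G (\<lambda>x. f x = f' x)"
  "ae_on G (\<lambda>x. g x = g' x)"
 shows "weak_gradient G f' g'"
proof -
 note l = weak_gradient_loc_int[OF assms(1,2)]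
 have l': "loc_int G f'" "loc_int G g'" 
  using loc_int_cong_AE[OF l(1) assms(3)] loc_int_cong_AE[OF l(2) assms(4)] by auto
 have "(Leb x. f' x *\<^sub>R grad \<psi> x) = - (Leb x. \<psi> x *\<^sub>R g' x)" if t: "test_fun G \<psi>" for \<psi>
 proof -
  have "(Leb x. f' x *\<^sub>R grad \<psi> x) = (Leb x. f x *\<^sub>R grad \<psi> x)"
  proof (rule integral_cong_AE)
   show "AE x in lebesgue. f' x *\<^sub>R grad \<psi> x = f x *\<^sub>R grad \<psi> x"
    using assms(3) by eventually_elim (use test_fun_zero_outside[OF t] in auto)
  qed (use borel_measurable_integrable test_fun_integrable_grad[OF t] l l' in auto)
  moreover have "(Leb x. \<psi> x *\<^sub>R g' x) = (Leb x. \<psi> x *\<^sub>R g x)"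
  proof (rule integral_cong_AE)
   show "AE x in lebesgue. \<psi> x *\<^sub>R g' x = \<psi> x *\<^sub>R g x"
    using assms(4) by eventually_elim (use test_fun_zero_outside[OF t] in auto)
  qed (use borel_measurable_integrable test_fun_integrable[OF t] l l' in auto)
  ultimately show ?thesis using assms(1,2) t by (simp add: weak_gradient_iff)
 qed
 with l' show ?thesis using assms(1) by (simp add: weak_gradient_iff)
qed

text \<open>Cutoffs converging to the indicator of a compact set \<open>T\<close> show that the
  integral of \<open>D - A\<close> over \<open>T\<close> is at most 0. A compact set inside
  \<open>{D - A > 1 / Suc m}\<close> is therefore null, and inner regularity of Lebesgue measure
  makes the level set itself null. The one-sided form is what later yields pointwise bounds from
  integral estimates.\<close>

theorem fundamental_lemma:
 assumes "open V" and l: "loc_int V D" "loc_int V A"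
  and le: "\<And>\<psi>. test_fun V \<psi> \<Longrightarrow> (\<And>x. 0 \<le> \<psi> x) \<Longrightarrow>
   (Leb x. \<psi> x * D x) \<le> (Leb x. \<psi> x * A x)"
 shows "ae_on V (\<lambda>x. D x \<le> A x)"
proof -
 define f where "f x = D x - A x" for x
 have lf: "loc_int V f" unfolding f_def by (rule loc_int_diff[OF l])
 have test: "(Leb x. \<psi> x * f x) \<le> 0" if "test_fun V \<psi>" "\<And>x. 0 \<le> \<psi> x" for \<psi>
  using le[OF that] Bochner_Integration.integral_diff[OF test_fun_integrable[OF that(1) l(1)] test_fun_integrable[OF that(1) l(2)]]
  by (simp add: f_def right_diff_distrib)
 have comp: "(Leb x. indicator T x * f x) \<le> 0" if T: "compact T" "T \<subseteq> V" for T
 proof -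
  obtain \<psi> :: "nat \<Rightarrow> 'a \<Rightarrow> real" and K where \<psi>: "compact K" "K \<subseteq> V"
   "\<And>n. test_fun V (\<psi> n)" "\<And>n x. 0 \<le> \<psi> n x" "\<And>n x. \<psi> n x \<le> 1"
   "\<And>n. supp (\<psi> n) \<subseteq> K" "\<And>n. \<exists>W. open W \<and> T \<subseteq> W \<and> W \<subseteq> V \<and> (\<forall>x\<in>W. \<psi> n x = 1)"
   "\<And>x. x \<notin> T \<Longrightarrow> \<forall>\<^sub>F n in sequentially. \<psi> n x = 0"
   using cutoff_sequence[OF T(1) assms(1) T(2)] by metis
  have i: "integrable lebesgue (\<lambda>x. indicator K x *\<^sub>R f x)"
   using lf \<psi>(1,2) by (auto simp: loc_int_def set_integrable_def)
   have d1: "integrable lebesgue (\<lambda>x. norm (indicator K x *\<^sub>R f x))" using i by (rule integrable_norm)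
   have "set_integrable lebesgue T f" using lf T by (auto simp: loc_int_def)
   then have d2: "(\<lambda>x. indicator T x *\<^sub>R f x) \<in> lmeas" by (auto simp: set_integrable_def)
   have d3: "(\<lambda>x. \<psi> n x *\<^sub>R f x) \<in> lmeas" for n
    using test_fun_integrable[OF \<psi>(3) lf] by (rule borel_measurable_integrable)
   have d4: "AE x in lebesgue. (\<lambda>n. \<psi> n x *\<^sub>R f x) \<longlonglongrightarrow> indicator T x *\<^sub>R f x"
   proof (rule AE_I2)
    fix x
    have "(\<lambda>n. \<psi> n x) \<longlonglongrightarrow> indicator T x"
    proof (rule tendsto_eventually, cases "x \<in> T")
     case True
     then have "\<psi> n x = 1" for n using \<psi>(7)[of n] by auto
     then show "\<forall>\<^sub>F n in sequentially. \<psi> n x = indicator T x" using True by simp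
    qed (use \<psi>(8) in auto)
    then show "(\<lambda>n. \<psi> n x *\<^sub>R f x) \<longlonglongrightarrow> indicator T x *\<^sub>R f x" by (rule tendsto_scaleR[OF _ tendsto_const])
   qed
   have d5: "AE x in lebesgue. norm (\<psi> n x *\<^sub>R f x) \<le> norm (indicator K x *\<^sub>R f x)" for n
   proof (rule AE_I2)
    fix x
    have "\<bar>\<psi> n x\<bar> \<le> indicator K x"
     using \<psi>(4)[of n x] \<psi>(5)[of n x] \<psi>(6)[of n] supp_mem[of "\<psi> n" x] by (simp add: indicator_def) blast
    then have "\<bar>\<psi> n x\<bar> * \<bar>f x\<bar> \<le> indicator K x * \<bar>f x\<bar>" by (rule mult_right_mono) simp
    then show "norm (\<psi> n x *\<^sub>R f x) \<le> norm (indicator K x *\<^sub>R f x)"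
     by (simp add: abs_mult)
   qed
  have "(\<lambda>n. (Leb x. \<psi> n x *\<^sub>R f x)) \<longlonglongrightarrow> (Leb x. indicator T x *\<^sub>R f x)"
   by (rule integral_dominated_convergence[OF d2 d3 d1 d4 d5])
  moreover have "(Leb x. \<psi> n x * f x) \<le> 0" for n
   by (rule test[of "\<psi> n"]) (rule \<psi>)+
  ultimately show ?thesis by (auto intro: LIMSEQ_le_const2)
 qed
 obtain K :: "nat \<Rightarrow> 'a set" where K': "\<forall>n. compact (K n)" "V = (\<Union>n. K n)" "\<forall>m n. m \<le> n \<longrightarrow> K m \<subseteq> K n"
  using open_exhaustion[OF assms(1)] by blast
 then have K: "\<And>n. compact (K n)" "V = (\<Union>n. K n)" "\<And>m n. m \<le> n \<Longrightarrow> K m \<subseteq> K n" by blast+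
 define E where "E n m = {x. 1 / real (Suc m) < indicator (K n) x *\<^sub>R f x}" for n m
 have null: "E n m \<in> null_sets lebesgue" for n m
 proof -
  have "K n \<subseteq> V" using K by auto
  then have "integrable lebesgue (\<lambda>x. indicator (K n) x *\<^sub>R f x)"
   using lf K(1) by (auto simp: loc_int_def set_integrable_def)
  then have "(\<lambda>x. indicator (K n) x *\<^sub>R f x) \<in> lmeas"
   by (rule borel_measurable_integrable)
  then have "{x\<in>space lebesgue. 1 / real (Suc m) < indicator (K n) x *\<^sub>R f x} \<in> sets lebesgue"
   by (rule borel_measurable_less[OF borel_measurable_const])
  then have E: "E n m \<in> sets lebesgue" by (simp add: E_def)
  have EK: "E n m \<subseteq> K n" by (auto simp: E_def indicator_def split: if_splits)
  have "emeasure lebesgue (E n m) \<le> ennreal e" if e: "e > 0" for e :: real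
  proof -
   obtain T where T: "closed T" "T \<subseteq> E n m" "E n m - T \<in> lmeasurable" "emeasure lebesgue (E n m - T) < ennreal e"
    using sets_lebesgue_inner_closed[OF E e] by blast
   have cT: "compact T" using T EK K(1)
    by (metis compact_Int_closed inf.absorb_iff2 order_trans)
   have TV: "T \<subseteq> V" using T EK \<open>K n \<subseteq> V\<close> by auto
   have fin: "emeasure lebesgue T < \<infinity>" using lmeasurable_compact[OF cT]
    by (simp add: fmeasurable_def del: emeasure_completion)
   have iT: "integrable lebesgue (\<lambda>x. indicator T x *\<^sub>R f x)"
    using lf cT TV by (auto simp: loc_int_def set_integrable_def)
   have "measure lebesgue T * (1 / real (Suc m)) = (Leb x. indicator T x * (1 / real (Suc m)))"
    using compact_sets_lebesgue[OF cT] by simp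
   also have "\<dots> \<le> (Leb x. indicator T x * f x)"
   proof (rule integral_mono)
    show "integrable lebesgue (\<lambda>x. indicator T x * (1 / real (Suc m)))"
     using fin compact_sets_lebesgue[OF cT] by simp
    show "indicator T x * (1 / real (Suc m)) \<le> indicator T x * f x" for x
    proof (cases "x \<in> T")
     case True
     then have "x \<in> E n m" "x \<in> K n" using T(2) EK by auto
     then have "1 / real (Suc m) < f x" unfolding E_def by simp
     with True show ?thesis by simp
    qed simp
   qed (use iT in simp)
   also have "\<dots> \<le> 0" by (rule comp[OF cT TV])
   finally have "measure lebesgue T \<le> 0" by (simp add: divide_le_0_iff)
   then have "measure lebesgue T = 0" by (metis antisym measure_nonneg)
   then have "emeasure lebesgue T = 0" using fin
    by (metis emeasure_eq_ennreal_measure ennreal_0 infinity_ennreal_def less_irrefl)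
   moreover have "emeasure lebesgue (E n m) \<le> emeasure lebesgue T + emeasure lebesgue (E n m - T)"
    using emeasure_subadditive[OF compact_sets_lebesgue[OF cT] sets.Diff[OF E compact_sets_lebesgue[OF cT]]] T(2)
    by (simp add: Un_absorb1)
   ultimately show ?thesis using T(4) by simp
  qed
  then have "emeasure lebesgue (E n m) = 0"
   by (metis ennreal_le_epsilon add_0 le_zero_eq)
  with E show ?thesis by auto
 qed
 have "AE x in lebesgue. \<forall>n m. x \<notin> E n m"
  using null by (intro AE_all_countable[THEN iffD2] allI AE_not_in)
 then show ?thesis
 proof eventually_elim
  fix x assume nE: "\<forall>n m. x \<notin> E n m"
  show "x \<in> V \<longrightarrow> D x \<le> A x"
  proof
   assume "x \<in> V"
   then obtain n where "x \<in> K n" using K by auto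
   have "f x \<le> 1 / real (Suc m)" for m
   proof -
    have "\<not> 1 / real (Suc m) < indicator (K n) x *\<^sub>R f x" using nE unfolding E_def by blast
    with \<open>x \<in> K n\<close> show ?thesis by simp
   qed
   then have "f x \<le> inverse (real (Suc m))" for m by (simp add: inverse_eq_divide)
   then have "f x \<le> 0"
    by (intro LIMSEQ_le_const[OF LIMSEQ_inverse_real_of_nat]) auto
   then show "D x \<le> A x" by (simp add: f_def)
  qed
 qed
qed

text \<open>The fundamental lemma is applied to each component, with the two gradients in either
  order.\<close>

lemma weak_gradient_unique:
 assumes "open G" "weak_gradient G f g" "weak_gradient G f g'"
 shows "ae_on G (\<lambda>x. g x = g' x)"
proof -
 have *: "ae_on G (\<lambda>x. g x \<bullet> b \<le> g' x \<bullet> b)"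
  if "weak_gradient G f g" "weak_gradient G f g'" for g g' and b :: 'a
 proof (rule fundamental_lemma[OF assms(1)])
  show "loc_int G (\<lambda>x. g x \<bullet> b)" "loc_int G (\<lambda>x. g' x \<bullet> b)"
   by (rule loc_int_inner, rule weak_gradient_loc_int(2)[OF assms(1)], rule that)+
  show "(Leb x. \<psi> x * (g x \<bullet> b)) \<le> (Leb x. \<psi> x * (g' x \<bullet> b))"
   if t: "test_fun G \<psi>" for \<psi>
   using weak_gradient_inner[OF assms(1) \<open>weak_gradient G f g\<close> t, of b]
    weak_gradient_inner[OF assms(1) \<open>weak_gradient G f g'\<close> t, of b] by linarith
 qed
 have "AE x in lebesgue. \<forall>b\<in>Basis. (x \<in> G \<longrightarrow> g x \<bullet> b \<le> g' x \<bullet> b) \<and> (x \<in> G \<longrightarrow> g' x \<bullet> b \<le> g x \<bullet> b)"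
  using *[OF assms(2,3)] *[OF assms(3,2)] by (intro AE_finite_allI) auto
 then show ?thesis
 proof eventually_elim
  fix x assume "\<forall>b\<in>Basis. (x \<in> G \<longrightarrow> g x \<bullet> b \<le> g' x \<bullet> b) \<and> (x \<in> G \<longrightarrow> g' x \<bullet> b \<le> g x \<bullet> b)"
  then show "x \<in> G \<longrightarrow> g x = g' x"
   by (intro impI euclidean_eqI[of "g x"] antisym) simp_all
 qed
qed


section \<open>Difference quotients\<close>

lemma nn_integral_translate:
 fixes f :: "'a::euclidean_space \<Rightarrow> ennreal"
 assumes "f \<in> bmeas"
 shows "(Bor+ x. f (x + a)) = (Bor+ x. f x)"
proof -
 have "(Bor+ x. f x) = (\<integral>\<^sup>+x. f x \<partial>distr lborel borel ((+) a))" by (simp add: lborel_distr_plus)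
 also have "\<dots> = (Bor+ x. f (a + x))" using assms by (intro nn_integral_distr) auto
 finally show ?thesis by (simp add: add.commute)
qed

lemma integral_translate:
 fixes f :: "'a::euclidean_space \<Rightarrow> 'b::euclidean_space"
 assumes "f \<in> bmeas"
 shows "(Bor x. f (x + a)) = (Bor x. f x)"
proof -
 have "(Bor x. f x) = (\<integral>x. f x \<partial>distr lborel borel ((+) a))" by (simp add: lborel_distr_plus)
 also have "\<dots> = (Bor x. f (a + x))" using assms by (intro integral_distr) auto
 finally show ?thesis by (simp add: add.commute)
qed

lemma integrable_translate:
 fixes f :: "'a::euclidean_space \<Rightarrow> 'b::euclidean_space"
 assumes "f \<in> bmeas" "integrable lborel f"
 shows "integrable lborel (\<lambda>x. f (x + a))"
proof -
 have "integrable (distr lborel borel ((+) a)) f" using assms by (simp add: lborel_distr_plus)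
 then have "integrable lborel (\<lambda>x. f (a + x))" using assms by (subst (asm) integrable_distr_eq) auto
 then show ?thesis by (simp add: add.commute)
qed

text \<open>Summation by parts for a translation, from the invariance of Lebesgue measure.\<close>

lemma integral_shift_difference:
 fixes f \<psi> :: "'a::euclidean_space \<Rightarrow> real"
 assumes [measurable]: "f \<in> bmeas" "\<psi> \<in> bmeas"
  and i0: "integrable lborel (\<lambda>x. \<psi> x * f x)" and i2: "integrable lborel (\<lambda>x. \<psi> (x - z) * f x)"
 shows "(Bor x. (\<psi> (x - z) - \<psi> x) * f x) = (Bor x. \<psi> x * (f (x + z) - f x))"
proof -
 have i3: "integrable lborel (\<lambda>x. \<psi> x * f (x + z))" using integrable_translate[OF _ i2, of z] by simp
 have "(Bor x. \<psi> (x - z) * f x) = (Bor x. \<psi> x * f (x + z))"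
  using integral_translate[of "\<lambda>x. \<psi> (x - z) * f x" z] by simp
 then show ?thesis using i0 i2 i3 by (simp add: left_diff_distrib right_diff_distrib)
qed

text \<open>If \<open>f\<close> is not integrable, the left side is 0 by the convention for Bochner
  integrals.\<close>

lemma norm_integral_le_nn_integral:
 fixes f :: "'a \<Rightarrow> 'b::{banach, second_countable_topology}"
 shows "ennreal (norm (\<integral>x. f x \<partial>M)) \<le> (\<integral>\<^sup>+x. ennreal (norm (f x)) \<partial>M)"
 by (cases "integrable M f") (auto simp: integral_norm_bound_ennreal not_integrable_integral_eq)

lemma smooth_lipschitz:
 fixes \<psi> :: "'a::euclidean_space \<Rightarrow> real"
 assumes "smooth \<psi>" "\<And>x. norm (grad \<psi> x) \<le> B"
 shows "\<bar>\<psi> x - \<psi> y\<bar> \<le> B * norm (x - y)"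
proof -
 have "onorm (\<lambda>h. h \<bullet> grad \<psi> x) \<le> B" for x
 proof (rule onorm_le)
  fix h
  have "norm (h \<bullet> grad \<psi> x) \<le> norm h * norm (grad \<psi> x)" by (simp add: Cauchy_Schwarz_ineq2)
  also have "\<dots> \<le> norm h * B" using assms(2) by (intro mult_left_mono) auto
  finally show "norm (h \<bullet> grad \<psi> x) \<le> B * norm h" by (simp add: mult.commute)
 qed
 then have "norm (\<psi> x - \<psi> y) \<le> B * norm (x - y)"
  using smooth_gderiv[OF assms(1)] unfolding gderiv_def
  by (intro differentiable_bound[of UNIV \<psi> "\<lambda>x h. h \<bullet> grad \<psi> x"]) auto
 then show ?thesis by simp
qed

lemma compact_segments:
 fixes K :: "'a::euclidean_space set"
 assumes "compact K"
 shows "compact ((\<lambda>(x, s). x + s *\<^sub>R z) ` (K \<times> {0..1::real}))"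
 by (intro compact_continuous_image compact_Times assms compact_Icc)
  (auto simp: case_prod_unfold intro!: continuous_intros)

lemma set_integrable_lebesgue_borel:
 fixes f :: "'a::euclidean_space \<Rightarrow> 'b::euclidean_space"
 assumes "f \<in> bmeas" "compact K"
 shows "set_integrable lebesgue K f \<longleftrightarrow> integrable lborel (\<lambda>x. indicator K x *\<^sub>R f x)"
 unfolding set_integrable_def
proof (rule integrable_completion)
 have [measurable]: "f \<in> bmeas" "K \<in> sets borel" using assms borel_compact by auto
 show "(\<lambda>x. indicator K x *\<^sub>R f x) \<in> borel_measurable lborel" by simp
qed

lemma set_integrable_nn_finite:
 fixes f :: "'a::euclidean_space \<Rightarrow> real"
 assumes "set_integrable lebesgue K f" 
 shows "(Bor+ x. ennreal (indicator K x * \<bar>f x\<bar>)) < \<infinity>"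
proof -
 have "(Leb+ x. ennreal (norm (indicator K x *\<^sub>R f x))) < \<infinity>"
  using assms unfolding set_integrable_def integrable_iff_bounded by simp
 then show ?thesis by (simp add: nn_integral_completion abs_mult)
qed

lemma segment_translate_test:
 assumes "test_fun V \<psi>" "\<And>x s. x \<in> V \<Longrightarrow> 0 \<le> s \<Longrightarrow> s \<le> 1 \<Longrightarrow> x + s *\<^sub>R z \<in> G" "0 \<le> s" "s \<le> 1"
 shows "test_fun G (\<lambda>y. \<psi> (y - s *\<^sub>R z))" "grad (\<lambda>y. \<psi> (y - s *\<^sub>R z)) y = grad \<psi> (y - s *\<^sub>R z)"
proof -
 have sm: "smooth \<psi>" and c: "compact (supp \<psi>)" "supp \<psi> \<subseteq> V" using assms(1) by (auto simp: test_fun_iff)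
 let ?S = "(+) (s *\<^sub>R z) ` supp \<psi>"
 have cS: "compact ?S" using c(1) by (rule compact_translation)
 have s: "supp (\<lambda>y. \<psi> (y - s *\<^sub>R z)) \<subseteq> ?S"
 proof (rule supp_subsetI)
  show "closed ?S" using cS by (rule compact_imp_closed)
  show "x \<in> ?S" if "\<psi> (x - s *\<^sub>R z) \<noteq> 0" for x
   using supp_mem[of \<psi>, OF that] by (intro image_eqI[of _ _ "x - s *\<^sub>R z"]) auto
 qed
 have "?S \<subseteq> G" using assms(2)[OF subsetD[OF c(2)] assms(3,4)] by (auto simp: add.commute)
 then show "test_fun G (\<lambda>y. \<psi> (y - s *\<^sub>R z))"
  using smooth_translate[OF sm, of "- (s *\<^sub>R z)"] compact_supp_subset[OF cS s] s by (auto simp: test_fun_iff)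
 show "grad (\<lambda>y. \<psi> (y - s *\<^sub>R z)) y = grad \<psi> (y - s *\<^sub>R z)"
  using grad_translate[OF sm, of "- (s *\<^sub>R z)"] by simp
qed

text \<open>Tested against \<open>\<psi>\<close>, the difference \<open>f (x + z) - f x\<close> becomes a difference of translates of \<open>\<psi>\<close>,
 so that no regularization of \<open>f\<close> is needed.\<close>

theorem weak_gradient_difference:
 assumes G: "open G" and V: "open V" and VG: "\<And>x s. x \<in> V \<Longrightarrow> 0 \<le> s \<Longrightarrow> s \<le> 1 \<Longrightarrow> x + s *\<^sub>R z \<in> G"
  and w: "weak_gradient G f g"
  and f[measurable]: "f \<in> bmeas" and \<gamma>[measurable]: "\<gamma> \<in> bmeas"
  and \<gamma>0: "\<And>x. 0 \<le> \<gamma> x" and \<gamma>l: "loc_int G \<gamma>" and \<gamma>g: "ae_on G (\<lambda>x. norm (g x) \<le> \<gamma> x)"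
 shows "ae_on V (\<lambda>x. ennreal \<bar>f (x + z) - f x\<bar>
  \<le> ennreal (norm z) * (segint \<gamma> x z))"
proof -
 define A where "A x = (segint \<gamma> x z)" for x
 have A[measurable]: "A \<in> bmeas" unfolding A_def by measurable
 \<comment> \<open>\<open>enn2real\<close> turns the value infinity into 0. By \<open>Afin\<close>
   this happens only on a null subset of each compact set in \<open>V\<close>, which
   \<open>fin\<close> below makes precise.\<close>
 define a where "a x = enn2real (A x)" for x
 have a[measurable]: "a \<in> bmeas" unfolding a_def by measurable
 have lf: "loc_int G f" using weak_gradient_loc_int(1)[OF G w] .
 have VsubG: "V \<subseteq> G" using VG[of _ 0] by auto
 define Sg where "Sg K = (\<lambda>(x, s). x + s *\<^sub>R z) ` (K \<times> {0..1::real})" for K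
 have SgI: "x + s *\<^sub>R z \<in> Sg K" if "x \<in> K" "0 \<le> s" "s \<le> 1" for x s K
  unfolding Sg_def using that by (intro image_eqI[of _ _ "(x, s)"]) auto
 have Sg: "compact (Sg K)" "Sg K \<subseteq> G" "Sg K \<in> sets borel" if "compact K" "K \<subseteq> V" for K
 proof -
  show c: "compact (Sg K)" using compact_segments[OF that(1)] by (simp add: Sg_def)
  then show "Sg K \<in> sets borel" by (rule borel_compact)
  show "Sg K \<subseteq> G" using that(2) VG by (auto simp: Sg_def)
 qed
 \<comment> \<open>For each \<open>s\<close> the translate of \<open>K\<close> by
   \<open>s *\<^sub>R z\<close> stays in the compact set \<open>Sg K\<close> swept out by the
   segments, so Fubini and translation invariance bound the double integral by that of
   \<open>\<gamma>\<close> over \<open>Sg K\<close>.\<close>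
 have Afin: "(Bor+ x. indicator K x * A x) < \<infinity>" if K: "compact K" "K \<subseteq> V" for K
 proof -
  have [measurable]: "K \<in> sets borel" "Sg K \<in> sets borel" using Sg[OF K] borel_compact K by auto
  have "(Bor+ x. indicator K x * A x)
    = (Bor+ x. (Bor+ s. indicator K x * (indicator {0..1} s * ennreal (\<gamma> (x + s *\<^sub>R z)))))"
   unfolding A_def by (subst nn_integral_cmult) auto
  also have "\<dots> = (Bor+ s. (Bor+ x. indicator K x * (indicator {0..1} s * ennreal (\<gamma> (x + s *\<^sub>R z)))))"
   by (subst lborel_pair.Fubini') auto
  also have "\<dots> \<le> (Bor+ s. (Bor+ x. indicator {0..1::real} s * ennreal (indicator (Sg K) (x + s *\<^sub>R z) * \<bar>\<gamma> (x + s *\<^sub>R z)\<bar>)))"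
   using \<gamma>0 by (intro nn_integral_mono) (auto simp: indicator_def SgI)
  also have "\<dots> = (Bor+ s. indicator {0..1::real} s * (Bor+ x. ennreal (indicator (Sg K) (x + s *\<^sub>R z) * \<bar>\<gamma> (x + s *\<^sub>R z)\<bar>)))"
   by (intro nn_integral_cong nn_integral_cmult) auto
  also have "\<dots> = (Bor+ s. indicator {0..1::real} s * (Bor+ x. ennreal (indicator (Sg K) x * \<bar>\<gamma> x\<bar>)))"
   by (subst nn_integral_translate[where f="\<lambda>x. ennreal (indicator (Sg K) x * \<bar>\<gamma> x\<bar>)"]) auto
  also have "\<dots> = (Bor+ x. ennreal (indicator (Sg K) x * \<bar>\<gamma> x\<bar>))"
   by (subst nn_integral_multc) auto
  also have "\<dots> < \<infinity>" using \<gamma>l Sg[OF K] by (intro set_integrable_nn_finite) (auto simp: loc_int_def)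
  finally show ?thesis .
 qed
 have ale: "ennreal (a x) \<le> A x" for x
  unfolding a_def by (cases "A x") (auto simp: ennreal_enn2real_if)
 have la: "loc_int V a"
  unfolding loc_int_def
 proof clarify
  fix K assume K: "compact K" "K \<subseteq> V"
  have [measurable]: "K \<in> sets borel" using borel_compact K by auto
  have "integrable lborel (\<lambda>x. indicator K x *\<^sub>R a x)"
  proof (rule integrableI_bounded)
   have "(Bor+ x. ennreal (norm (indicator K x *\<^sub>R a x))) \<le> (Bor+ x. indicator K x * A x)"
    using ale by (intro nn_integral_mono) (auto simp: indicator_def a_def)
   then show "(Bor+ x. ennreal (norm (indicator K x *\<^sub>R a x))) < \<infinity>" using Afin[OF K] by simp
  qed simp
  then show "set_integrable lebesgue K a" using set_integrable_lebesgue_borel[OF a K(1)] by simp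
 qed
 have lfz: "loc_int V (\<lambda>x. f (x + z))"
  unfolding loc_int_def
 proof clarify
  fix K assume K: "compact K" "K \<subseteq> V"
  have cK: "compact ((+) z ` K)" using K(1) by (rule compact_translation)
  have "(+) z ` K \<subseteq> G" using K(2) VG[of _ 1] by (auto simp: add.commute)
  then have "set_integrable lebesgue ((+) z ` K) f" using lf cK by (auto simp: loc_int_def)
  then have "integrable lborel (\<lambda>x. indicator ((+) z ` K) x *\<^sub>R f x)" 
   using set_integrable_lebesgue_borel[OF f cK] by simp
  then have "integrable lborel (\<lambda>x. indicator ((+) z ` K) (x + z) *\<^sub>R f (x + z))"
   using borel_compact[OF cK] by (intro integrable_translate[where f="\<lambda>x. indicator ((+) z ` K) x *\<^sub>R f x"]) auto
  moreover have "indicator ((+) z ` K) (x + z) = (indicator K x :: real)" for x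
   by (auto simp: indicator_def add.commute)
  ultimately show "set_integrable lebesgue K (\<lambda>x. f (x + z))"
   using set_integrable_lebesgue_borel[of "\<lambda>x. f (x + z)" K] K by simp
 qed
 have lD: "loc_int V (\<lambda>x. f (x + z) - f x)"
  by (rule loc_int_diff[OF lfz loc_int_mono[OF lf VsubG]])
 have lza: "loc_int V (\<lambda>x. norm z * a x)" using loc_int_scale[OF la, of "norm z"] by simp
 have test: "\<bar>(Leb x. \<psi> x * (f (x + z) - f x))\<bar> \<le> (Leb x. \<psi> x * (norm z * a x))"
  if t: "test_fun V \<psi>" and pos: "\<And>x. 0 \<le> \<psi> x" for \<psi>
 proof -
  have sm: "smooth \<psi>" and c: "compact (supp \<psi>)" "supp \<psi> \<subseteq> V" using t by (auto simp: test_fun_iff)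
  have [measurable]: "\<psi> \<in> bmeas" "grad \<psi> \<in> bmeas" using test_fun_borel[OF t] by auto
  obtain B where B: "B > 0" "\<And>x. \<bar>\<psi> x\<bar> \<le> B" "\<And>x. norm (grad \<psi> x) \<le> B" using test_fun_bounds[OF t] by blast
  let ?S = "Sg (supp \<psi>)"
  note S = Sg[OF c]
  have [measurable]: "?S \<in> sets borel" by (rule S)
  \<comment> \<open>\<open>H\<close> is integrated in both orders. Over \<open>s\<close> it yields
    the difference of the translates of \<open>\<psi>\<close> by the fundamental theorem of calculus
    (\<open>ftc\<close>); over \<open>y\<close> it tests the weak gradient with a translate of
    \<open>\<psi>\<close>, which is still supported in \<open>G\<close>
    (\<open>slice\<close>).\<close>
  define H where "H y s = f y * (indicator {0..1} s * (grad \<psi> (y - s *\<^sub>R z) \<bullet> z))" for y s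
  have Hm[measurable]: "case_prod H \<in> borel_measurable (lborel \<Otimes>\<^sub>M lborel)" unfolding H_def by measurable
  have Hb: "\<bar>H y s\<bar> \<le> indicator ?S y * \<bar>f y\<bar> * (indicator {0..1} s * (B * norm z))" for y s
  proof (cases "s \<in> {0..1} \<and> y - s *\<^sub>R z \<in> supp \<psi>")
   case True
   then have "y \<in> ?S" using SgI[of "y - s *\<^sub>R z" "supp \<psi>" s] by simp
   have "\<bar>grad \<psi> (y - s *\<^sub>R z) \<bullet> z\<bar> \<le> norm (grad \<psi> (y - s *\<^sub>R z)) * norm z" by (rule Cauchy_Schwarz_ineq2)
   also have "\<dots> \<le> B * norm z" using B by (intro mult_right_mono) auto
   finally show ?thesis using True \<open>y \<in> ?S\<close> by (auto simp: H_def abs_mult intro!: mult_left_mono)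
  next
   case False
   then have "H y s = 0" using grad_zero_outside[of "y - s *\<^sub>R z" \<psi>] by (auto simp: H_def indicator_def)
   then show ?thesis using B by simp
  qed
  have fS: "set_integrable lebesgue ?S f" using lf S by (auto simp: loc_int_def)
  have Hi: "integrable (lborel \<Otimes>\<^sub>M lborel) (case_prod H)"
  proof (rule integrableI_bounded[OF Hm])
   have "(\<integral>\<^sup>+p. ennreal (norm (case_prod H p)) \<partial>(lborel \<Otimes>\<^sub>M lborel)) = (Bor+ y. (Bor+ s. ennreal (norm (H y s))))"
    using lborel.nn_integral_fst[of "\<lambda>p. ennreal (norm (case_prod H p))" lborel] by simp
   also have "\<dots> \<le> (Bor+ y. (Bor+ s. ennreal (indicator ?S y * \<bar>f y\<bar>) * (ennreal (B * norm z) * indicator {0..1::real} s)))"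
   proof (intro nn_integral_mono)
    fix y s
    have "ennreal (norm (H y s)) \<le> ennreal (indicator ?S y * \<bar>f y\<bar> * (indicator {0..1} s * (B * norm z)))"
     using Hb by (intro ennreal_leI) simp
    also have "\<dots> = ennreal (indicator ?S y * \<bar>f y\<bar>) * (ennreal (B * norm z) * indicator {0..1::real} s)"
     using B(1) by (simp add: ennreal_mult'[symmetric] indicator_def)
    finally show "ennreal (norm (H y s)) \<le> \<dots>" .
   qed
   also have "\<dots> = (Bor+ y. ennreal (indicator ?S y * \<bar>f y\<bar>)) * ennreal (B * norm z)"
    by (simp add: nn_integral_cmult nn_integral_multc)
   also have "\<dots> < \<infinity>" using set_integrable_nn_finite[OF fS] by (simp add: ennreal_mult_less_top)
   finally show "(\<integral>\<^sup>+p. ennreal (norm (case_prod H p)) \<partial>(lborel \<Otimes>\<^sub>M lborel)) < \<infinity>" .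
  qed
  have ftc: "(Bor s. H y s) = - (f y * (\<psi> (y - z) - \<psi> y))" for y
  proof -
   let ?F = "\<lambda>s. - \<psi> (y - s *\<^sub>R z)"
   have d: "(?F has_vector_derivative (grad \<psi> (y - s *\<^sub>R z) \<bullet> z)) (at s within {0..1})" for s
   proof -
    have "(\<psi> has_derivative (\<lambda>h. h \<bullet> grad \<psi> (y - s *\<^sub>R z))) (at (y - s *\<^sub>R z))"
     using smooth_gderiv[OF sm] by (simp add: gderiv_def)
    then have "((\<lambda>s. \<psi> (y - s *\<^sub>R z)) has_derivative (\<lambda>h. (- (h *\<^sub>R z)) \<bullet> grad \<psi> (y - s *\<^sub>R z))) (at s within {0..1})"
     by (rule has_derivative_compose[rotated]) (auto intro!: derivative_eq_intros)
    then have "(?F has_derivative (\<lambda>h. - ((- (h *\<^sub>R z)) \<bullet> grad \<psi> (y - s *\<^sub>R z)))) (at s within {0..1})"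
     by (rule has_derivative_minus)
    then show ?thesis unfolding has_vector_derivative_def by (simp add: inner_commute)
   qed
   have "(Bor s. indicator {0..1} s *\<^sub>R (grad \<psi> (y - s *\<^sub>R z) \<bullet> z)) = ?F 1 - ?F 0"
   proof (rule integral_FTC_atLeastAtMost)
    show "continuous_on {0..1} (\<lambda>s. grad \<psi> (y - s *\<^sub>R z) \<bullet> z)"
     by (intro continuous_intros continuous_on_compose2[OF smooth_grad_continuous[OF sm]]) auto
   qed (use d in auto)
   then have "f y * (Bor s. indicator {0..1} s * (grad \<psi> (y - s *\<^sub>R z) \<bullet> z)) = f y * (\<psi> y - \<psi> (y - z))"
    by simp
   then show ?thesis by (simp add: H_def right_diff_distrib)
  qed
  have iz: "integrable lebesgue (\<lambda>x. \<psi> x * f (x + z))" using test_fun_integrable[OF t lfz] by simp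
  have i0: "integrable lebesgue (\<lambda>x. \<psi> x * f x)" using test_fun_integrable[OF t loc_int_mono[OF lf VsubG]] by simp
  have izb: "integrable lborel (\<lambda>x. \<psi> x * f (x + z))" and i0b: "integrable lborel (\<lambda>x. \<psi> x * f x)"
   using iz i0 by (simp_all add: integrable_completion)
  have iz': "integrable lborel (\<lambda>y. \<psi> (y - z) * f y)"
   using integrable_translate[of "\<lambda>x. \<psi> x * f (x + z)" "- z"] izb by simp
  have "(Leb x. \<psi> x * (f (x + z) - f x)) = (Bor x. \<psi> x * (f (x + z) - f x))"
   by (intro integral_completion) simp
  also have "\<dots> = (Bor x. \<psi> x * f (x + z)) - (Bor x. \<psi> x * f x)"
   using izb i0b by (simp add: right_diff_distrib)
  also have "(Bor x. \<psi> x * f (x + z)) = (Bor y. \<psi> (y - z) * f y)"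
   using integral_translate[of "\<lambda>x. \<psi> x * f (x + z)" "- z"] by simp
  also have "(Bor y. \<psi> (y - z) * f y) - (Bor x. \<psi> x * f x) = (Bor y. - (Bor s. H y s))"
   using iz' i0b by (simp add: ftc algebra_simps)
  also have "\<dots> = - (Bor s. (Bor y. H y s))"
   using lborel_pair.Fubini_integral[OF Hi] by simp
  finally have eq: "\<bar>(Leb x. \<psi> x * (f (x + z) - f x))\<bar> = norm (Bor s. (Bor y. H y s))" by simp
  have slice: "ennreal (norm (Bor y. H y s)) \<le> indicator {0..1} s * (Bor+ x. ennreal (\<psi> x * norm z) * ennreal (\<gamma> (x + s *\<^sub>R z)))" for s
  proof (cases "s \<in> {0..1}")
   case True
   have t': "test_fun G (\<lambda>y. \<psi> (y - s *\<^sub>R z))" and g': "\<And>y. grad (\<lambda>y. \<psi> (y - s *\<^sub>R z)) y = grad \<psi> (y - s *\<^sub>R z)"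
    using segment_translate_test[OF t VG] True by auto
   have "(Bor y. H y s) = (Leb y. H y s)"
    unfolding H_def by (intro integral_completion[symmetric]) measurable
   also have "\<dots> = - (Leb y. \<psi> (y - s *\<^sub>R z) * (g y \<bullet> z))"
    using weak_gradient_inner[OF G w t', of z] True by (simp add: H_def g')
   finally have "ennreal (norm (Bor y. H y s)) \<le> (Leb+ y. ennreal (norm (\<psi> (y - s *\<^sub>R z) * (g y \<bullet> z))))"
    using norm_integral_le_nn_integral[of lebesgue "\<lambda>y. \<psi> (y - s *\<^sub>R z) * (g y \<bullet> z)"] by simp
   also have "\<dots> \<le> (Leb+ y. ennreal (\<psi> (y - s *\<^sub>R z) * norm z) * ennreal (\<gamma> y))"
   proof (rule nn_integral_mono_AE)
    show "AE y in lebesgue. ennreal (norm (\<psi> (y - s *\<^sub>R z) * (g y \<bullet> z))) \<le> ennreal (\<psi> (y - s *\<^sub>R z) * norm z) * ennreal (\<gamma> y)"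
     using \<gamma>g
    proof eventually_elim
     case (elim y)
     show ?case
     proof (cases "y \<in> G")
      case True
      have "\<bar>g y \<bullet> z\<bar> \<le> norm (g y) * norm z" by (rule Cauchy_Schwarz_ineq2)
      also have "\<dots> \<le> \<gamma> y * norm z" using elim True by (intro mult_right_mono) auto
      finally have "\<psi> (y - s *\<^sub>R z) * \<bar>g y \<bullet> z\<bar> \<le> \<psi> (y - s *\<^sub>R z) * (\<gamma> y * norm z)"
       using pos by (intro mult_left_mono) auto
      then show ?thesis using pos \<gamma>0
       by (subst ennreal_mult'[symmetric]) (auto simp: abs_mult algebra_simps intro!: ennreal_leI)
     next
      case False
      then have "\<psi> (y - s *\<^sub>R z) = 0" using test_fun_zero_outside[OF t'] by blast
      then show ?thesis by simp
     qed
    qed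
   qed
   also have "\<dots> = (Bor+ y. ennreal (\<psi> (y - s *\<^sub>R z) * norm z) * ennreal (\<gamma> y))" by (rule nn_integral_completion)
   also have "\<dots> = (Bor+ x. ennreal (\<psi> x * norm z) * ennreal (\<gamma> (x + s *\<^sub>R z)))"
    using nn_integral_translate[of "\<lambda>y. ennreal (\<psi> (y - s *\<^sub>R z) * norm z) * ennreal (\<gamma> y)" "s *\<^sub>R z"] by simp
   finally show ?thesis using True by simp
  qed (simp add: H_def)
  have fin: "AE x in lborel. \<psi> x * norm z = 0 \<or> A x = ennreal (a x)"
  proof -
   have [measurable]: "supp \<psi> \<in> sets borel" using c borel_compact by auto
   have "AE x in lborel. indicator (supp \<psi>) x * A x \<noteq> \<infinity>"
    using Afin[OF c] by (intro nn_integral_PInf_AE) auto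
   then show ?thesis
   proof eventually_elim
    case (elim x)
    show ?case
    proof (cases "x \<in> supp \<psi>")
     case True
     then show ?thesis using elim by (auto simp: a_def top.not_eq_extremum)
    qed (use supp_mem in auto)
   qed
  qed
  have "ennreal \<bar>(Leb x. \<psi> x * (f (x + z) - f x))\<bar> \<le> (Bor+ s. ennreal (norm (Bor y. H y s)))"
   unfolding eq by (rule norm_integral_le_nn_integral)
  also have "\<dots> \<le> (Bor+ s. indicator {0..1} s * (Bor+ x. ennreal (\<psi> x * norm z) * ennreal (\<gamma> (x + s *\<^sub>R z))))"
   by (intro nn_integral_mono slice)
  also have "\<dots> = (Bor+ s. (Bor+ x. ennreal (\<psi> x * norm z) * (indicator {0..1} s * ennreal (\<gamma> (x + s *\<^sub>R z)))))"
   by (subst nn_integral_cmult[symmetric]) (auto simp: ac_simps)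
  also have "\<dots> = (Bor+ x. (Bor+ s. ennreal (\<psi> x * norm z) * (indicator {0..1} s * ennreal (\<gamma> (x + s *\<^sub>R z)))))"
   by (subst lborel_pair.Fubini') auto
  also have "\<dots> = (Bor+ x. ennreal (\<psi> x * norm z) * A x)"
   unfolding A_def by (intro nn_integral_cong nn_integral_cmult) auto
  also have "\<dots> = (Bor+ x. ennreal (\<psi> x * (norm z * a x)))"
  proof (rule nn_integral_cong_AE, use fin in eventually_elim)
   case (elim x)
   have "ennreal (\<psi> x * norm z) * ennreal (a x) = ennreal (\<psi> x * (norm z * a x))"
    by (subst ennreal_mult[symmetric]) (auto simp: pos a_def mult.assoc)
   moreover have "\<psi> x * (norm z * a x) = (\<psi> x * norm z) * a x" by simp
   ultimately show ?case using elim
    by (metis ennreal_0 mult_zero_left)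
  qed
  also have "\<dots> = (Leb+ x. ennreal (\<psi> x * (norm z * a x)))" by (simp add: nn_integral_completion)
  also have "\<dots> = ennreal (Leb x. \<psi> x * (norm z * a x))"
   using test_fun_integrable[OF t lza] pos by (intro nn_integral_eq_integral) (auto simp: a_def)
  finally show ?thesis
   by (subst (asm) ennreal_le_iff) (auto intro!: integral_nonneg_AE simp: pos a_def)
 qed
 \<comment> \<open>The integral estimate bounds an absolute value, so the fundamental lemma can be
   applied once to the difference and once to its negative.\<close>
 have "ae_on V (\<lambda>x. f (x + z) - f x \<le> norm z * a x)"
  by (rule fundamental_lemma[OF V lD lza]) (use test in fastforce)
 moreover have "ae_on V (\<lambda>x. - (f (x + z) - f x) \<le> norm z * a x)"
 proof (rule fundamental_lemma[OF V _ lza])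
  show "loc_int V (\<lambda>x. - (f (x + z) - f x))" using loc_int_scale[OF lD, of "-1"] by simp
  show "(Leb x. \<psi> x * - (f (x + z) - f x)) \<le> (Leb x. \<psi> x * (norm z * a x))"
   if "test_fun V \<psi>" "\<And>x. 0 \<le> \<psi> x" for \<psi>
  proof -
   have "(Leb x. \<psi> x * - (f (x + z) - f x)) = - (Leb x. \<psi> x * (f (x + z) - f x))"
    by (simp only: mult_minus_right Bochner_Integration.integral_minus)
   then show ?thesis using test[OF that] by linarith
  qed
 qed
 ultimately show ?thesis
 proof eventually_elim
  case (elim x)
  show ?case
  proof
   assume "x \<in> V"
   with elim have "ennreal \<bar>f (x + z) - f x\<bar> \<le> ennreal (norm z * a x)" by (intro ennreal_leI) auto
   also have "\<dots> = ennreal (norm z) * ennreal (a x)" by (simp add: ennreal_mult a_def)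
   also have "\<dots> \<le> ennreal (norm z) * A x" by (intro mult_left_mono ale) simp
   finally show "ennreal \<bar>f (x + z) - f x\<bar> \<le> ennreal (norm z) * (segint \<gamma> x z)"
    by (simp add: A_def)
  qed
 qed
qed


lemma compact_neighbourhood:
 fixes S G :: "'a::euclidean_space set"
 assumes "compact S" "open G" "S \<subseteq> G"
 obtains \<delta> K where "\<delta> > 0" "compact K" "K \<subseteq> G" "\<And>x y. x \<in> S \<Longrightarrow> norm y \<le> \<delta> \<Longrightarrow> x + y \<in> K"
proof -
 obtain \<delta> where \<delta>: "\<delta> > 0" "(\<Union>x\<in>S. cball x \<delta>) \<subseteq> G"
  using compact_subset_open_imp_cball_epsilon_subset[OF assms] by blast
 show ?thesis
 proof (rule that[of \<delta> "{x + y |x y. x \<in> S \<and> y \<in> cball 0 \<delta>}"])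
  show "compact {x + y |x y. x \<in> S \<and> y \<in> cball 0 \<delta>}" by (rule compact_sums[OF assms(1) compact_cball])
  show "{x + y |x y. x \<in> S \<and> y \<in> cball 0 \<delta>} \<subseteq> G"
  proof clarify
   fix x y :: 'a assume "x \<in> S" "y \<in> cball 0 \<delta>"
   then have "x + y \<in> cball x \<delta>" by (simp add: dist_norm)
   then show "x + y \<in> G" using \<delta>(2) \<open>x \<in> S\<close> by blast
  qed
  show "x + y \<in> {x + y |x y. x \<in> S \<and> y \<in> cball 0 \<delta>}" if "x \<in> S" "norm y \<le> \<delta>" for x y
   using that by (intro CollectI exI[of _ x] exI[of _ y]) simp
 qed (rule \<delta>)
qed

lemma AE_lebesgue_translate:
 assumes "AE x in lebesgue. P x"
 shows "AE x in lebesgue. P (x + a)"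
proof -
 have "AE x in lborel. P x" using assms by (simp add: AE_completion_iff)
 then obtain N where N: "{x \<in> space lborel. \<not> P x} \<subseteq> N" "N \<in> null_sets lborel"
  unfolding eventually_ae_filter by blast
 have "{x. x - (- a) \<in> N} \<in> null_sets lborel" using N(2) by (rule null_sets_translation)
 then have "AE x in lborel. x \<notin> {x. x - (- a) \<in> N}" by (rule AE_not_in)
 then have "AE x in lborel. P (x + a)" by eventually_elim (use N(1) in auto)
 then show ?thesis by (rule AE_completion)
qed

lemma smooth_directional_derivative:
 assumes "smooth \<psi>"
 shows "((\<lambda>t. (\<psi> (x + t *\<^sub>R b) - \<psi> x) / t) \<longlongrightarrow> grad \<psi> x \<bullet> b) (at 0)"
proof -
 have "(\<psi> has_derivative (\<lambda>h. h \<bullet> grad \<psi> (x + 0 *\<^sub>R b))) (at (x + 0 *\<^sub>R b))"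
  using smooth_gderiv[OF assms] by (simp add: gderiv_def)
 then have "((\<lambda>t. \<psi> (x + t *\<^sub>R b)) has_derivative (\<lambda>h. (h *\<^sub>R b) \<bullet> grad \<psi> (x + 0 *\<^sub>R b))) (at 0)"
  by (rule has_derivative_compose[rotated]) (auto intro!: derivative_eq_intros)
 moreover have "(\<lambda>h. (h *\<^sub>R b) \<bullet> grad \<psi> (x + 0 *\<^sub>R b)) = (*) (grad \<psi> x \<bullet> b)"
  by (auto simp: inner_commute)
 ultimately have "((\<lambda>t. \<psi> (x + t *\<^sub>R b)) has_real_derivative (grad \<psi> x \<bullet> b)) (at 0)"
  by (simp add: has_field_derivative_def)
 then show ?thesis by (simp add: DERIV_def)
qed

text \<open>The difference quotients of \<open>\<psi>\<close> are bounded by a bound of its gradient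
  and vanish off \<open>K\<close>, so a multiple of \<open>\<bar>f\<bar>\<close> on \<open>K\<close>
  dominates the integrands.\<close>

lemma difference_quotient_limit:
 fixes f :: "'a::euclidean_space \<Rightarrow> real"
 assumes f: "set_integrable lebesgue K f" and \<psi>: "test_fun G \<psi>" and b: "norm b \<le> 1"
  and K: "\<And>x y. x \<in> supp \<psi> \<Longrightarrow> norm y \<le> \<delta> \<Longrightarrow> x + y \<in> K"
  and t: "\<And>n. 0 < t n" "\<And>n. t n \<le> \<delta>" "t \<longlonglongrightarrow> 0"
 shows "(\<lambda>n. (Leb x. ((\<psi> (x + t n *\<^sub>R b) - \<psi> x) / t n) *\<^sub>R f x)) \<longlonglongrightarrow> (Leb x. (grad \<psi> x \<bullet> b) *\<^sub>R f x)"
  and "\<And>n. integrable lebesgue (\<lambda>x. ((\<psi> (x + t n *\<^sub>R b) - \<psi> x) / t n) *\<^sub>R f x)"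
proof -
 obtain B where B: "B > 0" "\<And>x. \<bar>\<psi> x\<bar> \<le> B" "\<And>x. norm (grad \<psi> x) \<le> B" using test_fun_bounds[OF \<psi>] by blast
 have sm: "smooth \<psi>" using \<psi> by (rule test_fun_smooth)
 have [measurable]: "\<psi> \<in> bmeas" "grad \<psi> \<in> bmeas" using test_fun_borel[OF \<psi>] by auto
 have SK: "x \<in> K" if "x \<in> supp \<psi>" for x using K[OF that, of 0] t(1,2)[of 0] by simp
 define q where "q n x = (\<psi> (x + t n *\<^sub>R b) - \<psi> x) / t n" for n x
 have q1: "\<bar>q n x\<bar> \<le> B" for n x
 proof -
  have "\<bar>\<psi> (x + t n *\<^sub>R b) - \<psi> x\<bar> \<le> B * norm (t n *\<^sub>R b)"
   using smooth_lipschitz[OF sm B(3), of "x + t n *\<^sub>R b" x] by simp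
  also have "\<dots> \<le> B * t n" using b t(1)[of n] B(1) by (intro mult_left_mono) (auto simp: mult_left_le)
  finally show ?thesis using t(1)[of n] by (simp add: q_def field_simps)
 qed
 have q0: "q n x = 0" if "x \<notin> K" for n x
 proof -
  have "\<psi> x = 0" using SK supp_mem[of \<psi> x] that by blast
  moreover have "\<psi> (x + t n *\<^sub>R b) = 0"
  proof (rule ccontr)
   assume "\<psi> (x + t n *\<^sub>R b) \<noteq> 0"
   then have "x + t n *\<^sub>R b \<in> supp \<psi>" by (rule supp_mem[of \<psi>])
   moreover have "norm (- (t n *\<^sub>R b)) \<le> \<delta>"
    using b t(1,2)[of n] mult_mono[of "t n" \<delta> "norm b" 1] by auto
   ultimately have "x + t n *\<^sub>R b + - (t n *\<^sub>R b) \<in> K" by (rule K)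
   with that show False by simp
  qed
  ultimately show ?thesis by (simp add: q_def)
 qed
 have qm: "q n \<in> bmeas" for n unfolding q_def by measurable
 show i: "integrable lebesgue (\<lambda>x. ((\<psi> (x + t n *\<^sub>R b) - \<psi> x) / t n) *\<^sub>R f x)" for n
  using loc_int_test[OF f qm q1 q0] by (simp add: q_def)
 have ig: "integrable lebesgue (\<lambda>x. (grad \<psi> x \<bullet> b) *\<^sub>R f x)"
 proof (rule loc_int_test[OF f])
  show "\<bar>grad \<psi> x \<bullet> b\<bar> \<le> B" for x
  proof -
   have "\<bar>grad \<psi> x \<bullet> b\<bar> \<le> norm (grad \<psi> x) * norm b" by (rule Cauchy_Schwarz_ineq2)
   also have "\<dots> \<le> B * 1" using B b by (intro mult_mono) auto
   finally show ?thesis by simp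
  qed
  show "grad \<psi> x \<bullet> b = 0" if "x \<notin> K" for x using SK grad_zero_outside[of x \<psi>] that by force
 qed measurable
 have d1: "integrable lebesgue (\<lambda>x. B * norm (indicator K x *\<^sub>R f x))"
  using f integrable_norm unfolding set_integrable_def by (intro integrable_mult_right) blast
 have d2: "AE x in lebesgue. (\<lambda>n. q n x *\<^sub>R f x) \<longlonglongrightarrow> (grad \<psi> x \<bullet> b) *\<^sub>R f x"
 proof (rule AE_I2)
  fix x
  have "filterlim t (at 0) sequentially"
   using t(3) t(1) by (auto simp: filterlim_at intro!: always_eventually less_imp_neq[THEN not_sym])
  then have "(\<lambda>n. q n x) \<longlonglongrightarrow> grad \<psi> x \<bullet> b"
   unfolding q_def by (rule filterlim_compose[OF smooth_directional_derivative[OF sm]])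
  then show "(\<lambda>n. q n x *\<^sub>R f x) \<longlonglongrightarrow> (grad \<psi> x \<bullet> b) *\<^sub>R f x" by (rule tendsto_scaleR[OF _ tendsto_const])
 qed
 have d3: "AE x in lebesgue. norm (q n x *\<^sub>R f x) \<le> B * norm (indicator K x *\<^sub>R f x)" for n
 proof (rule AE_I2)
  fix x
  show "norm (q n x *\<^sub>R f x) \<le> B * norm (indicator K x *\<^sub>R f x)"
   using q0[of x n] mult_right_mono[OF q1[of n x], of "\<bar>f x\<bar>"] by (cases "x \<in> K") (auto simp: abs_mult)
 qed
 have "(\<lambda>n. (Leb x. q n x *\<^sub>R f x)) \<longlonglongrightarrow> (Leb x. (grad \<psi> x \<bullet> b) *\<^sub>R f x)"
  by (rule integral_dominated_convergence[OF borel_measurable_integrable[OF ig] _ d1 d2 d3])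
   (use i in \<open>auto simp: q_def intro: borel_measurable_integrable\<close>)
 then show "(\<lambda>n. (Leb x. ((\<psi> (x + t n *\<^sub>R b) - \<psi> x) / t n) *\<^sub>R f x)) \<longlonglongrightarrow> (Leb x. (grad \<psi> x \<bullet> b) *\<^sub>R f x)"
  by (simp add: q_def)
qed

lemma loc_int_borel_nonneg:
 assumes "open G" "loc_int G g"
 obtains \<gamma> where "\<gamma> \<in> bmeas" "\<And>x. 0 \<le> \<gamma> x" "ae_on G (\<lambda>x. norm (g x) = \<gamma> x)" "loc_int G \<gamma>"
proof -
 obtain \<gamma>' where \<gamma>': "\<gamma>' \<in> bmeas" "ae_on G (\<lambda>x. norm (g x) = \<gamma>' x)"
  using loc_int_borel[OF assms(1) loc_int_norm[OF assms(2)]] by blast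
 have ae: "ae_on G (\<lambda>x. norm (g x) = \<bar>\<gamma>' x\<bar>)"
  using \<gamma>'(2) by eventually_elim (metis abs_norm_cancel)
 show ?thesis
  using \<gamma>'(1) ae loc_int_cong_AE[OF loc_int_norm[OF assms(2)] ae] by (intro that[of "\<lambda>x. \<bar>\<gamma>' x\<bar>"]) auto
qed

text \<open>The chain rule in the form of an estimate: no formula for \<open>w\<close> is needed, and \<open>f\<close> may be any
 function whose increments are dominated by those of \<open>v\<close> and \<open>\<phi>\<close>.\<close>

theorem weak_gradient_lipschitz_bound:
 assumes G: "open G" and wf: "weak_gradient G f w" and wv: "weak_gradient G v gv" and w\<phi>: "weak_gradient G \<phi> g\<phi>"
  and C: "0 \<le> C" and lip: "\<And>x y. x \<in> G \<Longrightarrow> y \<in> G \<Longrightarrow> \<bar>f x - f y\<bar> \<le> C * (\<bar>v x - v y\<bar> + \<bar>\<phi> x - \<phi> y\<bar>)"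
  and b: "norm b \<le> 1"
 shows "ae_on G (\<lambda>x. w x \<bullet> b \<le> C * (norm (gv x) + norm (g\<phi> x)))"
proof -
 note lf = weak_gradient_loc_int[OF G wf] and lv = weak_gradient_loc_int[OF G wv] and l\<phi> = weak_gradient_loc_int[OF G w\<phi>]
 obtain f' where f'[measurable]: "f' \<in> bmeas" and f'e: "ae_on G (\<lambda>x. f x = f' x)"
  using loc_int_borel[OF G lf(1)] by blast
 obtain v' where v'[measurable]: "v' \<in> bmeas" and v'e: "ae_on G (\<lambda>x. v x = v' x)"
  using loc_int_borel[OF G lv(1)] by blast
 obtain \<phi>' where \<phi>'[measurable]: "\<phi>' \<in> bmeas" and \<phi>'e: "ae_on G (\<lambda>x. \<phi> x = \<phi>' x)"
  using loc_int_borel[OF G l\<phi>(1)] by blast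
 obtain \<gamma>v where \<gamma>v[measurable]: "\<gamma>v \<in> bmeas" and \<gamma>v0: "\<And>x. 0 \<le> \<gamma>v x"
  and \<gamma>ve: "ae_on G (\<lambda>x. norm (gv x) = \<gamma>v x)" and \<gamma>vl: "loc_int G \<gamma>v"
  using loc_int_borel_nonneg[OF G lv(2)] by blast
 obtain \<gamma>\<phi> where \<gamma>\<phi>[measurable]: "\<gamma>\<phi> \<in> bmeas" and \<gamma>\<phi>0: "\<And>x. 0 \<le> \<gamma>\<phi> x"
  and \<gamma>\<phi>e: "ae_on G (\<lambda>x. norm (g\<phi> x) = \<gamma>\<phi> x)" and \<gamma>\<phi>l: "loc_int G \<gamma>\<phi>"
  using loc_int_borel_nonneg[OF G l\<phi>(2)] by blast
 have wf': "weak_gradient G f' w" by (rule weak_gradient_cong_AE[OF G wf f'e]) simp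
 have wv': "weak_gradient G v' gv" by (rule weak_gradient_cong_AE[OF G wv v'e]) simp
 have w\<phi>': "weak_gradient G \<phi>' g\<phi>" by (rule weak_gradient_cong_AE[OF G w\<phi> \<phi>'e]) simp
 note lf' = weak_gradient_loc_int(1)[OF G wf']
 define \<Gamma> where "\<Gamma> x = \<gamma>v x + \<gamma>\<phi> x" for x
 have \<Gamma>[measurable]: "\<Gamma> \<in> bmeas" unfolding \<Gamma>_def by measurable
 have \<Gamma>0: "0 \<le> \<Gamma> x" for x using \<gamma>v0 \<gamma>\<phi>0 by (simp add: \<Gamma>_def)
 have \<Gamma>l: "loc_int G \<Gamma>" unfolding \<Gamma>_def by (rule loc_int_add[OF \<gamma>vl \<gamma>\<phi>l])
 have C\<Gamma>l: "loc_int G (\<lambda>x. C * \<Gamma> x)" using loc_int_scale[OF \<Gamma>l, of C] by simp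
 have "ae_on G (\<lambda>x. w x \<bullet> b \<le> C * \<Gamma> x)"
 proof (rule fundamental_lemma[OF G loc_int_inner[OF lf(2)] C\<Gamma>l])
  fix \<psi> :: "'a \<Rightarrow> real" assume t: "test_fun G \<psi>" and pos: "\<And>x. 0 \<le> \<psi> x"
  have sm: "smooth \<psi>" and c: "compact (supp \<psi>)" "supp \<psi> \<subseteq> G" using t by (auto simp: test_fun_iff)
  have [measurable]: "\<psi> \<in> bmeas" "grad \<psi> \<in> bmeas" using test_fun_borel[OF t] by auto
  obtain B where B: "B > 0" "\<And>x. \<bar>\<psi> x\<bar> \<le> B" "\<And>x. norm (grad \<psi> x) \<le> B" using test_fun_bounds[OF t] by blast
  obtain \<delta>1 K where K: "\<delta>1 > 0" "compact K" "K \<subseteq> G" "\<And>x y. x \<in> supp \<psi> \<Longrightarrow> norm y \<le> \<delta>1 \<Longrightarrow> x + y \<in> K"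
   using compact_neighbourhood[OF c(1) G c(2)] by blast
  have [measurable]: "K \<in> sets borel" using K(2) borel_compact by auto
  \<comment> \<open>One half of \<open>\<delta>1\<close> is spent on the neighbourhood
    \<open>V\<close> of the support, the other on the shift of its points.\<close>
  define \<delta> where "\<delta> = \<delta>1 / 2"
  have \<delta>: "\<delta> > 0" using K(1) by (simp add: \<delta>_def)
  have K\<delta>: "x + y \<in> K" if "x \<in> supp \<psi>" "norm y \<le> \<delta>" for x y using K(1) that by (intro K(4)) (auto simp: \<delta>_def)
  define V where "V = (\<Union>x\<in>supp \<psi>. ball x \<delta>)"
  have V: "open V" unfolding V_def by (intro open_UN ballI open_ball)
  have SV: "supp \<psi> \<subseteq> V" using \<delta> by (auto simp: V_def)
  have VK: "x + y \<in> K" if xV: "x \<in> V" and "norm y \<le> \<delta>" for x y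
  proof -
   obtain x0 where x0: "x0 \<in> supp \<psi>" "x \<in> ball x0 \<delta>" using xV unfolding V_def by blast
   have "norm ((x - x0) + y) \<le> norm (x - x0) + norm y" by (rule norm_triangle_ineq)
   also have "\<dots> \<le> \<delta>1" using x0(2) that(2) by (simp add: dist_norm norm_minus_commute \<delta>_def)
   finally have "x0 + ((x - x0) + y) \<in> K" by (rule K(4)[OF x0(1)])
   then show ?thesis by simp
  qed
  define t where "t n = \<delta> / real (Suc n)" for n
  have tn: "0 < t n" "t n \<le> \<delta>" "t \<longlonglongrightarrow> 0" for n
   using \<delta> LIMSEQ_Suc[OF lim_const_over_n[of \<delta>]] by (auto simp: t_def[abs_def] field_simps)
  have iK\<Gamma>: "integrable lebesgue (\<lambda>x. indicator K x * \<Gamma> x)" and fK: "set_integrable lebesgue K f'"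
   using \<Gamma>l lf' K(2,3) by (auto simp: loc_int_def set_integrable_def)
  have i\<psi>\<Gamma>: "integrable lebesgue (\<lambda>x. \<psi> x * \<Gamma> x)" using test_fun_integrable[OF t \<Gamma>l] by simp
  define M where "M = (Leb x. indicator K x * \<Gamma> x)"
  define J where "J = (Leb x. \<psi> x * \<Gamma> x)"
  note lim = difference_quotient_limit[OF fK t b K\<delta> tn]
  define I where "I n = (Leb x. ((\<psi> (x + t n *\<^sub>R b) - \<psi> x) / t n) *\<^sub>R f' x)" for n
  have bound: "\<bar>I n\<bar> \<le> C * (J + B * t n * M)" for n
  proof -
   \<comment> \<open>Shifting \<open>\<psi>\<close> by \<open>t n *\<^sub>R b\<close> amounts to
     shifting \<open>f'\<close> by the opposite vector.\<close>
   define z where "z = - (t n *\<^sub>R b)"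
   have nz: "norm z \<le> t n" using b tn(1)[of n] by (simp add: z_def mult_left_le)
   then have nz\<delta>: "norm (s *\<^sub>R z) \<le> \<delta>" if "0 \<le> s" "s \<le> 1" for s
    using tn(2)[of n] that mult_mono[of s 1 "norm z" \<delta>] \<delta> by auto
   have VG: "x + s *\<^sub>R z \<in> G" if "x \<in> V" "0 \<le> s" "s \<le> 1" for x s
    using VK[OF that(1) nz\<delta>[OF that(2,3)]] K(3) by auto
   have dv: "ae_on V (\<lambda>x. ennreal \<bar>v' (x + z) - v' x\<bar>
     \<le> ennreal (norm z) * (segint \<gamma>v x z))"
    by (rule weak_gradient_difference[OF G V VG wv' v' \<gamma>v \<gamma>v0 \<gamma>vl]) (use \<gamma>ve in \<open>auto elim!: eventually_mono\<close>)
   have d\<phi>: "ae_on V (\<lambda>x. ennreal \<bar>\<phi>' (x + z) - \<phi>' x\<bar>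
     \<le> ennreal (norm z) * (segint \<gamma>\<phi> x z))"
    by (rule weak_gradient_difference[OF G V VG w\<phi>' \<phi>' \<gamma>\<phi> \<gamma>\<phi>0 \<gamma>\<phi>l]) (use \<gamma>\<phi>e in \<open>auto elim!: eventually_mono\<close>)
   have df: "ae_on V (\<lambda>x. ennreal \<bar>f' (x + z) - f' x\<bar>
     \<le> ennreal (C * t n) * (segint \<Gamma> x z))"
    using dv d\<phi> f'e v'e \<phi>'e AE_lebesgue_translate[OF f'e, of z] AE_lebesgue_translate[OF v'e, of z] AE_lebesgue_translate[OF \<phi>'e, of z]
   proof eventually_elim
    case (elim x)
    show ?case
    proof
     assume "x \<in> V"
     then have xG: "x \<in> G" "x + z \<in> G" using VG[of x 0] VG[of x 1] by auto
     let ?Iv = "(segint \<gamma>v x z)"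
     let ?I\<phi> = "(segint \<gamma>\<phi> x z)"
     have "ennreal \<bar>f' (x + z) - f' x\<bar> \<le> ennreal (C * (\<bar>v' (x + z) - v' x\<bar> + \<bar>\<phi>' (x + z) - \<phi>' x\<bar>))"
      using lip[OF xG(2,1)] elim xG by (intro ennreal_leI) auto
     also have "\<dots> = ennreal C * (ennreal \<bar>v' (x + z) - v' x\<bar> + ennreal \<bar>\<phi>' (x + z) - \<phi>' x\<bar>)"
      using C by (simp add: ennreal_mult)
     also have "\<dots> \<le> ennreal C * (ennreal (norm z) * ?Iv + ennreal (norm z) * ?I\<phi>)"
      using elim \<open>x \<in> V\<close> by (intro mult_left_mono add_mono) auto
     also have "\<dots> = ennreal (C * norm z) * (?Iv + ?I\<phi>)"
      using C by (simp add: ennreal_mult distrib_left mult.assoc)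
     also have "?Iv + ?I\<phi> = (segint \<Gamma> x z)"
      by (subst nn_integral_add[symmetric]) (auto simp: \<Gamma>_def \<gamma>v0 \<gamma>\<phi>0 distrib_left)
     also have "ennreal (C * norm z) * \<dots> \<le> ennreal (C * t n) * \<dots>"
      using C nz by (intro mult_right_mono ennreal_leI mult_left_mono) auto
     finally show "ennreal \<bar>f' (x + z) - f' x\<bar> \<le> ennreal (C * t n) * (segint \<Gamma> x z)" .
    qed
   qed
   have i0: "integrable lborel (\<lambda>x. \<psi> x * f' x)"
    using test_fun_integrable[OF t lf'] by (simp add: integrable_completion)
   have i1: "integrable lborel (\<lambda>x. (\<psi> (x + t n *\<^sub>R b) - \<psi> x) * f' x)"
   proof -
    have "integrable lebesgue (\<lambda>x. t n * (((\<psi> (x + t n *\<^sub>R b) - \<psi> x) / t n) *\<^sub>R f' x))"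
     using lim(2) by (intro integrable_mult_right) auto
    then have "integrable lebesgue (\<lambda>x. (\<psi> (x + t n *\<^sub>R b) - \<psi> x) * f' x)" using tn(1)[of n] by simp
    then show ?thesis by (simp add: integrable_completion)
   qed
   have i2: "integrable lborel (\<lambda>x. \<psi> (x - z) * f' x)"
   proof -
    have "integrable lborel (\<lambda>x. (\<psi> (x + t n *\<^sub>R b) - \<psi> x) * f' x + \<psi> x * f' x)"
     using i1 i0 by (rule Bochner_Integration.integrable_add)
    then show ?thesis by (simp add: z_def left_diff_distrib)
   qed
   have "I n = (Leb x. inverse (t n) * ((\<psi> (x + t n *\<^sub>R b) - \<psi> x) * f' x))"
    unfolding I_def by (intro Bochner_Integration.integral_cong) (auto simp: field_simps)
   also have "\<dots> = (Bor x. inverse (t n) * ((\<psi> (x + t n *\<^sub>R b) - \<psi> x) * f' x))"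
    by (intro integral_completion) simp
   finally have "t n * I n = (Bor x. (\<psi> (x - z) - \<psi> x) * f' x)"
    using tn(1)[of n] by (simp add: z_def)
   also have "\<dots> = (Bor x. \<psi> x * (f' (x + z) - f' x))"
    by (rule integral_shift_difference[OF _ _ i0 i2]) measurable
   finally have "ennreal \<bar>t n * I n\<bar> \<le> (Bor+ x. ennreal (norm (\<psi> x * (f' (x + z) - f' x))))"
    using norm_integral_le_nn_integral[of lborel "\<lambda>x. \<psi> x * (f' (x + z) - f' x)"] by simp
   also have "\<dots> \<le> (Bor+ x. ennreal (\<psi> x) * (ennreal (C * t n) * (segint \<Gamma> x z)))"
   proof (rule nn_integral_mono_AE)
    have "AE x in lborel. x \<in> V \<longrightarrow> ennreal \<bar>f' (x + z) - f' x\<bar>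
     \<le> ennreal (C * t n) * (segint \<Gamma> x z)"
     using df by (simp add: AE_completion_iff)
    then show "AE x in lborel. ennreal (norm (\<psi> x * (f' (x + z) - f' x))) \<le> ennreal (\<psi> x) * (ennreal (C * t n) * (segint \<Gamma> x z))"
    proof eventually_elim
     case (elim x)
     show ?case
     proof (cases "\<psi> x = 0")
      case False
      then have "x \<in> V" using SV supp_mem[of \<psi> x] by auto
      have "ennreal (norm (\<psi> x * (f' (x + z) - f' x))) = ennreal (\<psi> x) * ennreal \<bar>f' (x + z) - f' x\<bar>"
       using pos by (simp add: abs_mult ennreal_mult)
      also have "\<dots> \<le> ennreal (\<psi> x) * (ennreal (C * t n) * (segint \<Gamma> x z))"
       using elim \<open>x \<in> V\<close> by (intro mult_left_mono) auto
      finally show ?thesis .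
     qed simp
    qed
   qed
   also have "\<dots> = (Bor+ x. (Bor+ s. ennreal (C * t n) * (indicator {0..1} s * (ennreal (\<psi> x) * ennreal (\<Gamma> (x + s *\<^sub>R z))))))"
    by (intro nn_integral_cong) (simp add: nn_integral_cmult[symmetric] ac_simps)
   also have "\<dots> = (Bor+ s. (Bor+ x. ennreal (C * t n) * (indicator {0..1} s * (ennreal (\<psi> x) * ennreal (\<Gamma> (x + s *\<^sub>R z))))))"
    by (subst lborel_pair.Fubini') auto
   also have "\<dots> = (Bor+ s. ennreal (C * t n) * (indicator {0..1} s * (Bor+ x. ennreal (\<psi> x) * ennreal (\<Gamma> (x + s *\<^sub>R z)))))"
    by (simp add: nn_integral_cmult)
   also have "\<dots> \<le> (Bor+ s. ennreal (C * t n) * (indicator {0..1::real} s * ennreal (J + B * t n * M)))"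
   proof (rule nn_integral_mono, rule mult_left_mono)
    fix s :: real
    show "indicator {0..1} s * (Bor+ x. ennreal (\<psi> x) * ennreal (\<Gamma> (x + s *\<^sub>R z))) \<le> indicator {0..1} s * ennreal (J + B * t n * M)"
    proof (cases "s \<in> {0..1}")
     case True
     have "(Bor+ x. ennreal (\<psi> x) * ennreal (\<Gamma> (x + s *\<^sub>R z))) = (Bor+ y. ennreal (\<psi> (y - s *\<^sub>R z)) * ennreal (\<Gamma> y))"
      using nn_integral_translate[of "\<lambda>y. ennreal (\<psi> (y - s *\<^sub>R z)) * ennreal (\<Gamma> y)" "s *\<^sub>R z"] by simp
     also have "\<dots> \<le> (Bor+ y. ennreal (\<psi> y * \<Gamma> y + B * t n * (indicator K y * \<Gamma> y)))"
     proof (rule nn_integral_mono)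
      fix y
      \<comment> \<open>Replacing the translate of \<open>\<psi>\<close> by \<open>\<psi>\<close>
        costs at most \<open>B * t n\<close> on \<open>K\<close>. The error disappears as
        \<open>n\<close> grows, and the bound becomes \<open>C * J\<close>.\<close>
      have "\<psi> (y - s *\<^sub>R z) \<le> \<psi> y + B * t n * indicator K y"
      proof (cases "\<psi> (y - s *\<^sub>R z) = 0")
       case False
       then have "y - s *\<^sub>R z \<in> supp \<psi>" by (rule supp_mem[of \<psi>])
       then have "y \<in> K" using K\<delta>[of "y - s *\<^sub>R z" "s *\<^sub>R z"] nz\<delta>[of s] True by simp
       have "\<bar>\<psi> (y - s *\<^sub>R z) - \<psi> y\<bar> \<le> B * norm (s *\<^sub>R z)"
        using smooth_lipschitz[OF sm B(3), of "y - s *\<^sub>R z" y] by simp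
       also have "\<dots> \<le> B * t n" using True B(1) nz mult_mono[of s 1 "norm z" "t n"] by (intro mult_left_mono) auto
       finally show ?thesis using \<open>y \<in> K\<close> by simp
      next
       case True
       then show ?thesis using pos[of y] B(1) tn(1)[of n] by simp
      qed
      then have "\<psi> (y - s *\<^sub>R z) * \<Gamma> y \<le> (\<psi> y + B * t n * indicator K y) * \<Gamma> y" using \<Gamma>0 by (intro mult_right_mono)
      then show "ennreal (\<psi> (y - s *\<^sub>R z)) * ennreal (\<Gamma> y) \<le> ennreal (\<psi> y * \<Gamma> y + B * t n * (indicator K y * \<Gamma> y))"
       using pos \<Gamma>0 by (subst ennreal_mult[symmetric]) (auto intro!: ennreal_leI simp: algebra_simps)
     qed
     also have "\<dots> = (Leb+ y. ennreal (\<psi> y * \<Gamma> y + B * t n * (indicator K y * \<Gamma> y)))"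
      by (simp add: nn_integral_completion)
     also have "\<dots> = ennreal (Leb y. \<psi> y * \<Gamma> y + B * t n * (indicator K y * \<Gamma> y))"
      using i\<psi>\<Gamma> iK\<Gamma> pos \<Gamma>0 B(1) tn(1)[of n] by (intro nn_integral_eq_integral) auto
     also have "(Leb y. \<psi> y * \<Gamma> y + B * t n * (indicator K y * \<Gamma> y)) = J + B * t n * M"
      unfolding J_def M_def using i\<psi>\<Gamma> iK\<Gamma> by simp
     finally show ?thesis using True by simp
    qed simp
   qed simp
   also have "\<dots> = ennreal (C * t n) * ennreal (J + B * t n * M)"
    by (simp add: nn_integral_cmult nn_integral_multc)
   also have "\<dots> = ennreal (t n * (C * (J + B * t n * M)))"
   proof -
    have "0 \<le> J" "0 \<le> M" unfolding J_def M_def using pos \<Gamma>0 by (auto intro!: integral_nonneg_AE)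
    then show ?thesis using C tn(1)[of n] B(1) by (subst ennreal_mult[symmetric]) (auto simp: algebra_simps)
   qed
   finally have "ennreal \<bar>t n * I n\<bar> \<le> ennreal (t n * (C * (J + B * t n * M)))" .
   moreover have "0 \<le> J" "0 \<le> M" unfolding J_def M_def using pos \<Gamma>0 by (auto intro!: integral_nonneg_AE)
   ultimately have "\<bar>t n * I n\<bar> \<le> t n * (C * (J + B * t n * M))"
    using C tn(1)[of n] B(1) by (subst (asm) ennreal_le_iff) auto
   then show ?thesis using tn(1)[of n] by (simp add: abs_mult)
  qed
  have l1: "I \<longlonglongrightarrow> (Leb x. (grad \<psi> x \<bullet> b) *\<^sub>R f' x)" using lim(1) by (simp add: I_def[abs_def])
  have l2: "(\<lambda>n. C * (J + B * t n * M)) \<longlonglongrightarrow> C * (J + B * 0 * M)" by (intro tendsto_intros tn(3))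
  have "(\<lambda>n. - I n) \<longlonglongrightarrow> - (Leb x. (grad \<psi> x \<bullet> b) *\<^sub>R f' x)" by (intro tendsto_minus l1)
  then have "- (Leb x. (grad \<psi> x \<bullet> b) *\<^sub>R f' x) \<le> C * (J + B * 0 * M)"
  proof (rule LIMSEQ_le[OF _ l2])
   have "- I n \<le> C * (J + B * t n * M)" for n using bound[of n] by linarith
   then show "\<exists>N. \<forall>n\<ge>N. - I n \<le> C * (J + B * t n * M)" by auto
  qed
  moreover have "(Leb x. (grad \<psi> x \<bullet> b) *\<^sub>R f' x) = - (Leb x. \<psi> x * (w x \<bullet> b))"
   using weak_gradient_inner[OF G wf' t, of b] by (simp add: mult.commute)
  moreover have "C * J = (Leb x. \<psi> x * (C * \<Gamma> x))"
  proof -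
   have "(Leb x. \<psi> x * (C * \<Gamma> x)) = (Leb x. C * (\<psi> x * \<Gamma> x))"
    by (intro Bochner_Integration.integral_cong) auto
   then show ?thesis by (simp add: J_def)
  qed
  ultimately show "(Leb x. \<psi> x * (w x \<bullet> b)) \<le> (Leb x. \<psi> x * (C * \<Gamma> x))" by simp
 qed
 then show ?thesis using \<gamma>ve \<gamma>\<phi>e
  by eventually_elim (auto simp: \<Gamma>_def)
qed


section \<open>Lipschitz functions\<close>

lemma loc_int_const: "loc_int G (\<lambda>x. c::real)"
 unfolding loc_int_def set_integrable_def
 using lmeasurable_compact by (auto intro!: integrable_mult_left simp: lmeasurable_iff_integrable)

text \<open>The Lipschitz bound dominates the difference quotients of \<open>f\<close>, and the
  bounded gradient of \<open>\<psi>\<close> those of \<open>\<psi>\<close>; so both sides of the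
  discrete integration by parts pass to the limit.\<close>

theorem lipschitz_weak_gradient:
 fixes f :: "'a::euclidean_space \<Rightarrow> real"
 assumes L: "0 \<le> L" "\<And>x y. \<bar>f x - f y\<bar> \<le> L * norm (x - y)"
  and g: "g \<in> bmeas" "\<And>x. norm (g x) \<le> M"
  and d: "AE x in lebesgue. \<forall>b\<in>Basis. ((\<lambda>t. (f (x + t *\<^sub>R b) - f x) / t) \<longlongrightarrow> g x \<bullet> b) (at 0)"
 shows "weak_gradient UNIV f g"
proof -
 have fc: "continuous_on UNIV f"
 proof (rule continuous_onI)
  fix x :: 'a and e :: real assume "e > 0"
  then show "\<exists>d>0. \<forall>x'\<in>UNIV. dist x' x < d \<longrightarrow> dist (f x') (f x) \<le> e"
  proof (intro exI[of _ "e / (L + 1)"] conjI ballI impI)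
   fix x' assume "dist x' x < e / (L + 1)"
   then have "L * norm (x' - x) \<le> L * (e / (L + 1))" using L(1) by (intro mult_left_mono) (auto simp: dist_norm)
   also have "\<dots> \<le> e" using L(1) \<open>e > 0\<close> by (simp add: field_simps)
   finally show "dist (f x') (f x) \<le> e" using L(2)[of x' x] by (simp add: dist_real_def)
  qed (use L(1) in auto)
 qed
 then have fm[measurable]: "f \<in> bmeas" by (rule borel_measurable_continuous_onI)
 note [measurable] = g(1)
 have one: "loc_int UNIV (\<lambda>x::'a. 1::real)" by (rule loc_int_const)
 have lf: "loc_int UNIV f" using loc_int_mult_cont[OF one fc] by simp
 have lg: "loc_int UNIV g"
  unfolding loc_int_def
 proof clarify
  fix K :: "'a set" assume K: "compact K"
  have [measurable]: "K \<in> sets borel" using K borel_compact by auto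
  have i1: "set_integrable lebesgue K (\<lambda>x::'a. 1::real)" using one K by (auto simp: loc_int_def)
  have "integrable lebesgue (\<lambda>x. (1::real) *\<^sub>R (indicator K x *\<^sub>R g x))"
   by (rule loc_int_test_vec[OF i1, where B=M])
    (use g(2) order_trans[OF norm_ge_zero g(2)] in \<open>auto simp: indicator_def\<close>)
  then show "set_integrable lebesgue K g" by (simp add: set_integrable_def)
 qed
 show ?thesis
 proof (rule weak_gradientI[OF open_UNIV lf lg])
  fix \<psi> :: "'a \<Rightarrow> real" and b :: 'a assume t: "test_fun UNIV \<psi>" and b: "b \<in> Basis"
  have c: "compact (supp \<psi>)" using t by (auto simp: test_fun_iff)
  have [measurable]: "\<psi> \<in> bmeas" using test_fun_borel[OF t] by auto
  obtain \<delta> K where "\<delta> > 0" "compact K" "K \<subseteq> UNIV" "\<And>x y. x \<in> supp \<psi> \<Longrightarrow> norm y \<le> \<delta> \<Longrightarrow> x + y \<in> K"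
   using compact_neighbourhood[OF c open_UNIV subset_UNIV] by blast
  note K = this(1,2,4)
  define t' where "t' n = \<delta> / real (Suc n)" for n
  have tn: "0 < t' n" "t' n \<le> \<delta>" "t' \<longlonglongrightarrow> 0" for n
   using K(1) LIMSEQ_Suc[OF lim_const_over_n[of \<delta>]] by (auto simp: t'_def[abs_def] field_simps)
  have fK: "set_integrable lebesgue K f" using lf K(2) by (auto simp: loc_int_def)
  have nb: "norm b \<le> 1" using b by simp
  note lim = difference_quotient_limit[OF fK t nb K(3) tn]
  define I where "I n = (Leb x. ((\<psi> (x + t' n *\<^sub>R b) - \<psi> x) / t' n) *\<^sub>R f x)" for n
  have l1: "I \<longlonglongrightarrow> (Leb x. (grad \<psi> x \<bullet> b) *\<^sub>R f x)" using lim(1) by (simp add: I_def[abs_def])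
  \<comment> \<open>Backward quotients of \<open>f\<close> appear here because they are dual to the
    forward quotients of \<open>\<psi>\<close>.\<close>
  define q where "q n x = (f (x + (- t' n) *\<^sub>R b) - f x) / (- t' n)" for n x
  have qm[measurable]: "q n \<in> bmeas" for n unfolding q_def by measurable
  have ql: "\<bar>q n x\<bar> \<le> L" for n x
  proof -
   have "\<bar>f (x + (- t' n) *\<^sub>R b) - f x\<bar> \<le> L * norm ((- t' n) *\<^sub>R b)"
    using L(2)[of "x + (- t' n) *\<^sub>R b" x] by simp
   also have "\<dots> = L * t' n" using b tn(1)[of n] by simp
   finally show ?thesis using tn(1)[of n] by (simp add: q_def field_simps)
  qed
  have Iq: "I n = - (Leb x. \<psi> x * q n x)" for n
  proof -
   let ?z = "(- t' n) *\<^sub>R b"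
   have i0: "integrable lborel (\<lambda>x. \<psi> x * f x)"
    using test_fun_integrable[OF t lf] by (simp add: integrable_completion)
   have i1: "integrable lborel (\<lambda>x. ((\<psi> (x + t' n *\<^sub>R b) - \<psi> x) / t' n) * f x)"
    using lim(2)[of n] by (simp add: integrable_completion)
   have i2: "integrable lborel (\<lambda>x. \<psi> (x - ?z) * f x)"
   proof -
    have "integrable lborel (\<lambda>x. t' n * (((\<psi> (x + t' n *\<^sub>R b) - \<psi> x) / t' n) * f x) + \<psi> x * f x)"
     using i1 i0 by (intro Bochner_Integration.integrable_add integrable_mult_right)
    moreover have "t' n * (((\<psi> (x + t' n *\<^sub>R b) - \<psi> x) / t' n) * f x) + \<psi> x * f x = \<psi> (x - ?z) * f x" for x
     using tn(1)[of n] by (simp add: left_diff_distrib)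
    ultimately show ?thesis by simp
   qed
   have "I n = (Leb x. inverse (t' n) * ((\<psi> (x - ?z) - \<psi> x) * f x))"
    unfolding I_def by (intro Bochner_Integration.integral_cong) (auto simp: divide_inverse algebra_simps)
   also have "\<dots> = (Bor x. inverse (t' n) * ((\<psi> (x - ?z) - \<psi> x) * f x))"
    by (intro integral_completion) simp
   also have "\<dots> = inverse (t' n) * (Bor x. \<psi> x * (f (x + ?z) - f x))"
    by (simp only: integral_mult_right_zero integral_shift_difference[OF fm \<open>\<psi> \<in> bmeas\<close> i0 i2])
   also have "\<dots> = (Bor x. inverse (t' n) * (\<psi> x * (f (x + ?z) - f x)))" by simp
   also have "\<dots> = (Bor x. - (\<psi> x * q n x))"
    using tn(1)[of n] by (intro Bochner_Integration.integral_cong) (auto simp: q_def field_simps)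
   also have "\<dots> = - (Leb x. \<psi> x * q n x)"
    by (subst integral_completion) auto
   finally show ?thesis .
  qed
  have "(\<lambda>n. (Leb x. \<psi> x * q n x)) \<longlonglongrightarrow> (Leb x. \<psi> x * (g x \<bullet> b))"
  proof (rule integral_dominated_convergence[where w="\<lambda>x. L * \<bar>\<psi> x\<bar>"])
   show "integrable lebesgue (\<lambda>x. L * \<bar>\<psi> x\<bar>)" using test_fun_integrable[OF t one] by auto
   show "AE x in lebesgue. (\<lambda>n. \<psi> x * q n x) \<longlonglongrightarrow> \<psi> x * (g x \<bullet> b)"
    using d
   proof eventually_elim
    case (elim x)
    have "filterlim (\<lambda>n. - t' n) (at 0) sequentially"
     using tendsto_minus[OF tn(3)] tn(1) by (auto simp: filterlim_at intro!: always_eventually less_imp_neq[THEN not_sym])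
    moreover have "((\<lambda>t. (f (x + t *\<^sub>R b) - f x) / t) \<longlongrightarrow> g x \<bullet> b) (at 0)" using elim b by blast
    ultimately have "(\<lambda>n. q n x) \<longlonglongrightarrow> g x \<bullet> b"
     unfolding q_def by (rule filterlim_compose[rotated])
    then show ?case by (intro tendsto_mult tendsto_const)
   qed
   show "AE x in lebesgue. norm (\<psi> x * q n x) \<le> L * \<bar>\<psi> x\<bar>" for n
   proof (rule AE_I2)
    fix x
    show "norm (\<psi> x * q n x) \<le> L * \<bar>\<psi> x\<bar>"
     using mult_right_mono[OF ql[of n x], of "\<bar>\<psi> x\<bar>"] by (simp add: abs_mult mult.commute)
   qed
  qed (auto intro!: measurable_completion)
  then have "I \<longlonglongrightarrow> - (Leb x. \<psi> x * (g x \<bullet> b))" unfolding Iq[abs_def] by (rule tendsto_minus)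
  from LIMSEQ_unique[OF l1 this] show "(Leb x. f x * (grad \<psi> x \<bullet> b)) = - (Leb x. \<psi> x * (g x \<bullet> b))"
   by (simp add: mult.commute)
 qed
qed

lemma test_fun_weak_gradient:
 assumes "test_fun G \<phi>"
 shows "weak_gradient UNIV \<phi> (grad \<phi>)"
proof -
 obtain B where B: "B > 0" "\<And>x. \<bar>\<phi> x\<bar> \<le> B" "\<And>x. norm (grad \<phi> x) \<le> B" using test_fun_bounds[OF assms] by blast
 have sm: "smooth \<phi>" using assms by (rule test_fun_smooth)
 show ?thesis
  by (rule lipschitz_weak_gradient[of B \<phi>]) 
   (use B smooth_lipschitz[OF sm B(3)] test_fun_borel[OF assms] smooth_directional_derivative[OF sm] in auto)
qed

text \<open>The truncation \<open>T_k\<close> on the reals, where \<open>renorm_fun\<close> lives;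
  \<open>trunc\<close> is its counterpart on the extended reals.\<close>

definition clip :: "real \<Rightarrow> real \<Rightarrow> real" where
 "clip k t = max (- k) (min k t)"

lemma clip_lipschitz: "\<bar>clip k s - clip k t\<bar> \<le> \<bar>s - t\<bar>"
 by (auto simp: clip_def max_def min_def)

lemma clip_continuous: "continuous_on UNIV (clip k)"
 unfolding clip_def[abs_def] by (intro continuous_intros)

lemma clip_weak_gradient:
 assumes "k > 0"
 shows "weak_gradient UNIV (clip k) (indicator {-k..k})"
proof (rule lipschitz_weak_gradient[where L=1 and M=1])
 have "AE x::real in lebesgue. x \<notin> {k, - k}"
  by (intro AE_not_in null_sets_completionI finite_imp_null_set_lborel) auto
 then show "AE x in lebesgue. \<forall>b\<in>Basis. ((\<lambda>t. (clip k (x + t *\<^sub>R b) - clip k x) / t) \<longlongrightarrow> indicator {-k..k} x \<bullet> b) (at 0)"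
 proof eventually_elim
  case (elim x)
  have "(clip k has_real_derivative (indicator {-k..k} x)) (at x)"
  proof -
   consider "x < -k" | "-k < x" "x < k" | "k < x" using elim by fastforce
   then show ?thesis
   proof cases
    case 1
    have "((\<lambda>x. -k) has_real_derivative (indicator {-k..k} x)) (at x)" using 1 by auto
    then show ?thesis by (rule has_field_derivative_transform_within_open[where S="{..<-k}"])
     (use 1 assms in \<open>auto simp: clip_def\<close>)
   next
    case 2
    have "((\<lambda>x. x) has_real_derivative (indicator {-k..k} x)) (at x)" using 2 by auto
    then show ?thesis by (rule has_field_derivative_transform_within_open[where S="{-k<..<k}"])
     (use 2 assms in \<open>auto simp: clip_def\<close>)
   next
    case 3
    have "((\<lambda>x. k) has_real_derivative (indicator {-k..k} x)) (at x)" using 3 by auto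
    then show ?thesis by (rule has_field_derivative_transform_within_open[where S="{k<..}"])
     (use 3 assms in \<open>auto simp: clip_def\<close>)
   qed
  qed
  then show ?case by (simp add: DERIV_def)
 qed
qed (auto simp: indicator_def intro: clip_lipschitz)

section \<open>Structure of renormalizing functions\<close>

lemma continuous_le_AE:
 fixes F :: "'a::euclidean_space \<Rightarrow> real"
 assumes "continuous_on UNIV F" "open G" "ae_on G (\<lambda>x. F x \<le> c)" "x \<in> G"
 shows "F x \<le> c"
proof (rule ccontr)
 assume "\<not> F x \<le> c"
 let ?U = "G \<inter> {x. c < F x}"
 have "open ?U" using assms(1,2) by (intro open_Int open_Collect_less continuous_on_const)
 moreover have "?U \<noteq> {}" using assms(4) \<open>\<not> F x \<le> c\<close> by auto
 ultimately have "\<not> negligible ?U" by (rule open_not_negligible)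
 moreover have "?U \<in> null_sets lebesgue"
  using assms(3) open_sets_lebesgue[OF \<open>open ?U\<close>] by (subst AE_iff_null_sets) (auto elim!: eventually_mono)
 ultimately show False by (simp add: negligible_iff_null_sets)
qed

text \<open>An almost everywhere bound on increments holds everywhere by continuity. It is used with
  the essential bound of the derivative on the whole line, and with \<open>C = 0\<close> on the
  half-lines where the derivative vanishes.\<close>

lemma continuous_increment_AE:
 assumes c: "continuous_on UNIV h" and w: "weak_gradient UNIV h h'" and G: "open G"
  and bd: "ae_on G (\<lambda>x. \<bar>h' x\<bar> \<le> C)" and C: "0 \<le> C"
  and V: "open V" "\<And>x s. x \<in> V \<Longrightarrow> 0 \<le> s \<Longrightarrow> s \<le> 1 \<Longrightarrow> x + s * z \<in> G" "x \<in> V"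
 shows "\<bar>h (x + z) - h x\<bar> \<le> C * \<bar>z\<bar>"
proof -
 have hm: "h \<in> bmeas" using c by (rule borel_measurable_continuous_onI)
 have "ae_on V (\<lambda>x. ennreal \<bar>h (x + z) - h x\<bar>
  \<le> ennreal (norm z) * (Bor+ s. indicator {0..1::real} s * ennreal C))"
  by (rule weak_gradient_difference[where G=G and V=V and f=h and g=h' and \<gamma>="\<lambda>_. C"])
    (use V(1,2) G hm weak_gradient_mono[OF open_UNIV G _ w] loc_int_const bd C in auto)
 moreover have "(Bor+ s. indicator {0..1::real} s * ennreal C) = ennreal C"
  by (subst nn_integral_multc) auto
 ultimately have "ae_on V (\<lambda>x. ennreal \<bar>h (x + z) - h x\<bar> \<le> ennreal (C * \<bar>z\<bar>))"
  using C by (simp add: ennreal_mult mult.commute)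
 then have "ae_on V (\<lambda>x. \<bar>h (x + z) - h x\<bar> \<le> C * \<bar>z\<bar>)"
  by eventually_elim (use C in auto)
 moreover have "continuous_on UNIV (\<lambda>x. \<bar>h (x + z) - h x\<bar>)"
  by (intro continuous_intros continuous_on_compose2[OF c]) auto
 ultimately show ?thesis using continuous_le_AE[OF _ V(1) _ V(3)] by blast
qed

text \<open>These constants reduce \<open>h\<close> to a Lipschitz function of the truncation at
  level \<open>R\<close>, so that later estimates of \<open>h(u)\<close> involve a single Sobolev
  function.\<close>

lemma renorm_fun_properties:
 assumes "renorm_fun h"
 obtains L M R where "0 \<le> L" "\<And>x y. \<bar>h x - h y\<bar> \<le> L * \<bar>x - y\<bar>" "0 \<le> M" "\<And>x. \<bar>h x\<bar> \<le> M"
  "0 < R" "\<And>x. R \<le> x \<Longrightarrow> h x = h R" "\<And>x. x \<le> - R \<Longrightarrow> h x = h (- R)"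
proof -
 obtain h' where c: "continuous_on UNIV h" and b: "in_Linf UNIV h" and w: "weak_gradient UNIV h h'"
  and b': "in_Linf UNIV h'" and "\<exists>K. compact K \<and> (AE t in lebesgue. t \<notin> K \<longrightarrow> h' t = 0)"
  using assms by (auto simp: renorm_fun_def)
 then obtain K where K: "compact K" "AE t in lebesgue. t \<notin> K \<longrightarrow> h' t = 0" by blast
 obtain M0 where M0: "AE x in lebesgue. \<bar>h x\<bar> \<le> M0" using b unfolding in_Linf_def lebesgue_on_UNIV_eq by auto
 have M: "\<bar>h x\<bar> \<le> M0" for x
  by (rule continuous_le_AE[of "\<lambda>x. \<bar>h x\<bar>" UNIV]) (use M0 c in \<open>auto intro!: continuous_intros\<close>)
 obtain C where C: "AE x in lebesgue. \<bar>h' x\<bar> \<le> C" using b' unfolding in_Linf_def lebesgue_on_UNIV_eq by auto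
 have L: "\<bar>h x - h y\<bar> \<le> \<bar>C\<bar> * \<bar>x - y\<bar>" for x y
 proof -
  have "\<bar>h (y + (x - y)) - h y\<bar> \<le> \<bar>C\<bar> * \<bar>x - y\<bar>"
   by (rule continuous_increment_AE[OF c w open_UNIV, where V=UNIV]) (use C in \<open>auto elim!: eventually_mono\<close>)
  then show ?thesis by simp
 qed
 obtain R where R: "R > 0" "\<And>x. x \<in> K \<Longrightarrow> \<bar>x\<bar> \<le> R"
  using bounded_pos[of K] compact_imp_bounded[OF K(1)] by auto
 have K0: "ae_on ({R<..}) (\<lambda>x. \<bar>h' x\<bar> \<le> 0)" "ae_on ({..<-R}) (\<lambda>x. \<bar>h' x\<bar> \<le> 0)"
  using K(2) by (eventually_elim, use R(2) in force)+
 \<comment> \<open>The derivative vanishes on the open half-line beyond \<open>R\<close>;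
   \<open>R + 1\<close> is a point inside it from which increments can be measured.\<close>
 have up: "h x = h (R + 1)" if "R + 1 \<le> x" for x
 proof -
  have "\<bar>h ((R + 1) + (x - (R + 1))) - h (R + 1)\<bar> \<le> 0 * \<bar>x - (R + 1)\<bar>"
   by (rule continuous_increment_AE[OF c w, where V="{R<..}" and G="{R<..}"])
    (use K0 R that in \<open>auto intro: add_strict_increasing2 add_pos_nonneg order_less_le_trans\<close>)
  then show ?thesis by simp
 qed
 have down: "h x = h (- (R + 1))" if "x \<le> - (R + 1)" for x
 proof -
  have "\<bar>h (- (R + 1) + (x - (- (R + 1)))) - h (- (R + 1))\<bar> \<le> 0 * \<bar>x - (- (R + 1))\<bar>"
  proof (rule continuous_increment_AE[OF c w, where V="{..<-R}" and G="{..<-R}"])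
   show "y + s * (x - - (R + 1)) \<in> {..<- R}" if y: "y \<in> {..<- R}" "0 \<le> s" for y s
    using mult_nonneg_nonpos[OF y(2), of "x - - (R + 1)"] y \<open>x \<le> - (R + 1)\<close> by auto
  qed (use K0 R that in auto)
  then show ?thesis by simp
 qed
 show ?thesis
 proof (rule that[of "\<bar>C\<bar>" M0 "R + 1"])
  show "0 \<le> M0" using M[of 0] by linarith
  show "0 < R + 1" using R by simp
 qed (fact L M up down abs_ge_zero)+
qed

lemma renorm_fun_clip:
 assumes "k > 0"
 shows "renorm_fun (clip k)"
 unfolding renorm_fun_def
proof (intro conjI exI)
 show "continuous_on UNIV (clip k)" by (rule clip_continuous)
 have "clip k \<in> bmeas" using clip_continuous by (rule borel_measurable_continuous_onI)
 moreover have "\<bar>clip k x\<bar> \<le> k" for x using assms by (auto simp: clip_def)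
 ultimately show "in_Linf UNIV (clip k)"
  unfolding in_Linf_def by (auto intro!: exI[of _ k] measurable_completion simp: lebesgue_on_UNIV_eq)
 show "weak_gradient UNIV (clip k) (indicator {-k..k})" by (rule clip_weak_gradient[OF assms])
 show "in_Linf UNIV (indicator {-k..k} :: real \<Rightarrow> real)"
  unfolding in_Linf_def by (auto intro!: exI[of _ 1] measurable_completion simp: lebesgue_on_UNIV_eq indicator_def[abs_def])
 show "compact {-k..k}" by simp
 show "AE t in lebesgue. t \<notin> {- k..k} \<longrightarrow> indicator {- k..k} t = (0::real)" by auto
qed

lemma renorm_fun_const: "renorm_fun (\<lambda>t. c)"
 unfolding renorm_fun_def
proof (intro conjI exI)
 show "weak_gradient UNIV (\<lambda>t::real. c) (\<lambda>t. 0)"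
  by (rule lipschitz_weak_gradient[of 0 _ _ 0]) auto
 show "in_Linf UNIV (\<lambda>t::real. c)" "in_Linf UNIV (\<lambda>t::real. 0::real)"
  unfolding in_Linf_def by auto
 show "compact ({}::real set)" by simp
qed auto

section \<open>A Sobolev inequality on balls\<close>

text \<open>With \<open>y = x + z\<close> the difference is bounded by the integral of
  \<open>\<gamma>\<close> over the segment. After Fubini and the substitution of
  \<open>x - s z\<close> for \<open>x\<close>, the inner integral measures the \<open>z\<close> in a
  ball of radius \<open>2 * r\<close> with \<open>x - s z\<close> in \<open>E\<close>; it is at most
  the volume of that ball and at most \<open>s^(-N)\<close> times the volume of \<open>E\<close>.
  The geometric mean with weight \<open>\<theta>\<close> gives \<open>s^(-N \<theta>)\<close>,
  integrable at 0 since \<open>N \<theta> < 1\<close>, and gains a power of the volume of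
  \<open>E\<close>.\<close>

theorem ball_sobolev:
 fixes f \<gamma> :: "'a::euclidean_space \<Rightarrow> real" and a :: 'a
 assumes G: "open G" and BG: "ball a r \<subseteq> G" and r: "r > 0"
  and w: "weak_gradient G f g"
  and f[measurable]: "f \<in> bmeas" and \<gamma>[measurable]: "\<gamma> \<in> bmeas"
  and \<gamma>0: "\<And>x. 0 \<le> \<gamma> x" and \<gamma>l: "loc_int G \<gamma>" and \<gamma>g: "ae_on G (\<lambda>x. norm (g x) \<le> \<gamma> x)"
  and E[measurable]: "E \<in> sets borel" and EB: "E \<subseteq> ball a r"
  and \<theta>: "0 < \<theta>" "real DIM('a) * \<theta> < 1"
 defines "B \<equiv> ball a r"
 shows "(Bor+ x. indicator E x * (Bor+ y. indicator B y * ennreal \<bar>f y - f x\<bar>))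
  \<le> ennreal (2 * r * measure lborel (cball (0::'a) (2 * r)) powr (1 - \<theta>) / (1 - real DIM('a) * \<theta>)
    * measure lborel E powr \<theta>) * (Bor+ x. indicator B x * ennreal (\<gamma> x))"
proof -
 let ?N = "real DIM('a)"
 let ?K = "\<lambda>z x s. indicator {0..1::real} s * (indicator E x * (indicator B (x + z) * (ennreal (norm z) * ennreal (\<gamma> (x + s *\<^sub>R z)))))"
 let ?J = "\<lambda>x z s. (indicator B x * ennreal (\<gamma> x)) * (ennreal (2 * r) * (indicator E (x - s *\<^sub>R z) * indicator (cball 0 (2 * r)) z))"
 let ?\<Gamma> = "Bor+ x. indicator B x * ennreal (\<gamma> x)"
 define c where "c = measure lborel (cball (0::'a) (2 * r))"
 define m where "m = measure lborel E"
 have [measurable]: "B \<in> sets borel" "cball (0::'a) (2 * r) \<in> sets borel" by (simp_all add: B_def)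
 have Bo: "open B" "convex B" by (auto simp: B_def)
 have th1: "\<theta> < 1"
 proof -
  have "1 * \<theta> \<le> ?N * \<theta>" using \<theta>(1) DIM_positive[where 'a='a] by (intro mult_right_mono) auto
  with \<theta>(2) show ?thesis by simp
 qed
 have ball_diff: "norm z \<le> 2 * r" if "x \<in> B" "x + z \<in> B" for x z
  using that dist_triangle[of x "x + z" a] by (auto simp: B_def dist_norm norm_minus_commute)
 have emE: "emeasure lborel E = ennreal m"
 proof -
  have "emeasure lborel E \<le> emeasure lborel (ball a r)" using EB by (intro emeasure_mono) auto
  also have "\<dots> < \<infinity>" by (rule emeasure_lborel_ball_finite)
  finally show ?thesis unfolding m_def by (intro emeasure_eq_ennreal_measure) auto
 qed
 have emc: "emeasure lborel (cball (0::'a) (2 * r)) = ennreal c"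
  using emeasure_lborel_cball_finite[of "0::'a" "2 * r"] unfolding c_def by (intro emeasure_eq_ennreal_measure) auto
 have slice: "(Bor+ x. indicator E x * (indicator B (x + z) * ennreal \<bar>f (x + z) - f x\<bar>))
  \<le> (Bor+ x. (Bor+ s. ?K z x s))" for z
 proof -
  let ?V = "B \<inter> {x. x + z \<in> B}"
  have "open ((\<lambda>x. x + z) -` B)" by (intro open_vimage Bo continuous_intros)
  then have V: "open ?V" using Bo(1) by (intro open_Int) (simp_all add: vimage_def)
  have VG: "x + s *\<^sub>R z \<in> G" if "x \<in> ?V" "0 \<le> s" "s \<le> 1" for x s
  proof -
   have "(1 - s) *\<^sub>R x + s *\<^sub>R (x + z) \<in> B" using that by (intro convexD[OF Bo(2)]) auto
   then show ?thesis using BG by (auto simp: B_def algebra_simps)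
  qed
  have "AE x in lborel. x \<in> ?V \<longrightarrow> ennreal \<bar>f (x + z) - f x\<bar>
   \<le> ennreal (norm z) * (segint \<gamma> x z)"
   using weak_gradient_difference[OF G V VG w f \<gamma> \<gamma>0 \<gamma>l \<gamma>g] by (simp add: AE_completion_iff)
  then have ae: "AE x in lborel. indicator E x * (indicator B (x + z) * ennreal \<bar>f (x + z) - f x\<bar>)
   \<le> indicator E x * (indicator B (x + z) * (ennreal (norm z) * (segint \<gamma> x z)))"
  proof eventually_elim
   case (elim x)
   then show ?case using EB by (cases "x \<in> E \<and> x + z \<in> B") (auto simp: B_def indicator_def)
  qed
  show ?thesis
   using nn_integral_mono_AE[OF ae] by (simp add: nn_integral_cmult[symmetric] ac_simps)
 qed
 have "(Bor+ x. indicator E x * (Bor+ y. indicator B y * ennreal \<bar>f y - f x\<bar>))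
  = (Bor+ x. (Bor+ z. indicator E x * (indicator B (x + z) * ennreal \<bar>f (x + z) - f x\<bar>)))"
 proof (intro nn_integral_cong)
  fix x
  show "indicator E x * (Bor+ y. indicator B y * ennreal \<bar>f y - f x\<bar>)
   = (Bor+ z. indicator E x * (indicator B (x + z) * ennreal \<bar>f (x + z) - f x\<bar>))"
   using nn_integral_translate[of "\<lambda>y. indicator B y * ennreal \<bar>f y - f x\<bar>" x]
   by (simp add: nn_integral_cmult add.commute)
 qed
 also have "\<dots> = (Bor+ z. (Bor+ x. indicator E x * (indicator B (x + z) * ennreal \<bar>f (x + z) - f x\<bar>)))"
  by (subst lborel_pair.Fubini') auto
 also have "\<dots> \<le> (Bor+ z. (Bor+ x. (Bor+ s. ?K z x s)))"
  by (intro nn_integral_mono slice)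
 also have "\<dots> = (Bor+ z. (Bor+ s. (Bor+ x. ?K z x s)))"
  by (intro nn_integral_cong lborel_pair.Fubini') measurable
 also have "\<dots> = (Bor+ s. (Bor+ z. (Bor+ x. ?K z x s)))"
  by (rule lborel_pair.Fubini'[symmetric]) measurable
 \<comment> \<open>The single value \<open>s = 0\<close>, where the scaling by \<open>s\<close>
   degenerates, is dropped as a null set.\<close>
 also have "\<dots> \<le> (Bor+ s. indicator {0<..1} s * (ennreal (2 * r * c powr (1 - \<theta>) * m powr \<theta> * s powr (- (?N * \<theta>))) * ?\<Gamma>))"
 proof (rule nn_integral_mono_AE)
  have "AE s::real in lborel. s \<notin> {0}" by (intro AE_not_in finite_imp_null_set_lborel) auto
  then show "AE s in lborel. (Bor+ z. (Bor+ x. ?K z x s))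
   \<le> indicator {0<..1} s * (ennreal (2 * r * c powr (1 - \<theta>) * m powr \<theta> * s powr (- (?N * \<theta>))) * ?\<Gamma>)"
  proof eventually_elim
   case (elim s)
   show ?case
   proof (cases "s \<in> {0..1}")
    case True
    then have s: "0 < s" "s \<le> 1" using elim by auto
    have inner: "(Bor+ z. indicator E (x - s *\<^sub>R z) * indicator (cball 0 (2 * r)) z) \<le> ennreal (s powr (- (?N * \<theta>)) * m powr \<theta> * c powr (1 - \<theta>))" for x
    proof -
     let ?q = "(Bor+ z. indicator E (x - s *\<^sub>R z) * indicator (cball 0 (2 * r)) z)"
     have q1: "?q \<le> ennreal c"
     proof -
      have "?q \<le> (Bor+ z. indicator (cball (0::'a) (2 * r)) z)" by (intro nn_integral_mono) (auto simp: indicator_def)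
      also have "\<dots> = ennreal c" using emc by simp
      finally show ?thesis .
     qed
     have q2: "?q \<le> ennreal (s powr (- ?N) * m)"
     proof -
      have "ennreal m = (Bor+ z. indicator E z)" using emE by simp
      also have "\<dots> = (\<integral>\<^sup>+z. indicator E z \<partial>density (distr lborel borel (\<lambda>z. x + (- s) *\<^sub>R z)) (\<lambda>_. ennreal (\<bar>- s\<bar> ^ DIM('a))))"
       using lborel_affine[of "- s" x] s by simp
      also have "\<dots> = ennreal (s ^ DIM('a)) * (Bor+ z. indicator E (x - s *\<^sub>R z))"
       using s by (simp add: nn_integral_density nn_integral_distr nn_integral_cmult del: nn_integral_indicator)
      finally have e: "ennreal m = ennreal (s ^ DIM('a)) * (Bor+ z. indicator E (x - s *\<^sub>R z))" .
      have p: "s powr (- ?N) * s ^ DIM('a) = 1" using s by (simp add: powr_minus powr_realpow)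
      have "?q \<le> (Bor+ z. indicator E (x - s *\<^sub>R z))" by (intro nn_integral_mono) (auto simp: indicator_def)
      also have "\<dots> = ennreal (s powr (- ?N) * s ^ DIM('a)) * (Bor+ z. indicator E (x - s *\<^sub>R z))" using p by simp
      also have "\<dots> = ennreal (s powr (- ?N)) * ennreal m" unfolding e
       using s by (simp add: ennreal_mult mult.assoc)
      also have "\<dots> = ennreal (s powr (- ?N) * m)" by (simp add: ennreal_mult' m_def)
      finally show ?thesis .
     qed
     obtain y where y: "?q = ennreal y" "0 \<le> y" using q1 by (cases ?q) (auto simp: top_unique)
     have y1: "y \<le> c" "y \<le> s powr (- ?N) * m"
      using q1 q2 y by (auto simp: c_def m_def ennreal_le_iff)
     have "y = y powr \<theta> * y powr (1 - \<theta>)" using y(2) by (simp flip: powr_add)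
     also have "\<dots> \<le> (s powr (- ?N) * m) powr \<theta> * c powr (1 - \<theta>)"
      using y1 y(2) \<theta>(1) th1 by (intro mult_mono powr_mono2) auto
     also have "(s powr (- ?N) * m) powr \<theta> = s powr (- (?N * \<theta>)) * m powr \<theta>"
      using s by (simp add: powr_mult powr_powr m_def)
     finally show ?thesis unfolding y(1) by (intro ennreal_leI)
    qed
    have "(Bor+ z. (Bor+ x. ?K z x s))
     = (Bor+ z. (Bor+ x. indicator E (x - s *\<^sub>R z) * (indicator B (x - s *\<^sub>R z + z) * (ennreal (norm z) * ennreal (\<gamma> x)))))"
    proof (rule nn_integral_cong)
     fix z
     show "(Bor+ x. ?K z x s)
      = (Bor+ x. indicator E (x - s *\<^sub>R z) * (indicator B (x - s *\<^sub>R z + z) * (ennreal (norm z) * ennreal (\<gamma> x))))"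
      using nn_integral_translate[of "\<lambda>x. indicator E (x - s *\<^sub>R z) * (indicator B (x - s *\<^sub>R z + z) * (ennreal (norm z) * ennreal (\<gamma> x)))" "s *\<^sub>R z"] True
      by simp
    qed
    also have "\<dots> \<le> (Bor+ z. (Bor+ x. ?J x z s))"
    proof (intro nn_integral_mono)
     fix z x
     show "indicator E (x - s *\<^sub>R z) * (indicator B (x - s *\<^sub>R z + z) * (ennreal (norm z) * ennreal (\<gamma> x)))
      \<le> ?J x z s"
     proof (cases "x - s *\<^sub>R z \<in> E \<and> x - s *\<^sub>R z + z \<in> B")
      case EB': True
      then have i: "x - s *\<^sub>R z \<in> B" using EB by (auto simp: B_def)
      \<comment> \<open>After the substitution \<open>x\<close> is a point of the segment from
        \<open>x - s z\<close> to \<open>x - s z + z\<close>, so convexity puts it in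
        \<open>B\<close> and the integral of \<open>\<gamma>\<close> is confined to the
        ball.\<close>
      have "(1 - s) *\<^sub>R (x - s *\<^sub>R z) + s *\<^sub>R (x - s *\<^sub>R z + z) \<in> B" using s i EB' by (intro convexD[OF Bo(2)]) auto
      then have "x \<in> B" by (simp add: algebra_simps)
      moreover have nz: "norm z \<le> 2 * r" using ball_diff[OF i] EB' by blast
      moreover have "ennreal (norm z) * ennreal (\<gamma> x) \<le> ennreal (\<gamma> x) * ennreal (2 * r)"
       unfolding mult.commute[of "ennreal (norm z)"] using nz by (intro mult_left_mono ennreal_leI) auto
      ultimately show ?thesis using EB' by simp
     qed auto
    qed
    also have "\<dots> = (Bor+ x. (Bor+ z. ?J x z s))"
     by (subst lborel_pair.Fubini') auto
    also have "\<dots> = (Bor+ x. (indicator B x * ennreal (\<gamma> x)) * (ennreal (2 * r) * (Bor+ z. indicator E (x - s *\<^sub>R z) * indicator (cball 0 (2 * r)) z)))"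
    proof (rule nn_integral_cong)
     fix x
     show "(Bor+ z. ?J x z s)
      = (indicator B x * ennreal (\<gamma> x)) * (ennreal (2 * r) * (Bor+ z. indicator E (x - s *\<^sub>R z) * indicator (cball 0 (2 * r)) z))"
     proof -
      have "(Bor+ z. ?J x z s)
       = (indicator B x * ennreal (\<gamma> x)) * (Bor+ z. ennreal (2 * r) * (indicator E (x - s *\<^sub>R z) * indicator (cball 0 (2 * r)) z))"
       by (rule nn_integral_cmult) measurable
      also have "(Bor+ z. ennreal (2 * r) * (indicator E (x - s *\<^sub>R z) * indicator (cball 0 (2 * r)) z))
       = ennreal (2 * r) * (Bor+ z. indicator E (x - s *\<^sub>R z) * indicator (cball 0 (2 * r)) z)"
       by (rule nn_integral_cmult) measurable
      finally show ?thesis .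
     qed
    qed
    also have "\<dots> \<le> (Bor+ x. (indicator B x * ennreal (\<gamma> x)) * (ennreal (2 * r) * ennreal (s powr (- (?N * \<theta>)) * m powr \<theta> * c powr (1 - \<theta>))))"
     by (intro nn_integral_mono mult_left_mono inner) auto
    also have "\<dots> = ?\<Gamma> * (ennreal (2 * r) * ennreal (s powr (- (?N * \<theta>)) * m powr \<theta> * c powr (1 - \<theta>)))"
     by (rule nn_integral_multc) measurable
    also have "ennreal (2 * r) * ennreal (s powr (- (?N * \<theta>)) * m powr \<theta> * c powr (1 - \<theta>))
      = ennreal (2 * r * c powr (1 - \<theta>) * m powr \<theta> * s powr (- (?N * \<theta>)))"
     using r by (subst ennreal_mult'[symmetric]) (auto simp: ac_simps)
    finally show ?thesis using s by (simp add: mult.commute)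
   qed (auto simp: indicator_def)
  qed
 qed
 also have "\<dots> = (Bor+ s. (ennreal (2 * r * c powr (1 - \<theta>) * m powr \<theta>) * ?\<Gamma>) * ennreal (indicator {0..1} s * s powr (- (?N * \<theta>))))"
  using r by (intro nn_integral_cong) (auto simp: indicator_def ennreal_mult' ac_simps)
 also have "\<dots> = (ennreal (2 * r * c powr (1 - \<theta>) * m powr \<theta>) * ?\<Gamma>) * (Bor+ s. ennreal (indicator {0..1} s * s powr (- (?N * \<theta>))))"
  by (rule nn_integral_cmult) measurable
 also have "(Bor+ s. ennreal (indicator {0..1} s * s powr (- (?N * \<theta>)))) = ennreal (1 / (1 - ?N * \<theta>))"
 proof -
  have "((\<lambda>s::real. s powr (- (?N * \<theta>))) has_integral (1 powr (- (?N * \<theta>) + 1) / (- (?N * \<theta>) + 1))) {0..1}"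
   using \<theta> by (intro has_integral_powr_from_0) auto
  then have "((\<lambda>s::real. s powr (- (?N * \<theta>))) has_integral (1 / (1 - ?N * \<theta>))) {0..1}" by simp
  then have "((\<lambda>s. if s \<in> {0..1} then s powr (- (?N * \<theta>)) else 0) has_integral (1 / (1 - ?N * \<theta>))) UNIV"
   by (subst has_integral_restrict_UNIV)
  moreover have "(\<lambda>s::real. if s \<in> {0..1} then s powr (- (?N * \<theta>)) else 0) = (\<lambda>s. indicator {0..1} s * s powr (- (?N * \<theta>)))"
   by (auto simp: indicator_def)
  ultimately show ?thesis by (intro nn_integral_has_integral_lborel) auto
 qed
 also have "ennreal (2 * r * c powr (1 - \<theta>) * m powr \<theta>) * ?\<Gamma> * ennreal (1 / (1 - ?N * \<theta>))
   = (ennreal (2 * r * c powr (1 - \<theta>) * m powr \<theta>) * ennreal (1 / (1 - ?N * \<theta>))) * ?\<Gamma>"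
  by (simp only: ac_simps)
 also have "ennreal (2 * r * c powr (1 - \<theta>) * m powr \<theta>) * ennreal (1 / (1 - ?N * \<theta>))
   = ennreal (2 * r * c powr (1 - \<theta>) / (1 - ?N * \<theta>) * m powr \<theta>)"
  using r \<theta> by (subst ennreal_mult'[symmetric]) auto
 finally show ?thesis by (simp only: c_def m_def)
qed


section \<open>Capacity\<close>

definition energy :: "real \<Rightarrow> ('a::euclidean_space \<Rightarrow> real) \<Rightarrow> ennreal" where
 "energy r \<psi> = (Bor+ x. ennreal (\<bar>\<psi> x\<bar> powr r + norm (grad \<psi> x) powr r))"

definition admissible :: "'a::euclidean_space set \<Rightarrow> ('a \<Rightarrow> real) \<Rightarrow> bool" where
 "admissible K \<psi> \<longleftrightarrow> test_fun UNIV \<psi> \<and> (\<forall>x. indicator K x \<le> \<psi> x \<and> \<psi> x \<le> 1)"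

lemma cap_compact_energy: "cap_compact r K = (INF \<psi> \<in> {\<psi>. admissible K \<psi>}. energy r \<psi>)"
 by (simp add: cap_compact_def energy_def admissible_def)

lemma admissibleD:
 assumes "admissible K \<psi>"
 shows "test_fun UNIV \<psi>" "0 \<le> \<psi> x" "\<psi> x \<le> 1" "x \<in> K \<Longrightarrow> \<psi> x = 1"
proof -
 have *: "indicator K x \<le> \<psi> x" "\<psi> x \<le> 1" using assms by (auto simp: admissible_def)
 show "test_fun UNIV \<psi>" using assms by (simp add: admissible_def)
 show "0 \<le> \<psi> x" using order_trans[OF indicator_pos_le *(1)] .
 show "\<psi> x \<le> 1" by (rule *)
 show "\<psi> x = 1" if "x \<in> K" using * that by simp
qed

lemma admissibleI:
 assumes "test_fun UNIV \<psi>" "\<And>x. 0 \<le> \<psi> x" "\<And>x. \<psi> x \<le> 1" "\<And>x. x \<in> K \<Longrightarrow> \<psi> x = 1"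
 shows "admissible K \<psi>"
 using assms by (auto simp: admissible_def indicator_def)

lemma cap_compact_le: "admissible K \<psi> \<Longrightarrow> cap_compact r K \<le> energy r \<psi>"
 unfolding cap_compact_energy by (intro INF_lower) auto

lemma cap_compact_less:
 assumes "cap_compact r K < e"
 obtains \<psi> where "admissible K \<psi>" "energy r \<psi> < e"
 using assms unfolding cap_compact_energy by (auto simp: INF_less_iff)

lemma cap_compact_mono:
 assumes "K \<subseteq> L"
 shows "cap_compact r K \<le> cap_compact r L"
 unfolding cap_compact_energy
proof (rule INF_superset_mono)
 show "{\<psi>. admissible L \<psi>} \<subseteq> {\<psi>. admissible K \<psi>}"
  using assms by (auto intro!: admissibleI intro: admissibleD)
qed simp

lemma cap_less:
 assumes "cap r E < e"
 obtains U where "open U" "E \<subseteq> U" "\<And>K. compact K \<Longrightarrow> K \<subseteq> U \<Longrightarrow> cap_compact r K < e"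
proof -
 obtain U where U: "open U" "E \<subseteq> U" "(SUP K \<in> {K. compact K \<and> K \<subseteq> U}. cap_compact r K) < e"
  using assms unfolding cap_def by (auto simp: INF_less_iff)
 have "cap_compact r K < e" if "compact K" "K \<subseteq> U" for K
  using le_less_trans[OF SUP_upper U(3)] that by auto
 with U show ?thesis using that by blast
qed

lemma cap_compact_le_cap:
 assumes "compact K" "K \<subseteq> E"
 shows "cap_compact r K \<le> cap r E"
 unfolding cap_def using assms by (intro INF_greatest SUP_upper2[of K]) auto

lemma powr_add_le:
 fixes a b r :: real
 assumes "0 \<le> a" "0 \<le> b" "0 < r"
 shows "(a + b) powr r \<le> 2 powr r * (a powr r + b powr r)"
proof -
 have "(a + b) powr r \<le> (2 * max a b) powr r" using assms by (intro powr_mono2) auto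
 also have "\<dots> = 2 powr r * max a b powr r" using assms by (intro powr_mult)
 also have "\<dots> \<le> 2 powr r * (a powr r + b powr r)"
  by (intro mult_left_mono) (auto simp: max_def)
 finally show ?thesis .
qed

text \<open>Multiplication by a fixed cutoff enlarges the energy by at most a constant factor; this
  is how test functions for the capacity are localized.\<close>

lemma grad_mult_powr_bound:
 assumes s: "smooth \<rho>" "smooth \<psi>" and \<rho>: "0 \<le> \<rho> x" "\<rho> x \<le> 1" "norm (grad \<rho> x) \<le> B" and r: "0 < r"
 shows "norm (grad (\<lambda>x. \<rho> x * \<psi> x) x) powr r \<le> 2 powr r * (B powr r + 1) * (\<bar>\<psi> x\<bar> powr r + norm (grad \<psi> x) powr r)"
proof -
 let ?a = "\<bar>\<psi> x\<bar>" and ?b = "norm (grad \<psi> x)"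
 have B: "0 \<le> B" using \<rho>(3) norm_ge_zero order_trans by blast
 have "norm (grad (\<lambda>x. \<rho> x * \<psi> x) x) \<le> norm (\<rho> x *\<^sub>R grad \<psi> x) + norm (\<psi> x *\<^sub>R grad \<rho> x)"
  unfolding grad_mult[OF s] by (rule norm_triangle_ineq)
 also have "\<dots> \<le> ?b + B * ?a"
  using \<rho>(1,2) mult_left_mono[OF \<rho>(3), of ?a] by (intro add_mono) (auto simp: mult.commute intro!: mult_left_le_one_le)
 finally have "norm (grad (\<lambda>x. \<rho> x * \<psi> x) x) powr r \<le> (?b + B * ?a) powr r" using r by (intro powr_mono2) auto
 also have "\<dots> \<le> 2 powr r * (?b powr r + (B * ?a) powr r)" using r B by (intro powr_add_le) auto
 also have "\<dots> = 2 powr r * (?b powr r + B powr r * ?a powr r)" using B by (simp add: powr_mult)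
 also have "\<dots> \<le> 2 powr r * ((B powr r + 1) * (?a powr r + ?b powr r))"
  by (intro mult_left_mono) (auto simp: algebra_simps)
 finally show ?thesis by (simp add: mult.assoc)
qed

lemma energy_measurable:
 assumes "test_fun G \<psi>"
 shows "(\<lambda>x. ennreal (\<bar>\<psi> x\<bar> powr r + norm (grad \<psi> x) powr r)) \<in> bmeas"
proof -
 note [measurable] = test_fun_borel[OF assms]
 show ?thesis by measurable
qed

lemma energy_le_sum:
 assumes r: "0 < r" and t: "test_fun UNIV \<psi>1" "test_fun UNIV \<psi>2"
  and "\<And>x. \<bar>\<psi> x\<bar> \<le> \<bar>\<psi>1 x\<bar> + \<bar>\<psi>2 x\<bar>"
  and "\<And>x. norm (grad \<psi> x) \<le> norm (grad \<psi>1 x) + norm (grad \<psi>2 x)"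
 shows "energy r \<psi> \<le> ennreal (2 powr r) * (energy r \<psi>1 + energy r \<psi>2)"
proof -
 have "energy r \<psi> \<le> (Bor+ x. ennreal (2 powr r) * (ennreal (\<bar>\<psi>1 x\<bar> powr r + norm (grad \<psi>1 x) powr r)
   + ennreal (\<bar>\<psi>2 x\<bar> powr r + norm (grad \<psi>2 x) powr r)))"
  unfolding energy_def
 proof (rule nn_integral_mono)
  fix x
  have "\<bar>\<psi> x\<bar> powr r \<le> 2 powr r * (\<bar>\<psi>1 x\<bar> powr r + \<bar>\<psi>2 x\<bar> powr r)"
   using order_trans[OF powr_mono2[of r, OF _ _ assms(4)[of x]] powr_add_le] r by auto
  moreover have "norm (grad \<psi> x) powr r \<le> 2 powr r * (norm (grad \<psi>1 x) powr r + norm (grad \<psi>2 x) powr r)"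
   using order_trans[OF powr_mono2[of r, OF _ _ assms(5)[of x]] powr_add_le] r by auto
  ultimately have "\<bar>\<psi> x\<bar> powr r + norm (grad \<psi> x) powr r
   \<le> 2 powr r * ((\<bar>\<psi>1 x\<bar> powr r + norm (grad \<psi>1 x) powr r) + (\<bar>\<psi>2 x\<bar> powr r + norm (grad \<psi>2 x) powr r))"
   by (simp add: distrib_left)
  then have "ennreal (\<bar>\<psi> x\<bar> powr r + norm (grad \<psi> x) powr r)
   \<le> ennreal (2 powr r * ((\<bar>\<psi>1 x\<bar> powr r + norm (grad \<psi>1 x) powr r) + (\<bar>\<psi>2 x\<bar> powr r + norm (grad \<psi>2 x) powr r)))"
   by (rule ennreal_leI)
  also have "\<dots> = ennreal (2 powr r) * (ennreal (\<bar>\<psi>1 x\<bar> powr r + norm (grad \<psi>1 x) powr r)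
   + ennreal (\<bar>\<psi>2 x\<bar> powr r + norm (grad \<psi>2 x) powr r))"
   by (subst ennreal_plus[symmetric]) (auto simp: ennreal_mult)
  finally show "ennreal (\<bar>\<psi> x\<bar> powr r + norm (grad \<psi> x) powr r)
   \<le> ennreal (2 powr r) * (ennreal (\<bar>\<psi>1 x\<bar> powr r + norm (grad \<psi>1 x) powr r)
   + ennreal (\<bar>\<psi>2 x\<bar> powr r + norm (grad \<psi>2 x) powr r))" .
 qed
 also have "\<dots> = ennreal (2 powr r) * (energy r \<psi>1 + energy r \<psi>2)"
  unfolding energy_def using energy_measurable[OF t(1)] energy_measurable[OF t(2)]
  by (simp add: nn_integral_cmult nn_integral_add)
 finally show ?thesis .
qed

text \<open>The maximum of two test functions is not smooth; \<open>1 - (1 - \<psi>1) (1 - \<psi>2)\<close> replaces it.\<close>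

lemma cap_compact_Un:
 assumes r: "0 < r"
 shows "cap_compact r (K \<union> L) \<le> ennreal (2 powr r) * (cap_compact r K + cap_compact r L)"
proof -
 have main: "cap_compact r (K \<union> L) \<le> ennreal (2 powr r) * (energy r \<psi>1 + energy r \<psi>2)"
  if a: "admissible K \<psi>1" "admissible L \<psi>2" for \<psi>1 \<psi>2
 proof -
  note a1 = admissibleD[OF a(1)] and a2 = admissibleD[OF a(2)]
  define \<psi> where "\<psi> x = 1 - (1 - \<psi>1 x) * (1 - \<psi>2 x)" for x
  have s: "smooth \<psi>1" "smooth \<psi>2" using a1(1) a2(1) by (auto dest: test_fun_smooth)
  have \<psi>alt: "\<psi> x = \<psi>1 x + (1 - \<psi>1 x) * \<psi>2 x" for x by (simp add: \<psi>_def algebra_simps)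
  have sm: "smooth \<psi>" unfolding \<psi>_def by (intro smooth_diff smooth_mult smooth_const s)
  have supp: "supp \<psi> \<subseteq> supp \<psi>1 \<union> supp \<psi>2"
  proof (rule supp_subsetI)
   show "closed (supp \<psi>1 \<union> supp \<psi>2)" by (intro closed_Un closed_supp)
   show "x \<in> supp \<psi>1 \<union> supp \<psi>2" if "\<psi> x \<noteq> 0" for x
   proof -
    have "\<psi>1 x \<noteq> 0 \<or> \<psi>2 x \<noteq> 0" using that by (auto simp: \<psi>_def)
    then show ?thesis using supp_mem[of \<psi>1 x] supp_mem[of \<psi>2 x] by blast
   qed
  qed
  have "test_fun UNIV \<psi>"
   using sm supp a1(1) a2(1) compact_supp_subset[OF compact_Un supp] by (auto simp: test_fun_iff)
  moreover have "0 \<le> (1 - \<psi>1 x) * (1 - \<psi>2 x)" "(1 - \<psi>1 x) * (1 - \<psi>2 x) \<le> 1" for x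
   using a1(2,3)[of x] a2(2,3)[of x] by (auto intro!: mult_le_one)
  then have "0 \<le> \<psi> x" "\<psi> x \<le> 1" for x by (auto simp: \<psi>_def)
  moreover have "\<psi> x = 1" if "x \<in> K \<union> L" for x using that a1(4) a2(4) by (auto simp: \<psi>_def)
  ultimately have ad: "admissible (K \<union> L) \<psi>" by (intro admissibleI) auto
  have "grad \<psi> x = (1 - \<psi>2 x) *\<^sub>R grad \<psi>1 x + (1 - \<psi>1 x) *\<^sub>R grad \<psi>2 x" for x
  proof -
   have "grad \<psi> x = grad (\<lambda>x. 1) x - grad (\<lambda>x. (1 - \<psi>1 x) * (1 - \<psi>2 x)) x"
    unfolding \<psi>_def by (intro grad_diff smooth_mult smooth_diff smooth_const s)
   also have "grad (\<lambda>x. (1 - \<psi>1 x) * (1 - \<psi>2 x)) x = (1 - \<psi>1 x) *\<^sub>R grad (\<lambda>x. 1 - \<psi>2 x) x + (1 - \<psi>2 x) *\<^sub>R grad (\<lambda>x. 1 - \<psi>1 x) x"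
    by (intro grad_mult smooth_diff smooth_const s)
   finally show ?thesis using s by (simp add: grad_diff smooth_const grad_const)
  qed
  then have "norm (grad \<psi> x) \<le> norm (grad \<psi>1 x) + norm (grad \<psi>2 x)" for x
  proof -
   have "norm ((1 - \<psi>2 x) *\<^sub>R grad \<psi>1 x + (1 - \<psi>1 x) *\<^sub>R grad \<psi>2 x)
    \<le> (1 - \<psi>2 x) * norm (grad \<psi>1 x) + (1 - \<psi>1 x) * norm (grad \<psi>2 x)"
    using norm_triangle_ineq a1(3)[of x] a2(3)[of x] by (metis abs_of_nonneg diff_ge_0_iff_ge norm_scaleR)
   also have "\<dots> \<le> norm (grad \<psi>1 x) + norm (grad \<psi>2 x)"
    using a1(2)[of x] a2(2)[of x] a1(3)[of x] a2(3)[of x] by (intro add_mono mult_left_le_one_le) auto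
   finally show ?thesis using \<open>grad \<psi> x = _\<close> by simp
  qed
  moreover have "\<bar>\<psi> x\<bar> \<le> \<bar>\<psi>1 x\<bar> + \<bar>\<psi>2 x\<bar>" for x
  proof -
   have "(1 - \<psi>1 x) * \<psi>2 x \<le> \<psi>2 x" "0 \<le> (1 - \<psi>1 x) * \<psi>2 x"
    using a1(2,3)[of x] a2(2)[of x] by (auto intro!: mult_left_le_one_le)
   then show ?thesis using a1(2)[of x] a2(2)[of x] by (simp add: \<psi>alt)
  qed
  ultimately have "energy r \<psi> \<le> ennreal (2 powr r) * (energy r \<psi>1 + energy r \<psi>2)"
   using a1(1) a2(1) by (intro energy_le_sum r)
  then show ?thesis using cap_compact_le[OF ad] by (rule order_trans[rotated])
 qed
 \<comment> \<open>The infima need not be attained, so nearly optimal functions are chosen for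
   \<open>K\<close> and \<open>L\<close> separately. Infinite capacities are set apart below because
   the final limit is taken with real numbers.\<close>
 have step: "cap_compact r (K \<union> L) \<le> ennreal (2 powr r) * (x + y)" if x: "cap_compact r K < x" and y: "cap_compact r L < y" for x y
 proof -
  obtain \<psi>1 where 1: "admissible K \<psi>1" "energy r \<psi>1 < x" using cap_compact_less[OF x] .
  obtain \<psi>2 where 2: "admissible L \<psi>2" "energy r \<psi>2 < y" using cap_compact_less[OF y] .
  have "energy r \<psi>1 + energy r \<psi>2 \<le> x + y" using 1(2) 2(2) by (intro add_mono) auto
  then show ?thesis using main[OF 1(1) 2(1)] by (meson mult_left_mono order_trans zero_le)
 qed
 show ?thesis
 proof (cases "cap_compact r K = top \<or> cap_compact r L = top")
  case True
  then have "ennreal (2 powr r) * (cap_compact r K + cap_compact r L) = top" by (auto simp: ennreal_mult_eq_top_iff)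
  then show ?thesis by simp
 next
  case False
  then obtain a b where ab: "cap_compact r K = ennreal a" "cap_compact r L = ennreal b" "0 \<le> a" "0 \<le> b"
   by (metis ennreal_cases)
  have le: "cap_compact r (K \<union> L) \<le> ennreal (2 powr r * (a + b)) + ennreal e" if "e > 0" for e
  proof -
   define d where "d = e / (2 * 2 powr r)"
   have d: "d > 0" using that by (simp add: d_def)
   have "cap_compact r (K \<union> L) \<le> ennreal (2 powr r) * (ennreal (a + d) + ennreal (b + d))"
    using ab d by (intro step) (auto simp: ennreal_less_iff)
   also have "\<dots> = ennreal (2 powr r * (a + d + (b + d)))" using ab d by (simp add: ennreal_mult ennreal_plus[symmetric] del: ennreal_plus)
   also have "2 powr r * (a + d + (b + d)) = 2 powr r * (a + b) + e" by (simp add: d_def field_simps)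
   finally show ?thesis using ab that by (simp add: ennreal_plus[symmetric] del: ennreal_plus)
  qed
  have "cap_compact r (K \<union> L) \<le> ennreal (2 powr r * (a + b))" by (rule ennreal_le_epsilon) (rule le)
  then show ?thesis using ab by (simp add: ennreal_mult ennreal_plus[symmetric] del: ennreal_plus)
 qed
qed

text \<open>\<open>K1\<close> is cut out by a compact neighbourhood of the part of \<open>K\<close>
  outside \<open>V\<close>; removing a smaller open neighbourhood \<open>W\<close> of that part
  leaves a compact set in \<open>V\<close>.\<close>

lemma compact_split:
 fixes K U V :: "'a::euclidean_space set"
 assumes "compact K" "open U" "open V" "K \<subseteq> U \<union> V"
 obtains K1 K2 where "compact K1" "compact K2" "K1 \<subseteq> U" "K2 \<subseteq> V" "K = K1 \<union> K2"
proof -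
 have c: "compact (K - V)" using assms by (intro compact_diff)
 obtain \<delta> L where L: "\<delta> > 0" "compact L" "L \<subseteq> U" "\<And>x y. x \<in> K - V \<Longrightarrow> norm y \<le> \<delta> \<Longrightarrow> x + y \<in> L"
  using compact_neighbourhood[OF c assms(2)] assms(4) by blast
 define W where "W = (\<Union>x\<in>K - V. ball x \<delta>)"
 have W: "open W" "K - V \<subseteq> W" using L(1) by (auto simp: W_def)
 have WL: "W \<subseteq> L"
 proof
  fix y assume "y \<in> W"
  then obtain x where x: "x \<in> K - V" "y \<in> ball x \<delta>" by (auto simp: W_def)
  then have "x + (y - x) \<in> L" by (intro L(4)) (auto simp: dist_norm norm_minus_commute)
  then show "y \<in> L" by simp
 qed
 show ?thesis
 proof (rule that[of "K \<inter> L" "K - W"])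
  show "compact (K \<inter> L)" using assms(1) L(2) by (intro compact_Int)
  show "compact (K - W)" using assms(1) W(1) by (intro compact_diff)
 qed (use L W WL in auto)
qed

text \<open>Subadditivity is available up to the factor of \<open>cap_compact_Un\<close>. Each set
  that is split off multiplies the rest by this factor, whence the weights growing like its powers;
  the bounds \<open>\<epsilon> n\<close> have to be chosen small enough to beat them.\<close>

lemma cap_compact_finite_Union:
 fixes K :: "'a::euclidean_space set"
 assumes r: "0 < r"
 shows "compact K \<Longrightarrow> (\<And>n. open (U n)) \<Longrightarrow> K \<subseteq> (\<Union>n<m. U n) \<Longrightarrow>
  (\<And>n L. compact L \<Longrightarrow> L \<subseteq> U n \<Longrightarrow> cap_compact r L \<le> \<epsilon> n) \<Longrightarrow>
  cap_compact r K \<le> cap_compact r ({}::'a set) + (\<Sum>n<m. ennreal (2 powr r) ^ Suc n * (\<epsilon> n + cap_compact r ({}::'a set)))"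
proof (induction m arbitrary: K U \<epsilon>)
 case 0
 then show ?case by simp
next
 case (Suc m)
 have "K \<subseteq> U 0 \<union> (\<Union>n<m. U (Suc n))"
 proof
  fix x assume "x \<in> K"
  then obtain n where "n < Suc m" "x \<in> U n" using Suc.prems(3) by blast
  then show "x \<in> U 0 \<union> (\<Union>n<m. U (Suc n))" by (cases n) auto
 qed
 then obtain K1 K2 where K: "compact K1" "compact K2" "K1 \<subseteq> U 0" "K2 \<subseteq> (\<Union>n<m. U (Suc n))" "K = K1 \<union> K2"
  using compact_split[OF Suc.prems(1) Suc.prems(2) open_UN, of "{..<m}" "\<lambda>n. U (Suc n)" 0] Suc.prems(2) by metis
 let ?c = "ennreal (2 powr r)" and ?z = "cap_compact r ({}::'a set)"
 have "cap_compact r K2 \<le> ?z + (\<Sum>n<m. ?c ^ Suc n * (\<epsilon> (Suc n) + ?z))"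
  using Suc.prems(2,4) K by (intro Suc.IH[of K2 "\<lambda>n. U (Suc n)" "\<lambda>n. \<epsilon> (Suc n)"]) auto
 moreover have "cap_compact r K1 \<le> \<epsilon> 0" using Suc.prems(4) K by blast
 ultimately have "cap_compact r K \<le> ?c * (\<epsilon> 0 + (?z + (\<Sum>n<m. ?c ^ Suc n * (\<epsilon> (Suc n) + ?z))))"
  unfolding K(5) by (intro order_trans[OF cap_compact_Un[OF r]] mult_left_mono add_mono) auto
 also have "\<dots> = (\<Sum>n<Suc m. ?c ^ Suc n * (\<epsilon> n + ?z))"
  by (subst sum.lessThan_Suc_shift) (simp add: distrib_left sum_distrib_left mult.assoc add.assoc)
 also have "\<dots> \<le> ?z + \<dots>" by (intro add_increasing) auto
 finally show ?case .
qed

section \<open>Comparison of capacities with different exponents\<close>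

lemma cap_compact_empty:
 assumes "0 < r"
 shows "cap_compact r ({} :: 'a::euclidean_space set) = 0"
proof -
 have "admissible {} (\<lambda>x::'a. 0)"
  by (intro admissibleI) (auto simp: test_fun_iff smooth_const supp_def)
 then have "cap_compact r ({}::'a set) \<le> energy r (\<lambda>x::'a. 0)" by (rule cap_compact_le)
 also have "\<dots> = 0" using assms by (simp add: energy_def grad_const)
 finally show ?thesis by simp
qed

text \<open>Either the left side is at most \<open>d\<close>, or the excess factor
  \<open>a powr (q - p)\<close> is at least \<open>d powr (q / p - 1)\<close>. On sets of finite
  measure this controls the lower power by the higher one.\<close>

lemma powr_le_eps:
 fixes a :: real
 assumes "0 \<le> a" "0 < p" "p \<le> q" "0 < d"
 shows "a powr p \<le> d + d powr (1 - q / p) * a powr q"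
proof (cases "a powr p \<le> d")
 case True
 have "0 \<le> d powr (1 - q / p) * a powr q" by simp
 with True show ?thesis by linarith
next
 case False
 then have pos: "d < a powr p" by simp
 have "a powr q = (a powr p) * (a powr p) powr (q / p - 1)"
 proof -
  have p: "p * (q / p - 1) = q - p" using assms by (simp add: field_simps)
  have "(a powr p) powr (q / p - 1) = a powr (q - p)" using p by (simp add: powr_powr)
  then show ?thesis by (simp flip: powr_add)
 qed
 moreover have "d powr (q / p - 1) \<le> (a powr p) powr (q / p - 1)" using pos assms by (intro powr_mono2) auto
 ultimately have "a powr p * d powr (q / p - 1) \<le> a powr q" by (simp add: mult_left_mono)
 then have "d powr (1 - q / p) * (a powr p * d powr (q / p - 1)) \<le> d powr (1 - q / p) * a powr q"
  by (intro mult_left_mono) auto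
 moreover have "d powr (1 - q / p) * d powr (q / p - 1) = 1" using assms by (simp flip: powr_add)
 ultimately have "a powr p \<le> d powr (1 - q / p) * a powr q" by (simp add: mult.left_commute)
 with assms show ?thesis by linarith
qed

text \<open>A fixed cutoff \<open>\<rho>\<close> equal to 1 near \<open>C\<close> confines the test
  functions to a set of finite measure, where \<open>powr_le_eps\<close> exchanges the exponents at
  the price of a multiple of \<open>d\<close> times this measure.\<close>

lemma cap_compact_exponent:
 fixes C :: "'a::euclidean_space set"
 assumes "compact C" and p: "0 < p" "p \<le> q" and e: "0 < e"
 obtains \<delta> where "0 < \<delta>" "\<And>K. K \<subseteq> C \<Longrightarrow> cap_compact q K < ennreal \<delta> \<Longrightarrow> cap_compact p K \<le> ennreal e"
proof -
 obtain \<rho> V where \<rho>: "test_fun UNIV \<rho>" "\<And>x. 0 \<le> \<rho> x" "\<And>x. \<rho> x \<le> 1" "open V" "C \<subseteq> V" "V \<subseteq> UNIV" "\<And>x. x \<in> V \<Longrightarrow> \<rho> x = 1"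
  using smooth_cutoff[OF assms(1) open_UNIV subset_UNIV] by metis
 obtain B where B: "B > 0" "\<And>x. \<bar>\<rho> x\<bar> \<le> B" "\<And>x. norm (grad \<rho> x) \<le> B" using test_fun_bounds[OF \<rho>(1)] by blast
 have c: "compact (supp \<rho>)" using \<rho>(1) by (simp add: test_fun_iff)
 have [measurable]: "supp \<rho> \<in> sets borel" using c by (rule borel_compact)
 define v where "v = measure lborel (supp \<rho>)"
 have fin: "emeasure lborel (supp \<rho>) = ennreal v"
  using emeasure_compact_finite[OF c] unfolding v_def by (intro emeasure_eq_ennreal_measure) auto
 have v0: "0 \<le> v" by (simp add: v_def)
 define A where "A = 1 + 2 powr p * (B powr p + 1)"
 have A: "A > 0" unfolding A_def using B by (intro add_pos_nonneg) auto
 \<comment> \<open>\<open>d\<close> makes the additive error over the support of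
   \<open>\<rho>\<close> at most \<open>e / 2\<close>; then \<open>\<delta>\<close> makes the bound
   of the energy term, whose factor \<open>D\<close> depends on \<open>d\<close>, equal to
   \<open>e / 2\<close>. The \<open>v + 1\<close> avoids dividing by a vanishing volume.\<close>
 define d where "d = e / (4 * A * (v + 1))"
 have d: "d > 0" using e A v0 by (simp add: d_def)
 define D where "D = d powr (1 - q / p)"
 have D: "D > 0" using d by (simp add: D_def)
 define \<delta> where "\<delta> = e / (2 * A * D)"
 have \<delta>: "\<delta> > 0" using e A D by (simp add: \<delta>_def)
 show ?thesis
 proof (rule that[OF \<delta>])
  fix K assume K: "K \<subseteq> C" "cap_compact q K < ennreal \<delta>"
  obtain \<psi> where \<psi>: "admissible K \<psi>" "energy q \<psi> < ennreal \<delta>" using cap_compact_less[OF K(2)] .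
  note a = admissibleD[OF \<psi>(1)]
  have s: "smooth \<rho>" "smooth \<psi>" using \<rho>(1) a(1) by (auto dest: test_fun_smooth)
  note [measurable] = test_fun_borel[OF a(1)]
  have t: "test_fun UNIV (\<lambda>x. \<rho> x * \<psi> x)" using \<rho>(1) s by (intro test_fun_mult)
  have ad: "admissible K (\<lambda>x. \<rho> x * \<psi> x)"
   using t a \<rho>(2,3,7) \<rho>(5) K(1) by (intro admissibleI) (auto intro!: mult_le_one)
  have "energy p (\<lambda>x. \<rho> x * \<psi> x) \<le> (Bor+ x. ennreal (A * 2 * d) * indicator (supp \<rho>) x + ennreal (A * D) * ennreal (\<bar>\<psi> x\<bar> powr q + norm (grad \<psi> x) powr q))"
   unfolding energy_def
  proof (rule nn_integral_mono)
   fix x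
   show "ennreal (\<bar>\<rho> x * \<psi> x\<bar> powr p + norm (grad (\<lambda>x. \<rho> x * \<psi> x) x) powr p)
    \<le> ennreal (A * 2 * d) * indicator (supp \<rho>) x + ennreal (A * D) * ennreal (\<bar>\<psi> x\<bar> powr q + norm (grad \<psi> x) powr q)"
   proof (cases "x \<in> supp \<rho>")
    case False
    then have "\<rho> x = 0" using supp_mem by blast
    moreover have "x \<notin> supp (\<lambda>x. \<rho> x * \<psi> x)" using compact_supp_mult(2)[OF c, of \<psi>] False by blast
    then have "grad (\<lambda>x. \<rho> x * \<psi> x) x = 0" by (rule grad_zero_outside)
    ultimately show ?thesis using p by simp
   next
    case True
    let ?a = "\<bar>\<psi> x\<bar>" and ?b = "norm (grad \<psi> x)"
    have n1: "\<bar>\<rho> x * \<psi> x\<bar> powr p \<le> ?a powr p"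
     using \<rho>(2,3)[of x] p by (intro powr_mono2) (auto simp: abs_mult intro!: mult_left_le_one_le)
    have "\<bar>\<rho> x * \<psi> x\<bar> powr p + norm (grad (\<lambda>x. \<rho> x * \<psi> x) x) powr p \<le> ?a powr p + 2 powr p * (B powr p + 1) * (?a powr p + ?b powr p)"
     using n1 grad_mult_powr_bound[OF s \<rho>(2,3) B(3) p(1)] by (rule add_mono)
    also have "\<dots> \<le> A * (?a powr p + ?b powr p)" by (simp add: A_def distrib_right)
    also have "\<dots> \<le> A * ((d + D * ?a powr q) + (d + D * ?b powr q))"
     unfolding D_def using A p d by (intro mult_left_mono add_mono powr_le_eps) auto
    also have "\<dots> = A * 2 * d + A * D * (?a powr q + ?b powr q)" by (simp add: algebra_simps)
    finally have "ennreal (\<bar>\<rho> x * \<psi> x\<bar> powr p + norm (grad (\<lambda>x. \<rho> x * \<psi> x) x) powr p) \<le> ennreal (A * 2 * d + A * D * (?a powr q + ?b powr q))"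
     by (rule ennreal_leI)
    also have "\<dots> = ennreal (A * 2 * d) + ennreal (A * D) * ennreal (?a powr q + ?b powr q)"
     using A D d by (subst ennreal_plus) (auto simp: ennreal_mult simp del: ennreal_plus)
    finally show ?thesis using True by simp
   qed
  qed
  also have "\<dots> = ennreal (A * 2 * d) * ennreal v + ennreal (A * D) * energy q \<psi>"
   unfolding energy_def by (subst nn_integral_add) (auto simp: nn_integral_cmult fin)
  also have "\<dots> \<le> ennreal (A * 2 * d) * ennreal v + ennreal (A * D) * ennreal \<delta>"
   using \<psi>(2) by (intro add_left_mono mult_left_mono) auto
  also have "\<dots> = ennreal (A * 2 * d * v + A * D * \<delta>)"
   using A D d v0 \<delta> by (simp add: ennreal_mult'[symmetric] ennreal_plus[symmetric] del: ennreal_plus)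
  also have "\<dots> \<le> ennreal e"
  proof (rule ennreal_leI)
   have Ad: "A * d = e / (4 * (v + 1))" using A by (simp add: d_def)
   have "A * 2 * d * v = 2 * (A * d) * v" by simp
   also have "\<dots> = e / 2 * (v / (v + 1))" unfolding Ad using v0 by (simp add: divide_simps)
   also have "\<dots> \<le> e / 2 * 1" using e v0 by (intro mult_left_mono) (auto simp: field_simps)
   finally have "A * 2 * d * v \<le> e / 2" by simp
   moreover have "A * D * \<delta> = e / 2" using A D by (simp add: \<delta>_def)
   ultimately show "A * 2 * d * v + A * D * \<delta> \<le> e" by simp
  qed
  finally show "cap_compact p K \<le> ennreal e" using cap_compact_le[OF ad] by (rule order_trans[rotated])
 qed
qed

text \<open>The comparison of exponents is local, so \<open>E\<close> is covered by its parts in the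
  balls of radius \<open>n\<close>, and the pieces are put together by compactness.\<close>

theorem cap_zero_exponent:
 fixes E :: "'a::euclidean_space set"
 assumes "cap q E = 0" and p: "0 < p" "p \<le> q"
 shows "cap p E = 0"
proof -
 have le: "cap p E \<le> ennreal e" if e: "e > 0" for e
 proof -
  define c where "c = (2::real) powr p"
  have c: "c > 0" by (simp add: c_def)
  \<comment> \<open>The powers of \<open>c\<close> compensate the weights of
    \<open>cap_compact_finite_Union\<close>; the powers of \<open>1/2\<close> sum to at most
    1.\<close>
  define \<epsilon> where "\<epsilon> n = e * (1/2) ^ Suc n / c ^ Suc n" for n
  have \<epsilon>: "\<epsilon> n > 0" for n using e c by (simp add: \<epsilon>_def)
  have "\<exists>U. open U \<and> E \<inter> ball 0 (real n) \<subseteq> U \<and> (\<forall>L. compact L \<longrightarrow> L \<subseteq> U \<longrightarrow> cap_compact p L \<le> ennreal (\<epsilon> n))" for n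
  proof -
   obtain \<delta> where \<delta>: "0 < \<delta>" "\<And>K. K \<subseteq> cball (0::'a) (real n) \<Longrightarrow> cap_compact q K < ennreal \<delta> \<Longrightarrow> cap_compact p K \<le> ennreal (\<epsilon> n)"
    using cap_compact_exponent[OF compact_cball p \<epsilon>] by metis
   obtain U where U: "open U" "E \<subseteq> U" "\<And>K. compact K \<Longrightarrow> K \<subseteq> U \<Longrightarrow> cap_compact q K < ennreal \<delta>"
    using cap_less[of q E "ennreal \<delta>"] assms(1) \<delta>(1) by auto
   have "cap_compact p L \<le> ennreal (\<epsilon> n)" if L: "compact L" "L \<subseteq> U \<inter> ball 0 (real n)" for L
    using \<delta>(2)[of L] U(3)[of L] L ball_subset_cball by blast
   with U(1,2) show ?thesis by (intro exI[of _ "U \<inter> ball 0 (real n)"]) auto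
  qed
  then obtain U where U: "\<And>n. open (U n)" "\<And>n. E \<inter> ball 0 (real n) \<subseteq> U n"
   "\<And>n L. compact L \<Longrightarrow> L \<subseteq> U n \<Longrightarrow> cap_compact p L \<le> ennreal (\<epsilon> n)"
   by metis
  have EU: "E \<subseteq> (\<Union>n. U n)"
  proof
   fix x assume "x \<in> E"
   obtain n where "norm x < real n" using reals_Archimedean2 by blast
   then have "x \<in> E \<inter> ball 0 (real n)" using \<open>x \<in> E\<close> by simp
   then show "x \<in> (\<Union>n. U n)" using U(2) by blast
  qed
  have "cap_compact p K \<le> ennreal e" if K: "compact K" "K \<subseteq> (\<Union>n. U n)" for K
  proof -
   obtain T where T: "finite T" "K \<subseteq> (\<Union>n\<in>T. U n)"
    by (rule compactE_image[OF K(1), of UNIV U]) (use U(1) K(2) in auto)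
   obtain m where m: "T \<subseteq> {..<m}" using finite_nat_bounded[OF T(1)] by blast
   have "K \<subseteq> (\<Union>n<m. U n)" using T(2) m by blast
   then have "cap_compact p K \<le> cap_compact p ({}::'a set) + (\<Sum>n<m. ennreal (2 powr p) ^ Suc n * (ennreal (\<epsilon> n) + cap_compact p ({}::'a set)))"
    using U by (intro cap_compact_finite_Union[OF p(1) K(1)]) auto
   also have "\<dots> = (\<Sum>n<m. ennreal (e * (1/2) ^ Suc n))"
   proof -
    have "ennreal c ^ Suc n * ennreal (\<epsilon> n) = ennreal (e * (1/2) ^ Suc n)" for n
    proof -
     have "ennreal c ^ Suc n * ennreal (\<epsilon> n) = ennreal (c ^ Suc n * \<epsilon> n)"
      using c \<epsilon>[of n] by (simp only: ennreal_power ennreal_mult'' less_imp_le)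
     also have "c ^ Suc n * \<epsilon> n = e * (1/2) ^ Suc n" using c by (simp add: \<epsilon>_def)
     finally show ?thesis .
    qed
    then show ?thesis by (simp add: cap_compact_empty[OF p(1)] c_def del: power_Suc)
   qed
   also have "\<dots> = ennreal (\<Sum>n<m. e * (1/2) ^ Suc n)" using e by (intro sum_ennreal) auto
   also have "\<dots> \<le> ennreal e"
   proof (rule ennreal_leI)
    have "(\<Sum>n<m. (1/2::real) ^ Suc n) = 1 - (1/2) ^ m" by (induction m) (auto simp: field_simps)
    then have "(\<Sum>n<m. (1/2::real) ^ Suc n) \<le> 1" by simp
    then have "e * (\<Sum>n<m. (1/2::real) ^ Suc n) \<le> e * 1" using e by (intro mult_left_mono) auto
    then show "(\<Sum>n<m. e * (1/2) ^ Suc n) \<le> e" by (simp add: sum_distrib_left)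
   qed
   finally show ?thesis .
  qed
  then show ?thesis unfolding cap_def using EU U(1)
   by (intro INF_lower2[of "\<Union>n. U n"] SUP_least) auto
 qed
 have "cap p E \<le> 0" by (rule ennreal_le_epsilon) (use le in simp)
 then show ?thesis by simp
qed

text \<open>Lets the exceptional set of a quasicontinuous function absorb a neighbourhood of
  \<open>F\<close>. The union has capacity at most \<open>2 powr r\<close> times twice the assumed
  bound, that is \<open>e / 2\<close>, which leaves room for the strict inequality.\<close>

lemma cap_open_Un_less:
 assumes r: "0 < r" and U: "open U" and e: "0 < e"
  and lt: "cap r U < ennreal (e / (4 * 2 powr r))" "cap r F < ennreal (e / (4 * 2 powr r))"
 shows "\<exists>V. open V \<and> F \<subseteq> V \<and> cap r (U \<union> V) < ennreal e"
proof -
 obtain V where V: "open V" "F \<subseteq> V" "\<And>K. compact K \<Longrightarrow> K \<subseteq> V \<Longrightarrow> cap_compact r K < ennreal (e / (4 * 2 powr r))"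
  using cap_less[OF lt(2)] by blast
 have "cap r (U \<union> V) \<le> ennreal (e / 2)"
  unfolding cap_def
 proof (rule INF_lower2[of "U \<union> V"])
  show "U \<union> V \<in> {W. open W \<and> U \<union> V \<subseteq> W}" using U V by auto
  show "(SUP K \<in> {K. compact K \<and> K \<subseteq> U \<union> V}. cap_compact r K) \<le> ennreal (e / 2)"
  proof (rule SUP_least)
   fix K assume "K \<in> {K. compact K \<and> K \<subseteq> U \<union> V}"
   then obtain K1 K2 where K: "compact K1" "compact K2" "K1 \<subseteq> U" "K2 \<subseteq> V" "K = K1 \<union> K2"
    using compact_split[of K U V] U V(1) by auto
   have "cap_compact r K \<le> ennreal (2 powr r) * (cap_compact r K1 + cap_compact r K2)"
    unfolding K(5) by (rule cap_compact_Un[OF r])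
   also have "\<dots> \<le> ennreal (2 powr r) * (ennreal (e / (4 * 2 powr r)) + ennreal (e / (4 * 2 powr r)))"
    using lt(1) cap_compact_le_cap[OF K(1,3), of r] V(3)[OF K(2,4)] by (intro mult_left_mono add_mono) auto
   also have "\<dots> = ennreal (e / 2)" using e
    by (simp add: ennreal_mult'[symmetric] ennreal_plus[symmetric] del: ennreal_plus)
   finally show "cap_compact r K \<le> ennreal (e / 2)" .
  qed
 qed
 also have "\<dots> < ennreal e" using e by (simp add: ennreal_less_iff)
 finally show ?thesis using V by blast
qed

section \<open>Sets of zero capacity: Lebesgue measure and cutoffs\<close>

lemma relatively_closed_compact:
 assumes "closedin (top_of_set \<Omega>) F" "compact K" "K \<subseteq> \<Omega>"
 shows "compact (F \<inter> K)"
proof -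
 obtain T where "closed T" "F = \<Omega> \<inter> T" using assms(1) by (auto simp: closedin_closed)
 then have "F \<inter> K = T \<inter> K" using assms(3) by auto
 then show ?thesis using closed_Int_compact[OF \<open>closed T\<close> assms(2)] by simp
qed

text \<open>The capacity of \<open>F\<close> is defined through open supersets, so even a compact
  neighbourhood of \<open>C\<close> has small capacity; a test function for that neighbourhood
  equals 1 on an open set \<open>W\<close> around \<open>C\<close>, not merely on
  \<open>C\<close>.\<close>

lemma cap_zero_test_function:
 assumes "cap r F = 0" "compact C" "C \<subseteq> F" "0 < e"
 obtains \<psi> W where "test_fun UNIV \<psi>" "\<And>x. 0 \<le> \<psi> x" "\<And>x. \<psi> x \<le> 1" "open W" "C \<subseteq> W" "\<And>x. x \<in> W \<Longrightarrow> \<psi> x = 1"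
  "energy r \<psi> < ennreal e"
proof -
 obtain U where U: "open U" "F \<subseteq> U" "\<And>K. compact K \<Longrightarrow> K \<subseteq> U \<Longrightarrow> cap_compact r K < ennreal e"
  using cap_less[of r F "ennreal e"] assms(1,4) by auto
 obtain \<delta> K where K: "\<delta> > 0" "compact K" "K \<subseteq> U" "\<And>x y. x \<in> C \<Longrightarrow> norm y \<le> \<delta> \<Longrightarrow> x + y \<in> K"
  using compact_neighbourhood[OF assms(2) U(1)] assms(3) U(2) by blast
 obtain \<psi> where \<psi>: "admissible K \<psi>" "energy r \<psi> < ennreal e" using cap_compact_less[OF U(3)[OF K(2,3)]] .
 note a = admissibleD[OF \<psi>(1)]
 show ?thesis
 proof (rule that[of \<psi> "\<Union>x\<in>C. ball x \<delta>"])
  show "\<psi> y = 1" if "y \<in> (\<Union>x\<in>C. ball x \<delta>)" for y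
  proof -
   obtain x where x: "x \<in> C" "y \<in> ball x \<delta>" using \<open>y \<in> _\<close> by blast
   then have "x + (y - x) \<in> K" by (intro K(4)) (auto simp: dist_norm norm_minus_commute)
   then show ?thesis using a(4) by simp
  qed
 qed (use a \<psi> K(1) in auto)
qed

text \<open>A test function equal to 1 on a compact set has energy at least the volume of that set,
  and a relatively closed subset of an open set is a countable union of compact sets.\<close>

theorem cap_zero_null:
 assumes r: "0 < r" and cap: "cap r F = 0" and "open \<Omega>" and F: "closedin (top_of_set \<Omega>) F"
 shows "F \<in> null_sets lborel"
proof -
 have comp: "C \<in> null_sets lborel" if C: "compact C" "C \<subseteq> F" for C
 proof -
  have le: "emeasure lborel C \<le> 0 + ennreal e" if e: "e > 0" for e
  proof -
   obtain \<psi> W where \<psi>: "test_fun UNIV \<psi>" "\<And>x. 0 \<le> \<psi> x" "C \<subseteq> W" "\<And>x. x \<in> W \<Longrightarrow> \<psi> x = 1" "energy r \<psi> < ennreal e"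
    using cap_zero_test_function[OF cap C e] by metis
   have "emeasure lborel C = (Bor+ x. indicator C x)" using borel_compact[OF C(1)] by simp
   also have "\<dots> \<le> energy r \<psi>" unfolding energy_def
   proof (rule nn_integral_mono)
    fix x show "indicator C x \<le> ennreal (\<bar>\<psi> x\<bar> powr r + norm (grad \<psi> x) powr r)"
    proof (cases "x \<in> C")
     case True
     then have "\<psi> x = 1" using \<psi>(3,4) by auto
     then have "1 \<le> \<bar>\<psi> x\<bar> powr r + norm (grad \<psi> x) powr r" by simp
     then have "ennreal 1 \<le> ennreal (\<bar>\<psi> x\<bar> powr r + norm (grad \<psi> x) powr r)" by (rule ennreal_leI)
     then show ?thesis using True by (simp del: ennreal_plus)
    qed simp
   qed
   also have "\<dots> \<le> ennreal e" using \<psi>(5) by simp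
   finally show ?thesis by simp
  qed
  have "emeasure lborel C \<le> 0" by (rule ennreal_le_epsilon) (rule le)
  then show ?thesis using borel_compact[OF C(1)] by auto
 qed
 obtain K :: "nat \<Rightarrow> 'a set" where K: "\<forall>n. compact (K n)" "\<Omega> = (\<Union>n. K n)"
  using open_exhaustion[OF \<open>open \<Omega>\<close>] by blast
 have "F \<subseteq> \<Omega>" using F closedin_imp_subset by blast
 then have "F = (\<Union>n. F \<inter> K n)" using K(2) by blast
 moreover have "(\<Union>n. F \<inter> K n) \<in> null_sets lborel"
  using K relatively_closed_compact[OF F] by (intro null_sets_UN comp) auto
 ultimately show ?thesis by simp
qed

text \<open>\<open>F\<close> is closed only relative to \<open>\<Omega>\<close>, so the construction
  is made around the compact set \<open>F \<inter> S\<close>. Each function is a product: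
  \<open>\<rho> n\<close> gives the convergence to 0 off \<open>F\<close>, and a function of small
  energy, chosen after \<open>\<rho> n\<close>, gives the decay of the gradients.\<close>

theorem cap_zero_cutoffs:
 fixes F S :: "'a::euclidean_space set"
 assumes r: "0 < r" and cap: "cap r F = 0" and \<Omega>: "open \<Omega>" and F: "closedin (top_of_set \<Omega>) F"
  and S: "compact S" "S \<subseteq> \<Omega>"
 obtains \<eta> :: "nat \<Rightarrow> 'a \<Rightarrow> real" where "\<And>n. test_fun UNIV (\<eta> n)" "\<And>n x. 0 \<le> \<eta> n x" "\<And>n x. \<eta> n x \<le> 1"
  "\<And>n. \<exists>W. open W \<and> F \<inter> S \<subseteq> W \<and> (\<forall>x\<in>W. \<eta> n x = 1)" "\<And>x. x \<notin> F \<Longrightarrow> \<forall>\<^sub>F n in sequentially. \<eta> n x = 0"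
  "\<And>n. (Bor+ x. ennreal (norm (grad (\<eta> n) x) powr r)) \<le> ennreal (1 / real (Suc n))"
proof -
 let ?C = "F \<inter> S"
 have C: "compact ?C" using relatively_closed_compact[OF F S] .
 have C\<Omega>: "?C \<subseteq> \<Omega>" using S(2) by blast
 obtain \<rho> :: "nat \<Rightarrow> 'a \<Rightarrow> real" and K where "compact K" "K \<subseteq> \<Omega>" and \<rho>:
   "\<And>n. test_fun \<Omega> (\<rho> n)" "\<And>n x. 0 \<le> \<rho> n x" "\<And>n x. \<rho> n x \<le> 1"
   and "\<And>n. supp (\<rho> n) \<subseteq> K" and \<rho>': "\<And>n. \<exists>W. open W \<and> ?C \<subseteq> W \<and> W \<subseteq> \<Omega> \<and> (\<forall>x\<in>W. \<rho> n x = 1)"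
   "\<And>x. x \<notin> ?C \<Longrightarrow> \<forall>\<^sub>F n in sequentially. \<rho> n x = 0"
  using cutoff_sequence[OF C \<Omega> C\<Omega>] by metis
 note \<rho> = \<rho> \<rho>'
 have ex: "\<exists>\<eta>. test_fun UNIV \<eta> \<and> (\<forall>x. 0 \<le> \<eta> x) \<and> (\<forall>x. \<eta> x \<le> 1) \<and> (\<exists>W. open W \<and> ?C \<subseteq> W \<and> (\<forall>x\<in>W. \<eta> x = 1))
   \<and> (\<forall>x. \<rho> n x = 0 \<longrightarrow> \<eta> x = 0) \<and> (Bor+ x. ennreal (norm (grad \<eta> x) powr r)) \<le> ennreal (1 / real (Suc n))" for n
 proof -
  obtain B where B: "B > 0" "\<And>x. \<bar>\<rho> n x\<bar> \<le> B" "\<And>x. norm (grad (\<rho> n) x) \<le> B" using test_fun_bounds[OF \<rho>(1)] by blast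
  \<comment> \<open>\<open>A\<close> is the factor by which multiplication with
    \<open>\<rho> n\<close> may enlarge the energy. It depends on \<open>n\<close>, so the energy of
    \<open>\<psi>\<close> is required to be below \<open>1 / (A * Suc n)\<close>.\<close>
  define A where "A = 2 powr r * (B powr r + 1)"
  have A: "A > 0" unfolding A_def using B by (intro mult_pos_pos add_nonneg_pos) auto
  obtain \<psi> W where \<psi>: "test_fun UNIV \<psi>" "\<And>x. 0 \<le> \<psi> x" "\<And>x. \<psi> x \<le> 1" "open W" "?C \<subseteq> W" "\<And>x. x \<in> W \<Longrightarrow> \<psi> x = 1"
   "energy r \<psi> < ennreal (1 / (A * real (Suc n)))"
   using cap_zero_test_function[OF cap C, of "1 / (A * real (Suc n))"] A by (metis inf_le1 of_nat_0_less_iff zero_less_Suc mult_pos_pos zero_less_divide_1_iff)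
  obtain W' where W': "open W'" "?C \<subseteq> W'" "\<And>x. x \<in> W' \<Longrightarrow> \<rho> n x = 1" using \<rho>'(1)[of n] by blast
  have s: "smooth (\<rho> n)" "smooth \<psi>" using \<rho>(1)[of n] \<psi>(1) by (auto dest: test_fun_smooth)
  note [measurable] = test_fun_borel[OF \<psi>(1)]
  have "(Bor+ x. ennreal (norm (grad (\<lambda>x. \<rho> n x * \<psi> x) x) powr r)) \<le> (Bor+ x. ennreal A * ennreal (\<bar>\<psi> x\<bar> powr r + norm (grad \<psi> x) powr r))"
  proof (rule nn_integral_mono)
   fix x
   let ?a = "\<bar>\<psi> x\<bar>" and ?b = "norm (grad \<psi> x)"
   have "ennreal (norm (grad (\<lambda>x. \<rho> n x * \<psi> x) x) powr r) \<le> ennreal (A * (?a powr r + ?b powr r))"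
    unfolding A_def by (intro ennreal_leI grad_mult_powr_bound s \<rho> B r)
   also have "\<dots> = ennreal A * ennreal (?a powr r + ?b powr r)" using A by (intro ennreal_mult) auto
   finally show "ennreal (norm (grad (\<lambda>x. \<rho> n x * \<psi> x) x) powr r) \<le> ennreal A * ennreal (?a powr r + ?b powr r)" .
  qed
  also have "\<dots> = ennreal A * energy r \<psi>" unfolding energy_def by (rule nn_integral_cmult) measurable
  also have "\<dots> \<le> ennreal A * ennreal (1 / (A * real (Suc n)))" using \<psi>(7) by (intro mult_left_mono) auto
  also have "\<dots> = ennreal (1 / real (Suc n))" using A by (subst ennreal_mult'[symmetric]) (auto simp del: of_nat_Suc)
  finally have en: "(Bor+ x. ennreal (norm (grad (\<lambda>x. \<rho> n x * \<psi> x) x) powr r)) \<le> ennreal (1 / real (Suc n))" .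
  have t: "test_fun UNIV (\<lambda>x. \<rho> n x * \<psi> x)" using test_fun_mono[OF \<rho>(1) subset_UNIV] s by (intro test_fun_mult)
  show ?thesis
   using t en \<rho>(2,3) \<psi> W'
   by (intro exI[of _ "\<lambda>x. \<rho> n x * \<psi> x"] conjI exI[of _ "W \<inter> W'"]) (auto intro!: mult_le_one open_Int)
 qed
 then obtain \<eta> where \<eta>: "\<And>n. test_fun UNIV (\<eta> n) \<and> (\<forall>x. 0 \<le> \<eta> n x) \<and> (\<forall>x. \<eta> n x \<le> 1) \<and> (\<exists>W. open W \<and> ?C \<subseteq> W \<and> (\<forall>x\<in>W. \<eta> n x = 1))
   \<and> (\<forall>x. \<rho> n x = 0 \<longrightarrow> \<eta> n x = 0) \<and> (Bor+ x. ennreal (norm (grad (\<eta> n) x) powr r)) \<le> ennreal (1 / real (Suc n))"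
  by metis
 show ?thesis
 proof (rule that[of \<eta>])
  show "\<forall>\<^sub>F n in sequentially. \<eta> n x = 0" if "x \<notin> F" for x
   using \<rho>'(2)[of x] that \<eta> by (auto elim!: eventually_mono)
 qed (use \<eta> in auto)
qed


section \<open>Radon measures\<close>

lemma pos_radon_space: "pos_radon G M \<Longrightarrow> space M = G"
 by (auto simp: pos_radon_def space_restrict_space dest: sets_eq_imp_space_eq)

lemma pos_radon_sets:
 assumes "open G" "pos_radon G M"
 shows "B \<in> sets M \<longleftrightarrow> B \<in> sets borel \<and> B \<subseteq> G"
 using assms by (auto simp: pos_radon_def sets_restrict_space_iff)

lemma pos_radon_compact: "pos_radon G M \<Longrightarrow> compact K \<Longrightarrow> K \<subseteq> G \<Longrightarrow> emeasure M K < \<infinity>"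
 by (auto simp: pos_radon_def)

text \<open>Inner regularity by compact sets, applied to the finite restrictions of \<open>M\<close>
  to the members of an exhaustion of \<open>G\<close>.\<close>

theorem pos_radon_null:
 assumes G: "open G" and M: "pos_radon G M" and B: "B \<in> sets borel" "B \<subseteq> G"
  and null: "\<And>K. compact K \<Longrightarrow> K \<subseteq> B \<Longrightarrow> emeasure M K = 0"
 shows "emeasure M B = 0"
proof -
 note sets = pos_radon_sets[OF G M]
 obtain K :: "nat \<Rightarrow> 'a set" where K: "\<forall>n. compact (K n)" "G = (\<Union>n. K n)" 
  using open_exhaustion[OF G] by blast
 have KG: "K n \<subseteq> G" for n using K(2) by blast
 have Ks: "K n \<in> sets M" for n using K(1) KG sets borel_compact by blast
 have "emeasure M (B \<inter> K n) = 0" for n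
 proof -
  \<comment> \<open>\<open>inner_regular\<close> concerns finite measures on \<open>borel\<close>;
    the restriction of \<open>M\<close> to \<open>K n\<close> is therefore pushed forward from the
    trace sigma-algebra to \<open>borel\<close>.\<close>
  define \<nu> where "\<nu> = distr (restrict_space M (K n)) borel (\<lambda>x. x)"
  have m: "(\<lambda>x. x) \<in> measurable (restrict_space M (K n)) borel"
  proof (rule measurableI)
   fix A :: "'a set" assume "A \<in> sets borel"
   then have "A \<inter> K n \<in> sets M" using sets KG borel_compact K(1) by blast
   then show "(\<lambda>x. x) -` A \<inter> space (restrict_space M (K n)) \<in> sets (restrict_space M (K n))"
    using Ks pos_radon_space[OF M] KG by (auto simp: space_restrict_space sets_restrict_space_iff Int_absorb1 Int_commute)
  qed simp
  have e: "emeasure \<nu> A = emeasure M (A \<inter> K n)" if "A \<in> sets borel" for A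
  proof -
   have "emeasure \<nu> A = emeasure (restrict_space M (K n)) (A \<inter> K n)"
    unfolding \<nu>_def using that pos_radon_space[OF M] KG
    by (subst emeasure_distr[OF m]) (auto simp: space_restrict_space Int_absorb1 Int_commute)
   also have "\<dots> = emeasure M (A \<inter> K n)" using Ks by (intro emeasure_restrict_space) auto
   finally show ?thesis .
  qed
  have "emeasure \<nu> B = (SUP C \<in> {C. C \<subseteq> B \<and> compact C}. emeasure \<nu> C)"
  proof (rule inner_regular)
   show "sets \<nu> = sets borel" by (simp add: \<nu>_def)
   have "space \<nu> = UNIV" by (simp add: \<nu>_def)
   then show "emeasure \<nu> (space \<nu>) \<noteq> \<infinity>" 
    using e[of UNIV] pos_radon_compact[OF M K(1)[rule_format] KG, of n] by simp
  qed (rule B)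
  also have "\<dots> \<le> 0"
  proof (rule SUP_least)
   fix C assume "C \<in> {C. C \<subseteq> B \<and> compact C}"
   then have C: "C \<subseteq> B" "compact C" by auto
   have "emeasure M (C \<inter> K n) = 0" using C K(1) by (intro null compact_Int) auto
   then show "emeasure \<nu> C \<le> 0" using e[OF borel_compact[OF C(2)]] by simp
  qed
  finally show ?thesis using e[OF B(1)] by simp
 qed
 then have "(\<Union>n. B \<inter> K n) \<in> null_sets M"
  using sets B KG borel_compact[OF K(1)[rule_format]] by (intro null_sets_UN) (auto simp: null_sets_def)
 moreover have "(\<Union>n. B \<inter> K n) = B" using B(2) K(2) by blast
 ultimately show ?thesis by auto
qed

text \<open>A vanishing signed value on compact sets only says that the positive and the negative
  part agree there. Mutual singularity separates them: on \<open>A\<close> the negative part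
  vanishes, hence so does the positive one, and off \<open>A\<close> the roles are
  exchanged.\<close>

theorem radon_cap_null:
 assumes G: "open G" and \<mu>: "radon_cap r G \<mu>" and B: "B \<in> sets borel" "B \<subseteq> G"
  and cap: "\<And>K. compact K \<Longrightarrow> K \<subseteq> B \<Longrightarrow> cap_compact r K = 0"
 shows "emeasure (fst \<mu>) B = 0" "emeasure (snd \<mu>) B = 0"
proof -
 have M: "pos_radon G (fst \<mu>)" and N: "pos_radon G (snd \<mu>)" and ms: "mutually_singular (fst \<mu>) (snd \<mu>)"
  and z: "\<And>K. compact K \<Longrightarrow> K \<subseteq> G \<Longrightarrow> cap_compact r K = 0 \<Longrightarrow> sval \<mu> K = 0"
  using \<mu> by (auto simp: radon_cap_def signed_radon_def)
 note sM = pos_radon_sets[OF G M] and sN = pos_radon_sets[OF G N]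
 obtain A where A: "A \<in> sets (fst \<mu>)" "emeasure (fst \<mu>) (G - A) = 0" "emeasure (snd \<mu>) A = 0"
  using ms pos_radon_space[OF M] by (auto simp: mutually_singular_def)
 have Ab: "A \<in> sets borel" "A \<subseteq> G" using A(1) sM by auto
 have Gb: "G \<in> sets borel" using G by simp
 have eq: "measure (fst \<mu>) K = measure (snd \<mu>) K" if "compact K" "K \<subseteq> B" for K
  using z[OF that(1) _ cap[OF that]] that(2) B(2) by (auto simp: sval_def)
 have "emeasure (fst \<mu>) (B \<inter> A) = 0"
 proof (rule pos_radon_null[OF G M])
  fix K assume K: "compact K" "K \<subseteq> B \<inter> A"
  have "emeasure (snd \<mu>) K \<le> emeasure (snd \<mu>) A" using K Ab sN by (intro emeasure_mono) auto
  then have "measure (fst \<mu>) K = 0" using A(3) eq[of K] K by (simp add: measure_def)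
  then show "emeasure (fst \<mu>) K = 0"
   using pos_radon_compact[OF M K(1) subset_trans[OF _ B(2)]] K(2) by (auto simp: measure_def enn2real_eq_0_iff)
 qed (use B Ab in auto)
 moreover have "emeasure (fst \<mu>) (B - A) \<le> emeasure (fst \<mu>) (G - A)"
  using B Ab Gb sM by (intro emeasure_mono) auto
 moreover have "emeasure (fst \<mu>) B \<le> emeasure (fst \<mu>) (B \<inter> A) + emeasure (fst \<mu>) (B - A)"
  using B Ab sM emeasure_subadditive[of "B \<inter> A" "fst \<mu>" "B - A"] by (auto simp: Int_Diff_Un)
 ultimately show "emeasure (fst \<mu>) B = 0" using A(2) by simp
 have "emeasure (snd \<mu>) (B - A) = 0"
 proof (rule pos_radon_null[OF G N])
  fix K assume K: "compact K" "K \<subseteq> B - A"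
  have "emeasure (fst \<mu>) K \<le> emeasure (fst \<mu>) (G - A)" using K Ab Gb B sM by (intro emeasure_mono) auto
  then have "measure (snd \<mu>) K = 0" using A(2) eq[of K] K by (auto simp: measure_def)
  then show "emeasure (snd \<mu>) K = 0"
   using pos_radon_compact[OF N K(1) subset_trans[OF subset_trans[OF K(2) Diff_subset] B(2)]]
   by (auto simp: measure_def enn2real_eq_0_iff)
 qed (use B Ab in auto)
 moreover have "emeasure (snd \<mu>) (B \<inter> A) \<le> emeasure (snd \<mu>) A"
  using B Ab sN by (intro emeasure_mono) auto
 moreover have "emeasure (snd \<mu>) B \<le> emeasure (snd \<mu>) (B \<inter> A) + emeasure (snd \<mu>) (B - A)"
  using B Ab sN emeasure_subadditive[of "B \<inter> A" "snd \<mu>" "B - A"] by (auto simp: Int_Diff_Un)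
 ultimately show "emeasure (snd \<mu>) B = 0" using A(3) by simp
qed

section \<open>Extension of measures by zero\<close>

definition zero_ext :: "'a::euclidean_space set \<Rightarrow> 'a measure \<Rightarrow> 'a measure" where
 "zero_ext \<Omega> M = distr M (restrict_space borel \<Omega>) (\<lambda>x. x)"

lemma zero_ext_measurable:
 assumes "open G" "open \<Omega>" "G \<subseteq> \<Omega>" "pos_radon G M"
 shows "(\<lambda>x. x) \<in> measurable M (restrict_space borel \<Omega>)"
proof (rule measurableI)
 fix A assume "A \<in> sets (restrict_space borel \<Omega>)"
 then show "(\<lambda>x. x) -` A \<inter> space M \<in> sets M"
  using assms(1,2) pos_radon_space[OF assms(4)] pos_radon_sets[OF assms(1,4)] by (auto simp: sets_restrict_space_iff)
qed (use assms pos_radon_space[OF assms(4)] in auto)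

lemma sets_zero_ext[simp]: "sets (zero_ext \<Omega> M) = sets (restrict_space borel \<Omega>)"
 and space_zero_ext[simp]: "space (zero_ext \<Omega> M) = \<Omega>"
 by (auto simp: zero_ext_def space_restrict_space)

lemma emeasure_zero_ext:
 assumes "open G" "open \<Omega>" "G \<subseteq> \<Omega>" "pos_radon G M" "X \<in> sets borel" "X \<subseteq> \<Omega>"
 shows "emeasure (zero_ext \<Omega> M) X = emeasure M (X \<inter> G)" "measure (zero_ext \<Omega> M) X = measure M (X \<inter> G)"
proof -
 show "emeasure (zero_ext \<Omega> M) X = emeasure M (X \<inter> G)"
  unfolding zero_ext_def using assms pos_radon_space[OF assms(4)]
  by (subst emeasure_distr[OF zero_ext_measurable[OF assms(1-4)]]) (auto simp: sets_restrict_space_iff)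
 then show "measure (zero_ext \<Omega> M) X = measure M (X \<inter> G)" by (simp add: measure_def)
qed

text \<open>Mass of \<open>M\<close> could accumulate at the removed set; domination by a measure
  that is finite on compact subsets of \<open>\<Omega>\<close> excludes this. Domination on compact
  subsets of \<open>G\<close> is enough, since they exhaust \<open>G\<close> from inside.\<close>

lemma pos_radon_zero_ext:
 assumes G: "open G" "open \<Omega>" "G \<subseteq> \<Omega>" and M: "pos_radon G M" and N: "pos_radon \<Omega> N"
  and le: "\<And>L. compact L \<Longrightarrow> L \<subseteq> G \<Longrightarrow> emeasure M L \<le> emeasure N L"
 shows "pos_radon \<Omega> (zero_ext \<Omega> M)"
 unfolding pos_radon_def
proof (intro conjI allI impI, simp)
 fix K assume "compact K \<and> K \<subseteq> \<Omega>"
 then have K: "compact K" "K \<subseteq> \<Omega>" by auto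
 note sM = pos_radon_sets[OF G(1) M]
 obtain L :: "nat \<Rightarrow> 'a set" where L: "\<forall>n. compact (L n)" "G = (\<Union>n. L n)" "\<forall>m n. m \<le> n \<longrightarrow> L m \<subseteq> L n"
  using open_exhaustion[OF G(1)] by blast
 have "emeasure (zero_ext \<Omega> M) K = emeasure M (K \<inter> G)"
  using emeasure_zero_ext(1)[OF G M] K borel_compact by auto
 also have "K \<inter> G = (\<Union>n. K \<inter> L n)" using L(2) by blast
 also have "emeasure M (\<Union>n. K \<inter> L n) = (SUP n. emeasure M (K \<inter> L n))"
 proof (rule SUP_emeasure_incseq[symmetric])
  show "range (\<lambda>n. K \<inter> L n) \<subseteq> sets M" using sM L K borel_compact compact_Int by blast
  show "incseq (\<lambda>n. K \<inter> L n)" using L(3) by (auto simp: incseq_def)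
 qed
 also have "\<dots> \<le> emeasure N K"
 proof (rule SUP_least)
  fix n
  have "emeasure M (K \<inter> L n) \<le> emeasure N (K \<inter> L n)" using L K by (intro le compact_Int) auto
  also have "\<dots> \<le> emeasure N K"
   using pos_radon_sets[OF G(2) N] K borel_compact by (intro emeasure_mono) auto
  finally show "emeasure M (K \<inter> L n) \<le> emeasure N K" .
 qed
 also have "\<dots> < \<infinity>" using pos_radon_compact[OF N K] .
 finally show "emeasure (zero_ext \<Omega> M) K < \<infinity>" .
qed

lemma integral_zero_ext:
 fixes f :: "'a::euclidean_space \<Rightarrow> real"
 assumes "open G" "open \<Omega>" "G \<subseteq> \<Omega>" "pos_radon G M" "f \<in> borel_measurable (restrict_space borel \<Omega>)"
 shows "(\<integral>x. f x \<partial>zero_ext \<Omega> M) = (\<integral>x. f x \<partial>M)"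
 unfolding zero_ext_def by (rule integral_distr[OF zero_ext_measurable[OF assms(1-4)] assms(5)])

text \<open>The parts of the decomposition of \<open>\<mu>\<close> on the smaller set are bounded by \<open>\<mu>\<^sup>+\<close> or \<open>\<mu>\<^sup>-\<close>, as they
 live on disjoint sets; therefore their extensions by zero are still locally finite.\<close>

theorem cap_decomposition_extend:
 assumes \<Omega>: "open \<Omega>" and G: "open G" "G = \<Omega> - F" and Fb: "F \<subseteq> \<Omega>" "F \<in> sets borel"
  and \<mu>: "signed_radon \<Omega> \<mu>" and F0: "emeasure (fst \<mu>) F = 0" "emeasure (snd \<mu>) F = 0"
  and dec: "cap_decomposition p G (srestrict \<mu> G) \<mu>0 \<sigma>p \<sigma>m"
 shows "cap_decomposition p \<Omega> \<mu> (zero_ext \<Omega> (fst \<mu>0), zero_ext \<Omega> (snd \<mu>0)) (zero_ext \<Omega> \<sigma>p) (zero_ext \<Omega> \<sigma>m)"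
proof -
 have G\<Omega>: "G \<subseteq> \<Omega>" using G(2) by auto
 have Gb: "G \<in> sets borel" using G(1) by simp
 have \<mu>r: "pos_radon \<Omega> (fst \<mu>)" "pos_radon \<Omega> (snd \<mu>)" using \<mu> by (auto simp: signed_radon_def)
 have rc0: "radon_cap p G \<mu>0" and p: "pos_radon G \<sigma>p" and m: "pos_radon G \<sigma>m"
  and cp: "concentrated_on_null_cap p G \<sigma>p" and cm: "concentrated_on_null_cap p G \<sigma>m"
  and sing: "mutually_singular \<sigma>p \<sigma>m"
  and id: "\<And>B. B \<in> sets borel \<Longrightarrow> compact (closure B) \<Longrightarrow> closure B \<subseteq> G \<Longrightarrow>
    sval (srestrict \<mu> G) B = sval \<mu>0 B + measure \<sigma>p B - measure \<sigma>m B"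
  using dec unfolding cap_decomposition_def by blast+
 have f: "pos_radon G (fst \<mu>0)" and s: "pos_radon G (snd \<mu>0)" and ms0: "mutually_singular (fst \<mu>0) (snd \<mu>0)"
  using rc0 by (auto simp: radon_cap_def signed_radon_def)
 note sets = pos_radon_sets[OF G(1) p] pos_radon_sets[OF G(1) m] pos_radon_sets[OF G(1) f] pos_radon_sets[OF G(1) s]
  and sets\<mu> = pos_radon_sets[OF \<Omega> \<mu>r(1)] pos_radon_sets[OF \<Omega> \<mu>r(2)]
 \<comment> \<open>Four carriers are fixed: \<open>Ep\<close> and \<open>Em\<close> are sets of zero
   capacity carrying \<open>\<sigma>p\<close> and \<open>\<sigma>m\<close>, \<open>S\<close>
   separates these two measures, and \<open>A\<close> separates the two parts of
   \<open>\<mu>0\<close>.\<close>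
 obtain Ep where Ep: "Ep \<in> sets borel" "Ep \<subseteq> G" "cap p Ep = 0" "emeasure \<sigma>p (G - Ep) = 0"
  using cp by (auto simp: concentrated_on_null_cap_def)
 obtain Em where Em: "Em \<in> sets borel" "Em \<subseteq> G" "cap p Em = 0" "emeasure \<sigma>m (G - Em) = 0"
  using cm by (auto simp: concentrated_on_null_cap_def)
 obtain S where S: "S \<in> sets borel" "S \<subseteq> G" "emeasure \<sigma>p (G - S) = 0" "emeasure \<sigma>m S = 0"
  using sing sets(1) pos_radon_space[OF p] by (auto simp: mutually_singular_def)
 obtain A where A: "A \<in> sets borel" "A \<subseteq> G" "emeasure (fst \<mu>0) (G - A) = 0" "emeasure (snd \<mu>0) A = 0"
  using ms0 sets(3) pos_radon_space[OF f] by (auto simp: mutually_singular_def)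
 have sv: "sval (srestrict \<mu> G) B = sval \<mu> B" if "B \<in> sets borel" "B \<subseteq> G" for B
 proof -
  have "G \<inter> space (fst \<mu>) \<in> sets (fst \<mu>)" "G \<inter> space (snd \<mu>) \<in> sets (snd \<mu>)"
   using pos_radon_space[OF \<mu>r(1)] pos_radon_space[OF \<mu>r(2)] sets\<mu> Gb G\<Omega> by (auto simp: Int_absorb2)
  then show ?thesis using that by (simp add: sval_def srestrict_def measure_restrict_space)
 qed
 have id': "sval \<mu> B = sval \<mu>0 B + measure \<sigma>p B - measure \<sigma>m B" if "B \<in> sets borel" "B \<subseteq> L" "compact L" "L \<subseteq> G" for B L
 proof -
  have "closure B \<subseteq> L" using that by (intro closure_minimal compact_imp_closed)
  then show ?thesis using id[of B] sv[of B] that compact_Int_closed[OF that(3) closed_closure[of B]]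
   by (auto simp: Int_absorb1)
 qed
 have null: "emeasure (fst \<mu>0) B = 0 \<and> emeasure (snd \<mu>0) B = 0" if "B \<in> sets borel" "B \<subseteq> E" "E \<subseteq> G" "cap p E = 0" for B E
 proof -
  have "cap_compact p K = 0" if "compact K" "K \<subseteq> B" for K
   using cap_compact_le_cap[OF that(1), of E p] that(2) \<open>B \<subseteq> E\<close> \<open>cap p E = 0\<close> by auto
  then show ?thesis
   using radon_cap_null[OF G(1) rc0 that(1)] that(2,3) by auto
 qed
 have mono0: "measure M X = 0" if "emeasure M Y = 0" "X \<subseteq> Y" "Y \<in> sets M" for M :: "'a measure" and X Y
  using emeasure_mono[OF that(2,3)] that(1) by (simp add: measure_def)
 have fin: "measure M X \<le> measure M L" if "pos_radon \<Omega> M" "X \<in> sets borel" "X \<subseteq> L" "compact L" "L \<subseteq> G" for M X L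
  using that pos_radon_sets[OF \<Omega> that(1)] pos_radon_compact[OF that(1,4)] G\<Omega> borel_compact[OF that(4)]
  by (intro measure_mono_fmeasurable) (auto simp: fmeasurable_def)
 have Diff: "measure M (X - Y) = measure M X" if "pos_radon G M" "X \<in> sets borel" "X \<subseteq> G" "Y \<in> sets borel" "Y \<subseteq> G" "emeasure M Y = 0" for M X Y
  using that pos_radon_sets[OF G(1) that(1)] by (intro measure_Diff_null_set) (auto simp: null_sets_def)
 have em: "emeasure M L \<le> emeasure N L" if "pos_radon G M" "pos_radon \<Omega> N" "compact L" "L \<subseteq> G" "measure M L \<le> measure N L" for M N L
  using pos_radon_compact[OF that(1,3,4)] pos_radon_compact[OF that(2,3) subset_trans[OF that(4) G\<Omega>]] that(5)
  by (subst (1 2) emeasure_eq_ennreal_measure) (auto intro!: ennreal_leI)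
 have cut: "emeasure M (G - X \<inter> Y) = 0" if "pos_radon G M" "X \<in> sets borel" "Y \<in> sets borel" "emeasure M (G - X) = 0" "emeasure M (G - Y) = 0" for M X Y
 proof -
  have "G - X \<inter> Y = (G - X) \<union> (G - Y)" by auto
  moreover have "G - X \<in> sets M" "G - Y \<in> null_sets M" using that pos_radon_sets[OF G(1) that(1)] Gb by (auto simp: null_sets_def)
  ultimately show ?thesis using that(4) by (simp add: emeasure_Un_null_set)
 qed
 \<comment> \<open>To dominate \<open>M\<close> by \<open>N\<close> on a compact set it is enough to
   compare them on Borel subsets of a carrier \<open>C\<close> of \<open>M\<close>.\<close>
 have dom: "emeasure M L \<le> emeasure N L"
  if M: "pos_radon G M" and N: "pos_radon \<Omega> N" and L: "compact L" "L \<subseteq> G" and C: "C \<in> sets borel" "emeasure M (G - C) = 0"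
   and le: "\<And>B. B \<in> sets borel \<Longrightarrow> B \<subseteq> L \<Longrightarrow> B \<subseteq> C \<Longrightarrow> measure M B \<le> measure N B" for M N L C
 proof (rule em[OF M N L])
  define B where "B = L - (G - C)"
  have B: "B \<in> sets borel" "B \<subseteq> L" "B \<subseteq> C" using C(1) Gb L borel_compact[OF L(1)] by (auto simp: B_def intro!: sets.Diff)
  have "measure M L = measure M B" unfolding B_def using C Gb L borel_compact[OF L(1)] by (intro Diff[OF M, symmetric]) auto
  also have "\<dots> \<le> measure N B" by (rule le[OF B])
  also have "\<dots> \<le> measure N L" by (rule fin[OF N B(1,2) L])
  finally show "measure M L \<le> measure N L" .
 qed
 have G2: "G - (G - X) = X" if "X \<subseteq> G" for X using that by auto
 \<comment> \<open>On \<open>Ep \<inter> S\<close> both \<open>\<mu>0\<close> and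
   \<open>\<sigma>m\<close> vanish, so the decomposition reads \<open>\<sigma>p = \<mu>\<close>
   there, and \<open>\<mu>\<close> is at most its positive part. The next three estimates use the
   analogous carriers for the other measures.\<close>
 have bp: "emeasure \<sigma>p L \<le> emeasure (fst \<mu>) L" if L: "compact L" "L \<subseteq> G" for L
 proof (rule dom[OF p \<mu>r(1) L, of "Ep \<inter> S"])
  fix B assume B: "B \<in> sets borel" "B \<subseteq> L" "B \<subseteq> Ep \<inter> S"
  then have "measure \<sigma>p B = sval \<mu> B"
   using id'[OF B(1,2) L] null[OF B(1) _ Ep(2,3)] mono0[OF S(4), of B] S sets(2) by (simp add: sval_def measure_def)
  then show "measure \<sigma>p B \<le> measure (fst \<mu>) B" by (simp add: sval_def)
 qed (use Ep S cut[OF p] in auto)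
 have bm: "emeasure \<sigma>m L \<le> emeasure (snd \<mu>) L" if L: "compact L" "L \<subseteq> G" for L
 proof (rule dom[OF m \<mu>r(2) L, of "Em \<inter> (G - S)"])
  fix B assume B: "B \<in> sets borel" "B \<subseteq> L" "B \<subseteq> Em \<inter> (G - S)"
  then have "measure \<sigma>m B = - sval \<mu> B"
   using id'[OF B(1,2) L] null[OF B(1) _ Em(2,3)] mono0[OF S(3), of B] S sets(1) Gb by (simp add: sval_def measure_def)
  then show "measure \<sigma>m B \<le> measure (snd \<mu>) B" by (simp add: sval_def)
 qed (use Em S Gb cut[OF m, of Em "G - S"] G2[of S] in auto)
 have nullE: "emeasure (fst \<mu>0) Ep = 0" "emeasure (fst \<mu>0) Em = 0" "emeasure (snd \<mu>0) Ep = 0" "emeasure (snd \<mu>0) Em = 0"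
  using null[OF Ep(1) order_refl Ep(2,3)] null[OF Em(1) order_refl Em(2,3)] by auto
 have EE: "emeasure M (G - (G - Ep) \<inter> (G - Em)) = 0" if "pos_radon G M" "emeasure M Ep = 0" "emeasure M Em = 0" for M
  using cut[OF that(1), of "G - Ep" "G - Em"] that Ep Em Gb by (simp add: G2)
 have EEb: "(G - Ep) \<inter> (G - Em) \<in> sets borel" using Ep Em Gb by auto
 have bf: "emeasure (fst \<mu>0) L \<le> emeasure (fst \<mu>) L" if L: "compact L" "L \<subseteq> G" for L
 proof (rule dom[OF f \<mu>r(1) L, of "A \<inter> ((G - Ep) \<inter> (G - Em))"])
  fix B assume B: "B \<in> sets borel" "B \<subseteq> L" "B \<subseteq> A \<inter> ((G - Ep) \<inter> (G - Em))"
  then have "measure (fst \<mu>0) B = sval \<mu> B"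
   using id'[OF B(1,2) L] mono0[OF A(4), of B] mono0[OF Ep(4), of B] mono0[OF Em(4), of B] A Ep Em Gb sets by (simp add: sval_def)
  then show "measure (fst \<mu>0) B \<le> measure (fst \<mu>) B" by (simp add: sval_def)
 qed (use A EEb cut[OF f _ EEb _ EE[OF f nullE(1,2)]] in auto)
 have bs: "emeasure (snd \<mu>0) L \<le> emeasure (snd \<mu>) L" if L: "compact L" "L \<subseteq> G" for L
 proof (rule dom[OF s \<mu>r(2) L, of "(G - A) \<inter> ((G - Ep) \<inter> (G - Em))"])
  fix B assume B: "B \<in> sets borel" "B \<subseteq> L" "B \<subseteq> (G - A) \<inter> ((G - Ep) \<inter> (G - Em))"
  then have "measure (snd \<mu>0) B = - sval \<mu> B"
   using id'[OF B(1,2) L] mono0[OF A(3), of B] mono0[OF Ep(4), of B] mono0[OF Em(4), of B] A Ep Em Gb sets by (simp add: sval_def)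
  then show "measure (snd \<mu>0) B \<le> measure (snd \<mu>) B" by (simp add: sval_def)
 qed (use A Gb EEb cut[OF s _ EEb _ EE[OF s nullE(3,4)], of "G - A"] G2[of A] in auto)
 note ext = pos_radon_zero_ext[OF G(1) \<Omega> G\<Omega>]
 have zp: "pos_radon \<Omega> (zero_ext \<Omega> \<sigma>p)" by (rule ext[OF p \<mu>r(1) bp])
 have zm: "pos_radon \<Omega> (zero_ext \<Omega> \<sigma>m)" by (rule ext[OF m \<mu>r(2) bm])
 have zf: "pos_radon \<Omega> (zero_ext \<Omega> (fst \<mu>0))" by (rule ext[OF f \<mu>r(1) bf])
 have zs: "pos_radon \<Omega> (zero_ext \<Omega> (snd \<mu>0))" by (rule ext[OF s \<mu>r(2) bs])
 note ee = emeasure_zero_ext[OF G(1) \<Omega> G\<Omega>]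
 have rel: "(\<Omega> - X) \<inter> G = G - X" "X \<inter> G = X" if "X \<subseteq> G" for X using that G\<Omega> by auto
 have con: "concentrated_on_null_cap p \<Omega> (zero_ext \<Omega> \<sigma>)" if c: "concentrated_on_null_cap p G \<sigma>" and r: "pos_radon G \<sigma>" for \<sigma>
 proof -
  obtain E where E: "E \<in> sets borel" "E \<subseteq> G" "cap p E = 0" "emeasure \<sigma> (G - E) = 0"
   using c by (auto simp: concentrated_on_null_cap_def)
  have "emeasure (zero_ext \<Omega> \<sigma>) (\<Omega> - E) = 0"
   using ee(1)[OF r, of "\<Omega> - E"] E \<Omega> by (simp add: rel)
  then show ?thesis unfolding concentrated_on_null_cap_def using E G\<Omega> by (intro bexI[of _ E]) auto
 qed
 have sng: "mutually_singular (zero_ext \<Omega> M) (zero_ext \<Omega> N)" if m: "mutually_singular M N" and r: "pos_radon G M" "pos_radon G N" for M N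
 proof -
  obtain X where X: "X \<in> sets borel" "X \<subseteq> G" "emeasure M (G - X) = 0" "emeasure N X = 0"
   using m pos_radon_sets[OF G(1) r(1)] pos_radon_space[OF r(1)] by (auto simp: mutually_singular_def)
  have "emeasure (zero_ext \<Omega> M) (\<Omega> - X) = 0" "emeasure (zero_ext \<Omega> N) X = 0"
   using ee(1)[OF r(1), of "\<Omega> - X"] ee(1)[OF r(2), of X] X \<Omega> G\<Omega> by (auto simp: rel)
  then show ?thesis unfolding mutually_singular_def using X G\<Omega> \<Omega>
   by (intro bexI[of _ X]) (auto simp: sets_restrict_space_iff)
 qed
 have rc: "radon_cap p \<Omega> (zero_ext \<Omega> (fst \<mu>0), zero_ext \<Omega> (snd \<mu>0))"
  unfolding radon_cap_def signed_radon_def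
 proof (intro conjI allI impI)
  fix K assume K: "compact K \<and> K \<subseteq> \<Omega> \<and> cap_compact p K = 0"
  have Kb: "K \<inter> G \<in> sets borel" using K borel_compact Gb by auto
  have "cap_compact p C = 0" if "compact C" "C \<subseteq> K \<inter> G" for C
   using cap_compact_mono[of C K p] that K by auto
  then have "emeasure (fst \<mu>0) (K \<inter> G) = 0" "emeasure (snd \<mu>0) (K \<inter> G) = 0"
   using radon_cap_null[OF G(1) rc0 Kb] by auto
  then show "sval (zero_ext \<Omega> (fst \<mu>0), zero_ext \<Omega> (snd \<mu>0)) K = 0"
   using K borel_compact[of K] ee(2)[OF f, of K] ee(2)[OF s, of K] by (simp add: sval_def measure_def)
 qed (simp_all add: zf zs sng[OF ms0 f s])
 \<comment> \<open>The closure of \<open>B\<close> may meet \<open>F\<close>, where the given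
   identity says nothing. It is used on \<open>B \<inter> L n\<close> with \<open>L n\<close>
   exhausting \<open>G\<close>; the limit is legitimate because all measures involved are finite on
   \<open>B \<inter> G\<close>, and \<open>\<mu>\<close> does not charge \<open>F\<close>.\<close>
 have ident: "sval \<mu> B = sval (zero_ext \<Omega> (fst \<mu>0), zero_ext \<Omega> (snd \<mu>0)) B + measure (zero_ext \<Omega> \<sigma>p) B - measure (zero_ext \<Omega> \<sigma>m) B"
  if B: "B \<in> sets borel" "compact (closure B)" "closure B \<subseteq> \<Omega>" for B
 proof -
  have B\<Omega>: "B \<subseteq> \<Omega>" using B(3) closure_subset by blast
  obtain L :: "nat \<Rightarrow> 'a set" where L: "\<forall>n. compact (L n)" "G = (\<Union>n. L n)" "\<forall>m n. m \<le> n \<longrightarrow> L m \<subseteq> L n"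
   using open_exhaustion[OF G(1)] by blast
  have LG: "L n \<subseteq> G" for n using L(2) by blast
  have Bn: "B \<inter> L n \<in> sets borel" for n using B(1) L(1) borel_compact by auto
  have un: "(\<Union>n. B \<inter> L n) = B \<inter> G" using L(2) by blast
  have inc: "incseq (\<lambda>n. B \<inter> L n)" using L(3) by (auto simp: incseq_def)
  have lim: "(\<lambda>n. measure M (B \<inter> L n)) \<longlonglongrightarrow> measure M (B \<inter> G)"
   if "\<And>X. X \<in> sets borel \<Longrightarrow> X \<subseteq> G \<Longrightarrow> X \<in> sets M" "emeasure M (B \<inter> G) < \<infinity>" for M
  proof -
   have "range (\<lambda>n. B \<inter> L n) \<subseteq> sets M" using that(1)[OF Bn] LG by blast
   moreover have "emeasure M (\<Union>n. B \<inter> L n) \<noteq> \<infinity>" using that(2) unfolding un by simp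
   ultimately have "(\<lambda>n. measure M (B \<inter> L n)) \<longlonglongrightarrow> measure M (\<Union>n. B \<inter> L n)"
    using inc by (intro Lim_measure_incseq)
   then show ?thesis unfolding un .
  qed
  have finz: "emeasure M (B \<inter> G) < \<infinity>" if "pos_radon G M" "pos_radon \<Omega> (zero_ext \<Omega> M)" for M
  proof -
   have "emeasure M (B \<inter> G) = emeasure (zero_ext \<Omega> M) B" using ee(1)[OF that(1) B(1) B\<Omega>] by simp
   also have "\<dots> \<le> emeasure (zero_ext \<Omega> M) (closure B)"
    using B \<Omega> by (intro emeasure_mono closure_subset) (auto simp: sets_restrict_space_iff)
   also have "\<dots> < \<infinity>" using pos_radon_compact[OF that(2) B(2,3)] .
   finally show ?thesis .
  qed
  have fin\<mu>: "emeasure M (B \<inter> G) < \<infinity>" if "pos_radon \<Omega> M" for M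
  proof -
   have "emeasure M (B \<inter> G) \<le> emeasure M (closure B)"
    using pos_radon_sets[OF \<Omega> that] B closure_subset[of B] by (intro emeasure_mono) auto
   also have "\<dots> < \<infinity>" using pos_radon_compact[OF that B(2,3)] .
   finally show ?thesis .
  qed
  have l1: "(\<lambda>n. sval \<mu> (B \<inter> L n)) \<longlonglongrightarrow> measure (fst \<mu>) (B \<inter> G) - measure (snd \<mu>) (B \<inter> G)"
   unfolding sval_def
   by (rule tendsto_diff; rule lim[OF _ fin\<mu>]) (use sets\<mu> G\<Omega> \<mu>r in auto)
  have l2: "(\<lambda>n. sval \<mu>0 (B \<inter> L n) + measure \<sigma>p (B \<inter> L n) - measure \<sigma>m (B \<inter> L n)) \<longlonglongrightarrow>
   (measure (fst \<mu>0) (B \<inter> G) - measure (snd \<mu>0) (B \<inter> G)) + measure \<sigma>p (B \<inter> G) - measure \<sigma>m (B \<inter> G)"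
   unfolding sval_def
   by (rule tendsto_diff[OF tendsto_add[OF tendsto_diff[OF lim[OF _ finz[OF f zf]] lim[OF _ finz[OF s zs]]]
    lim[OF _ finz[OF p zp]]] lim[OF _ finz[OF m zm]]]) (use sets in simp_all)
  have "sval \<mu> (B \<inter> L n) = sval \<mu>0 (B \<inter> L n) + measure \<sigma>p (B \<inter> L n) - measure \<sigma>m (B \<inter> L n)" for n
   using id'[OF Bn, of n "L n"] L(1) LG by auto
  with l1 have "(\<lambda>n. sval \<mu>0 (B \<inter> L n) + measure \<sigma>p (B \<inter> L n) - measure \<sigma>m (B \<inter> L n)) \<longlonglongrightarrow> measure (fst \<mu>) (B \<inter> G) - measure (snd \<mu>) (B \<inter> G)"
   by simp
  from LIMSEQ_unique[OF this l2]
  have "measure (fst \<mu>) (B \<inter> G) - measure (snd \<mu>) (B \<inter> G) =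
   (measure (fst \<mu>0) (B \<inter> G) - measure (snd \<mu>0) (B \<inter> G)) + measure \<sigma>p (B \<inter> G) - measure \<sigma>m (B \<inter> G)" .
  moreover have "measure (fst \<mu>) (B \<inter> G) = measure (fst \<mu>) B" "measure (snd \<mu>) (B \<inter> G) = measure (snd \<mu>) B"
  proof -
   have "B \<inter> G = B - F" using G(2) B\<Omega> by auto
   then show "measure (fst \<mu>) (B \<inter> G) = measure (fst \<mu>) B" "measure (snd \<mu>) (B \<inter> G) = measure (snd \<mu>) B"
    using sets\<mu> B(1) B\<Omega> Fb F0 by (auto intro!: measure_Diff_null_set simp: null_sets_def)
  qed
  ultimately show ?thesis using ee(2)[OF f B(1) B\<Omega>] ee(2)[OF s B(1) B\<Omega>] ee(2)[OF p B(1) B\<Omega>] ee(2)[OF m B(1) B\<Omega>]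
   by (simp add: sval_def)
 qed
 show ?thesis unfolding cap_decomposition_def
  by (intro conjI ballI impI rc zp zm con[OF cp p] con[OF cm m] sng[OF sing p m], elim conjE) (rule ident)
qed


section \<open>Cutting off a set of zero capacity\<close>

text \<open>The factor \<open>1 - \<eta>\<close> vanishes on the open set \<open>W\<close> around
  the part of \<open>F\<close> in the support of \<open>\<phi>\<close>, so the product is supported
  in the compact set \<open>supp \<phi> - W\<close>, away from \<open>F\<close>.\<close>

lemma supp_cutoff:
 fixes \<phi> \<eta> :: "'a::euclidean_space \<Rightarrow> real"
 assumes c: "compact (supp \<phi>)" "supp \<phi> \<subseteq> \<Omega>" and W: "open W" "F \<inter> supp \<phi> \<subseteq> W" "\<And>x. x \<in> W \<Longrightarrow> \<eta> x = 1"
 shows "compact (supp (\<lambda>x. \<phi> x * (1 - \<eta> x)))" "supp (\<lambda>x. \<phi> x * (1 - \<eta> x)) \<subseteq> \<Omega> - F"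
  "supp (\<lambda>x. \<phi> x * (1 - \<eta> x)) \<subseteq> supp \<phi>"
proof -
 have s: "supp (\<lambda>x. \<phi> x * (1 - \<eta> x)) \<subseteq> supp \<phi> - W"
 proof (rule supp_subsetI)
  show "closed (supp \<phi> - W)" using W(1) by (intro closed_Diff closed_supp)
  show "x \<in> supp \<phi> - W" if "\<phi> x * (1 - \<eta> x) \<noteq> 0" for x
   using that W(3)[of x] supp_mem[of \<phi> x] by auto
 qed
 have "compact (supp \<phi> - W)" using c W by (intro compact_diff)
 then show "compact (supp (\<lambda>x. \<phi> x * (1 - \<eta> x)))" using s by (rule compact_supp_subset)
 show "supp (\<lambda>x. \<phi> x * (1 - \<eta> x)) \<subseteq> \<Omega> - F" "supp (\<lambda>x. \<phi> x * (1 - \<eta> x)) \<subseteq> supp \<phi>" using s c(2) W(2) by auto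
qed

lemma test_fun_cutoff:
 assumes "test_fun \<Omega> \<phi>" "smooth \<eta>" "\<exists>W. open W \<and> F \<inter> supp \<phi> \<subseteq> W \<and> (\<forall>x\<in>W. \<eta> x = 1)"
 shows "test_fun (\<Omega> - F) (\<lambda>x. \<phi> x * (1 - \<eta> x))"
proof -
 obtain W where W: "open W" "F \<inter> supp \<phi> \<subseteq> W" "\<And>x. x \<in> W \<Longrightarrow> \<eta> x = 1" using assms(3) by blast
 have c: "compact (supp \<phi>)" "supp \<phi> \<subseteq> \<Omega>" "smooth \<phi>" using assms(1) by (auto simp: test_fun_iff)
 show ?thesis
  using supp_cutoff[OF c(1,2) W] c(3) assms(2) by (auto simp: test_fun_iff intro!: smooth_mult smooth_diff smooth_const)
qed

lemma grad_cutoff: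
 assumes "smooth \<phi>" "smooth \<eta>"
 shows "grad (\<lambda>x. \<phi> x * (1 - \<eta> x)) x = (1 - \<eta> x) *\<^sub>R grad \<phi> x - \<phi> x *\<^sub>R grad \<eta> x"
 using assms by (subst grad_mult) (auto simp: grad_diff grad_const smooth_const intro!: smooth_diff)

lemma young_scaled:
 fixes a b d s r :: real
 assumes "1 < s" "1 < r" "1 / s + 1 / r = 1" "0 \<le> a" "0 \<le> b" "0 < d"
 shows "a * b \<le> d powr s * a powr s + d powr (- r) * b powr r"
proof -
 have "a * b = (d * a) * (b / d)" using assms by simp
 also have "\<dots> \<le> (d * a) powr s / s + (b / d) powr r / r" using assms by (intro Youngs_inequality) auto
 also have "\<dots> \<le> (d * a) powr s + (b / d) powr r"
  using assms by (intro add_mono) (simp_all add: divide_le_eq mult_le_cancel_left1)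
 also have "\<dots> = d powr s * a powr s + d powr (- r) * b powr r"
  using assms by (simp add: powr_mult powr_divide powr_minus field_simps)
 finally show ?thesis .
qed

lemma young_tendsto_zero:
 assumes e: "1 < s" "1 < r" "1 / s + 1 / r = 1"
  and A: "\<And>x. 0 \<le> A x" "A \<in> lmeas" "(Leb+ x. ennreal (A x powr s)) < \<infinity>"
  and b: "\<And>n x. 0 \<le> b n x" "\<And>n. b n \<in> bmeas" "\<And>n. (Bor+ x. ennreal (b n x powr r)) \<le> ennreal (1 / real (Suc n))"
 shows "(\<lambda>n. (Leb+ x. ennreal (A x * b n x))) \<longlonglongrightarrow> 0"
proof -
 obtain P where P: "(Leb+ x. ennreal (A x powr s)) = ennreal P" "0 \<le> P"
  using A(3) by (cases "(Leb+ x. ennreal (A x powr s))") auto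
 have bm: "b n \<in> lmeas" for n using b(2)[of n] by (intro measurable_completion) simp
 note [measurable] = A(2) bm
 have le: "(Leb+ x. ennreal (A x * b n x)) \<le> ennreal (d powr s * P + d powr (- r) * (1 / real (Suc n)))" if d: "d > 0" for d n
 proof -
  have "(Leb+ x. ennreal (A x * b n x)) \<le> (Leb+ x. ennreal (d powr s) * ennreal (A x powr s) + ennreal (d powr (- r)) * ennreal (b n x powr r))"
  proof (rule nn_integral_mono)
   fix x
   have "ennreal (A x * b n x) \<le> ennreal (d powr s * A x powr s + d powr (- r) * b n x powr r)"
    by (rule ennreal_leI, rule young_scaled[OF e A(1) b(1) d])
   also have "\<dots> = ennreal (d powr s) * ennreal (A x powr s) + ennreal (d powr (- r)) * ennreal (b n x powr r)"
    by (simp add: ennreal_mult)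
   finally show "ennreal (A x * b n x) \<le> \<dots>" .
  qed
  also have "\<dots> = (Leb+ x. ennreal (d powr s) * ennreal (A x powr s)) + (Leb+ x. ennreal (d powr (- r)) * ennreal (b n x powr r))"
   by (rule nn_integral_add) measurable
  also have "(Leb+ x. ennreal (d powr s) * ennreal (A x powr s)) = ennreal (d powr s) * ennreal P"
   unfolding P(1)[symmetric] by (rule nn_integral_cmult) measurable
  also have "(Leb+ x. ennreal (d powr (- r)) * ennreal (b n x powr r)) = ennreal (d powr (- r)) * (Leb+ x. ennreal (b n x powr r))"
   by (rule nn_integral_cmult) measurable
  also have "(Leb+ x. ennreal (b n x powr r)) = (Bor+ x. ennreal (b n x powr r))" by (rule nn_integral_completion)
  also have "ennreal (d powr s) * ennreal P + ennreal (d powr (- r)) * (Bor+ x. ennreal (b n x powr r)) \<le> ennreal (d powr s) * ennreal P + ennreal (d powr (- r)) * ennreal (1 / real (Suc n))"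
   by (intro add_left_mono mult_left_mono b(3)) simp
  also have "\<dots> = ennreal (d powr s * P + d powr (- r) * (1 / real (Suc n)))"
   using P(2) by (simp add: ennreal_mult'[symmetric] ennreal_plus[symmetric] del: ennreal_plus of_nat_Suc)
  finally show ?thesis .
 qed
 show ?thesis
 proof (rule order_tendstoI)
  fix y :: ennreal assume "0 < y"
  then obtain z where z: "0 < z" "z < y" using dense by blast
  then obtain e where "z = ennreal e" by (cases z) auto
  with z have e': "0 < e" "ennreal e < y" by auto
  \<comment> \<open>\<open>P + 1\<close> instead of \<open>P\<close> covers the case
    \<open>P = 0\<close>.\<close>
  define d where "d = (e / (2 * (P + 1))) powr (1 / s)"
  have d: "d > 0" using e' P by (simp add: d_def)
  have "d powr s = e / (2 * (P + 1))" using e' P e by (simp add: d_def powr_powr)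
  then have "d powr s * P = e / 2 * (P / (P + 1))" by simp
  also have "\<dots> \<le> e / 2 * 1" using e' P by (intro mult_left_mono) auto
  finally have dP: "d powr s * P \<le> e / 2" by simp
  have "(\<lambda>n. d powr (- r) * inverse (real (Suc n))) \<longlonglongrightarrow> d powr (- r) * 0"
   by (intro tendsto_mult tendsto_const LIMSEQ_inverse_real_of_nat)
  then have "\<forall>\<^sub>F n in sequentially. d powr (- r) * inverse (real (Suc n)) < e / 2"
   using e'(1) by (intro order_tendstoD(2)) auto
  then show "\<forall>\<^sub>F n in sequentially. (Leb+ x. ennreal (A x * b n x)) < y"
  proof eventually_elim
   case (elim n)
   have "(Leb+ x. ennreal (A x * b n x)) \<le> ennreal (d powr s * P + d powr (- r) * (1 / real (Suc n)))" by (rule le[OF d])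
   also have "\<dots> \<le> ennreal e"
    by (rule ennreal_leI) (use dP elim in \<open>unfold inverse_eq_divide, linarith\<close>)
   also have "\<dots> < y" by (rule e')
   finally show ?case .
  qed
 qed simp
qed

text \<open>At \<open>x = 0\<close> both sides are 0, since \<open>0 powr a = 0\<close> for every
  exponent; the singular factor for \<open>p < 2\<close> is thus harmless.\<close>

lemma powr_mult_norm: "norm (x::'a::real_normed_vector) powr (p - 2) * norm x = norm x powr (p - 1)"
proof (cases "x = 0")
 case False
 then have "norm x powr (p - 2) * norm x = norm x powr (p - 2) * norm x powr 1" by simp
 also have "\<dots> = norm x powr (p - 1)" by (simp only: powr_add[symmetric]) simp
 finally show ?thesis .
qed simp

text \<open>The integrand of the equation: \<open>\<xi>\<close> is the gradient of the solution,
  \<open>\<zeta>\<close> and \<open>t\<close> are the gradient and the value of the test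
  function.\<close>

abbreviation "eqint p q \<xi> \<zeta> t \<equiv> norm \<xi> powr (p - 2) * (\<xi> \<bullet> \<zeta>) + norm \<xi> powr q * (t::real)"

section \<open>Common setting for both parts of the theorem\<close>

locale removable =
 fixes p q qs :: real and \<Omega> F :: "'a::euclidean_space set"
 assumes p: "1 < p" and q: "p - 1 < q" and qs: "qs = q / (q + 1 - p)"
  and \<Omega>: "open \<Omega>" and F: "closedin (top_of_set \<Omega>) F" and cap: "cap qs F = 0"
begin

text \<open>The conjugate exponent of \<open>qs\<close>: the power \<open>p - 1\<close> of the norm
  of the gradient lies in \<open>L^s\<close> exactly when its power \<open>q\<close> is
  integrable.\<close>

definition s where "s = q / (p - 1)"

lemma exponents: "1 < qs" "1 < s" "1 / s + 1 / qs = 1"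
proof -
 show "1 < qs" "1 < s" using p q by (simp_all add: qs s_def less_divide_eq)
 have "1 / s + 1 / qs = (p - 1) / q + (q + 1 - p) / q" by (simp add: qs s_def)
 also have "\<dots> = 1" using p q by (simp flip: add_divide_distrib)
 finally show "1 / s + 1 / qs = 1" .
qed

lemma F_subset: "F \<subseteq> \<Omega>" using F by (rule closedin_imp_subset)

lemma G_open: "open (\<Omega> - F)"
proof -
 have "openin (top_of_set \<Omega>) (\<Omega> - F)" using F by (simp add: closedin_def)
 then show ?thesis using \<Omega> openin_open_trans by blast
qed

lemma F_borel: "F \<in> sets borel"
proof -
 have "F = \<Omega> - (\<Omega> - F)" using F_subset by auto
 then show ?thesis using \<Omega> G_open by (metis borel_open sets.Diff)
qed

lemma F_AE: "AE x in lebesgue. x \<notin> F"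
proof -
 have "F \<in> null_sets lborel" using exponents(1) by (intro cap_zero_null[OF _ cap \<Omega> F]) simp
 then show ?thesis by (intro AE_not_in null_sets_completionI)
qed

definition cutoffs :: "'a set \<Rightarrow> (nat \<Rightarrow> 'a \<Rightarrow> real) \<Rightarrow> bool" where
 "cutoffs S \<eta> \<longleftrightarrow> (\<forall>n. test_fun UNIV (\<eta> n)) \<and> (\<forall>n x. 0 \<le> \<eta> n x \<and> \<eta> n x \<le> 1) \<and>
  (\<forall>n. \<exists>W. open W \<and> F \<inter> S \<subseteq> W \<and> (\<forall>x\<in>W. \<eta> n x = 1)) \<and> (\<forall>x. x \<notin> F \<longrightarrow> (\<forall>\<^sub>F n in sequentially. \<eta> n x = 0)) \<and>
  (\<forall>n. (Bor+ x. ennreal (norm (grad (\<eta> n) x) powr qs)) \<le> ennreal (1 / real (Suc n)))"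

lemma cutoffs_exist:
 assumes "compact S" "S \<subseteq> \<Omega>"
 shows "\<exists>\<eta>. cutoffs S \<eta>"
proof -
 obtain \<eta> :: "nat \<Rightarrow> 'a \<Rightarrow> real" where \<eta>: "\<And>n. test_fun UNIV (\<eta> n)" "\<And>n x. 0 \<le> \<eta> n x" "\<And>n x. \<eta> n x \<le> 1"
  "\<And>n. \<exists>W. open W \<and> F \<inter> S \<subseteq> W \<and> (\<forall>x\<in>W. \<eta> n x = 1)" "\<And>x. x \<notin> F \<Longrightarrow> \<forall>\<^sub>F n in sequentially. \<eta> n x = 0"
  "\<And>n. (Bor+ x. ennreal (norm (grad (\<eta> n) x) powr qs)) \<le> ennreal (1 / real (Suc n))"
  using cap_zero_cutoffs[OF less_trans[OF zero_less_one exponents(1)] cap \<Omega> F assms] by blast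
 then have "cutoffs S \<eta>" unfolding cutoffs_def by blast
 then show ?thesis by blast
qed

lemma cutoffsD:
 assumes "cutoffs S \<eta>"
 shows "test_fun UNIV (\<eta> n)" "smooth (\<eta> n)" "0 \<le> \<eta> n x" "\<eta> n x \<le> 1" "\<exists>W. open W \<and> F \<inter> S \<subseteq> W \<and> (\<forall>x\<in>W. \<eta> n x = 1)"
  "x \<notin> F \<Longrightarrow> \<forall>\<^sub>F n in sequentially. \<eta> n x = 0"
  "(Bor+ x. ennreal (norm (grad (\<eta> n) x) powr qs)) \<le> ennreal (1 / real (Suc n))"
  "\<eta> n \<in> bmeas" "grad (\<eta> n) \<in> bmeas"
proof -
 show t: "test_fun UNIV (\<eta> n)" using assms by (simp add: cutoffs_def)
 show "smooth (\<eta> n)" using t by (rule test_fun_smooth)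
 show "\<eta> n \<in> bmeas" "grad (\<eta> n) \<in> bmeas" using test_fun_borel[OF t] by auto
qed (use assms in \<open>auto simp: cutoffs_def\<close>)

text \<open>Common form of the limit passages across \<open>F\<close>. \<open>H\<close> is the limit
  integrand, recovered by dominated convergence off the null set \<open>F\<close>;
  \<open>X n\<close> is the error caused by \<open>grad (\<eta> n)\<close>, and \<open>A\<close> in
  \<open>L^s\<close> pairs with these gradients, which tend to 0 in \<open>L^qs\<close>.\<close>

lemma cutoff_limit:
 assumes c: "cutoffs S \<eta>" and H: "integrable lebesgue H" and Xm[measurable]: "\<And>n. X n \<in> lmeas"
  and A: "\<And>x. 0 \<le> A x" "A \<in> lmeas" "integrable lebesgue (\<lambda>x. A x powr s)" and Xb: "\<And>n x. \<bar>X n x\<bar> \<le> A x * norm (grad (\<eta> n) x)"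
 shows "(\<lambda>n. Leb x. (1 - \<eta> n x) * H x - X n x) \<longlonglongrightarrow> (Leb x. H x)"
proof -
 have [measurable]: "\<eta> n \<in> lmeas" "grad (\<eta> n) \<in> lmeas" for n
  using cutoffsD(8,9)[OF c] by (auto intro!: measurable_completion)
 note [measurable] = A(2) borel_measurable_integrable[OF H]
 have a: "AE x in lebesgue. (\<lambda>n. (1 - \<eta> n x) * H x) \<longlonglongrightarrow> H x"
  using F_AE
 proof eventually_elim
  case (elim x)
  have "\<forall>\<^sub>F n in sequentially. (1 - \<eta> n x) * H x = H x" using cutoffsD(6)[OF c elim] by (auto elim!: eventually_mono)
  then show ?case by (rule tendsto_eventually)
 qed
 have bd: "AE x in lebesgue. norm ((1 - \<eta> n x) * H x) \<le> norm (H x)" for n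
  using cutoffsD(3,4)[OF c] by (auto simp: abs_mult intro!: mult_left_le_one_le)
 have hm: "H \<in> lmeas" "(\<lambda>x. (1 - \<eta> n x) * H x) \<in> lmeas" for n by measurable
 have lim1: "(\<lambda>n. Leb x. (1 - \<eta> n x) * H x) \<longlonglongrightarrow> (Leb x. H x)"
  by (rule integral_dominated_convergence[OF hm integrable_norm[OF H] a bd])
 have i1: "integrable lebesgue (\<lambda>x. (1 - \<eta> n x) * H x)" for n by (rule integrable_le[OF H hm(2) bd])
 have Aint: "(Leb+ x. ennreal (A x powr s)) < \<infinity>" using integrableD(2)[OF A(3)] by (simp add: less_top)
 have yt: "(\<lambda>n. Leb+ x. ennreal (A x * norm (grad (\<eta> n) x))) \<longlonglongrightarrow> 0"
  by (rule young_tendsto_zero[OF exponents(2,1,3) A(1,2) Aint])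
   (use cutoffsD(7,9)[OF c] in auto)
 have i2: "integrable lebesgue (X n)" for n
 proof (rule integrableI_bounded[OF Xm])
  have "(Leb+ x. ennreal (norm (X n x))) \<le> (Leb+ x. ennreal (A x powr s) + ennreal (norm (grad (\<eta> n) x) powr qs))"
  proof (rule nn_integral_mono)
   fix x
   have "norm (X n x) \<le> A x * norm (grad (\<eta> n) x)" using Xb by simp
   also have "\<dots> \<le> 1 powr s * A x powr s + 1 powr (- qs) * norm (grad (\<eta> n) x) powr qs"
    by (rule young_scaled[OF exponents(2,1,3) A(1)]) auto
   finally have "ennreal (norm (X n x)) \<le> ennreal (A x powr s + norm (grad (\<eta> n) x) powr qs)" by (intro ennreal_leI) simp
   then show "ennreal (norm (X n x)) \<le> ennreal (A x powr s) + ennreal (norm (grad (\<eta> n) x) powr qs)" by simp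
  qed
  also have "\<dots> = (Leb+ x. ennreal (A x powr s)) + (Leb+ x. ennreal (norm (grad (\<eta> n) x) powr qs))"
   by (rule nn_integral_add) measurable
  also have "\<dots> < \<infinity>"
  proof -
   have "(Leb+ x. ennreal (norm (grad (\<eta> n) x) powr qs)) < \<infinity>"
    unfolding nn_integral_completion using cutoffsD(7)[OF c, of n] by (rule order_le_less_trans) simp
   then show ?thesis using Aint by simp
  qed
  finally show "(Leb+ x. ennreal (norm (X n x))) < \<infinity>" .
 qed
 have lim2: "(\<lambda>n. Leb x. X n x) \<longlonglongrightarrow> 0"
 proof -
  have le: "ennreal (norm (Leb x. X n x)) \<le> (Leb+ x. ennreal (A x * norm (grad (\<eta> n) x)))" for n
   by (rule order_trans[OF norm_integral_le_nn_integral nn_integral_mono]) (simp add: Xb ennreal_leI)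
  have "(\<lambda>n. ennreal (norm (Leb x. X n x))) \<longlonglongrightarrow> 0"
   by (rule tendsto_sandwich[OF _ _ tendsto_const yt]) (use le in auto)
  then have "(\<lambda>n. norm (Leb x. X n x)) \<longlonglongrightarrow> 0" by (simp add: ennreal_0[symmetric] del: ennreal_0)
  then show ?thesis by (rule tendsto_norm_zero_cancel)
 qed
 show ?thesis using tendsto_diff[OF lim1 lim2] by (simp add: Bochner_Integration.integral_diff[OF i1 i2])
qed

text \<open>A cutoff \<open>\<zeta>\<close> equal to 1 near \<open>K0\<close> is multiplied with
  \<open>1 - \<eta> n\<close>. The gradient of \<open>\<zeta>\<close> does not become small, so the
  gradients of the products are only bounded in \<open>L^qs\<close>, uniformly in
  \<open>n\<close>.\<close>

lemma cutoff_test_sequence: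
 assumes K0: "compact K0" "K0 \<subseteq> \<Omega>"
 obtains \<xi> :: "nat \<Rightarrow> 'a \<Rightarrow> real" and S and D :: real where "compact S" "S \<subseteq> \<Omega>" "\<And>n. test_fun (\<Omega> - F) (\<xi> n)"
  "\<And>n x. 0 \<le> \<xi> n x" "\<And>n x. \<xi> n x \<le> 1" "\<And>n. supp (\<xi> n) \<subseteq> S"
  "\<And>x. x \<in> K0 - F \<Longrightarrow> \<forall>\<^sub>F n in sequentially. \<xi> n x = 1"
  "\<And>n. integrable lebesgue (\<lambda>x. norm (grad (\<xi> n) x) powr qs)" "\<And>n. (Leb x. norm (grad (\<xi> n) x) powr qs) \<le> D"
proof -
 obtain \<zeta> V where \<zeta>: "test_fun \<Omega> \<zeta>" "\<And>x. 0 \<le> \<zeta> x" "\<And>x. \<zeta> x \<le> 1" "open V" "K0 \<subseteq> V" "V \<subseteq> \<Omega>" "\<And>x. x \<in> V \<Longrightarrow> \<zeta> x = 1"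
  using smooth_cutoff[OF K0(1) \<Omega> K0(2)] by metis
 define S where "S = supp \<zeta>"
 have S: "compact S" "S \<subseteq> \<Omega>" using \<zeta>(1) by (auto simp: test_fun_iff S_def)
 obtain \<eta> where c\<eta>: "cutoffs S \<eta>" using cutoffs_exist[OF S] by blast
 note \<eta> = cutoffsD(1,3-7)[OF c\<eta>]
 have qs0: "0 < qs" using exponents(1) by simp
 define \<xi> where "\<xi> n x = \<zeta> x * (1 - \<eta> n x)" for n x
 have sm: "smooth \<zeta>" "smooth (\<eta> n)" for n using \<zeta>(1) \<eta>(1) by (auto dest: test_fun_smooth)
 have t\<xi>: "test_fun (\<Omega> - F) (\<xi> n)" for n
  unfolding \<xi>_def using test_fun_cutoff[OF \<zeta>(1) sm(2) \<eta>(4)[unfolded S_def]] .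
 have \<xi>01: "0 \<le> \<xi> n x" "\<xi> n x \<le> 1" for n x
  unfolding \<xi>_def using \<zeta>(2,3)[of x] \<eta>(2,3)[of n x] by (auto intro!: mult_le_one)
 have grad\<xi>: "norm (grad (\<xi> n) x) \<le> norm (grad \<zeta> x) + norm (grad (\<eta> n) x)" for n x
 proof -
  have "norm (grad (\<xi> n) x) \<le> norm ((1 - \<eta> n x) *\<^sub>R grad \<zeta> x) + norm (\<zeta> x *\<^sub>R grad (\<eta> n) x)"
   unfolding \<xi>_def grad_cutoff[OF sm] by (rule norm_triangle_ineq4)
  also have "\<dots> \<le> norm (grad \<zeta> x) + norm (grad (\<eta> n) x)"
   using \<zeta>(2,3)[of x] \<eta>(2,3)[of n x] by (intro add_mono) (auto intro!: mult_left_le_one_le)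
  finally show ?thesis .
 qed
 note [measurable] = test_fun_borel[OF \<zeta>(1)] test_fun_borel[OF \<eta>(1)] test_fun_borel[OF t\<xi>]
 define Z where "Z = (Bor+ x. ennreal (norm (grad \<zeta> x) powr qs))"
 have Zfin: "Z < \<infinity>"
 proof -
  obtain B where "B > 0" "\<And>x. \<bar>\<zeta> x\<bar> \<le> B" "\<And>x. norm (grad \<zeta> x) \<le> B" using test_fun_bounds[OF \<zeta>(1)] by blast
  note B = this(1,3)
  have [measurable]: "S \<in> sets borel" using S(1) by (rule borel_compact)
  have "Z \<le> (Bor+ x. ennreal (B powr qs) * indicator S x)"
   unfolding Z_def
  proof (rule nn_integral_mono)
   fix x
   show "ennreal (norm (grad \<zeta> x) powr qs) \<le> ennreal (B powr qs) * indicator S x"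
    using grad_zero_outside[of x \<zeta>] B(2)[of x] qs0
    by (cases "x \<in> S") (auto simp: S_def intro!: ennreal_leI powr_mono2)
  qed
  also have "\<dots> = ennreal (B powr qs) * emeasure lborel S" by (simp add: nn_integral_cmult_indicator)
  also have "\<dots> < \<infinity>" using emeasure_compact_finite[OF S(1)] by (simp add: ennreal_mult_less_top)
  finally show ?thesis .
 qed
 define D where "D = ennreal (2 powr qs) * (Z + 1)"
 have Dfin: "D < \<infinity>" using Zfin by (simp add: D_def ennreal_mult_less_top)
 have gradint: "(Bor+ x. ennreal (norm (grad (\<xi> n) x) powr qs)) \<le> D" for n
 proof -
  have "(Bor+ x. ennreal (norm (grad (\<xi> n) x) powr qs))
   \<le> (Bor+ x. ennreal (2 powr qs) * (ennreal (norm (grad \<zeta> x) powr qs) + ennreal (norm (grad (\<eta> n) x) powr qs)))"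
  proof (rule nn_integral_mono)
   fix x
   have "norm (grad (\<xi> n) x) powr qs \<le> (norm (grad \<zeta> x) + norm (grad (\<eta> n) x)) powr qs"
    using grad\<xi>[of n x] qs0 by (intro powr_mono2) auto
   also have "\<dots> \<le> 2 powr qs * (norm (grad \<zeta> x) powr qs + norm (grad (\<eta> n) x) powr qs)"
    using qs0 by (intro powr_add_le) auto
   finally have "ennreal (norm (grad (\<xi> n) x) powr qs) \<le> ennreal (2 powr qs * (norm (grad \<zeta> x) powr qs + norm (grad (\<eta> n) x) powr qs))"
    by (rule ennreal_leI)
   also have "\<dots> = ennreal (2 powr qs) * (ennreal (norm (grad \<zeta> x) powr qs) + ennreal (norm (grad (\<eta> n) x) powr qs))"
    by (simp add: ennreal_mult)
   finally show "ennreal (norm (grad (\<xi> n) x) powr qs) \<le> \<dots>" .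
  qed
  also have "\<dots> = ennreal (2 powr qs) * (Z + (Bor+ x. ennreal (norm (grad (\<eta> n) x) powr qs)))"
   unfolding Z_def by (subst nn_integral_cmult, measurable, subst nn_integral_add) auto
  also have "\<dots> \<le> D" unfolding D_def
  proof (intro mult_left_mono add_left_mono)
   have "ennreal (1 / real (Suc n)) \<le> ennreal 1" by (intro ennreal_leI) simp
   then show "(Bor+ x. ennreal (norm (grad (\<eta> n) x) powr qs)) \<le> 1" using \<eta>(6)[of n] by (metis ennreal_1 order_trans)
  qed simp
  finally show ?thesis .
 qed
 have int: "integrable lebesgue (\<lambda>x. norm (grad (\<xi> n) x) powr qs)" "(Leb x. norm (grad (\<xi> n) x) powr qs) \<le> enn2real D" for n
 proof -
  have m: "(\<lambda>x. norm (grad (\<xi> n) x) powr qs) \<in> lmeas" by (rule measurable_completion) measurable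
  have nn: "(Leb+ x. ennreal (norm (grad (\<xi> n) x) powr qs)) \<le> D" using gradint[of n] by (simp add: nn_integral_completion)
  show i: "integrable lebesgue (\<lambda>x. norm (grad (\<xi> n) x) powr qs)" using m nn Dfin by (intro integrableI_nonneg) auto
  have "ennreal (Leb x. norm (grad (\<xi> n) x) powr qs) \<le> D" using nn nn_integral_eq_integral[OF i] by simp
  then show "(Leb x. norm (grad (\<xi> n) x) powr qs) \<le> enn2real D" using Dfin by (cases D) (auto simp: ennreal_le_iff)
 qed
 show ?thesis
 proof (rule that[of S \<xi> "enn2real D"])
  show "supp (\<xi> n) \<subseteq> S" for n
  proof (rule supp_subsetI)
   show "closed S" using S(1) by (rule compact_imp_closed)
   show "x \<in> S" if "\<xi> n x \<noteq> 0" for x using that supp_mem[of \<zeta> x] by (auto simp: \<xi>_def S_def)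
  qed
  show "\<forall>\<^sub>F n in sequentially. \<xi> n x = 1" if "x \<in> K0 - F" for x
   using \<eta>(5)[of x] that by (auto elim!: eventually_mono simp: \<xi>_def subsetD[OF \<zeta>(5)] \<zeta>(7))
 qed (fact S t\<xi> \<xi>01 int)+
qed

text \<open>Fatou's lemma turns bounds uniform in \<open>n\<close> into a bound on \<open>K\<close>;
  the points of \<open>F\<close>, where the limit is not known, form a null set.\<close>

lemma cutoff_fatou:
 assumes X: "\<And>n. integrable lebesgue (X n)" "\<And>n x. 0 \<le> X n x" "\<And>n. (Leb x. X n x) \<le> C"
  and lim: "\<And>x. x \<in> K - F \<Longrightarrow> \<forall>\<^sub>F n in sequentially. X n x = Y x"
 shows "(Leb+ x. ennreal (indicator K x * Y x)) \<le> ennreal C"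
proof -
 have "(Leb+ x. ennreal (indicator K x * Y x)) \<le> (Leb+ x. liminf (\<lambda>n. ennreal (X n x)))"
 proof (rule nn_integral_mono_AE)
  show "AE x in lebesgue. ennreal (indicator K x * Y x) \<le> liminf (\<lambda>n. ennreal (X n x))"
   using F_AE
  proof eventually_elim
   case (elim x)
   show ?case
   proof (cases "x \<in> K")
    case True
    have "\<forall>\<^sub>F n in sequentially. ennreal (X n x) = ennreal (Y x)" using lim[of x] True elim by (auto elim!: eventually_mono)
    then have "liminf (\<lambda>n. ennreal (X n x)) = ennreal (Y x)" by (intro lim_imp_Liminf tendsto_eventually) auto
    then show ?thesis using True by simp
   qed simp
  qed
 qed
 also have "\<dots> \<le> liminf (\<lambda>n. Leb+ x. ennreal (X n x))" using X(1) by (intro nn_integral_liminf) auto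
 also have "\<dots> \<le> ennreal C"
  by (rule order_trans[OF Liminf_le_Limsup Limsup_bounded]) (use X in \<open>simp_all add: nn_integral_eq_integral ennreal_leI\<close>)
 finally show ?thesis .
qed

text \<open>Testing the equation with \<open>(\<zeta> (1 - \<eta>\<^sub>n))\<^sup>m\<close>, \<open>m \<ge> q\<^sub>*\<close>, lets Young's inequality absorb the
 \<open>p\<close>-Laplacian into the gradient term.\<close>

theorem gradient_power_loc_int:
 assumes gm: "g \<in> lmeas" and gl: "loc_int (\<Omega> - F) (\<lambda>x. norm (g x) powr q)"
  and bound: "\<And>S. compact S \<Longrightarrow> S \<subseteq> \<Omega> \<Longrightarrow> \<exists>M. \<forall>\<phi>. test_fun (\<Omega> - F) \<phi> \<and> supp \<phi> \<subseteq> S \<and> (\<forall>x. 0 \<le> \<phi> x \<and> \<phi> x \<le> 1) \<longrightarrow>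
   (Leb x. eqint p q (g x) (grad \<phi> x) (\<phi> x)) \<le> M"
 shows "loc_int \<Omega> (\<lambda>x. norm (g x) powr q)"
 unfolding loc_int_def
proof (intro allI impI)
 fix K0 :: "'a set" assume "compact K0 \<and> K0 \<subseteq> \<Omega>"
 then have K0: "compact K0" "K0 \<subseteq> \<Omega>" by auto
 note [measurable] = gm
 note ce = exponents
 obtain \<xi> :: "nat \<Rightarrow> 'a \<Rightarrow> real" and S D where S: "compact S" "S \<subseteq> \<Omega>" and t\<xi>: "\<And>n. test_fun (\<Omega> - F) (\<xi> n)"
  and \<xi>01: "\<And>n x. 0 \<le> \<xi> n x" "\<And>n x. \<xi> n x \<le> 1" and \<xi>S: "\<And>n. supp (\<xi> n) \<subseteq> S"
  and \<xi>1: "\<And>x. x \<in> K0 - F \<Longrightarrow> \<forall>\<^sub>F n in sequentially. \<xi> n x = 1"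
  and iG: "\<And>n. integrable lebesgue (\<lambda>x. norm (grad (\<xi> n) x) powr qs)" and bG: "\<And>n. (Leb x. norm (grad (\<xi> n) x) powr qs) \<le> D"
  using cutoff_test_sequence[OF K0] by metis
 have s\<xi>: "smooth (\<xi> n)" for n using t\<xi> by (rule test_fun_smooth)
 obtain M where M: "\<And>\<phi>. test_fun (\<Omega> - F) \<phi> \<Longrightarrow> supp \<phi> \<subseteq> S \<Longrightarrow> (\<And>x. 0 \<le> \<phi> x \<and> \<phi> x \<le> 1) \<Longrightarrow>
   (Leb x. eqint p q (g x) (grad \<phi> x) (\<phi> x)) \<le> M"
  using bound[OF S] by blast
 \<comment> \<open>After Young's inequality the power \<open>\<xi>^((m - 1) s)\<close> must be
   bounded by \<open>\<xi>^m\<close>, that is \<open>(m - 1) s \<ge> m\<close>; since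
   \<open>s / (s - 1) = qs\<close>, this is \<open>m \<ge> qs\<close>. The bound
   \<open>m \<ge> 2\<close> keeps the exponent \<open>m - 1\<close> positive where
   \<open>\<xi>\<close> vanishes.\<close>
 define m where "m = nat \<lceil>max 2 qs\<rceil>"
 have m: "2 \<le> m" "qs \<le> real m" unfolding m_def by linarith+
 define \<phi> where "\<phi> n x = \<xi> n x ^ m" for n x
 have \<phi>eq: "\<phi> n = (\<lambda>x. \<xi> n x * \<xi> n x ^ (m - 1))" for n
  using m(1) by (auto simp: \<phi>_def fun_eq_iff power_eq_if)
 have t\<phi>: "test_fun (\<Omega> - F) (\<phi> n)" for n
  unfolding \<phi>eq by (intro test_fun_mult t\<xi> smooth_power s\<xi>)
 have \<phi>01: "0 \<le> \<phi> n x" "\<phi> n x \<le> 1" for n x unfolding \<phi>_def using \<xi>01 by (auto intro: power_le_one)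
 have \<phi>S: "supp (\<phi> n) \<subseteq> S" for n
 proof -
  have "compact (supp (\<xi> n))" using t\<xi>[of n] by (simp add: test_fun_iff)
  then show ?thesis unfolding \<phi>eq by (rule order_trans[OF compact_supp_mult(2) \<xi>S])
 qed
 have grad\<phi>: "grad (\<phi> n) x = (real m * \<xi> n x ^ (m - 1)) *\<^sub>R grad (\<xi> n) x" for n x
  unfolding \<phi>_def by (rule grad_power[OF s\<xi>])
 note [measurable] = test_fun_borel[OF t\<xi>] test_fun_borel[OF t\<phi>]
 define Y where "Y x = norm (g x) powr q" for x
 have Ym[measurable]: "Y \<in> lmeas" unfolding Y_def by measurable
 have \<phi>m[measurable]: "\<phi> n \<in> lmeas" "grad (\<phi> n) \<in> lmeas" "grad (\<xi> n) \<in> lmeas" for n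
  using test_fun_borel[OF t\<phi>] test_fun_borel[OF t\<xi>] by (auto intro!: measurable_completion)
 have iY: "integrable lebesgue (\<lambda>x. \<phi> n x * Y x)" for n
  using test_fun_integrable[OF t\<phi> gl, of n] by (simp add: Y_def)
 define X where "X n x = norm (g x) powr (p - 2) * (g x \<bullet> grad (\<phi> n) x)" for n x
 define R where "R n x = (real m * norm (grad (\<xi> n) x)) powr qs" for n x
 \<comment> \<open>Young's inequality in its plain form: the factor \<open>1 / s < 1\<close> in
   front of the main term already allows absorption.\<close>
 have Xb: "\<bar>X n x\<bar> \<le> (\<phi> n x * Y x) / s + R n x / qs" for n x
 proof -
  have "\<bar>X n x\<bar> \<le> norm (g x) powr (p - 2) * (norm (g x) * norm (grad (\<phi> n) x))"
   unfolding X_def abs_mult using Cauchy_Schwarz_ineq2[of "g x" "grad (\<phi> n) x"] by (intro mult_mono) auto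
  also have "\<dots> = norm (g x) powr (p - 1) * (real m * \<xi> n x ^ (m - 1) * norm (grad (\<xi> n) x))"
   unfolding grad\<phi> mult.assoc[symmetric] powr_mult_norm using \<xi>01(1)[of n x] by simp
  also have "\<dots> = (norm (g x) powr (p - 1) * \<xi> n x ^ (m - 1)) * (real m * norm (grad (\<xi> n) x))" by simp
  also have "\<dots> \<le> (norm (g x) powr (p - 1) * \<xi> n x ^ (m - 1)) powr s / s + R n x / qs"
   unfolding R_def using ce \<xi>01(1)[of n x] by (intro Youngs_inequality) auto
  also have "(norm (g x) powr (p - 1) * \<xi> n x ^ (m - 1)) powr s \<le> \<phi> n x * Y x"
  proof (cases "\<xi> n x = 0")
   case True
   then show ?thesis using m(1) \<phi>01(1)[of n x] by (simp add: Y_def power_0_left)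
  next
   case False
   then have pos: "0 < \<xi> n x" using \<xi>01(1)[of n x] by simp
   have e1: "(p - 1) * s = q" using p by (simp add: s_def)
   have "real m \<le> real (m - 1) * s"
   proof -
    have "s / (s - 1) = qs" using p q unfolding s_def qs by (simp add: divide_simps) 
    then have "s = qs * (s - 1)" using ce(2) by (simp add: field_simps)
    also have "\<dots> \<le> real m * (s - 1)" using m(2) ce(2) by (intro mult_right_mono) auto
    finally have "s \<le> real m * (s - 1)" .
    then show ?thesis using m(1) by (simp add: of_nat_diff algebra_simps)
   qed
   then have "\<xi> n x powr (real (m - 1) * s) \<le> \<xi> n x powr real m" using pos \<xi>01(2)[of n x] by (intro powr_mono') auto
   moreover have "(\<xi> n x ^ (m - 1)) powr s = \<xi> n x powr (real (m - 1) * s)" using pos by (simp add: powr_realpow[symmetric] powr_powr)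
   moreover have "(norm (g x) powr (p - 1)) powr s = Y x" using e1 by (simp add: powr_powr Y_def)
   ultimately have "(norm (g x) powr (p - 1) * \<xi> n x ^ (m - 1)) powr s \<le> Y x * \<xi> n x powr real m"
    using pos by (subst powr_mult) (auto simp: Y_def intro!: mult_left_mono)
   also have "\<dots> = \<phi> n x * Y x" using pos by (simp add: \<phi>_def powr_realpow)
   finally show ?thesis .
  qed
  finally show ?thesis using ce(2) by (simp add: divide_right_mono)
 qed
 have R: "R n x = real m powr qs * norm (grad (\<xi> n) x) powr qs" for n x by (simp add: R_def powr_mult)
 have iR: "integrable lebesgue (R n)" for n unfolding R using iG by (rule integrable_mult_right)
 have intR: "(Leb x. R n x) \<le> real m powr qs * D" for n unfolding R using bG[of n] by (simp add: mult_left_mono)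
 have iX: "integrable lebesgue (X n)" for n
 proof (rule integrable_le)
  show "integrable lebesgue (\<lambda>x. (\<phi> n x * Y x) / s + R n x / qs)" using iY iR by auto
  show "X n \<in> lmeas" unfolding X_def by measurable
  show "AE x in lebesgue. norm (X n x) \<le> norm ((\<phi> n x * Y x) / s + R n x / qs)"
   using order_trans[OF Xb abs_ge_self] by auto
 qed
 \<comment> \<open>The term \<open>?I / s\<close> is subtracted from both sides, which is possible
   because \<open>?I\<close> is finite for the cut-off function; the remaining factor is
   \<open>1 - 1 / s = 1 / qs\<close>.\<close>
 have I: "(Leb x. \<phi> n x * Y x) \<le> qs * M + real m powr qs * D" for n
 proof -
  let ?I = "(Leb x. \<phi> n x * Y x)"
  have "(Leb x. X n x + \<phi> n x * Y x) \<le> M"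
   using M[OF t\<phi> \<phi>S, of n] \<phi>01 by (simp add: X_def Y_def mult.commute)
  then have "(Leb x. X n x) + ?I \<le> M" using iX iY by simp
  moreover have "- (Leb x. X n x) \<le> (Leb x. (\<phi> n x * Y x) / s + R n x / qs)"
  proof -
   have "(Leb x. - X n x) \<le> (Leb x. (\<phi> n x * Y x) / s + R n x / qs)"
   proof (rule integral_mono)
    show "- X n x \<le> (\<phi> n x * Y x) / s + R n x / qs" for x using Xb[of n x] by linarith
   qed (use iX iY iR in auto)
   then show ?thesis by simp
  qed
  moreover have "(Leb x. (\<phi> n x * Y x) / s + R n x / qs) = ?I / s + (Leb x. R n x) / qs" using iY iR by simp
  ultimately have "?I \<le> M + ?I / s + (Leb x. R n x) / qs" by linarith
  then have "?I * (1 - 1 / s) \<le> M + real m powr qs * D / qs" using divide_right_mono[OF intR[of n], of qs] ce(1) by (simp add: algebra_simps)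
  moreover have "1 - 1 / s = 1 / qs" using ce(3) by linarith
  ultimately have "?I / qs \<le> M + real m powr qs * D / qs" by simp
  then show ?thesis using ce(1) by (simp add: field_simps)
 qed
 have "(Leb+ x. ennreal (indicator K0 x * Y x)) \<le> ennreal (qs * M + real m powr qs * D)"
 proof (rule cutoff_fatou[OF iY _ I])
  show "0 \<le> \<phi> n x * Y x" for n x using \<phi>01 by (simp add: Y_def)
  show "\<forall>\<^sub>F n in sequentially. \<phi> n x * Y x = Y x" if "x \<in> K0 - F" for x
   using \<xi>1[OF that] by (rule eventually_mono) (simp add: \<phi>_def)
 qed
 then have fin: "(Leb+ x. ennreal (indicator K0 x * Y x)) < \<infinity>" using order_le_less_trans by fastforce
 have [measurable]: "K0 \<in> sets lebesgue" using K0(1) by (rule compact_sets_lebesgue)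
 have "integrable lebesgue (\<lambda>x. indicator K0 x * Y x)" using fin by (intro integrableI_nonneg) (auto simp: Y_def)
 then show "set_integrable lebesgue K0 (\<lambda>x. norm (g x) powr q)" by (simp add: set_integrable_def Y_def)
qed

text \<open>The integration by parts off \<open>F\<close> holds for
  \<open>\<psi> (1 - \<eta> n)\<close> and brings in the integral of \<open>\<psi> f\<close> against
  \<open>grad (\<eta> n)\<close>. As \<open>f\<close> is bounded and \<open>\<psi>\<close> has
  compact support, \<open>cutoff_limit\<close> makes this error vanish.\<close>

theorem weak_gradient_extend:
 assumes w: "weak_gradient (\<Omega> - F) f g" and fb: "\<And>x. \<bar>f x\<bar> \<le> k" and l: "loc_int \<Omega> f" "loc_int \<Omega> g"
 shows "weak_gradient \<Omega> f g"
proof (rule weak_gradientI[OF \<Omega> l])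
 fix \<psi> and b :: 'a assume t: "test_fun \<Omega> \<psi>" and b: "b \<in> Basis"
 have S: "compact (supp \<psi>)" "supp \<psi> \<subseteq> \<Omega>" and sm: "smooth \<psi>" using t by (auto simp: test_fun_iff)
 have Sl: "supp \<psi> \<in> sets lebesgue" using S(1) by (rule compact_sets_lebesgue)
 have z: "\<psi> x = 0" if "x \<notin> supp \<psi>" for x using that supp_mem[of \<psi> x] by auto
 obtain B where "B > 0" "\<And>x. \<bar>\<psi> x\<bar> \<le> B" "\<And>x. norm (grad \<psi> x) \<le> B" using test_fun_bounds[OF t] by blast
 note B = this(1,2)
 obtain \<eta> where \<eta>: "cutoffs (supp \<psi>) \<eta>" using cutoffs_exist[OF S] by blast
 have i1: "integrable lebesgue (\<lambda>x. f x * (grad \<psi> x \<bullet> b))" if "test_fun G \<psi>" "loc_int G f" for G \<psi>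
  using integrable_inner_left[OF test_fun_integrable_grad[OF that], of b] by simp
 have i2: "integrable lebesgue (\<lambda>x. \<psi> x * (g x \<bullet> b))" if "test_fun G \<psi>" "loc_int G g" for G \<psi>
  using test_fun_integrable[OF that(1) loc_int_inner[OF that(2)], of b] by simp
 define H where "H x = f x * (grad \<psi> x \<bullet> b) + \<psi> x * (g x \<bullet> b)" for x
 have fm: "(\<lambda>x. \<psi> x * f x) \<in> lmeas" using test_fun_integrable[OF t l(1)] by (simp add: borel_measurable_integrable)
 have "(\<lambda>n. Leb x. (1 - \<eta> n x) * H x - (\<psi> x * f x) * (grad (\<eta> n) x \<bullet> b)) \<longlonglongrightarrow> (Leb x. H x)"
 proof (rule cutoff_limit[OF \<eta>, where A="\<lambda>x. B * \<bar>k\<bar> * indicator (supp \<psi>) x"])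
  show "integrable lebesgue H" unfolding H_def using i1[OF t l(1)] i2[OF t l(2)] by (rule Bochner_Integration.integrable_add)
  show "(\<lambda>x. (\<psi> x * f x) * (grad (\<eta> n) x \<bullet> b)) \<in> lmeas" for n
  proof -
   have "grad (\<eta> n) \<in> lmeas" using cutoffsD(9)[OF \<eta>] by (auto intro!: measurable_completion)
   then show ?thesis using fm by measurable
  qed
  show "(\<lambda>x. B * \<bar>k\<bar> * indicator (supp \<psi>) x) \<in> lmeas" using Sl by measurable
  have "integrable lebesgue (\<lambda>x. (B * \<bar>k\<bar>) powr s * (indicator (supp \<psi>) x :: real))"
   using Sl emeasure_compact_finite[OF S(1)] borel_compact[OF S(1)] by (intro integrable_mult_right integrable_real_indicator) auto
  moreover have "(B * \<bar>k\<bar> * indicator (supp \<psi>) x) powr s = (B * \<bar>k\<bar>) powr s * indicator (supp \<psi>) x" for x by (auto simp: indicator_def)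
  ultimately show "integrable lebesgue (\<lambda>x. (B * \<bar>k\<bar> * indicator (supp \<psi>) x) powr s)" by simp
  fix n x
  show "\<bar>(\<psi> x * f x) * (grad (\<eta> n) x \<bullet> b)\<bar> \<le> B * \<bar>k\<bar> * indicator (supp \<psi>) x * norm (grad (\<eta> n) x)"
  proof (cases "x \<in> supp \<psi>")
   case True
   have "\<bar>\<psi> x\<bar> * \<bar>f x\<bar> \<le> B * \<bar>k\<bar>" using B(1) B(2)[of x] fb[of x] by (intro mult_mono) auto
   moreover have "\<bar>grad (\<eta> n) x \<bullet> b\<bar> \<le> norm (grad (\<eta> n) x)" using Cauchy_Schwarz_ineq2[of "grad (\<eta> n) x" b] b by simp
   ultimately have "(\<bar>\<psi> x\<bar> * \<bar>f x\<bar>) * \<bar>grad (\<eta> n) x \<bullet> b\<bar> \<le> (B * \<bar>k\<bar>) * norm (grad (\<eta> n) x)"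
    by (rule mult_mono) (use B(1) in auto)
   then show ?thesis using True by (simp add: abs_mult)
  qed (simp add: z)
 qed (use B(1) in auto)
 moreover have "(Leb x. (1 - \<eta> n x) * H x - (\<psi> x * f x) * (grad (\<eta> n) x \<bullet> b)) = 0" for n
 proof -
  let ?\<xi> = "\<lambda>x. \<psi> x * (1 - \<eta> n x)"
  have t': "test_fun (\<Omega> - F) ?\<xi>" by (rule test_fun_cutoff[OF t cutoffsD(2,5)[OF \<eta>]])
  have "(Leb x. f x * (grad ?\<xi> x \<bullet> b) + ?\<xi> x * (g x \<bullet> b)) = 0"
   using weak_gradient_inner[OF G_open w t', of b] i1[OF t' loc_int_mono[OF l(1) Diff_subset]] i2[OF t' loc_int_mono[OF l(2) Diff_subset]] by simp
  then show ?thesis unfolding grad_cutoff[OF sm cutoffsD(2)[OF \<eta>]] H_def by (simp add: inner_diff_left algebra_simps)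
 qed
 ultimately have "(Leb x. H x) = 0" by (simp add: LIMSEQ_const_iff)
 then show "(Leb x. f x * (grad \<psi> x \<bullet> b)) = - (Leb x. \<psi> x * (g x \<bullet> b))"
  using i1[OF t l(1)] i2[OF t l(2)] by (simp add: H_def)
qed

end


section \<open>Truncations\<close>

lemma trunc_simps:
 "0 < k \<Longrightarrow> trunc k (ereal t) = clip k t"
 "0 < k \<Longrightarrow> trunc k \<infinity> = k"
 "0 < k \<Longrightarrow> trunc k (-\<infinity>) = - k"
proof -
 show "trunc k (ereal t) = clip k t"
  unfolding trunc_def clip_def by (metis real_of_ereal.simps(1) ereal_max ereal_min uminus_ereal.simps(1))
qed (auto simp: trunc_def min_def max_def)

lemma trunc_bound: "0 < k \<Longrightarrow> \<bar>trunc k s\<bar> \<le> k"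
 by (cases s) (auto simp: trunc_simps clip_def)

lemma trunc_double:
 assumes "0 < k"
 shows "\<bar>s\<bar> \<le> ereal k \<Longrightarrow> trunc (2 * k) s = trunc k s"
  "ereal (2 * k) \<le> \<bar>s\<bar> \<Longrightarrow> \<bar>trunc (2 * k) s - trunc k s\<bar> = k"
 using assms by (cases s; auto simp: trunc_simps clip_def)+

lemma trunc_ext_fun: "0 < k \<Longrightarrow> ext_fun (clip k) s = trunc k s"
proof (cases s)
 case PInf
 assume k: "0 < k"
 have "\<forall>\<^sub>F t in at_top. clip k t = k" using eventually_ge_at_top[of k] by eventually_elim (use k in \<open>auto simp: clip_def\<close>)
 then have "((\<lambda>t. clip k t) \<longlongrightarrow> k) at_top" by (rule tendsto_eventually)
 then have "Lim at_top (clip k) = k" by (intro tendsto_Lim) auto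
 then show ?thesis using PInf k by (simp add: ext_fun_def trunc_simps)
next
 case MInf
 assume k: "0 < k"
 have "\<forall>\<^sub>F t in at_bot. clip k t = - k" using eventually_le_at_bot[of "- k"] by eventually_elim (use k in \<open>auto simp: clip_def\<close>)
 then have "((\<lambda>t. clip k t) \<longlongrightarrow> - k) at_bot" by (rule tendsto_eventually)
 then have "Lim at_bot (clip k) = - k" by (intro tendsto_Lim) auto
 then show ?thesis using MInf k by (simp add: ext_fun_def trunc_simps)
qed (simp add: ext_fun_def trunc_simps)

context removable
begin

text \<open>The test function \<open>T\<^sub>k(u) \<xi>\<close> gives the energy bound; \<open>T\<^sub>k\<close> is itself an admissible
 renormalizing function, so that no chain rule is involved.\<close>

theorem truncation_energy:
 fixes g :: "'a::euclidean_space \<Rightarrow> 'a" and u :: "'a \<Rightarrow> ereal"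
 defines "gk \<equiv> \<lambda>k x. if \<bar>u x\<bar> \<le> ereal k then g x else 0"
 assumes gm: "g \<in> lmeas" and gl: "loc_int \<Omega> (\<lambda>x. norm (g x) powr q)"
  and gkm: "\<And>k. 0 < k \<Longrightarrow> gk k \<in> lmeas"
  and gkl: "\<And>k. 0 < k \<Longrightarrow> loc_int (\<Omega> - F) (\<lambda>x. norm (gk k x) powr p)"
  and Tm: "\<And>k. 0 < k \<Longrightarrow> (\<lambda>x. trunc k (u x)) \<in> lmeas"
  and bound: "\<And>S. compact S \<Longrightarrow> S \<subseteq> \<Omega> \<Longrightarrow> \<exists>M. \<forall>k \<phi>. 0 < k \<and> test_fun (\<Omega> - F) \<phi> \<and> supp \<phi> \<subseteq> S \<and> (\<forall>x. 0 \<le> \<phi> x \<and> \<phi> x \<le> 1) \<longrightarrow>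
   (Leb x. eqint p q (g x) (\<phi> x *\<^sub>R gk k x + trunc k (u x) *\<^sub>R grad \<phi> x) (trunc k (u x) * \<phi> x)) \<le> k * M"
  and K0: "compact K0" "K0 \<subseteq> \<Omega>"
 shows "\<exists>C\<ge>0. \<forall>k>0. (Leb+ x. ennreal (indicator K0 x * norm (gk k x) powr p)) \<le> ennreal (C * k)"
proof -
 note ce = exponents
 obtain \<xi> :: "nat \<Rightarrow> 'a \<Rightarrow> real" and S D where S: "compact S" "S \<subseteq> \<Omega>" and t\<xi>: "\<And>n. test_fun (\<Omega> - F) (\<xi> n)"
  and \<xi>01: "\<And>n x. 0 \<le> \<xi> n x" "\<And>n x. \<xi> n x \<le> 1" and \<xi>S: "\<And>n. supp (\<xi> n) \<subseteq> S"
  and \<xi>1: "\<And>x. x \<in> K0 - F \<Longrightarrow> \<forall>\<^sub>F n in sequentially. \<xi> n x = 1"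
  and iG: "\<And>n. integrable lebesgue (\<lambda>x. norm (grad (\<xi> n) x) powr qs)" and bG: "\<And>n. (Leb x. norm (grad (\<xi> n) x) powr qs) \<le> D"
  using cutoff_test_sequence[OF K0] by metis
 obtain M where M: "\<And>k \<phi>. 0 < k \<Longrightarrow> test_fun (\<Omega> - F) \<phi> \<Longrightarrow> supp \<phi> \<subseteq> S \<Longrightarrow> (\<And>x. 0 \<le> \<phi> x \<and> \<phi> x \<le> 1) \<Longrightarrow>
   (Leb x. eqint p q (g x) (\<phi> x *\<^sub>R gk k x + trunc k (u x) *\<^sub>R grad \<phi> x) (trunc k (u x) * \<phi> x)) \<le> k * M"
  using bound[OF S] by blast
 have Sm: "S \<in> sets lebesgue" using S(1) by (rule compact_sets_lebesgue)
 have m1: "\<xi> n \<in> lmeas" "grad (\<xi> n) \<in> lmeas" for n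
  using test_fun_borel[OF t\<xi>] by (auto intro!: measurable_completion)
 note [measurable] = gm m1 Sm
 define Y where "Y x = indicator S x * norm (g x) powr q" for x
 have iY: "integrable lebesgue Y" using gl S unfolding loc_int_def set_integrable_def Y_def by simp
 define R where "R n x = norm (grad (\<xi> n) x) powr qs" for n x
 define IY where "IY = (Leb x. Y x)"
 have Y0: "0 \<le> Y x" and R0: "0 \<le> R n x" for n x by (auto simp: Y_def R_def)
 have IY0: "0 \<le> IY" unfolding IY_def using Y0 by (intro integral_nonneg_AE) auto
 have iR: "integrable lebesgue (R n)" and intR: "(Leb x. R n x) \<le> D" for n unfolding R_def by (rule iG, rule bG)
 have D0: "0 \<le> D" using intR[of 0] R0 by (intro order_trans[OF integral_nonneg_AE]) auto
 have grad0: "grad (\<xi> n) x = 0" if "x \<notin> S" for n x using that \<xi>S[of n] by (intro grad_zero_outside) auto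
 have \<xi>0: "\<xi> n x = 0" if "x \<notin> S" for n x using that \<xi>S[of n] supp_mem[of "\<xi> n" x] by auto
 \<comment> \<open>The contributions to the constant: \<open>\<bar>M\<bar>\<close> from the
   measures, \<open>IY\<close> once from the lower order term and once from the
   \<open>p\<close>-Laplacian acting on the gradient of the cutoff, \<open>D\<close> from that
   gradient itself. All carry the factor \<open>k\<close> because the truncation is bounded by
   \<open>k\<close>.\<close>
 have main: "(Leb+ x. ennreal (indicator K0 x * norm (gk k x) powr p)) \<le> ennreal ((\<bar>M\<bar> + 2 * IY + D) * k)" if k: "0 < k" for k
 proof -
  note [measurable] = gkm[OF k] Tm[OF k]
  have Tb: "\<bar>trunc k (u x)\<bar> \<le> k" for x by (rule trunc_bound[OF k])
  define X1 where "X1 n x = \<xi> n x * norm (gk k x) powr p" for n x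
  define X2 where "X2 n x = norm (g x) powr (p - 2) * (g x \<bullet> (trunc k (u x) *\<^sub>R grad (\<xi> n) x))" for n x
  define X3 where "X3 n x = norm (g x) powr q * (trunc k (u x) * \<xi> n x)" for n x
  have i1: "integrable lebesgue (X1 n)" for n
   using test_fun_integrable[OF t\<xi> gkl[OF k], of n] by (simp add: X1_def[abs_def])
  have b2: "\<bar>X2 n x\<bar> \<le> k * (Y x + R n x)" for n x
  proof (cases "x \<in> S")
   case True
   have "\<bar>X2 n x\<bar> \<le> norm (g x) powr (p - 2) * (norm (g x) * norm (trunc k (u x) *\<^sub>R grad (\<xi> n) x))"
    unfolding X2_def abs_mult using Cauchy_Schwarz_ineq2[of "g x" "trunc k (u x) *\<^sub>R grad (\<xi> n) x"]
    by (intro mult_mono) auto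
   also have "\<dots> = \<bar>trunc k (u x)\<bar> * (norm (g x) powr (p - 1) * norm (grad (\<xi> n) x))"
    unfolding powr_mult_norm[symmetric] by (simp add: ac_simps)
   also have "\<dots> \<le> k * (norm (g x) powr (p - 1) * norm (grad (\<xi> n) x))" using Tb by (intro mult_right_mono) auto
   also have "\<dots> \<le> k * (1 powr s * (norm (g x) powr (p - 1)) powr s + 1 powr (- qs) * norm (grad (\<xi> n) x) powr qs)"
    using k by (intro mult_left_mono young_scaled[OF ce(2,1,3)]) auto
   also have "\<dots> = k * (Y x + R n x)" using p True by (simp add: Y_def R_def powr_powr s_def)
   finally show ?thesis .
  next
   case False
   then show ?thesis using grad0[of x n] k Y0 R0 by (simp add: X2_def)
  qed
  have b3: "\<bar>X3 n x\<bar> \<le> k * Y x" for n x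
  proof (cases "x \<in> S")
   case True
   have "\<bar>trunc k (u x)\<bar> * \<bar>\<xi> n x\<bar> \<le> k * 1" using Tb[of x] \<xi>01[of n x] k by (intro mult_mono) auto
   then have "norm (g x) powr q * (\<bar>trunc k (u x)\<bar> * \<bar>\<xi> n x\<bar>) \<le> norm (g x) powr q * (k * 1)" by (intro mult_left_mono) auto
   then show ?thesis using True by (simp add: X3_def Y_def abs_mult mult.commute)
  qed (use \<xi>0[of x n] k Y0 in \<open>simp add: X3_def\<close>)
  have i2: "integrable lebesgue (X2 n)" for n
  proof (rule integrable_le)
   show "integrable lebesgue (\<lambda>x. k * (Y x + R n x))" using iY iR by auto
   show "X2 n \<in> lmeas" unfolding X2_def by measurable
   show "AE x in lebesgue. norm (X2 n x) \<le> norm (k * (Y x + R n x))" using order_trans[OF b2 abs_ge_self] by auto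
  qed
  have i3: "integrable lebesgue (X3 n)" for n
  proof (rule integrable_le)
   show "integrable lebesgue (\<lambda>x. k * Y x)" using iY by auto
   show "X3 n \<in> lmeas" unfolding X3_def by measurable
   show "AE x in lebesgue. norm (X3 n x) \<le> norm (k * Y x)" using order_trans[OF b3 abs_ge_self] by auto
  qed
  have pt: "eqint p q (g x) (\<xi> n x *\<^sub>R gk k x + trunc k (u x) *\<^sub>R grad (\<xi> n) x) (trunc k (u x) * \<xi> n x)
    = X1 n x + X2 n x + X3 n x" for n x
  proof -
   have "norm (g x) powr (p - 2) * (g x \<bullet> gk k x) = norm (gk k x) powr p"
   proof (cases "\<bar>u x\<bar> \<le> ereal k")
    case True
    have "norm (g x) powr (p - 2) * (norm (g x) * norm (g x)) = norm (g x) powr p"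
     unfolding mult.assoc[symmetric] powr_mult_norm using powr_mult_norm[of "g x" "p + 1"] by (simp add: add.commute)
    then show ?thesis using True by (simp add: gk_def dot_square_norm power2_eq_square)
   qed (use p in \<open>simp add: gk_def\<close>)
   then show ?thesis by (simp add: X1_def X2_def X3_def inner_add_right distrib_left)
  qed
  have I1: "(Leb x. X1 n x) \<le> (\<bar>M\<bar> + 2 * IY + D) * k" for n
  proof -
   have "(Leb x. X1 n x) + (Leb x. X2 n x) + (Leb x. X3 n x) = (Leb x. X1 n x + X2 n x + X3 n x)"
    using i1 i2 i3 by simp
   also have "\<dots> \<le> k * M" using M[OF k t\<xi> \<xi>S, of n] \<xi>01 unfolding pt by auto
   finally have s: "(Leb x. X1 n x) + (Leb x. X2 n x) + (Leb x. X3 n x) \<le> k * M" .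
   have "(Leb x. - X2 n x) \<le> (Leb x. k * (Y x + R n x))"
   proof (rule integral_mono)
    show "- X2 n x \<le> k * (Y x + R n x)" for x using b2[of n x] by linarith
   qed (use i2 iY iR in auto)
   moreover have "(Leb x. k * (Y x + R n x)) = k * (IY + (Leb x. R n x))" unfolding IY_def using iY iR by simp
   moreover have "k * (IY + (Leb x. R n x)) \<le> k * (IY + D)"
    using k intR[of n] by (intro mult_left_mono add_left_mono) auto
   ultimately have 2: "- (Leb x. X2 n x) \<le> k * (IY + D)" unfolding Bochner_Integration.integral_minus by linarith
   have "(Leb x. - X3 n x) \<le> (Leb x. k * Y x)"
   proof (rule integral_mono)
    show "- X3 n x \<le> k * Y x" for x using b3[of n x] by linarith
   qed (use i3 iY in auto)
   then have 3: "- (Leb x. X3 n x) \<le> k * IY" by (simp add: IY_def)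
   have "k * M \<le> k * \<bar>M\<bar>" using k by (intro mult_left_mono) auto
   with s 2 3 show ?thesis by (simp add: algebra_simps)
  qed
  show ?thesis
  proof (rule cutoff_fatou[OF i1 _ I1])
   show "0 \<le> X1 n x" for n x using \<xi>01 by (simp add: X1_def)
   show "\<forall>\<^sub>F n in sequentially. X1 n x = norm (gk k x) powr p" if "x \<in> K0 - F" for x
    using \<xi>1[OF that] by (rule eventually_mono) (simp add: X1_def)
  qed
 qed
 show ?thesis
  by (rule exI[of _ "\<bar>M\<bar> + 2 * IY + D"]) (use main IY0 D0 in auto)
qed

end

section \<open>Decay of the level sets\<close>

text \<open>On the dyadic level \<open>2^j k0 \<le> f < 2^(j+1) k0\<close> the integrand is at most
  \<open>(2^(j+1) k0) powr t\<close>, and the decay makes the sum a geometric series of ratio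
  \<open>2 powr (t - a) < 1\<close>.\<close>

lemma layer_cake_powr:
 assumes f: "f \<in> lmeas" "\<And>x. 0 \<le> f x" and B: "B \<in> sets lebesgue" "emeasure lebesgue B < \<infinity>"
  and t: "0 < t" "t < a" and k0: "0 < k0" and A: "0 \<le> A"
  and decay: "\<And>k. k0 \<le> k \<Longrightarrow> emeasure lebesgue {x \<in> B. k \<le> f x} \<le> ennreal (A * k powr (- a))"
 shows "(Leb+ x. ennreal (indicator B x * f x powr t)) < \<infinity>"
proof -
 note [measurable] = f(1) B(1)
 define E where "E j = {x \<in> B. 2 ^ j * k0 \<le> f x}" for j :: nat
 have E[measurable]: "E j \<in> sets lebesgue" for j
 proof -
  have "{x \<in> space lebesgue. x \<in> B \<and> 2 ^ j * k0 \<le> f x} \<in> sets lebesgue" by measurable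
  then show ?thesis by (simp add: E_def)
 qed
 have pw: "ennreal (indicator B x * f x powr t) \<le> ennreal (k0 powr t) * indicator B x + (\<Sum>j. ennreal ((2 ^ Suc j * k0) powr t) * indicator (E j) x)" for x
 proof (cases "x \<in> B \<and> k0 \<le> f x")
  case False
  then have "ennreal (indicator B x * f x powr t) \<le> ennreal (k0 powr t) * indicator B x"
   using f(2)[of x] t by (auto simp: indicator_def intro!: ennreal_leI powr_mono2)
  then show ?thesis by (rule order_trans) simp
 next
  case True
  obtain n where "f x / k0 < 2 ^ n" using real_arch_pow[of 2 "f x / k0"] by auto
  then have ex: "\<exists>n. f x < 2 ^ n * k0" using k0 by (auto simp: field_simps)
  define n where "n = (LEAST n. f x < 2 ^ n * k0)"
  have n: "f x < 2 ^ n * k0" unfolding n_def using ex by (rule LeastI_ex)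
  then obtain j where j: "n = Suc j" using True by (cases n) auto
  have "\<not> f x < 2 ^ j * k0" using not_less_Least[of j "\<lambda>n. f x < 2 ^ n * k0"] j by (simp add: n_def)
  then have xE: "x \<in> E j" using True by (simp add: E_def)
  have "ennreal (indicator B x * f x powr t) \<le> ennreal ((2 ^ Suc j * k0) powr t) * indicator (E j) x"
   using True xE n j f(2)[of x] t by (auto intro!: ennreal_leI powr_mono2)
  also have "\<dots> \<le> (\<Sum>j. ennreal ((2 ^ Suc j * k0) powr t) * indicator (E j) x)"
   using sum_le_suminf[OF summableI finite.insertI[OF finite.emptyI] zero_le, of "\<lambda>j. ennreal ((2 ^ Suc j * k0) powr t) * indicator (E j) x" j]
   by (simp only: sum.insert[OF finite.emptyI empty_iff[THEN iffD1, THEN notI]] sum.empty add_0_right)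
  finally show ?thesis by (rule order_trans) simp
 qed
 have "(Leb+ x. ennreal (indicator B x * f x powr t))
  \<le> (Leb+ x. ennreal (k0 powr t) * indicator B x + (\<Sum>j. ennreal ((2 ^ Suc j * k0) powr t) * indicator (E j) x))"
  by (intro nn_integral_mono pw)
 also have "\<dots> = (Leb+ x. ennreal (k0 powr t) * indicator B x) + (Leb+ x. (\<Sum>j. ennreal ((2 ^ Suc j * k0) powr t) * indicator (E j) x))"
  by (rule nn_integral_add) measurable
 also have "(Leb+ x. ennreal (k0 powr t) * indicator B x) = ennreal (k0 powr t) * emeasure lebesgue B"
  by (rule nn_integral_cmult_indicator) measurable
 also have "(Leb+ x. (\<Sum>j. ennreal ((2 ^ Suc j * k0) powr t) * indicator (E j) x))
   = (\<Sum>j. (Leb+ x. ennreal ((2 ^ Suc j * k0) powr t) * indicator (E j) x))"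
  by (rule nn_integral_suminf) measurable
 also have "\<dots> = (\<Sum>j. ennreal ((2 ^ Suc j * k0) powr t) * emeasure lebesgue (E j))"
  by (intro suminf_cong nn_integral_cmult_indicator) measurable
 also have "\<dots> \<le> (\<Sum>j. ennreal (2 powr t * k0 powr (t - a) * A * (2 powr (t - a)) ^ j))"
 proof (rule suminf_le)
  fix j
  have e: "emeasure lebesgue (E j) \<le> ennreal (A * (2 ^ j * k0) powr (- a))"
  proof -
   have "1 * k0 \<le> 2 ^ j * k0" using k0 by (intro mult_right_mono) auto
   then show ?thesis unfolding E_def by (intro decay) simp
  qed
  have "ennreal ((2 ^ Suc j * k0) powr t) * emeasure lebesgue (E j) \<le> ennreal ((2 ^ Suc j * k0) powr t) * ennreal (A * (2 ^ j * k0) powr (- a))"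
   by (intro mult_left_mono e) simp
  also have "\<dots> = ennreal ((2 ^ Suc j * k0) powr t * (A * (2 ^ j * k0) powr (- a)))" using A by (simp add: ennreal_mult)
  also have "(2 ^ Suc j * k0) powr t * (A * (2 ^ j * k0) powr (- a)) = 2 powr t * k0 powr (t - a) * A * (2 powr (t - a)) ^ j"
  proof -
   have "(2 ^ Suc j * k0) powr t = 2 powr t * (2 ^ j * k0) powr t" using k0 by (simp add: powr_mult mult.assoc)
   moreover have "(2 ^ j * k0) powr t * (2 ^ j * k0) powr (- a) = (2 ^ j * k0) powr (t - a)" by (simp flip: powr_add)
   moreover have "(2 ^ j * k0) powr (t - a) = (2 powr (t - a)) ^ j * k0 powr (t - a)"
    using k0 by (simp add: powr_mult powr_realpow[symmetric] powr_powr mult.commute)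
   ultimately show ?thesis by (simp add: ac_simps)
  qed
  finally show "ennreal ((2 ^ Suc j * k0) powr t) * emeasure lebesgue (E j) \<le> ennreal (2 powr t * k0 powr (t - a) * A * (2 powr (t - a)) ^ j)" .
 qed auto
 also have "\<dots> = ennreal (\<Sum>j. 2 powr t * k0 powr (t - a) * A * (2 powr (t - a)) ^ j)"
 proof (rule suminf_ennreal2)
  have "2 powr (t - a) < (2::real) powr 0" using t by (intro powr_less_mono) auto
  then show "summable (\<lambda>j. 2 powr t * k0 powr (t - a) * A * (2 powr (t - a)) ^ j)"
   by (intro summable_mult summable_geometric) auto
 qed (use A in simp)
 finally have le: "(Leb+ x. ennreal (indicator B x * f x powr t))
  \<le> ennreal (k0 powr t) * emeasure lebesgue B + ennreal (\<Sum>j. 2 powr t * k0 powr (t - a) * A * (2 powr (t - a)) ^ j)"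
  by (simp add: add_left_mono)
 also have "\<dots> < \<infinity>" using B(2) by (simp add: ennreal_mult_less_top del: emeasure_completion)
 finally show ?thesis .
qed

lemma exponent_bounds:
 assumes "1 < p" "p \<le> N" "0 < \<theta>" "N * \<theta> < (1::real)"
 shows "p * \<theta> < 1" "\<theta> < 1"
proof -
 have "p * \<theta> \<le> N * \<theta>" "1 * \<theta> \<le> p * \<theta>" using assms by (auto intro!: mult_right_mono)
 then show "p * \<theta> < 1" "\<theta> < 1" using assms(4) by linarith+
qed

text \<open>The exponent \<open>a\<close> is the one that the recursion reproduces: inserting
  \<open>k powr (- a)\<close> gives the condition
  \<open>(1 - 1 / p) (1 + a) = a (1 - \<theta>)\<close>, which is \<open>id\<close> below. The bound
  propagates along \<open>2^j k0\<close>, and monotonicity fills the gaps.\<close>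

lemma recursion_decay:
 fixes e :: "real \<Rightarrow> real"
 assumes p: "1 < p" and \<theta>: "0 < \<theta>" "p * \<theta> < 1" and k0: "1 \<le> k0"
  and e: "\<And>k. 0 \<le> e k" "\<And>k l. k0 \<le> k \<Longrightarrow> k \<le> l \<Longrightarrow> e l \<le> e k"
  and C: "0 \<le> C" and rec: "\<And>k. k0 \<le> k \<Longrightarrow> e (2 * k) powr (1 - \<theta>) \<le> C * k powr (1 / p - 1) * e k powr (1 - 1 / p)"
 defines "a \<equiv> (p - 1) / (1 - p * \<theta>)"
 shows "\<exists>A\<ge>0. \<forall>k\<ge>k0. e k \<le> A * k powr (- a)"
proof -
 have a: "a > 0" using p \<theta> by (simp add: a_def)
 have th1: "\<theta> < 1"
 proof -
  have "1 * \<theta> \<le> p * \<theta>" using p \<theta>(1) by (intro mult_right_mono) auto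
  then show ?thesis using \<theta>(2) by linarith
 qed
 have g: "0 < 1 / p - \<theta>" using p \<theta> by (simp add: field_simps)
 have id: "(1 - 1 / p) * (1 + a) = a * (1 - \<theta>)"
 proof -
  have "a * (1 - p * \<theta>) = p - 1" using \<theta> by (simp add: a_def)
  then have "a / p - a * \<theta> = 1 - 1 / p" using p by (simp add: field_simps)
  then show ?thesis by (simp add: algebra_simps add_divide_distrib)
 qed
 \<comment> \<open>The first entry starts the induction; the second makes the constant large enough
   to close it, which is possible because the exponent of \<open>A\<close> on the right side of the
   recursion is smaller by \<open>1 / p - \<theta> > 0\<close>. The 1 ensures positivity.\<close>
 define A where "A = max (e k0 * k0 powr a) ((C * 2 powr (a * (1 - \<theta>))) powr (1 / (1 / p - \<theta>))) + 1"
 have A: "A > 0" "e k0 * k0 powr a \<le> A" "(C * 2 powr (a * (1 - \<theta>))) powr (1 / (1 / p - \<theta>)) \<le> A"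
 proof -
  have "0 \<le> e k0 * k0 powr a" using e(1) by simp
  then show "A > 0" "e k0 * k0 powr a \<le> A" "(C * 2 powr (a * (1 - \<theta>))) powr (1 / (1 / p - \<theta>)) \<le> A"
   unfolding A_def by linarith+
 qed
 have CA: "C * 2 powr (a * (1 - \<theta>)) \<le> A powr (1 / p - \<theta>)"
 proof -
  have "((C * 2 powr (a * (1 - \<theta>))) powr (1 / (1 / p - \<theta>))) powr (1 / p - \<theta>) \<le> A powr (1 / p - \<theta>)"
   using A g by (intro powr_mono2) auto
  moreover have "((C * 2 powr (a * (1 - \<theta>))) powr (1 / (1 / p - \<theta>))) powr (1 / p - \<theta>) = C * 2 powr (a * (1 - \<theta>))"
   using g C by (simp add: powr_powr)
  ultimately show ?thesis by simp
 qed
 have dy: "e (2 ^ j * k0) \<le> A * (2 ^ j * k0) powr (- a)" for j :: nat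
 proof (induction j)
  case 0
  have "e k0 = (e k0 * k0 powr a) * k0 powr (- a)" using k0 by (simp add: mult.assoc flip: powr_add)
  also have "\<dots> \<le> A * k0 powr (- a)" using A by (intro mult_right_mono) auto
  finally show ?case by simp
 next
  case (Suc j)
  define k where "k = 2 ^ j * k0"
  have "1 * k0 \<le> 2 ^ j * k0" using k0 by (intro mult_right_mono) auto
  then have k: "k0 \<le> k" "0 < k" using k0 by (auto simp: k_def)
  have IH: "e k \<le> A * k powr (- a)" using Suc by (simp add: k_def)
  have "e (2 * k) powr (1 - \<theta>) \<le> C * k powr (1 / p - 1) * e k powr (1 - 1 / p)" by (rule rec[OF k(1)])
  also have "\<dots> \<le> C * k powr (1 / p - 1) * (A * k powr (- a)) powr (1 - 1 / p)"
   using C IH e(1) p by (intro mult_left_mono powr_mono2) auto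
  also have "(A * k powr (- a)) powr (1 - 1 / p) = A powr (1 - 1 / p) * k powr (- a * (1 - 1 / p))"
   using A k by (simp add: powr_mult powr_powr)
  also have "C * k powr (1 / p - 1) * (A powr (1 - 1 / p) * k powr (- a * (1 - 1 / p))) = C * A powr (1 - 1 / p) * k powr (- (a * (1 - \<theta>)))"
  proof -
   have "k powr (1 / p - 1) * k powr (- a * (1 - 1 / p)) = k powr (- ((1 - 1 / p) * (1 + a)))"
   proof -
    have "1 / p - 1 + - a * (1 - 1 / p) = - ((1 - 1 / p) * (1 + a))" by (simp add: algebra_simps add_divide_distrib)
    then show ?thesis by (simp only: powr_add[symmetric])
   qed
   then show ?thesis unfolding id by (simp add: ac_simps)
  qed
  also have "\<dots> = (C * 2 powr (a * (1 - \<theta>))) * A powr (1 - 1 / p) * (2 * k) powr (- (a * (1 - \<theta>)))"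
   using k by (simp add: powr_mult powr_minus)
  also have "\<dots> \<le> A powr (1 / p - \<theta>) * A powr (1 - 1 / p) * (2 * k) powr (- (a * (1 - \<theta>)))"
   using CA by (intro mult_right_mono) auto
  also have "\<dots> = (A * (2 * k) powr (- a)) powr (1 - \<theta>)"
  proof -
   have "A powr (1 / p - \<theta>) * A powr (1 - 1 / p) = A powr (1 - \<theta>)" by (simp flip: powr_add)
   then show ?thesis using A k by (simp add: powr_mult powr_powr)
  qed
  finally have le: "e (2 * k) powr (1 - \<theta>) \<le> (A * (2 * k) powr (- a)) powr (1 - \<theta>)" .
  have "e (2 * k) \<le> A * (2 * k) powr (- a)"
  proof (rule ccontr)
   assume "\<not> e (2 * k) \<le> A * (2 * k) powr (- a)"
   then have "(A * (2 * k) powr (- a)) powr (1 - \<theta>) < e (2 * k) powr (1 - \<theta>)"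
    using th1 A by (intro powr_less_mono2) auto
   with le show False by simp
  qed
  then show ?case by (simp add: k_def mult.assoc)
 qed
 \<comment> \<open>A general \<open>k\<close> lies between some \<open>2^j k0\<close> and its
   double; falling back to the lower point costs the factor \<open>2 powr a\<close>.\<close>
 have "e k \<le> (A * 2 powr a) * k powr (- a)" if k: "k0 \<le> k" for k
 proof -
  obtain n where "k / k0 < 2 ^ n" using real_arch_pow[of 2 "k / k0"] by auto
  then have ex: "\<exists>n. k < 2 ^ n * k0" using k0 by (auto simp: field_simps)
  define n where "n = (LEAST n. k < 2 ^ n * k0)"
  have n: "k < 2 ^ n * k0" unfolding n_def using ex by (rule LeastI_ex)
  then obtain j where j: "n = Suc j" using k by (cases n) auto
  have "\<not> k < 2 ^ j * k0" using not_less_Least[of j "\<lambda>n. k < 2 ^ n * k0"] j by (simp add: n_def)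
  then have jk: "2 ^ j * k0 \<le> k" by simp
  have "1 * k0 \<le> 2 ^ j * k0" using k0 by (intro mult_right_mono) auto
  then have jk0: "k0 \<le> 2 ^ j * k0" by simp
  have "e k \<le> e (2 ^ j * k0)" by (rule e(2)[OF jk0 jk])
  also have "\<dots> \<le> A * (2 ^ j * k0) powr (- a)" by (rule dy)
  also have "\<dots> \<le> A * (k / 2) powr (- a)"
   using A a n j k k0 by (intro mult_left_mono powr_mono2') auto
  also have "(k / 2) powr (- a) = 2 powr a * k powr (- a)" using k k0 by (simp add: powr_divide powr_minus field_simps)
  finally show ?thesis by (simp add: mult.assoc)
 qed
 then show ?thesis using A by (intro exI[of _ "A * 2 powr a"]) auto
qed


text \<open>For \<open>f = T_2k(u) - T_k(u)\<close> the Sobolev inequality is applied with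
  \<open>E\<close> the set \<open>\<bar>f\<bar> \<ge> k\<close>, which contains the level set at
  \<open>2 * k\<close> up to a null set. Beyond \<open>k0\<close> the function \<open>f\<close>
  vanishes on at least half the ball, so the double integral of its differences is at least a
  multiple of \<open>k\<close> times the volume of \<open>E\<close>. The gradient of
  \<open>f\<close> lives on the level set at \<open>k\<close> and its energy is at most
  \<open>C * (2 * k)\<close>; this gives the hypothesis of \<open>recursion_decay\<close>.\<close>

theorem level_set_decay:
 fixes g :: "'a::euclidean_space \<Rightarrow> 'a" and u :: "'a \<Rightarrow> ereal" and a :: 'a
 defines "gk \<equiv> \<lambda>k x. if \<bar>u x\<bar> \<le> ereal k then g x else 0"
 assumes \<Omega>: "open \<Omega>" and r: "0 < r" and B\<Omega>: "ball a r \<subseteq> \<Omega>"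
  and um: "u \<in> lmeas" and fin: "ae_on \<Omega> (\<lambda>x. \<bar>u x\<bar> \<noteq> \<infinity>)"
  and w: "\<And>k. 0 < k \<Longrightarrow> weak_gradient \<Omega> (\<lambda>x. trunc k (u x)) (gk k)"
  and C: "0 \<le> C" and en: "\<And>k. 0 < k \<Longrightarrow> (Leb+ x. ennreal (indicator (ball a r) x * norm (gk k x) powr p)) \<le> ennreal (C * k)"
  and p: "1 < p" "p \<le> real DIM('a)" and \<theta>: "0 < \<theta>" "real DIM('a) * \<theta> < 1"
 shows "\<exists>k0\<ge>1. \<exists>A\<ge>0. \<forall>k\<ge>k0. emeasure lebesgue {x \<in> ball a r. ereal k \<le> \<bar>u x\<bar>} \<le> ennreal (A * k powr (- ((p - 1) / (1 - p * \<theta>))))"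
proof -
 define B where "B = ball a r"
 define EE where "EE k = {x \<in> B. ereal k \<le> \<bar>u x\<bar>}" for k
 define e where "e k = measure lebesgue (EE k)" for k
 note [measurable] = um
 have Bm[measurable]: "B \<in> sets borel" by (simp add: B_def)
 have Bl[measurable]: "B \<in> sets lebesgue" by simp
 have EEm[measurable]: "EE k \<in> sets lebesgue" for k
 proof -
  have "{x \<in> space lebesgue. x \<in> B \<and> ereal k \<le> \<bar>u x\<bar>} \<in> sets lebesgue" by measurable
  then show ?thesis by (simp add: EE_def)
 qed
 have Bfin: "emeasure lebesgue B < \<infinity>"
  using emeasure_lborel_ball_finite[of a r] by (simp add: B_def less_top)
 have EEle: "emeasure lebesgue (EE k) \<le> emeasure lebesgue B" for k
  by (rule emeasure_mono) (auto simp: EE_def)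
 have EEfin: "emeasure lebesgue (EE k) < \<infinity>" for k using EEle[of k] Bfin by (rule order_le_less_trans)
 have eEE: "emeasure lebesgue (EE k) = ennreal (e k)" for k
  unfolding e_def by (rule emeasure_eq_ennreal_measure) (use EEfin[of k] in auto)
 have e0: "0 \<le> e k" for k by (simp add: e_def)
 have emono: "e l \<le> e k" if "k \<le> l" for k l
 proof -
  have "emeasure lebesgue (EE l) \<le> emeasure lebesgue (EE k)"
  proof (rule emeasure_mono)
   show "EE l \<subseteq> EE k" using that by (auto simp: EE_def intro: order_trans[of "ereal k" "ereal l"])
  qed simp
  then show ?thesis unfolding eEE using e0[of k] by (simp add: ennreal_le_iff)
 qed
 define b where "b = measure lborel B"
 have b: "0 < b" unfolding b_def B_def using r by (rule content_ball_pos)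
 have eB: "emeasure lborel B = ennreal b"
  unfolding b_def by (rule emeasure_eq_ennreal_measure) (use Bfin in auto)
 \<comment> \<open>Since \<open>u\<close> is finite almost everywhere, the level sets shrink to a
   null set; this provides the \<open>k0\<close> from which on they occupy less than half of the
   ball.\<close>
 have "(\<lambda>n. measure lebesgue (EE (real n))) \<longlonglongrightarrow> measure lebesgue (\<Inter>n. EE (real n))"
 proof (rule Lim_measure_decseq)
  show "decseq (\<lambda>n. EE (real n))" by (auto simp: decseq_def EE_def intro: order_trans[rotated])
  show "emeasure lebesgue (EE (real n)) \<noteq> \<infinity>" for n using EEfin[of n] by simp
 qed auto
 moreover have "measure lebesgue (\<Inter>n. EE (real n)) = 0"
 proof -
  have "AE x in lebesgue. x \<notin> (\<Inter>n. EE (real n))" using fin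
  proof eventually_elim
   case (elim x)
   show ?case
   proof
    assume x: "x \<in> (\<Inter>n. EE (real n))"
    then have xB: "x \<in> \<Omega>" using B\<Omega> by (auto simp: EE_def B_def)
    obtain t where "\<bar>u x\<bar> = ereal t" using elim xB by (cases "\<bar>u x\<bar>") auto
    moreover obtain n where "t < real n" using reals_Archimedean2 by blast
    moreover have "ereal (real n) \<le> \<bar>u x\<bar>" using x by (auto simp: EE_def)
    ultimately show False by simp
   qed
  qed
  moreover have "(\<Inter>n. EE (real n)) \<in> sets lebesgue" by (intro sets.countable_INT') auto
  ultimately have "(\<Inter>n. EE (real n)) \<in> null_sets lebesgue" using AE_iff_null_sets by blast
  then show ?thesis by (simp add: measure_def null_sets_def del: emeasure_completion)
 qed
 ultimately have "(\<lambda>n. e (real n)) \<longlonglongrightarrow> 0" by (simp add: e_def)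
 then have "\<forall>\<^sub>F n in sequentially. e (real n) < b / 2" using b by (intro order_tendstoD(2)) auto
 then obtain n0 where n0: "\<And>n. n \<ge> n0 \<Longrightarrow> e (real n) < b / 2" by (auto simp: eventually_sequentially)
 define k0 where "k0 = real (max n0 1)"
 have k0: "1 \<le> k0" "e k0 < b / 2" using n0[of "max n0 1"] by (auto simp: k0_def)
 define cs where "cs = 2 * r * measure lborel (cball (0::'a) (2 * r)) powr (1 - \<theta>) / (1 - real DIM('a) * \<theta>)"
 have cs: "0 \<le> cs" using r \<theta> by (simp add: cs_def)
 note p\<theta> = exponent_bounds(1)[OF p \<theta>]
 note th1 = exponent_bounds(2)[OF p \<theta>]
 define C' where "C' = 2 * cs * (1 + 2 * C) / b"
 have C': "0 \<le> C'" using cs C b by (simp add: C'_def)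
 have rec: "e (2 * k) powr (1 - \<theta>) \<le> C' * k powr (1 / p - 1) * e k powr (1 - 1 / p)" if kk0: "k0 \<le> k" for k
 proof -
  have k: "0 < k" "0 < 2 * k" using kk0 k0 by auto
  have ek: "e k \<le> b / 2" using emono[OF kk0] k0 by simp
  define f where "f x = trunc (2 * k) (u x) - trunc k (u x)" for x
  define d where "d x = gk (2 * k) x - gk k x" for x
  have wf: "weak_gradient \<Omega> f d" unfolding f_def d_def by (rule weak_gradient_diff[OF \<Omega> w[OF k(2)] w[OF k(1)]])
  note lf = weak_gradient_loc_int[OF \<Omega> wf]
  obtain f' where f': "f' \<in> bmeas" "ae_on \<Omega> (\<lambda>x. f x = f' x)"
   using loc_int_borel[OF \<Omega> lf(1)] by blast
  obtain \<gamma> where \<gamma>: "\<gamma> \<in> bmeas" "\<And>x. 0 \<le> \<gamma> x" "ae_on \<Omega> (\<lambda>x. norm (d x) = \<gamma> x)" "loc_int \<Omega> \<gamma>"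
   using loc_int_borel_nonneg[OF \<Omega> lf(2)] by blast
  note [measurable] = f'(1) \<gamma>(1)
  have wf': "weak_gradient \<Omega> f' d" by (rule weak_gradient_cong_AE[OF \<Omega> wf f'(2)]) simp
  define E where "E = {x \<in> B. k \<le> \<bar>f' x\<bar>}"
  define Z where "Z = {x \<in> B. f' x = 0}"
  have Em[measurable]: "E \<in> sets borel" unfolding E_def by measurable
  have Zm[measurable]: "Z \<in> sets borel" unfolding Z_def by measurable
  define m where "m = measure lborel E"
  have "emeasure lborel E \<le> emeasure lborel B" by (rule emeasure_mono) (auto simp: E_def)
  then have em: "emeasure lborel E = ennreal m"
   unfolding m_def using eB by (intro emeasure_eq_ennreal_measure) (auto simp: top_unique)
  have m0: "0 \<le> m" by (simp add: m_def)
  have e2m: "e (2 * k) \<le> m"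
  proof -
   have "emeasure lebesgue (EE (2 * k)) \<le> emeasure lebesgue E"
   proof (rule emeasure_mono_AE)
    show "ae_on (EE (2 * k)) (\<lambda>x. x \<in> E)" using f'(2)
    proof eventually_elim
     case (elim x)
     show ?case
     proof
      assume x: "x \<in> EE (2 * k)"
      then have "x \<in> \<Omega>" "\<bar>f x\<bar> = k" using trunc_double(2)[OF k(1), of "u x"] B\<Omega> by (auto simp: EE_def B_def f_def)
      then show "x \<in> E" using elim x by (auto simp: E_def EE_def)
     qed
    qed
   qed simp
   also have "emeasure lebesgue E = ennreal m" using em by simp
   finally show ?thesis unfolding eEE using m0 by (simp add: ennreal_le_iff)
  qed
  \<comment> \<open>Where \<open>\<bar>u\<bar> \<le> k\<close> both truncations agree, so
    \<open>f\<close> vanishes off the level set at \<open>k\<close>, which fills at most half of the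
    ball.\<close>
  have Zge: "ennreal (b / 2) \<le> emeasure lborel Z"
  proof -
   have "emeasure lebesgue B \<le> emeasure lebesgue (Z \<union> EE k)"
   proof (rule emeasure_mono_AE)
    show "ae_on B (\<lambda>x. x \<in> Z \<union> EE k)" using f'(2)
    proof eventually_elim
     case (elim x)
     have "x \<in> Z" if "x \<in> B" "x \<notin> EE k"
     proof -
      have "\<bar>u x\<bar> \<le> ereal k" using that by (auto simp: EE_def)
      then have "f x = 0" using trunc_double(1)[OF k(1)] by (simp add: f_def)
      then show ?thesis using elim that B\<Omega> by (auto simp: Z_def B_def)
     qed
     then show ?case by blast
    qed
   qed auto
   also have "\<dots> \<le> emeasure lebesgue Z + emeasure lebesgue (EE k)" by (rule emeasure_subadditive) auto
   finally have le: "ennreal b \<le> emeasure lborel Z + ennreal (e k)" using eB eEE by simp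
   have "emeasure lborel Z \<le> emeasure lborel B" by (rule emeasure_mono) (auto simp: Z_def)
   then obtain z where z: "emeasure lborel Z = ennreal z" "0 \<le> z" using eB by (cases "emeasure lborel Z") (auto simp: top_unique)
   have "ennreal b \<le> ennreal (z + e k)" using le z e0[of k] by simp
   then have "b \<le> z + e k" using z e0[of k] by (subst (asm) ennreal_le_iff) auto
   then show ?thesis using z ek by (simp add: ennreal_leI)
  qed
  \<comment> \<open>Only pairs with \<open>x\<close> in \<open>E\<close> and \<open>y\<close> in
    \<open>Z\<close> are kept; for them the difference is at least \<open>k\<close>.\<close>
  have low: "ennreal (m * (k * (b / 2))) \<le> (Bor+ x. indicator E x * (Bor+ y. indicator B y * ennreal \<bar>f' y - f' x\<bar>))"
  proof -
   have in1: "ennreal (k * (b / 2)) \<le> (Bor+ y. indicator B y * ennreal \<bar>f' y - f' x\<bar>)" if x: "x \<in> E" for x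
   proof -
    have "ennreal (k * (b / 2)) = ennreal k * ennreal (b / 2)" by (rule ennreal_mult) (use k b in auto)
    also have "\<dots> \<le> ennreal k * emeasure lborel Z" by (intro mult_left_mono Zge) simp
    also have "\<dots> = (Bor+ y. ennreal k * indicator Z y)" by (rule nn_integral_cmult_indicator[symmetric]) simp
    also have "\<dots> \<le> (Bor+ y. indicator B y * ennreal \<bar>f' y - f' x\<bar>)"
    proof (rule nn_integral_mono)
     fix y
     show "ennreal k * indicator Z y \<le> indicator B y * ennreal \<bar>f' y - f' x\<bar>"
      using x by (cases "y \<in> Z") (auto simp: Z_def E_def intro!: ennreal_leI)
    qed
    finally show ?thesis .
   qed
   have "ennreal (m * (k * (b / 2))) = ennreal (k * (b / 2)) * emeasure lborel E"
    unfolding em using m0 k b by (simp add: ennreal_mult[symmetric] mult.commute del: ennreal_mult)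
   also have "\<dots> = (Bor+ x. ennreal (k * (b / 2)) * indicator E x)" by (rule nn_integral_cmult_indicator[symmetric]) simp
   also have "\<dots> \<le> (Bor+ x. indicator E x * (Bor+ y. indicator B y * ennreal \<bar>f' y - f' x\<bar>))"
   proof (rule nn_integral_mono)
    fix x
    show "ennreal (k * (b / 2)) * indicator E x \<le> indicator E x * (Bor+ y. indicator B y * ennreal \<bar>f' y - f' x\<bar>)"
     using in1[of x] by (cases "x \<in> E") auto
   qed
   finally show ?thesis .
  qed
  show ?thesis
  \<comment> \<open>The parameter \<open>l\<close> below divides by \<open>e k\<close>.\<close>
  proof (cases "e k = 0")
   case True
   then have "e (2 * k) = 0" using emono[of k "2 * k"] e0[of "2 * k"] k by simp
   then show ?thesis using C' by simp
  next
   case False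
   then have ekp: "0 < e k" using e0[of k] by simp
   \<comment> \<open>Hoelder's inequality through \<open>powr_le_eps\<close>: on the level set the
     norm of the gradient is at most \<open>l\<close> plus \<open>l powr (1 - p)\<close> times its
     \<open>p\<close>-th power. This \<open>l\<close> balances the two terms, both becoming
     multiples of \<open>Q\<close>.\<close>
   define l where "l = (k / e k) powr (1 / p)"
   have l: "0 < l" using k ekp by (simp add: l_def)
   define Q where "Q = k powr (1 / p) * e k powr (1 - 1 / p)"
   have Q0: "0 \<le> Q" by (simp add: Q_def)
   have Q1: "l * e k = Q"
   proof -
    have "l * e k = k powr (1 / p) * (e k powr 1 / e k powr (1 / p))" using k ekp by (simp add: l_def powr_divide)
    moreover have "e k powr 1 / e k powr (1 / p) = e k powr (1 - 1 / p)" by (rule powr_diff[symmetric])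
    ultimately show ?thesis by (simp only: Q_def)
   qed
   have Q2: "l powr (1 - p) * k = Q"
   proof -
    have lp: "l powr p = k / e k" using k ekp p by (simp add: l_def powr_powr)
    have "l powr (1 - p) = l / l powr p" using l by (simp add: powr_diff)
    then have "l powr (1 - p) = l * e k / k" unfolding lp using k ekp by simp
    then show ?thesis using Q1 k by simp
   qed
   have dle: "norm (d x) \<le> indicator {x. ereal k \<le> \<bar>u x\<bar>} x * norm (gk (2 * k) x)" for x
   proof (cases "\<bar>u x\<bar> \<le> ereal k")
    case True
    then have "\<bar>u x\<bar> \<le> ereal (2 * k)" using k by (auto intro: order_trans)
    then have "d x = 0" using True by (simp add: d_def gk_def)
    then show ?thesis by simp
   next
    case False
    then have "ereal k \<le> \<bar>u x\<bar>" by auto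
    then show ?thesis using False by (simp add: d_def gk_def)
   qed
   have enm[measurable]: "(\<lambda>x. ennreal (indicator B x * norm (gk (2 * k) x) powr p)) \<in> lmeas"
   proof -
    have [measurable]: "(\<lambda>x. indicator \<Omega> x *\<^sub>R gk (2 * k) x) \<in> lmeas"
     by (rule loc_int_measurable[OF \<Omega> weak_gradient_loc_int(2)[OF \<Omega> w[OF k(2)]]])
    have m: "(\<lambda>x. ennreal (indicator B x * norm (indicator \<Omega> x *\<^sub>R gk (2 * k) x) powr p)) \<in> lmeas" by measurable
    have eq: "(\<lambda>x. ennreal (indicator B x * norm (indicator \<Omega> x *\<^sub>R gk (2 * k) x) powr p)) = (\<lambda>x. ennreal (indicator B x * norm (gk (2 * k) x) powr p))"
    proof
     fix x
     show "ennreal (indicator B x * norm (indicator \<Omega> x *\<^sub>R gk (2 * k) x) powr p) = ennreal (indicator B x * norm (gk (2 * k) x) powr p)"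
      using B\<Omega> by (cases "x \<in> B") (auto simp: B_def)
    qed
    show ?thesis using m unfolding eq .
   qed
   have "(Bor+ x. indicator B x * ennreal (\<gamma> x)) = (Leb+ x. indicator B x * ennreal (\<gamma> x))"
    by (simp add: nn_integral_completion)
   also have "\<dots> \<le> (Leb+ x. ennreal l * indicator (EE k) x + ennreal (l powr (1 - p)) * ennreal (indicator B x * norm (gk (2 * k) x) powr p))"
   proof (rule nn_integral_mono_AE)
    show "AE x in lebesgue. indicator B x * ennreal (\<gamma> x) \<le> ennreal l * indicator (EE k) x + ennreal (l powr (1 - p)) * ennreal (indicator B x * norm (gk (2 * k) x) powr p)"
     using \<gamma>(3)
    proof eventually_elim
     case (elim x)
     show ?case
     proof (cases "x \<in> EE k")
      case True
      then have xB: "x \<in> B" "x \<in> \<Omega>" using B\<Omega> by (auto simp: EE_def B_def)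
      have "\<gamma> x \<le> norm (gk (2 * k) x)" using dle[of x] elim xB True by (simp add: EE_def)
      also have "\<dots> \<le> l + l powr (1 - p) * norm (gk (2 * k) x) powr p"
       using powr_le_eps[of "norm (gk (2 * k) x)" 1 p l] p l by simp
      finally have "ennreal (\<gamma> x) \<le> ennreal (l + l powr (1 - p) * norm (gk (2 * k) x) powr p)" by (rule ennreal_leI)
      also have "\<dots> = ennreal l + ennreal (l powr (1 - p)) * ennreal (norm (gk (2 * k) x) powr p)"
       using l by (simp add: ennreal_mult)
      finally show ?thesis using True xB by simp
     next
      case False
      then have "x \<in> B \<Longrightarrow> \<gamma> x = 0" using dle[of x] elim B\<Omega> by (auto simp: EE_def B_def)
      then show ?thesis by (cases "x \<in> B") auto
     qed
    qed
   qed
   also have "\<dots> = (Leb+ x. ennreal l * indicator (EE k) x) + (Leb+ x. ennreal (l powr (1 - p)) * ennreal (indicator B x * norm (gk (2 * k) x) powr p))"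
    by (intro nn_integral_add borel_measurable_times_ennreal[OF borel_measurable_const enm]) measurable
   also have "(Leb+ x. ennreal l * indicator (EE k) x) = ennreal l * ennreal (e k)"
    unfolding eEE[symmetric] by (rule nn_integral_cmult_indicator) simp
   also have "(Leb+ x. ennreal (l powr (1 - p)) * ennreal (indicator B x * norm (gk (2 * k) x) powr p))
    \<le> ennreal (l powr (1 - p)) * ennreal (C * (2 * k))"
   proof -
    have "(Leb+ x. ennreal (l powr (1 - p)) * ennreal (indicator B x * norm (gk (2 * k) x) powr p))
     = ennreal (l powr (1 - p)) * (Leb+ x. ennreal (indicator B x * norm (gk (2 * k) x) powr p))"
     by (rule nn_integral_cmult[OF enm])
    then show ?thesis using en[OF k(2)] by (simp add: B_def mult_left_mono)
   qed
   also have "ennreal l * ennreal (e k) + ennreal (l powr (1 - p)) * ennreal (C * (2 * k)) = ennreal (l * e k + l powr (1 - p) * (C * (2 * k)))"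
    using l ekp C k by (simp add: ennreal_mult[symmetric] ennreal_plus[symmetric] del: ennreal_plus)
   also have "l * e k + l powr (1 - p) * (C * (2 * k)) = (1 + 2 * C) * Q"
   proof -
    have "l powr (1 - p) * (C * (2 * k)) = 2 * C * (l powr (1 - p) * k)" by simp
    then show ?thesis unfolding Q1 Q2 by (simp add: distrib_right)
   qed
   finally have \<gamma>int: "(Bor+ x. indicator B x * ennreal (\<gamma> x)) \<le> ennreal ((1 + 2 * C) * Q)" by (simp add: add_left_mono)
   have \<gamma>g: "ae_on \<Omega> (\<lambda>x. norm (d x) \<le> \<gamma> x)" using \<gamma>(3) by eventually_elim auto
   have EB: "E \<subseteq> ball a r" by (auto simp: E_def B_def)
   have "ennreal (m * (k * (b / 2))) \<le> ennreal (cs * m powr \<theta>) * (Bor+ x. indicator B x * ennreal (\<gamma> x))"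
    using low ball_sobolev[OF \<Omega> B\<Omega> r wf' f'(1) \<gamma>(1,2,4) \<gamma>g Em EB \<theta>] unfolding cs_def m_def B_def by (rule order_trans)
   also have "\<dots> \<le> ennreal (cs * m powr \<theta>) * ennreal ((1 + 2 * C) * Q)" by (intro mult_left_mono \<gamma>int) simp
   also have "\<dots> = ennreal (cs * m powr \<theta> * ((1 + 2 * C) * Q))" using cs C Q0 by (intro ennreal_mult[symmetric]) auto
   finally have le: "m * (k * (b / 2)) \<le> cs * m powr \<theta> * ((1 + 2 * C) * Q)"
    using cs C Q0 by (subst (asm) ennreal_le_iff) auto
   have "m powr (1 - \<theta>) \<le> C' * k powr (1 / p - 1) * e k powr (1 - 1 / p)"
   proof (cases "m = 0")
    case True
    then show ?thesis using C' by simp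
   next
    case False
    then have m: "0 < m" using m0 by simp
    have "m powr (1 - \<theta>) * (m powr \<theta> * (k * (b / 2))) = m * (k * (b / 2))" using m by (simp flip: powr_add mult.assoc)
    also have "\<dots> \<le> (cs * ((1 + 2 * C) * Q)) * m powr \<theta>" using le by (simp add: ac_simps)
    also have "\<dots> = (C' * (Q / k)) * (m powr \<theta> * (k * (b / 2)))" using b k by (simp add: C'_def)
    finally have "m powr (1 - \<theta>) \<le> C' * (Q / k)" by (rule mult_right_le_imp_le) (use m k b in auto)
    moreover have "Q / k = k powr (1 / p - 1) * e k powr (1 - 1 / p)" using k by (simp add: Q_def powr_diff)
    ultimately show ?thesis by (simp add: mult.assoc)
   qed
   moreover have "e (2 * k) powr (1 - \<theta>) \<le> m powr (1 - \<theta>)" using e2m e0 th1 by (intro powr_mono2) auto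
   ultimately show ?thesis by simp
  qed
 qed
 obtain A where A: "0 \<le> A" "\<And>k. k0 \<le> k \<Longrightarrow> e k \<le> A * k powr (- ((p - 1) / (1 - p * \<theta>)))"
  using recursion_decay[OF p(1) \<theta>(1) p\<theta> k0(1) e0 emono C' rec] by blast
 show ?thesis
 proof (intro exI conjI allI impI)
  fix k assume "k0 \<le> k"
  then show "emeasure lebesgue {x \<in> ball a r. ereal k \<le> \<bar>u x\<bar>} \<le> ennreal (A * k powr (- ((p - 1) / (1 - p * \<theta>))))"
   using A(2)[of k] eEE[of k] by (simp add: EE_def B_def ennreal_leI)
 qed (fact k0 A)+
qed

section \<open>From the energy bound to local integrability of powers\<close>

lemma compact_integral_finite:
 assumes \<Omega>: "open \<Omega>" and f: "f \<in> lmeas" "\<And>x. 0 \<le> f x"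
  and fin: "\<And>a r. 0 < r \<Longrightarrow> cball a r \<subseteq> \<Omega> \<Longrightarrow> (Leb+ x. ennreal (indicator (ball a r) x * f x)) < \<infinity>"
  and K: "compact K" "K \<subseteq> \<Omega>"
 shows "(Leb+ x. ennreal (indicator K x * f x)) < \<infinity>"
proof -
 have "\<forall>x\<in>K. \<exists>r>0. cball x r \<subseteq> \<Omega>" using \<Omega> K(2) by (meson open_contains_cball subsetD)
 then obtain r where r: "\<And>x. x \<in> K \<Longrightarrow> 0 < r x" "\<And>x. x \<in> K \<Longrightarrow> cball x (r x) \<subseteq> \<Omega>" by metis
 have "K \<subseteq> (\<Union>x\<in>K. ball x (r x))" using r(1) by auto
 then obtain T where T: "T \<subseteq> K" "finite T" "K \<subseteq> (\<Union>x\<in>T. ball x (r x))"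
  using compactE_image[OF K(1), of K "\<lambda>x. ball x (r x)"] by auto
 note [measurable] = f(1)
 have "(Leb+ x. ennreal (indicator K x * f x)) \<le> (Leb+ x. (\<Sum>c\<in>T. ennreal (indicator (ball c (r c)) x * f x)))"
 proof (rule nn_integral_mono)
  fix x
  show "ennreal (indicator K x * f x) \<le> (\<Sum>c\<in>T. ennreal (indicator (ball c (r c)) x * f x))"
  proof (cases "x \<in> K")
   case True
   then obtain c where c: "c \<in> T" "x \<in> ball c (r c)" using T(3) by auto
   have "ennreal (indicator K x * f x) = ennreal (indicator (ball c (r c)) x * f x)" using True c by simp
   also have "\<dots> \<le> (\<Sum>c\<in>T. ennreal (indicator (ball c (r c)) x * f x))" by (rule member_le_sum[OF c(1) _ T(2)]) simp
   finally show ?thesis .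
  qed simp
 qed
 also have "\<dots> = (\<Sum>c\<in>T. (Leb+ x. ennreal (indicator (ball c (r c)) x * f x)))"
 proof (rule nn_integral_sum)
  fix c
  have [measurable]: "ball c (r c) \<in> sets lebesgue" by simp
  show "(\<lambda>x. ennreal (indicator (ball c (r c)) x * f x)) \<in> lmeas" by measurable
 qed
 also have "\<dots> < \<infinity>" using fin r T(1) by (subst infinity_ennreal_def, subst ennreal_sum_less_top) (use T(2) in auto)
 finally show ?thesis .
qed

lemma nn_integral_powr_finite:
 fixes f :: "'a::euclidean_space \<Rightarrow> 'b::euclidean_space"
 assumes f: "f \<in> lmeas" and K: "compact K" and ab: "0 < a" "a \<le> b"
  and fin: "(Leb+ x. ennreal (indicator K x * norm (f x) powr b)) < \<infinity>"
 shows "(Leb+ x. ennreal (indicator K x * norm (f x) powr a)) < \<infinity>"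
proof -
 note [measurable] = f compact_sets_lebesgue[OF K]
 have "(Leb+ x. ennreal (indicator K x * norm (f x) powr a)) \<le> (Leb+ x. indicator K x + ennreal (indicator K x * norm (f x) powr b))"
 proof (rule nn_integral_mono)
  fix x
  have "norm (f x) powr a \<le> 1 + norm (f x) powr b" using powr_le_eps[of "norm (f x)" a b 1] ab by simp
  then have "ennreal (norm (f x) powr a) \<le> ennreal (1 + norm (f x) powr b)" by (rule ennreal_leI)
  then have "ennreal (norm (f x) powr a) \<le> 1 + ennreal (norm (f x) powr b)" by simp
  then show "ennreal (indicator K x * norm (f x) powr a) \<le> indicator K x + ennreal (indicator K x * norm (f x) powr b)"
   by (cases "x \<in> K") auto
 qed
 also have "\<dots> = emeasure lebesgue K + (Leb+ x. ennreal (indicator K x * norm (f x) powr b))"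
  by (subst nn_integral_add) (auto simp del: emeasure_completion)
 also have "\<dots> < \<infinity>" using fin emeasure_compact_finite[OF K] borel_compact[OF K] by simp
 finally show ?thesis .
qed

lemma in_Lp_locI:
 assumes f: "f \<in> lmeas"
  and fin: "\<And>K. compact K \<Longrightarrow> K \<subseteq> \<Omega> \<Longrightarrow> (Leb+ x. ennreal (indicator K x * norm (f x) powr s)) < \<infinity>"
 shows "in_Lp_loc s \<Omega> f"
 unfolding in_Lp_loc_def
proof (intro allI impI, elim conjE)
 fix K :: "'a set" assume K: "compact K" "K \<subseteq> \<Omega>"
 have Km[measurable]: "K \<in> sets lebesgue" using K(1) by (rule compact_sets_lebesgue)
 note [measurable] = f
 have "integrable lebesgue (\<lambda>x. indicator K x * norm (f x) powr s)"
  using fin[OF K] by (intro integrableI_nonneg) auto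
 then show "in_Lp s K f" unfolding in_Lp_iff[OF Km] by simp
qed

text \<open>As \<open>\<theta>\<close> tends to \<open>1 / N\<close>, the decay exponent
  \<open>a = (p - 1) / (1 - p \<theta>)\<close> of the level sets of \<open>u\<close> tends to
  \<open>(p - 1) N / (N - p)\<close>, or to infinity if \<open>p = N\<close>, and that of the
  gradient, \<open>b = (p - 1) / (1 - \<theta>)\<close>, to \<open>(p - 1) N / (N - 1)\<close>.
  These are the ends of the admissible ranges, which are open, so some
  \<open>\<theta> < 1 / N\<close> serves each exponent.\<close>

theorem energy_integrability:
 fixes g :: "'a::euclidean_space \<Rightarrow> 'a" and u :: "'a \<Rightarrow> ereal"
 defines "gk \<equiv> \<lambda>k x. if \<bar>u x\<bar> \<le> ereal k then g x else 0"
 assumes \<Omega>: "open \<Omega>"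
  and um: "u \<in> lmeas" and fin: "ae_on \<Omega> (\<lambda>x. \<bar>u x\<bar> \<noteq> \<infinity>)"
  and gm: "g \<in> lmeas"
  and w: "\<And>k. 0 < k \<Longrightarrow> weak_gradient \<Omega> (\<lambda>x. trunc k (u x)) (gk k)"
  and en: "\<And>K. compact K \<Longrightarrow> K \<subseteq> \<Omega> \<Longrightarrow> \<exists>C\<ge>0. \<forall>k>0. (Leb+ x. ennreal (indicator K x * norm (gk k x) powr p)) \<le> ennreal (C * k)"
  and p: "1 < p" "p \<le> real DIM('a)"
 shows "1 \<le> s \<Longrightarrow> (p < real DIM('a) \<longrightarrow> s < real DIM('a) / (real DIM('a) - p)) \<Longrightarrow>
   in_Lp_loc s \<Omega> (\<lambda>x. real_of_ereal \<bar>u x\<bar> powr (p - 1))"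
  and "1 \<le> t \<Longrightarrow> t < real DIM('a) / (real DIM('a) - 1) \<Longrightarrow> in_Lp_loc t \<Omega> (\<lambda>x. norm (g x) powr (p - 1))"
proof -
 note [measurable] = um gm
 let ?N = "real DIM('a)"
 have N: "1 < ?N" using p by linarith
 have [measurable]: "ball c r \<in> sets lebesgue" for c :: 'a and r by simp
 have ball: "\<exists>C\<ge>0. \<forall>k>0. (Leb+ x. ennreal (indicator (ball a r) x * norm (gk k x) powr p)) \<le> ennreal (C * k)"
  if ar: "cball a r \<subseteq> \<Omega>" for a r
 proof -
  obtain C where C: "0 \<le> C" "\<And>k. 0 < k \<Longrightarrow> (Leb+ x. ennreal (indicator (cball a r) x * norm (gk k x) powr p)) \<le> ennreal (C * k)"
   using en[OF compact_cball ar] by metis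
  have "(Leb+ x. ennreal (indicator (ball a r) x * norm (gk k x) powr p)) \<le> (Leb+ x. ennreal (indicator (cball a r) x * norm (gk k x) powr p))" for k
   by (rule nn_integral_mono) (auto simp: indicator_def intro!: ennreal_leI)
  then show ?thesis using C order_trans by blast
 qed
 have decay: "\<exists>k0\<ge>1. \<exists>A\<ge>0. \<forall>k\<ge>k0. emeasure lebesgue {x \<in> ball a r. ereal k \<le> \<bar>u x\<bar>} \<le> ennreal (A * k powr (- ((p - 1) / (1 - p * \<theta>))))"
  if b: "0 < r" "cball a r \<subseteq> \<Omega>" and \<theta>: "0 < \<theta>" "?N * \<theta> < 1" for a r \<theta>
 proof -
  obtain C where C: "0 \<le> C" "\<And>k. 0 < k \<Longrightarrow> (Leb+ x. ennreal (indicator (ball a r) x * norm (gk k x) powr p)) \<le> ennreal (C * k)"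
   using ball[OF b(2)] by blast
  have "ball a r \<subseteq> \<Omega>" using b(2) by auto
  from level_set_decay[OF \<Omega> b(1) this um fin w[unfolded gk_def] C(1) C(2)[unfolded gk_def] p \<theta>] show ?thesis .
 qed
 show "in_Lp_loc s \<Omega> (\<lambda>x. real_of_ereal \<bar>u x\<bar> powr (p - 1))" if s: "1 \<le> s" "p < ?N \<longrightarrow> s < ?N / (?N - p)"
 proof (rule in_Lp_locI)
  fix K :: "'a set" assume K: "compact K" "K \<subseteq> \<Omega>"
  \<comment> \<open>\<open>(p - 1) * s\<close> is below the decay exponent exactly when
    \<open>\<theta>\<close> exceeds \<open>lo\<close>; the hypotheses on \<open>s\<close> put
    \<open>lo\<close> below \<open>1 / N\<close>.\<close>
  define lo where "lo = (1 - 1 / s) / p"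
  have lo0: "0 \<le> lo" using s p by (simp add: lo_def)
  have "lo < 1 / ?N"
  proof -
   have "1 - 1 / s < p / ?N"
   proof (cases "p < ?N")
    case True
    then have "s * (?N - p) < ?N" using s by (simp add: field_simps)
    then have "?N * (1 - 1 / s) < p" using s by (simp add: field_simps)
    then show ?thesis using N by (simp add: field_simps)
   next
    case False
    then have "p / ?N = 1" using p N by simp
    moreover have "1 - 1 / s < 1" using s by simp
    ultimately show ?thesis by linarith
   qed
   then show ?thesis using p N by (simp add: lo_def field_simps)
  qed
  then obtain \<theta> where \<theta>: "lo < \<theta>" "\<theta> < 1 / ?N" using dense by blast
  have \<theta>': "0 < \<theta>" "?N * \<theta> < 1" using \<theta> lo0 N by (auto simp: field_simps)
  note p\<theta> = exponent_bounds(1)[OF p \<theta>']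
  have a: "(p - 1) * s < (p - 1) / (1 - p * \<theta>)"
  proof -
   have "1 - 1 / s < p * \<theta>" using \<theta>(1) p by (simp add: lo_def field_simps)
   then have "s * (1 - p * \<theta>) < 1" using s by (simp add: field_simps)
   then have "s < 1 / (1 - p * \<theta>)" using p\<theta> by (simp add: field_simps)
   then show ?thesis using p mult_strict_left_mono[of s "1 / (1 - p * \<theta>)" "p - 1"] by simp
  qed
  have "(Leb+ x. ennreal (indicator K x * real_of_ereal \<bar>u x\<bar> powr ((p - 1) * s))) < \<infinity>"
  proof (rule compact_integral_finite[OF \<Omega> _ _ _ K])
   fix a r assume b: "0 < r" "cball a r \<subseteq> \<Omega>"
   obtain k0 A where k0: "1 \<le> k0" "0 \<le> A" and
    A: "\<And>k. k0 \<le> k \<Longrightarrow> emeasure lebesgue {x \<in> ball a r. ereal k \<le> \<bar>u x\<bar>} \<le> ennreal (A * k powr (- ((p - 1) / (1 - p * \<theta>))))"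
    using decay[OF b \<theta>'] by blast
   show "(Leb+ x. ennreal (indicator (ball a r) x * real_of_ereal \<bar>u x\<bar> powr ((p - 1) * s))) < \<infinity>"
   proof (rule layer_cake_powr[OF _ _ _ _ _ a _ k0(2)])
    show "emeasure lebesgue (ball a r) < \<infinity>" using emeasure_lborel_ball_finite[of a r] by (simp add: less_top)
    fix k assume k: "k0 \<le> k"
    have "emeasure lebesgue {x \<in> ball a r. k \<le> real_of_ereal \<bar>u x\<bar>} \<le> emeasure lebesgue {x \<in> ball a r. ereal k \<le> \<bar>u x\<bar>}"
    proof (rule emeasure_mono)
     show "{x \<in> ball a r. k \<le> real_of_ereal \<bar>u x\<bar>} \<subseteq> {x \<in> ball a r. ereal k \<le> \<bar>u x\<bar>}"
     proof safe
      fix x assume "k \<le> real_of_ereal \<bar>u x\<bar>"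
      then show "ereal k \<le> \<bar>u x\<bar>" by (cases "u x") auto
     qed
     have "{x \<in> space lebesgue. x \<in> ball a r \<and> ereal k \<le> \<bar>u x\<bar>} \<in> sets lebesgue" by measurable
     then show "{x \<in> ball a r. ereal k \<le> \<bar>u x\<bar>} \<in> sets lebesgue" by simp
    qed
    also note A[OF k]
    finally show "emeasure lebesgue {x \<in> ball a r. k \<le> real_of_ereal \<bar>u x\<bar>} \<le> ennreal (A * k powr (- ((p - 1) / (1 - p * \<theta>))))" .
   qed (use s p k0 in \<open>auto intro: real_of_ereal_pos\<close>)
  qed auto
  then show "(Leb+ x. ennreal (indicator K x * norm (real_of_ereal \<bar>u x\<bar> powr (p - 1)) powr s)) < \<infinity>"
   by (simp add: powr_powr)
 qed measurable
 show "in_Lp_loc t \<Omega> (\<lambda>x. norm (g x) powr (p - 1))" if t: "1 \<le> t" "t < ?N / (?N - 1)"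
 proof (rule in_Lp_locI)
  fix K :: "'a set" assume K: "compact K" "K \<subseteq> \<Omega>"
  have "1 - 1 / t < 1 / ?N"
  proof -
   have "t * (?N - 1) < ?N" using t N by (simp add: field_simps)
   then show ?thesis using t N by (simp add: field_simps)
  qed
  then obtain \<theta> where \<theta>: "1 - 1 / t < \<theta>" "\<theta> < 1 / ?N" using dense by blast
  have "0 \<le> 1 - 1 / t" using t by simp
  then have \<theta>': "0 < \<theta>" "?N * \<theta> < 1" using \<theta> N by (auto simp: field_simps)
  note p\<theta> = exponent_bounds(1)[OF p \<theta>']
  note th1 = exponent_bounds(2)[OF p \<theta>']
  define a where "a = (p - 1) / (1 - p * \<theta>)"
  have a: "0 < a" using p p\<theta> by (simp add: a_def)
  define b where "b = p * a / (a + 1)"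
  have beq: "b = (p - 1) / (1 - \<theta>)"
  proof -
   have "a + 1 = p * (1 - \<theta>) / (1 - p * \<theta>)" using p\<theta> by (simp add: a_def field_simps)
   then show ?thesis using p p\<theta> th1 by (simp add: b_def a_def)
  qed
  have tb: "(p - 1) * t < b"
  proof -
   have "t * (1 - \<theta>) < 1" using \<theta>(1) t by (simp add: field_simps)
   then have "t < 1 / (1 - \<theta>)" using th1 by (simp add: field_simps)
   then show ?thesis unfolding beq using p mult_strict_left_mono[of t "1 / (1 - \<theta>)" "p - 1"] by simp
  qed
  have "(Leb+ x. ennreal (indicator K x * norm (g x) powr ((p - 1) * t))) < \<infinity>"
  proof (rule compact_integral_finite[OF \<Omega> _ _ _ K])
   fix c r assume cr: "0 < r" "cball c r \<subseteq> \<Omega>"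
   obtain k0 A where k0: "1 \<le> k0" "0 \<le> A" and
    A: "\<And>k. k0 \<le> k \<Longrightarrow> emeasure lebesgue {x \<in> ball c r. ereal k \<le> \<bar>u x\<bar>} \<le> ennreal (A * k powr (- a))"
    using decay[OF cr \<theta>'] unfolding a_def by blast
   obtain C where C: "0 \<le> C" "\<And>k. 0 < k \<Longrightarrow> (Leb+ x. ennreal (indicator (ball c r) x * norm (gk k x) powr p)) \<le> ennreal (C * k)"
    using ball[OF cr(2)] by blast
   have AC: "0 \<le> A + C" using k0(2) C(1) by simp
   \<comment> \<open>Chosen so that \<open>l \<ge> l0\<close> corresponds to
     \<open>k \<ge> k0\<close> under the substitution below.\<close>
   define l0 where "l0 = k0 powr ((a + 1) / p)"
   have l0: "0 < l0" using k0 by (simp add: l0_def)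
   show "(Leb+ x. ennreal (indicator (ball c r) x * norm (g x) powr ((p - 1) * t))) < \<infinity>"
   proof (rule layer_cake_powr[OF _ _ _ _ _ tb l0 AC])
    show "emeasure lebesgue (ball c r) < \<infinity>" using emeasure_lborel_ball_finite[of c r] by (simp add: less_top)
    fix l assume l: "l0 \<le> l"
    have lp: "0 < l" using l l0 by simp
    \<comment> \<open>A point with a large gradient either has \<open>\<bar>u\<bar> \<ge> k\<close>
      or lies in the region where the energy of the truncation controls it by Chebyshev's
      inequality. This \<open>k\<close> balances the two bounds \<open>k powr (- a)\<close> and
      \<open>l powr (- p) * k\<close>; both equal \<open>l powr (- b)\<close>.\<close>
    define k where "k = l powr (p / (a + 1))"
    have k: "0 < k" using lp by (simp add: k_def)
    have kk0: "k0 \<le> k"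
    proof -
     have "l0 powr (p / (a + 1)) \<le> k" unfolding k_def using l l0 p a by (intro powr_mono2) auto
     moreover have "l0 powr (p / (a + 1)) = k0" using k0 p a by (simp add: l0_def powr_powr)
     ultimately show ?thesis by simp
    qed
    define E1 where "E1 = {x \<in> ball c r. ereal k \<le> \<bar>u x\<bar>}"
    define E2 where "E2 = {x \<in> ball c r. \<bar>u x\<bar> \<le> ereal k \<and> l \<le> norm (g x)}"
    have "{x \<in> space lebesgue. x \<in> ball c r \<and> ereal k \<le> \<bar>u x\<bar>} \<in> sets lebesgue"
     "{x \<in> space lebesgue. x \<in> ball c r \<and> \<bar>u x\<bar> \<le> ereal k \<and> l \<le> norm (g x)} \<in> sets lebesgue" by measurable
    then have E12[measurable]: "E1 \<in> sets lebesgue" "E2 \<in> sets lebesgue" by (simp_all add: E1_def E2_def)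
    have E2: "emeasure lebesgue E2 \<le> ennreal (C * (l powr (- p) * k))"
    proof -
     have "ennreal (l powr p) * emeasure lebesgue E2 = (Leb+ x. ennreal (l powr p) * indicator E2 x)"
      by (rule nn_integral_cmult_indicator[symmetric]) simp
     also have "\<dots> \<le> (Leb+ x. ennreal (indicator (ball c r) x * norm (gk k x) powr p))"
     proof (rule nn_integral_mono)
      fix x
      show "ennreal (l powr p) * indicator E2 x \<le> ennreal (indicator (ball c r) x * norm (gk k x) powr p)"
       using lp p by (cases "x \<in> E2") (auto simp: E2_def gk_def intro!: ennreal_leI powr_mono2)
     qed
     also have "\<dots> \<le> ennreal (C * k)" by (rule C(2)[OF k])
     finally have "ennreal (l powr (- p)) * (ennreal (l powr p) * emeasure lebesgue E2) \<le> ennreal (l powr (- p)) * ennreal (C * k)"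
      by (intro mult_left_mono) auto
     moreover have "ennreal (l powr (- p)) * (ennreal (l powr p) * emeasure lebesgue E2) = emeasure lebesgue E2"
      using lp by (simp add: mult.assoc[symmetric] ennreal_mult[symmetric] powr_add[symmetric] del: ennreal_mult emeasure_completion)
     moreover have "ennreal (l powr (- p)) * ennreal (C * k) = ennreal (C * (l powr (- p) * k))"
      using C(1) k by (simp add: ennreal_mult[symmetric] ac_simps del: ennreal_mult)
     ultimately show ?thesis by simp
    qed
    have x1: "k powr (- a) = l powr (- b)" by (simp add: k_def powr_powr b_def)
    have x2: "l powr (- p) * k = l powr (- b)"
    proof -
     have "- p + p / (a + 1) = - b" using a by (simp add: b_def field_simps)
     then show ?thesis by (simp add: k_def powr_add[symmetric])
    qed
    have "emeasure lebesgue {x \<in> ball c r. l \<le> norm (g x)} \<le> emeasure lebesgue (E1 \<union> E2)"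
    proof (rule emeasure_mono)
     show "{x \<in> ball c r. l \<le> norm (g x)} \<subseteq> E1 \<union> E2" by (auto simp: E1_def E2_def)
    qed measurable
    also have "\<dots> \<le> emeasure lebesgue E1 + emeasure lebesgue E2" by (rule emeasure_subadditive) auto
    also have "\<dots> \<le> ennreal (A * l powr (- b)) + ennreal (C * l powr (- b))"
     using A[OF kk0] E2 unfolding x1 x2 E1_def by (rule add_mono)
    also have "\<dots> = ennreal ((A + C) * l powr (- b))"
     using k0(2) C(1) by (simp add: distrib_right)
    finally show "emeasure lebesgue {x \<in> ball c r. l \<le> norm (g x)} \<le> ennreal ((A + C) * l powr (- b))" .
   qed (use t p in auto)
  qed auto
  then show "(Leb+ x. ennreal (indicator K x * norm (norm (g x) powr (p - 1)) powr t)) < \<infinity>"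
   by (simp add: powr_powr)
 qed measurable
qed


section \<open>Changing functions on null sets\<close>

text \<open>Completeness of Lebesgue measure: any subset of the exceptional null set is
  measurable.\<close>

lemma measurable_lebesgue_AE:
 assumes f: "f \<in> lmeas" and ae: "AE x in lebesgue. f x = f' x"
 shows "f' \<in> lmeas"
proof (rule measurableI)
 fix A :: "'b set" assume A: "A \<in> sets borel"
 obtain N where N: "N \<in> null_sets lebesgue" "\<And>x. f x \<noteq> f' x \<Longrightarrow> x \<in> N"
  using ae by (auto simp: eventually_ae_filter)
 have "f -` A \<in> sets lebesgue" using measurable_sets[OF f A] by simp
 moreover have "f' -` A \<inter> N \<in> sets lebesgue" using null_sets_completion_subset[OF Int_lower2 N(1)] by auto
 moreover have "f' -` A = (f -` A - N) \<union> (f' -` A \<inter> N)"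
 proof (intro set_eqI iffI)
  fix x assume "x \<in> f' -` A"
  then show "x \<in> (f -` A - N) \<union> (f' -` A \<inter> N)" using N(2)[of x] by (cases "x \<in> N") force+
 next
  fix x assume "x \<in> (f -` A - N) \<union> (f' -` A \<inter> N)"
  then show "x \<in> f' -` A" using N(2)[of x] by (cases "x \<in> N") force+
 qed
 ultimately have "f' -` A \<in> sets lebesgue" using null_setsD2[OF N(1)] by (metis sets.Un sets.Diff)
 then show "f' -` A \<inter> space lebesgue \<in> sets lebesgue" by simp
qed simp

lemma lebesgue_on_iff:
 assumes "S \<in> sets lebesgue"
 shows "f \<in> borel_measurable (lebesgue_on S) \<longleftrightarrow> (\<lambda>x. if x \<in> S then f x else c) \<in> lmeas"
 using assms by (intro measurable_restrict_space_iff) auto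

lemma AE_lebesgue_on:
 assumes "S \<in> sets lebesgue"
 shows "(AE x in lebesgue_on S. P x) \<longleftrightarrow> (AE x in lebesgue. x \<in> S \<longrightarrow> P x)"
 using assms by (intro AE_restrict_space_iff) simp

lemma integral_lebesgue_on:
 fixes f :: "'a::euclidean_space \<Rightarrow> real"
 assumes "S \<in> sets lebesgue" "\<And>x. x \<notin> S \<Longrightarrow> f x = 0"
 shows "(\<integral>x. f x \<partial>lebesgue_on S) = (Leb x. f x)"
proof -
 have "(\<integral>x. f x \<partial>lebesgue_on S) = (Leb x. indicator S x *\<^sub>R f x)"
  using assms(1) by (intro integral_restrict_space) simp
 also have "\<dots> = (Leb x. f x)"
  by (rule Bochner_Integration.integral_cong) (use assms(2) in \<open>auto simp: indicator_def\<close>)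
 finally show ?thesis .
qed

lemma in_Lp_cong_AE:
 fixes f f' :: "'a::euclidean_space \<Rightarrow> 'b::euclidean_space"
 assumes S: "S \<in> sets lebesgue" and ae: "ae_on S (\<lambda>x. f x = f' x)" and f: "in_Lp r S f"
 shows "in_Lp r S f'"
proof -
 have m: "(\<lambda>x. indicator S x *\<^sub>R f x) \<in> lmeas" and i: "integrable lebesgue (\<lambda>x. indicator S x *\<^sub>R norm (f x) powr r)"
  using f by (auto simp: in_Lp_iff[OF S])
 have "AE x in lebesgue. indicator S x *\<^sub>R f x = indicator S x *\<^sub>R f' x" using ae by eventually_elim (auto simp: indicator_def)
 then have 1: "(\<lambda>x. indicator S x *\<^sub>R f' x) \<in> lmeas" by (rule measurable_lebesgue_AE[OF m])
 have e: "AE x in lebesgue. indicator S x *\<^sub>R norm (f x) powr r = indicator S x *\<^sub>R norm (f' x) powr r"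
  using ae by eventually_elim (auto simp: indicator_def)
 have "integrable lebesgue (\<lambda>x. indicator S x *\<^sub>R norm (f' x) powr r)"
  by (rule integrable_cong_AE_imp[OF i measurable_lebesgue_AE[OF borel_measurable_integrable[OF i] e] e])
 with 1 show ?thesis by (simp add: in_Lp_iff[OF S])
qed

lemma in_Lp_loc_cong_AE:
 assumes ae: "ae_on G (\<lambda>x. f x = f' x)" and f: "in_Lp_loc r G f"
 shows "in_Lp_loc r G f'"
 unfolding in_Lp_loc_def
proof (intro allI impI, elim conjE)
 fix K assume K: "compact K" "K \<subseteq> G"
 have ae': "ae_on K (\<lambda>x. f x = f' x)" using ae K(2) by (auto elim!: AE_mp)
 show "in_Lp r K f'"
  by (rule in_Lp_cong_AE[OF compact_sets_lebesgue[OF K(1)] ae']) (use f K in \<open>simp add: in_Lp_loc_def\<close>)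
qed

lemma in_W1p_cong_AE:
 assumes G: "open G" and ae: "ae_on G (\<lambda>x. f x = f' x)" and f: "in_W1p r G f"
 shows "in_W1p r G f'"
proof -
 obtain g where g: "weak_gradient G f g" "in_Lp r G g" using f by (auto simp: in_W1p_def)
 have "weak_gradient G f' g" by (rule weak_gradient_cong_AE[OF G g(1) ae]) simp
 moreover have "in_Lp r G f'" using f by (intro in_Lp_cong_AE[OF open_sets_lebesgue[OF G] ae]) (simp add: in_W1p_def)
 ultimately show ?thesis using g(2) by (auto simp: in_W1p_def)
qed

lemma in_W1p_loc_cong_AE:
 assumes G: "open G" and ae: "ae_on G (\<lambda>x. f x = f' x)" and f: "in_W1p_loc r G f"
 shows "in_W1p_loc r G f'"
proof -
 obtain g where g: "weak_gradient G f g" "in_Lp_loc r G g" using f by (auto simp: in_W1p_loc_def)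
 have "weak_gradient G f' g" by (rule weak_gradient_cong_AE[OF G g(1) ae]) simp
 moreover have "in_Lp_loc r G f'" using f by (intro in_Lp_loc_cong_AE[OF ae]) (simp add: in_W1p_loc_def)
 ultimately show ?thesis using g(2) by (auto simp: in_W1p_loc_def)
qed

lemma meas_finite_ae_iff:
 assumes "S \<in> sets lebesgue"
 shows "meas_finite_ae S u \<longleftrightarrow> (\<lambda>x. if x \<in> S then u x else 0) \<in> lmeas \<and> (AE x in lebesgue. x \<in> S \<longrightarrow> \<bar>u x\<bar> \<noteq> \<infinity>)"
 unfolding meas_finite_ae_def lebesgue_on_iff[OF assms, of u 0] AE_lebesgue_on[OF assms] ..

lemma meas_finite_ae_cong:
 assumes S: "S \<in> sets lebesgue" and ae: "ae_on S (\<lambda>x. u x = u' x)" and u: "meas_finite_ae S u"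
 shows "meas_finite_ae S u'"
 unfolding meas_finite_ae_iff[OF S]
proof
 have m: "(\<lambda>x. if x \<in> S then u x else 0) \<in> lmeas" and f: "ae_on S (\<lambda>x. \<bar>u x\<bar> \<noteq> \<infinity>)"
  using u by (auto simp: meas_finite_ae_iff[OF S])
 have "AE x in lebesgue. (if x \<in> S then u x else 0) = (if x \<in> S then u' x else 0)" using ae by eventually_elim auto
 then show "(\<lambda>x. if x \<in> S then u' x else 0) \<in> lmeas" by (rule measurable_lebesgue_AE[OF m])
 show "ae_on S (\<lambda>x. \<bar>u' x\<bar> \<noteq> \<infinity>)" using f ae by eventually_elim auto
qed

lemma trunc_gradient_cong:
 assumes G: "open G" and ae: "ae_on G (\<lambda>x. u x = u' x)" and gg: "\<And>x. x \<in> G \<Longrightarrow> g x = g' x"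
  and t: "trunc_gradient G u g"
 shows "trunc_gradient G u' g'"
 unfolding trunc_gradient_def
proof (intro conjI allI impI)
 have "g \<in> borel_measurable (lebesgue_on G)" using t by (simp add: trunc_gradient_def)
 then show "g' \<in> borel_measurable (lebesgue_on G)"
  by (rule measurable_cong[THEN iffD1, rotated]) (simp add: gg)
 fix k :: real assume k: "0 < k"
 have "weak_gradient G (\<lambda>x. trunc k (u x)) (\<lambda>x. if \<bar>u x\<bar> \<le> ereal k then g x else 0)" using t k by (simp add: trunc_gradient_def)
 then show "weak_gradient G (\<lambda>x. trunc k (u' x)) (\<lambda>x. if \<bar>u' x\<bar> \<le> ereal k then g' x else 0)"
 proof (rule weak_gradient_cong_AE[OF G])
  show "ae_on G (\<lambda>x. trunc k (u x) = trunc k (u' x))" using ae by eventually_elim auto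
  show "ae_on G (\<lambda>x. (if \<bar>u x\<bar> \<le> ereal k then g x else 0) = (if \<bar>u' x\<bar> \<le> ereal k then g' x else 0))"
   using ae by eventually_elim (simp add: gg)
 qed
qed

lemma weak_solution_cong:
 assumes G: "open G" and ae: "ae_on G (\<lambda>x. u x = u' x)" and u: "weak_solution p q G \<mu> u"
 shows "weak_solution p q G \<mu> u'"
proof -
 have aek: "ae_on G (\<lambda>x. trunc k (u x) = trunc k (u' x))" for k using ae by eventually_elim auto
 have "in_W1p_loc p G (\<lambda>x. trunc k (u' x))" if "0 < k" for k
  using u that by (intro in_W1p_loc_cong_AE[OF G aek]) (simp add: weak_solution_def)
 moreover have "meas_finite_ae G u'" using u by (intro meas_finite_ae_cong[OF open_sets_lebesgue[OF G] ae]) (simp add: weak_solution_def)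
 moreover have "trunc_gradient G u g \<Longrightarrow> trunc_gradient G u' g" for g by (rule trunc_gradient_cong[OF G ae]) auto
 ultimately show ?thesis using u unfolding weak_solution_def by blast
qed

definition renormalized_equation ::
  "real \<Rightarrow> real \<Rightarrow> 'a::euclidean_space set \<Rightarrow> ('a \<Rightarrow> ereal) \<Rightarrow> ('a \<Rightarrow> 'a) \<Rightarrow> ('a \<Rightarrow> ereal) \<Rightarrow>
   'a signed \<Rightarrow> 'a measure \<Rightarrow> 'a measure \<Rightarrow> bool" where
 "renormalized_equation p q G u g v \<mu>0 \<sigma>p \<sigma>m \<longleftrightarrow> (\<forall>h \<phi> m w.
   renorm_fun h \<and> real DIM('a) < m \<and>
   continuous_on UNIV \<phi> \<and> compact (supp \<phi>) \<and> supp \<phi> \<subseteq> G \<and> in_W1p m G \<phi> \<and>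
   in_W1p p G (\<lambda>x. ext_fun h (u x) * \<phi> x) \<and>
   weak_gradient G (\<lambda>x. ext_fun h (u x) * \<phi> x) w \<longrightarrow>
   (\<integral>x. eqint p q (g x) (w x) (ext_fun h (u x) * \<phi> x) \<partial>lebesgue_on G)
   = sintegral \<mu>0 (\<lambda>x. ext_fun h (v x) * \<phi> x)
    + ext_fun h \<infinity> * (\<integral>x. \<phi> x \<partial>\<sigma>p) - ext_fun h (-\<infinity>) * (\<integral>x. \<phi> x \<partial>\<sigma>m))"

lemma renormalized_equationD:
 fixes u :: "'a::euclidean_space \<Rightarrow> ereal"
 assumes "renormalized_equation p q G u g v \<mu>0 \<sigma>p \<sigma>m"
  and "renorm_fun h" "real DIM('a) < m" "continuous_on UNIV \<phi>" "compact (supp \<phi>)" "supp \<phi> \<subseteq> G" "in_W1p m G \<phi>"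
  "in_W1p p G (\<lambda>x. ext_fun h (u x) * \<phi> x)" "weak_gradient G (\<lambda>x. ext_fun h (u x) * \<phi> x) w"
 shows "(\<integral>x. eqint p q (g x) (w x) (ext_fun h (u x) * \<phi> x) \<partial>lebesgue_on G)
  = sintegral \<mu>0 (\<lambda>x. ext_fun h (v x) * \<phi> x) + ext_fun h \<infinity> * (\<integral>x. \<phi> x \<partial>\<sigma>p) - ext_fun h (-\<infinity>) * (\<integral>x. \<phi> x \<partial>\<sigma>m)"
 using assms(1)[unfolded renormalized_equation_def, rule_format, of h m \<phi> w] assms(2-) by blast

lemma locally_renormalized_solution_iff:
 fixes u :: "'a::euclidean_space \<Rightarrow> ereal"
 shows "locally_renormalized_solution p q G \<mu> u \<longleftrightarrow> meas_finite_ae G u \<and>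
   (\<forall>k>0. in_W1p_loc p G (\<lambda>x. trunc k (u x))) \<and>
   (\<forall>s\<ge>1. (p < real DIM('a) \<longrightarrow> s < real DIM('a) / (real DIM('a) - p)) \<longrightarrow>
    in_Lp_loc s G (\<lambda>x. real_of_ereal \<bar>u x\<bar> powr (p - 1))) \<and>
   (\<exists>g v \<mu>0 \<sigma>p \<sigma>m. trunc_gradient G u g \<and> quasicont_rep p G u v \<and>
    cap_decomposition p G \<mu> \<mu>0 \<sigma>p \<sigma>m \<and>
    in_Lp_loc 1 G (\<lambda>x. norm (g x) powr q) \<and>
    (\<forall>t\<ge>1. t < real DIM('a) / (real DIM('a) - 1) \<longrightarrow>
      in_Lp_loc t G (\<lambda>x. norm (g x) powr (p - 1))) \<and>
    renormalized_equation p q G u g v \<mu>0 \<sigma>p \<sigma>m)"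
 unfolding locally_renormalized_solution_def renormalized_equation_def ..

lemma locally_renormalized_solution_cong:
 assumes G: "open G" and ae: "ae_on G (\<lambda>x. u x = u' x)" and u: "locally_renormalized_solution p q G \<mu> u"
 shows "locally_renormalized_solution p q G \<mu> u'"
proof -
 note Gl = open_sets_lebesgue[OF G]
 have aek: "ae_on G (\<lambda>x. trunc k (u x) = trunc k (u' x))" for k using ae by eventually_elim auto
 have aep: "ae_on G (\<lambda>x. real_of_ereal \<bar>u x\<bar> powr (p - 1) = real_of_ereal \<bar>u' x\<bar> powr (p - 1))"
  using ae by eventually_elim auto
 have aeh: "ae_on G (\<lambda>x. ext_fun h (u' x) * \<phi> x = ext_fun h (u x) * \<phi> x)" for h and \<phi> :: "'a \<Rightarrow> real"
  using ae by eventually_elim auto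
 obtain g v \<mu>0 \<sigma>p \<sigma>m where s: "trunc_gradient G u g" "quasicont_rep p G u v" "cap_decomposition p G \<mu> \<mu>0 \<sigma>p \<sigma>m"
   "in_Lp_loc 1 G (\<lambda>x. norm (g x) powr q)"
   "\<And>t. t \<ge> 1 \<Longrightarrow> t < real DIM('a) / (real DIM('a) - 1) \<Longrightarrow> in_Lp_loc t G (\<lambda>x. norm (g x) powr (p - 1))"
  and eq: "renormalized_equation p q G u g v \<mu>0 \<sigma>p \<sigma>m"
  using u unfolding locally_renormalized_solution_iff by blast
 show ?thesis
  unfolding locally_renormalized_solution_iff
 proof (intro conjI)
  show "meas_finite_ae G u'" using u by (intro meas_finite_ae_cong[OF Gl ae]) (simp add: locally_renormalized_solution_iff)
  show "\<forall>k>0. in_W1p_loc p G (\<lambda>x. trunc k (u' x))"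
   using u in_W1p_loc_cong_AE[OF G aek] by (simp add: locally_renormalized_solution_iff)
  show "\<forall>s\<ge>1. (p < real DIM('a) \<longrightarrow> s < real DIM('a) / (real DIM('a) - p)) \<longrightarrow> in_Lp_loc s G (\<lambda>x. real_of_ereal \<bar>u' x\<bar> powr (p - 1))"
   using u in_Lp_loc_cong_AE[OF aep] unfolding locally_renormalized_solution_iff by blast
  have q: "quasicont_rep p G u' v"
  proof -
   have "ae_on G (\<lambda>x. v x = u x)" using s(2) by (simp add: quasicont_rep_def AE_lebesgue_on[OF Gl])
   with ae have "ae_on G (\<lambda>x. v x = u' x)" by eventually_elim auto
   then show ?thesis using s(2) by (simp add: quasicont_rep_def AE_lebesgue_on[OF Gl])
  qed
  have e: "(\<integral>x. eqint p q (g x) (w x) (ext_fun h (u' x) * \<phi> x) \<partial>lebesgue_on G)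
   = sintegral \<mu>0 (\<lambda>x. ext_fun h (v x) * \<phi> x) + ext_fun h \<infinity> * (\<integral>x. \<phi> x \<partial>\<sigma>p) - ext_fun h (-\<infinity>) * (\<integral>x. \<phi> x \<partial>\<sigma>m)"
   if a: "renorm_fun h" "real DIM('a) < m" "continuous_on UNIV \<phi>" "compact (supp \<phi>)" "supp \<phi> \<subseteq> G" "in_W1p m G \<phi>"
    "in_W1p p G (\<lambda>x. ext_fun h (u' x) * \<phi> x)" "weak_gradient G (\<lambda>x. ext_fun h (u' x) * \<phi> x) w" for h \<phi> m w
  proof -
   have w: "weak_gradient G (\<lambda>x. ext_fun h (u x) * \<phi> x) w" by (rule weak_gradient_cong_AE[OF G a(8) aeh]) simp
   define X where "X x = eqint p q (g x) (w x) (ext_fun h (u x) * \<phi> x)" for x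
   define X' where "X' x = eqint p q (g x) (w x) (ext_fun h (u' x) * \<phi> x)" for x
   have XX: "AE x in lebesgue. indicator G x *\<^sub>R X x = indicator G x *\<^sub>R X' x"
    using ae by eventually_elim (auto simp: X_def X'_def indicator_def)
   then have XX': "AE x in lebesgue. indicator G x *\<^sub>R X' x = indicator G x *\<^sub>R X x" by eventually_elim (rule sym)
   have "(Leb x. indicator G x *\<^sub>R X' x) = (Leb x. indicator G x *\<^sub>R X x)"
   \<comment> \<open>The definition does not presuppose that the integrand is integrable. If it is
     measurable, so is its modification and the integrals agree; if not, neither version is
     integrable and both integrals are 0 by convention.\<close>
   proof (cases "(\<lambda>x. indicator G x *\<^sub>R X x) \<in> lmeas")
    case True
    then show ?thesis by (intro integral_cong_AE XX' measurable_lebesgue_AE[OF True XX])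
   next
    case False
    then have "(\<lambda>x. indicator G x *\<^sub>R X' x) \<notin> lmeas" using measurable_lebesgue_AE[OF _ XX'] by blast
    with False have "\<not> integrable lebesgue (\<lambda>x. indicator G x *\<^sub>R X x)" "\<not> integrable lebesgue (\<lambda>x. indicator G x *\<^sub>R X' x)"
     using borel_measurable_integrable by blast+
    then show ?thesis by (simp add: not_integrable_integral_eq)
   qed
   moreover have "(\<integral>x. Y x \<partial>lebesgue_on G) = (Leb x. indicator G x *\<^sub>R Y x)" for Y :: "'a \<Rightarrow> real"
    using Gl by (intro integral_restrict_space) simp
   ultimately have "(\<integral>x. X' x \<partial>lebesgue_on G) = (\<integral>x. X x \<partial>lebesgue_on G)" by simp
   moreover have "(\<integral>x. X x \<partial>lebesgue_on G) = sintegral \<mu>0 (\<lambda>x. ext_fun h (v x) * \<phi> x) + ext_fun h \<infinity> * (\<integral>x. \<phi> x \<partial>\<sigma>p) - ext_fun h (-\<infinity>) * (\<integral>x. \<phi> x \<partial>\<sigma>m)"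
    unfolding X_def by (rule renormalized_equationD[OF eq a(1-6) in_W1p_cong_AE[OF G aeh a(7)] w])
   ultimately show ?thesis unfolding X'_def by simp
  qed
  have e': "renormalized_equation p q G u' g v \<mu>0 \<sigma>p \<sigma>m" unfolding renormalized_equation_def using e by blast
  have t': "trunc_gradient G u' g" by (rule trunc_gradient_cong[OF G ae _ s(1)]) simp
  show "\<exists>g v \<mu>0 \<sigma>p \<sigma>m. trunc_gradient G u' g \<and> quasicont_rep p G u' v \<and>
    cap_decomposition p G \<mu> \<mu>0 \<sigma>p \<sigma>m \<and>
    in_Lp_loc 1 G (\<lambda>x. norm (g x) powr q) \<and>
    (\<forall>t\<ge>1. t < real DIM('a) / (real DIM('a) - 1) \<longrightarrow>
      in_Lp_loc t G (\<lambda>x. norm (g x) powr (p - 1))) \<and>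
    renormalized_equation p q G u' g v \<mu>0 \<sigma>p \<sigma>m"
   using t' q s(3-5) e' by blast
 qed
qed

section \<open>Passing to the limit in the cut-off equation\<close>

context removable
begin

text \<open>The cutoffs tend to 0 at every point off \<open>F\<close>, not only almost everywhere
  for Lebesgue measure; hence the limit holds for any Radon measure that does not charge
  \<open>F\<close>.\<close>

lemma cutoff_measure_limit:
 assumes c: "cutoffs S \<eta>" and M: "pos_radon \<Omega> M" and MF: "emeasure M F = 0" and S: "compact S" "S \<subseteq> \<Omega>"
  and f: "f \<in> borel_measurable (restrict_space borel \<Omega>)" and b: "\<And>x. x \<in> \<Omega> \<Longrightarrow> \<bar>f x\<bar> \<le> k" "\<And>x. x \<notin> S \<Longrightarrow> f x = 0"
 shows "(\<lambda>n. \<integral>x. f x * (1 - \<eta> n x) \<partial>M) \<longlonglongrightarrow> (\<integral>x. f x \<partial>M)"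
proof -
 have sM: "sets M = sets (restrict_space borel \<Omega>)" using M by (simp add: pos_radon_def)
 have spM: "space M = \<Omega>" using M by (rule pos_radon_space)
 have fM[measurable]: "f \<in> borel_measurable M" using f by (simp add: measurable_cong_sets[OF sM])
 have \<eta>M[measurable]: "\<eta> n \<in> borel_measurable M" for n
  using cutoffsD(8)[OF c, of n] by (simp add: measurable_cong_sets[OF sM] measurable_restrict_space1)
 have SM: "S \<in> sets M" using pos_radon_sets[OF \<Omega> M] S borel_compact by blast
 have i: "integrable M (\<lambda>x. \<bar>k\<bar> * indicator S x)"
  using pos_radon_compact[OF M S] SM by (intro integrable_mult_right integrable_real_indicator) auto
 have "AE x in M. x \<notin> F" using MF pos_radon_sets[OF \<Omega> M] F_borel F_subset by (intro AE_not_in) (auto simp: null_sets_def)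
 then have a: "AE x in M. (\<lambda>n. f x * (1 - \<eta> n x)) \<longlonglongrightarrow> f x"
 proof eventually_elim
  case (elim x)
  have "\<forall>\<^sub>F n in sequentially. f x * (1 - \<eta> n x) = f x" using cutoffsD(6)[OF c elim] by (auto elim!: eventually_mono)
  then show ?case by (rule tendsto_eventually)
 qed
 have bd: "AE x in M. norm (f x * (1 - \<eta> n x)) \<le> \<bar>k\<bar> * indicator S x" for n
 proof (rule AE_I2)
  fix x assume "x \<in> space M"
  then have x: "x \<in> \<Omega>" by (simp add: spM)
  have "\<bar>f x\<bar> * \<bar>1 - \<eta> n x\<bar> \<le> \<bar>k\<bar> * 1"
   using b(1)[OF x] cutoffsD(3,4)[OF c, of n x] by (intro mult_mono) auto
  then show "norm (f x * (1 - \<eta> n x)) \<le> \<bar>k\<bar> * indicator S x" using b(2)[of x] by (cases "x \<in> S") (auto simp: abs_mult)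
 qed
 have fm: "(\<lambda>x. f x * (1 - \<eta> n x)) \<in> borel_measurable M" for n by measurable
 show ?thesis by (rule integral_dominated_convergence[OF fM fm i a bd])
qed

text \<open>Instance of \<open>cutoff_limit\<close> in which the error carries the power
  \<open>p - 1\<close> of the gradient on \<open>S\<close>; that this lies in \<open>L^s\<close> is
  the integrability of the power \<open>q\<close> up to \<open>F\<close>.\<close>

lemma cutoff_equation_limit:
 assumes c: "cutoffs S \<eta>" and S: "compact S" "S \<subseteq> \<Omega>"
  and g: "g \<in> lmeas" "loc_int \<Omega> (\<lambda>x. norm (g x) powr q)"
  and \<psi>: "\<psi> \<in> lmeas" "\<And>x. x \<in> S \<Longrightarrow> \<bar>\<psi> x\<bar> \<le> k" "\<And>x. x \<notin> S \<Longrightarrow> \<psi> x = 0"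
  and H: "integrable lebesgue H"
 shows "(\<lambda>n. (Leb x. (1 - \<eta> n x) * H x - \<psi> x * (norm (g x) powr (p - 2) * (g x \<bullet> grad (\<eta> n) x)))) \<longlonglongrightarrow> (Leb x. H x)"
proof (rule cutoff_limit[OF c H])
 have Sm[measurable]: "S \<in> sets lebesgue" using S(1) by (rule compact_sets_lebesgue)
 have [measurable]: "grad (\<eta> n) \<in> lmeas" for n using cutoffsD(9)[OF c] by (auto intro!: measurable_completion)
 note [measurable] = g(1) \<psi>(1)
 define A where "A x = \<bar>k\<bar> * indicator S x * norm (g x) powr (p - 1)" for x
 show "(\<lambda>x. \<psi> x * (norm (g x) powr (p - 2) * (g x \<bullet> grad (\<eta> n) x))) \<in> lmeas" for n by measurable
 show "0 \<le> A x" for x by (simp add: A_def)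
 show "A \<in> lmeas" unfolding A_def by measurable
 have As: "A x powr s = \<bar>k\<bar> powr s * (indicator S x * norm (g x) powr q)" for x
  using p exponents(2) by (cases "x \<in> S") (auto simp: A_def powr_mult powr_powr s_def)
 show "integrable lebesgue (\<lambda>x. A x powr s)"
  unfolding As using g(2) S by (intro integrable_mult_right) (simp add: loc_int_def set_integrable_def)
 fix n x
 show "\<bar>\<psi> x * (norm (g x) powr (p - 2) * (g x \<bullet> grad (\<eta> n) x))\<bar> \<le> A x * norm (grad (\<eta> n) x)"
 proof (cases "x \<in> S")
  case True
  have "\<bar>\<psi> x * (norm (g x) powr (p - 2) * (g x \<bullet> grad (\<eta> n) x))\<bar> \<le> \<bar>\<psi> x\<bar> * (norm (g x) powr (p - 2) * (norm (g x) * norm (grad (\<eta> n) x)))"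
   unfolding abs_mult by (intro mult_left_mono mult_mono Cauchy_Schwarz_ineq2) auto
  also have "\<dots> = \<bar>\<psi> x\<bar> * (norm (g x) powr (p - 1) * norm (grad (\<eta> n) x))" unfolding powr_mult_norm[symmetric] by (simp add: mult.assoc)
  also have "\<dots> \<le> \<bar>k\<bar> * (norm (g x) powr (p - 1) * norm (grad (\<eta> n) x))" using \<psi>(2)[OF True] by (intro mult_right_mono) auto
  finally show ?thesis using True by (simp add: A_def mult.assoc)
 qed (simp add: \<psi>(3) A_def)
qed

text \<open>The hypothesis \<open>fin\<close> is where the two cases part: for \<open>p < q\<close>
  it comes from the power \<open>q\<close> of the gradient, for \<open>q \<le> p\<close> from
  \<open>truncation_energy\<close>.\<close>

lemma trunc_gradient_extend:
 assumes um: "u \<in> lmeas" and gm: "g \<in> lmeas" and tg: "trunc_gradient (\<Omega> - F) u g"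
  and fin: "\<And>k K. 0 < k \<Longrightarrow> compact K \<Longrightarrow> K \<subseteq> \<Omega> \<Longrightarrow>
   (Leb+ x. ennreal (indicator K x * norm (if \<bar>u x\<bar> \<le> ereal k then g x else 0) powr p)) < \<infinity>"
 shows "trunc_gradient \<Omega> u g" "\<And>k. 0 < k \<Longrightarrow> in_W1p_loc p \<Omega> (\<lambda>x. trunc k (u x))"
proof -
 note [measurable] = um gm
 define gk where "gk k x = (if \<bar>u x\<bar> \<le> ereal k then g x else 0)" for k x
 have gkm[measurable]: "gk k \<in> lmeas" for k unfolding gk_def by measurable
 have Tm[measurable]: "(\<lambda>x. trunc k (u x)) \<in> lmeas" for k unfolding trunc_def by measurable
 have L1: "loc_int \<Omega> f" if f: "f \<in> lmeas"
  "\<And>K. compact K \<Longrightarrow> K \<subseteq> \<Omega> \<Longrightarrow> (Leb+ x. ennreal (indicator K x * norm (f x) powr p)) < \<infinity>" for f :: "'a \<Rightarrow> 'b::euclidean_space"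
  unfolding in_Lp_loc_1_iff[symmetric]
 by (rule in_Lp_locI[OF f(1) nn_integral_powr_finite[OF f(1) _ _ _ f(2)]]) (use p in auto)
 have Tfin: "(Leb+ x. ennreal (indicator K x * norm (trunc k (u x)) powr p)) < \<infinity>" if k: "0 < k" and K: "compact K" for k K
 proof -
  note [measurable] = compact_sets_lebesgue[OF K(1)]
  have "(Leb+ x. ennreal (indicator K x * norm (trunc k (u x)) powr p)) \<le> (Leb+ x. ennreal (k powr p) * indicator K x)"
  proof (rule nn_integral_mono)
   fix x
   show "ennreal (indicator K x * norm (trunc k (u x)) powr p) \<le> ennreal (k powr p) * indicator K x"
    using trunc_bound[OF k, of "u x"] p by (cases "x \<in> K") (auto intro!: ennreal_leI powr_mono2)
  qed
  also have "\<dots> = ennreal (k powr p) * emeasure lebesgue K" by (rule nn_integral_cmult_indicator) simp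
  also have "\<dots> < \<infinity>" using emeasure_compact_finite[OF K(1)] borel_compact[OF K(1)] by (simp add: ennreal_mult_less_top)
  finally show ?thesis .
 qed
 have gfin: "(Leb+ x. ennreal (indicator K x * norm (gk k x) powr p)) < \<infinity>" if "0 < k" "compact K" "K \<subseteq> \<Omega>" for k K
  unfolding gk_def by (rule fin[OF that])
 have w: "weak_gradient \<Omega> (\<lambda>x. trunc k (u x)) (gk k)" if k: "0 < k" for k
 proof (rule weak_gradient_extend)
  show "weak_gradient (\<Omega> - F) (\<lambda>x. trunc k (u x)) (gk k)" using tg k by (simp add: trunc_gradient_def gk_def[abs_def])
  show "\<bar>trunc k (u x)\<bar> \<le> k" for x by (rule trunc_bound[OF k])
  show "loc_int \<Omega> (\<lambda>x. trunc k (u x))" by (rule L1[OF Tm Tfin[OF k]])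
  show "loc_int \<Omega> (gk k)" by (rule L1[OF gkm gfin[OF k]])
 qed
 have "g \<in> borel_measurable (lebesgue_on \<Omega>)" using gm by (rule measurable_restrict_space1)
 then show "trunc_gradient \<Omega> u g" using w unfolding trunc_gradient_def gk_def by blast
 show "in_W1p_loc p \<Omega> (\<lambda>x. trunc k (u x))" if k: "0 < k" for k
  unfolding in_W1p_loc_def using w[OF k] in_Lp_locI[OF Tm Tfin[OF k]] in_Lp_locI[OF gkm gfin[OF k]] by blast
qed

lemma zero_extension:
 fixes g :: "'a \<Rightarrow> 'a" and u :: "'a \<Rightarrow> ereal"
 defines "g' \<equiv> \<lambda>x. if x \<in> \<Omega> - F then g x else 0"
 assumes "trunc_gradient (\<Omega> - F) u g"
 shows "g' \<in> lmeas" "trunc_gradient (\<Omega> - F) u g'"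
proof -
 have "g \<in> borel_measurable (lebesgue_on (\<Omega> - F))" using assms(2) by (simp add: trunc_gradient_def)
 then show "g' \<in> lmeas" unfolding g'_def using lebesgue_on_iff[OF open_sets_lebesgue[OF G_open]] by blast
 show "trunc_gradient (\<Omega> - F) u g'" by (rule trunc_gradient_cong[OF G_open _ _ assms(2)]) (auto simp: g'_def)
qed

lemma meas_finite_ae_extend:
 assumes "meas_finite_ae (\<Omega> - F) u"
 shows "(\<lambda>x. if x \<in> \<Omega> - F then u x else 0) \<in> lmeas"
  "ae_on \<Omega> (\<lambda>x. \<bar>u x\<bar> \<noteq> \<infinity>)"
proof -
 note i = meas_finite_ae_iff[OF open_sets_lebesgue[OF G_open], of u]
 show "(\<lambda>x. if x \<in> \<Omega> - F then u x else 0) \<in> lmeas" using assms i by blast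
 have "ae_on (\<Omega> - F) (\<lambda>x. \<bar>u x\<bar> \<noteq> \<infinity>)" using assms i by blast
 then show "ae_on \<Omega> (\<lambda>x. \<bar>u x\<bar> \<noteq> \<infinity>)" using F_AE by eventually_elim auto
qed

lemma capacity_null_F:
 assumes "radon_cap qs \<Omega> \<mu>"
 shows "emeasure (fst \<mu>) F = 0" "emeasure (snd \<mu>) F = 0"
proof -
 have "cap_compact qs K = 0" if "compact K" "K \<subseteq> F" for K using cap_compact_le_cap[OF that, of qs] cap by simp
 then show "emeasure (fst \<mu>) F = 0" "emeasure (snd \<mu>) F = 0"
  using radon_cap_null[OF \<Omega> assms F_borel F_subset] by auto
qed

theorem weak_solution_extend:
 assumes pq: "p < q" and \<mu>: "radon_cap qs \<Omega> \<mu>" and u: "weak_solution p q (\<Omega> - F) (srestrict \<mu> (\<Omega> - F)) u"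
  and um: "u \<in> lmeas"
 shows "weak_solution p q \<Omega> \<mu> u"
proof -
 define G where "G = \<Omega> - F"
 note Go = G_open[folded G_def]
 note Gl = open_sets_lebesgue[OF Go]
 have \<mu>r: "pos_radon \<Omega> (fst \<mu>)" "pos_radon \<Omega> (snd \<mu>)" using \<mu> by (auto simp: radon_cap_def signed_radon_def)
 note \<mu>F = capacity_null_F[OF \<mu>]
 obtain g0 where g0: "trunc_gradient G u g0" "in_Lp_loc 1 G (\<lambda>x. norm (g0 x) powr q)"
  "\<And>\<phi>. test_fun G \<phi> \<Longrightarrow> (\<integral>x. eqint p q (g0 x) (grad \<phi> x) (\<phi> x)
       \<partial>lebesgue_on G) = sintegral (srestrict \<mu> G) \<phi>"
  using u unfolding weak_solution_def G_def by blast
 \<comment> \<open>For \<open>g0\<close> only measurability on \<open>G\<close> is given; the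
   extension by 0 is measurable on the whole space and represents the same gradient on
   \<open>G\<close>.\<close>
 define g where "g x = (if x \<in> G then g0 x else 0)" for x
 have gm: "g \<in> lmeas" and tg: "trunc_gradient G u g"
  using zero_extension[OF g0(1)[unfolded G_def]] by (simp_all add: g_def[abs_def] G_def)
 have gl: "loc_int G (\<lambda>x. norm (g x) powr q)"
  by (rule loc_int_cong_AE[OF g0(2)[unfolded in_Lp_loc_1_iff]]) (auto simp: g_def)
 have eq: "(Leb x. eqint p q (g x) (grad \<phi> x) (\<phi> x))
   = (\<integral>x. \<phi> x \<partial>fst \<mu>) - (\<integral>x. \<phi> x \<partial>snd \<mu>)" if t: "test_fun G \<phi>" for \<phi>
 proof -
  have "(Leb x. eqint p q (g x) (grad \<phi> x) (\<phi> x))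
   = (\<integral>x. eqint p q (g x) (grad \<phi> x) (\<phi> x) \<partial>lebesgue_on G)"
   by (rule integral_lebesgue_on[OF Gl, symmetric]) (use test_fun_zero_outside[OF t] in auto)
  also have "\<dots> = (\<integral>x. eqint p q (g0 x) (grad \<phi> x) (\<phi> x) \<partial>lebesgue_on G)"
   by (rule Bochner_Integration.integral_cong) (auto simp: g_def)
  also have "\<dots> = sintegral (srestrict \<mu> G) \<phi>" by (rule g0(3)[OF t])
  also have "\<dots> = (\<integral>x. \<phi> x \<partial>fst \<mu>) - (\<integral>x. \<phi> x \<partial>snd \<mu>)"
  proof -
   have "(\<integral>x. \<phi> x \<partial>restrict_space M G) = (\<integral>x. \<phi> x \<partial>M)" if M: "pos_radon \<Omega> M" for M
   proof -
    have "G \<inter> space M \<in> sets M" using pos_radon_sets[OF \<Omega> M] pos_radon_space[OF M] Go by (auto simp: G_def intro: borel_open)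
    then have "(\<integral>x. \<phi> x \<partial>restrict_space M G) = (\<integral>x. indicator G x *\<^sub>R \<phi> x \<partial>M)" by (rule integral_restrict_space)
    also have "\<dots> = (\<integral>x. \<phi> x \<partial>M)"
     by (rule Bochner_Integration.integral_cong) (use test_fun_zero_outside[OF t] in \<open>auto simp: indicator_def\<close>)
    finally show ?thesis .
   qed
   then show ?thesis using \<mu>r by (simp add: sintegral_def srestrict_def)
  qed
  finally show ?thesis .
 qed
 have gl': "loc_int \<Omega> (\<lambda>x. norm (g x) powr q)"
 proof (rule gradient_power_loc_int[OF gm gl[unfolded G_def]])
  fix S :: "'a set" assume S: "compact S" "S \<subseteq> \<Omega>"
  show "\<exists>M. \<forall>\<phi>. test_fun (\<Omega> - F) \<phi> \<and> supp \<phi> \<subseteq> S \<and> (\<forall>x. 0 \<le> \<phi> x \<and> \<phi> x \<le> 1) \<longrightarrow>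
   (Leb x. eqint p q (g x) (grad \<phi> x) (\<phi> x)) \<le> M"
  \<comment> \<open>The bound is the mass of \<open>S\<close> under the positive part of
    \<open>\<mu>\<close>; the negative part contributes with a favourable sign.\<close>
  proof (intro exI allI impI, elim conjE)
   fix \<phi> assume \<phi>: "test_fun (\<Omega> - F) \<phi>" "supp \<phi> \<subseteq> S" "\<forall>x. 0 \<le> \<phi> x \<and> \<phi> x \<le> 1"
   have SM: "S \<in> sets (fst \<mu>)" using pos_radon_sets[OF \<Omega> \<mu>r(1)] S borel_compact by blast
   have i: "integrable (fst \<mu>) (indicator S :: 'a \<Rightarrow> real)" using SM pos_radon_compact[OF \<mu>r(1) S] by (intro integrable_real_indicator) auto
   have "(\<integral>x. \<phi> x \<partial>fst \<mu>) \<le> (\<integral>x. indicator S x \<partial>fst \<mu>)"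
   proof (rule integral_mono')
    fix x
    show "\<phi> x \<le> indicator S x"
    proof (cases "x \<in> S")
     case False
     then have "\<phi> x = 0" using \<phi>(2) supp_mem[of \<phi> x] by auto
     then show ?thesis by simp
    qed (use \<phi>(3) in simp)
   qed (use i in auto)
   moreover have "0 \<le> (\<integral>x. \<phi> x \<partial>snd \<mu>)" by (rule integral_nonneg_AE) (use \<phi> in auto)
   ultimately show "(Leb x. eqint p q (g x) (grad \<phi> x) (\<phi> x)) \<le> (\<integral>x. indicator S x \<partial>fst \<mu>)"
    using eq[OF \<phi>(1)[folded G_def]] by linarith
  qed
 qed
 \<comment> \<open>Here \<open>p < q\<close> enters: on a compact set the power \<open>p\<close> of
   the gradient is dominated by 1 plus its power \<open>q\<close>.\<close>
 have fin: "(Leb+ x. ennreal (indicator K x * norm (if \<bar>u x\<bar> \<le> ereal k then g x else 0) powr p)) < \<infinity>"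
  if K: "compact K" "K \<subseteq> \<Omega>" for k K
 proof -
  have "(Leb+ x. ennreal (indicator K x * norm (if \<bar>u x\<bar> \<le> ereal k then g x else 0) powr p)) \<le> (Leb+ x. ennreal (indicator K x * norm (g x) powr p))"
   by (rule nn_integral_mono) (use p in \<open>auto simp: indicator_def\<close>)
  also have "\<dots> < \<infinity>"
  proof (rule nn_integral_powr_finite[OF gm K(1)])
   have "integrable lebesgue (\<lambda>x. indicator K x * norm (g x) powr q)" using gl' K by (simp add: loc_int_def set_integrable_def)
   from integrableD(2)[OF this] show "(Leb+ x. ennreal (indicator K x * norm (g x) powr q)) < \<infinity>" by (simp add: less_top)
  qed (use p pq in auto)
  finally show ?thesis .
 qed
 note ext = trunc_gradient_extend[OF um gm tg[unfolded G_def] fin]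
 have equation: "(\<integral>x. eqint p q (g x) (grad \<phi> x) (\<phi> x) \<partial>lebesgue_on \<Omega>) = sintegral \<mu> \<phi>"
  if t: "test_fun \<Omega> \<phi>" for \<phi>
 proof -
  note [measurable] = gm
  have sm: "smooth \<phi>" and S: "compact (supp \<phi>)" "supp \<phi> \<subseteq> \<Omega>" using t by (auto simp: test_fun_iff)
  obtain \<eta> where \<eta>: "cutoffs (supp \<phi>) \<eta>" using cutoffs_exist[OF S] by blast
  obtain B where B: "B > 0" "\<And>x. \<bar>\<phi> x\<bar> \<le> B" "\<And>x. norm (grad \<phi> x) \<le> B" using test_fun_bounds[OF t] by blast
  have \<phi>m[measurable]: "\<phi> \<in> lmeas" "grad \<phi> \<in> lmeas"
   using test_fun_borel[OF t] by (auto intro!: measurable_completion)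
  define H where "H x = eqint p q (g x) (grad \<phi> x) (\<phi> x)" for x
  have iS: "integrable lebesgue (\<lambda>x. indicator (supp \<phi>) x * norm (g x) powr q)" using gl' S by (simp add: loc_int_def set_integrable_def)
  have iH: "integrable lebesgue H"
  proof (rule integrable_le)
   have "integrable lebesgue (indicator (supp \<phi>) :: 'a \<Rightarrow> real)"
    using compact_sets_lebesgue[OF S(1)] emeasure_compact_finite[OF S(1)] borel_compact[OF S(1)] by (intro integrable_real_indicator) auto
   then show "integrable lebesgue (\<lambda>x. B * (indicator (supp \<phi>) x + 2 * (indicator (supp \<phi>) x * norm (g x) powr q)))"
    using iS by auto
   show "H \<in> lmeas" unfolding H_def by measurable
   have "norm (H x) \<le> B * (indicator (supp \<phi>) x + 2 * (indicator (supp \<phi>) x * norm (g x) powr q))" for x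
   proof (cases "x \<in> supp \<phi>")
    case True
    have "\<bar>g x \<bullet> grad \<phi> x\<bar> \<le> norm (g x) * B"
     using Cauchy_Schwarz_ineq2[of "g x" "grad \<phi> x"] mult_left_mono[OF B(3)[of x] norm_ge_zero[of "g x"]] by linarith
    then have "norm (g x) powr (p - 2) * \<bar>g x \<bullet> grad \<phi> x\<bar> \<le> norm (g x) powr (p - 2) * (norm (g x) * B)" by (intro mult_left_mono) auto
    also have "\<dots> = norm (g x) powr (p - 1) * B" unfolding powr_mult_norm[symmetric] by simp
    also have "\<dots> \<le> (1 + norm (g x) powr q) * B" using powr_le_eps[of "norm (g x)" "p - 1" q 1] p q B(1) by (intro mult_right_mono) auto
    finally have 1: "norm (g x) powr (p - 2) * \<bar>g x \<bullet> grad \<phi> x\<bar> \<le> (1 + norm (g x) powr q) * B" .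
    have 2: "norm (g x) powr q * \<bar>\<phi> x\<bar> \<le> norm (g x) powr q * B" using B(2)[of x] by (intro mult_left_mono) auto
    have "norm (H x) \<le> norm (g x) powr (p - 2) * \<bar>g x \<bullet> grad \<phi> x\<bar> + norm (g x) powr q * \<bar>\<phi> x\<bar>"
     unfolding H_def real_norm_def by (rule order_trans[OF abs_triangle_ineq]) (simp add: abs_mult)
    also have "\<dots> \<le> B * (1 + 2 * norm (g x) powr q)" using 1 2 by (simp add: algebra_simps)
    finally show ?thesis using True by simp
   next
    case False
    then have "grad \<phi> x = 0" "\<phi> x = 0" using grad_zero_outside[of x \<phi>] supp_mem[of \<phi> x] by auto
    then show ?thesis using False by (simp add: H_def)
   qed
   then show "AE x in lebesgue. norm (H x) \<le> norm (B * (indicator (supp \<phi>) x + 2 * (indicator (supp \<phi>) x * norm (g x) powr q)))"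
    using order_trans[OF _ abs_ge_self] by auto
  qed
  have l1: "(\<lambda>n. (Leb x. (1 - \<eta> n x) * H x - \<phi> x * (norm (g x) powr (p - 2) * (g x \<bullet> grad (\<eta> n) x)))) \<longlonglongrightarrow> (Leb x. H x)"
   by (rule cutoff_equation_limit[OF \<eta> S gm gl' \<phi>m(1) B(2) _ iH]) (use supp_mem[of \<phi>] in auto)
  have \<phi>r: "\<phi> \<in> borel_measurable (restrict_space borel \<Omega>)" using test_fun_borel(1)[OF t] by (rule measurable_restrict_space1)
  have \<phi>0: "\<phi> x = 0" if "x \<notin> supp \<phi>" for x using that supp_mem[of \<phi> x] by auto
  have l2: "(\<lambda>n. (\<integral>x. \<phi> x * (1 - \<eta> n x) \<partial>fst \<mu>) - (\<integral>x. \<phi> x * (1 - \<eta> n x) \<partial>snd \<mu>)) \<longlonglongrightarrow> sintegral \<mu> \<phi>"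
   unfolding sintegral_def
   by (intro tendsto_diff cutoff_measure_limit[OF \<eta> \<mu>r(1) \<mu>F(1) S \<phi>r B(2) \<phi>0] cutoff_measure_limit[OF \<eta> \<mu>r(2) \<mu>F(2) S \<phi>r B(2) \<phi>0])
  \<comment> \<open>This is the equation off \<open>F\<close> for the test function
    \<open>\<phi> (1 - \<eta> n)\<close>, whose gradient is expanded by
    \<open>grad_cutoff\<close>.\<close>
  have "(Leb x. (1 - \<eta> n x) * H x - \<phi> x * (norm (g x) powr (p - 2) * (g x \<bullet> grad (\<eta> n) x)))
   = (\<integral>x. \<phi> x * (1 - \<eta> n x) \<partial>fst \<mu>) - (\<integral>x. \<phi> x * (1 - \<eta> n x) \<partial>snd \<mu>)" for n
  proof -
   have "test_fun G (\<lambda>x. \<phi> x * (1 - \<eta> n x))" unfolding G_def by (rule test_fun_cutoff[OF t cutoffsD(2,5)[OF \<eta>]])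
   from eq[OF this] show ?thesis
    unfolding grad_cutoff[OF sm cutoffsD(2)[OF \<eta>]] H_def by (simp add: inner_diff_right algebra_simps)
  qed
  with l1 have "(\<lambda>n. (\<integral>x. \<phi> x * (1 - \<eta> n x) \<partial>fst \<mu>) - (\<integral>x. \<phi> x * (1 - \<eta> n x) \<partial>snd \<mu>)) \<longlonglongrightarrow> (Leb x. H x)" by simp
  from LIMSEQ_unique[OF this l2] have "(Leb x. H x) = sintegral \<mu> \<phi>" .
  moreover have "(\<integral>x. H x \<partial>lebesgue_on \<Omega>) = (Leb x. H x)"
   by (rule integral_lebesgue_on[OF open_sets_lebesgue[OF \<Omega>]]) (use test_fun_zero_outside[OF t] in \<open>auto simp: H_def\<close>)
  ultimately show ?thesis by (simp add: H_def)
 qed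
 have "meas_finite_ae \<Omega> u"
 proof -
  have "meas_finite_ae (\<Omega> - F) u" using u by (simp add: weak_solution_def)
  from meas_finite_ae_extend(2)[OF this] show ?thesis
   using um by (simp add: meas_finite_ae_def AE_lebesgue_on[OF open_sets_lebesgue[OF \<Omega>]] measurable_restrict_space1)
 qed
 then show ?thesis
  unfolding weak_solution_def using ext gl'[folded in_Lp_loc_1_iff] equation by blast
qed

end


section \<open>Test functions for the renormalized equation\<close>

lemma in_Lp_dominated:
 assumes S: "S \<in> sets lebesgue" and r: "0 < r" and 1: "in_Lp r S f1" and 2: "in_Lp r S f2"
  and m: "(\<lambda>x. indicator S x *\<^sub>R f x) \<in> lmeas"
  and C: "0 \<le> C" and b: "\<And>x. x \<in> S \<Longrightarrow> norm (f x) \<le> C * (norm (f1 x) + norm (f2 x))"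
 shows "in_Lp r S f"
 unfolding in_Lp_iff[OF S]
proof
 have i: "integrable lebesgue (\<lambda>x. indicator S x *\<^sub>R norm (f1 x) powr r)" "integrable lebesgue (\<lambda>x. indicator S x *\<^sub>R norm (f2 x) powr r)"
  using 1 2 by (auto simp: in_Lp_iff[OF S])
 have e: "indicator S x *\<^sub>R norm (f x) powr r = norm (indicator S x *\<^sub>R f x) powr r" for x
  by (auto simp: indicator_def)
 show "integrable lebesgue (\<lambda>x. indicator S x *\<^sub>R norm (f x) powr r)"
 proof (rule integrable_le)
  show "integrable lebesgue (\<lambda>x. C powr r * (2 powr r * (indicator S x *\<^sub>R norm (f1 x) powr r + indicator S x *\<^sub>R norm (f2 x) powr r)))"
   using i by auto
  show "(\<lambda>x. indicator S x *\<^sub>R norm (f x) powr r) \<in> lmeas" unfolding e using m by measurable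
  have le: "indicator S x *\<^sub>R norm (f x) powr r \<le> C powr r * (2 powr r * (indicator S x *\<^sub>R norm (f1 x) powr r + indicator S x *\<^sub>R norm (f2 x) powr r))" for x
  proof (cases "x \<in> S")
   case True
   have "norm (f x) powr r \<le> (C * (norm (f1 x) + norm (f2 x))) powr r" using b[OF True] r by (intro powr_mono2) auto
   also have "\<dots> = C powr r * (norm (f1 x) + norm (f2 x)) powr r" using C by (simp add: powr_mult)
   also have "\<dots> \<le> C powr r * (2 powr r * (norm (f1 x) powr r + norm (f2 x) powr r))"
    using r by (intro mult_left_mono powr_add_le) auto
   finally show ?thesis using True by simp
  qed simp
  show "AE x in lebesgue. norm (indicator S x *\<^sub>R norm (f x) powr r) \<le> norm (C powr r * (2 powr r * (indicator S x *\<^sub>R norm (f1 x) powr r + indicator S x *\<^sub>R norm (f2 x) powr r)))"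
  proof (rule AE_I2)
   fix x :: 'a
   have "norm (indicator S x *\<^sub>R norm (f x) powr r) = indicator S x *\<^sub>R norm (f x) powr r" by simp
   then show "norm (indicator S x *\<^sub>R norm (f x) powr r) \<le> norm (C powr r * (2 powr r * (indicator S x *\<^sub>R norm (f1 x) powr r + indicator S x *\<^sub>R norm (f2 x) powr r)))"
    using le[of x] abs_ge_self[of "C powr r * (2 powr r * (indicator S x *\<^sub>R norm (f1 x) powr r + indicator S x *\<^sub>R norm (f2 x) powr r))"]
    unfolding real_norm_def by linarith
  qed
 qed
qed (fact m)

lemma bounded_compact_in_Lp:
 assumes S: "S \<in> sets lebesgue" and K: "compact K" and m: "f \<in> lmeas" and r: "0 < r"
  and b: "\<And>x. norm (f x) \<le> B" "\<And>x. x \<notin> K \<Longrightarrow> f x = 0"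
 shows "in_Lp r S f"
proof -
 have "0 \<le> B" using order_trans[OF norm_ge_zero b(1)] .
 have ik: "integrable lebesgue (indicator K :: 'a \<Rightarrow> real)"
  using compact_sets_lebesgue[OF K] emeasure_compact_finite[OF K] borel_compact[OF K] by (intro integrable_real_indicator) auto
 have "integrable lebesgue (\<lambda>x. indicator S x *\<^sub>R (indicator K x :: real))"
  by (rule integrable_mult_indicator[OF S ik])
 moreover have e: "(\<lambda>x::'a. indicator S x *\<^sub>R norm (indicator K x :: real) powr r) = (\<lambda>x. indicator S x *\<^sub>R (indicator K x :: real))"
  by (auto simp: fun_eq_iff indicator_def)
 moreover have "(\<lambda>x. indicator S x *\<^sub>R (indicator K x :: real)) \<in> lmeas"
  using S compact_sets_lebesgue[OF K] by measurable
 ultimately have l: "in_Lp r S (\<lambda>x. indicator K x :: real)" unfolding in_Lp_iff[OF S] e by blast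
 show ?thesis
 proof (rule in_Lp_dominated[OF S r l l _ \<open>0 \<le> B\<close>])
  show "(\<lambda>x. indicator S x *\<^sub>R f x) \<in> lmeas" using S m by measurable
  show "norm (f x) \<le> B * (norm (indicator K x :: real) + norm (indicator K x :: real))" for x
   using b(1)[of x] b(2)[of x] \<open>0 \<le> B\<close> by (cases "x \<in> K") auto
 qed
qed

lemma in_Lp_loc_powr:
 fixes f :: "'a::euclidean_space \<Rightarrow> 'b::euclidean_space"
 assumes "in_Lp_loc r G f"
 shows "loc_int G (\<lambda>x. norm (f x) powr r)"
 using assms unfolding in_Lp_loc_def loc_int_def set_integrable_def
 by (auto simp: in_Lp_iff compact_sets_lebesgue)

lemma in_Lp_mono:
 assumes S: "S \<in> sets lebesgue" "T \<in> sets lebesgue" "T \<subseteq> S" and f: "in_Lp r S f"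
 shows "in_Lp r T f"
proof -
 have m: "(\<lambda>x. indicator S x *\<^sub>R f x) \<in> lmeas" and i: "integrable lebesgue (\<lambda>x. indicator S x *\<^sub>R norm (f x) powr r)"
  using f by (auto simp: in_Lp_iff[OF S(1)])
 have e1: "indicator T x *\<^sub>R f x = indicator T x *\<^sub>R (indicator S x *\<^sub>R f x)"
  and e2: "indicator T x *\<^sub>R norm (f x) powr r = indicator T x *\<^sub>R (indicator S x *\<^sub>R norm (f x) powr r)" for x
  using S(3) by (auto simp: indicator_def)
 have "(\<lambda>x. indicator T x *\<^sub>R (indicator S x *\<^sub>R f x)) \<in> lmeas" using m S(2) by measurable
 moreover have "integrable lebesgue (\<lambda>x. indicator T x *\<^sub>R (indicator S x *\<^sub>R norm (f x) powr r))"
  by (rule integrable_mult_indicator[OF S(2) i])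
 ultimately show ?thesis unfolding in_Lp_iff[OF S(2)] by (subst e1, subst e2) blast
qed

text \<open>\<open>in_W1p\<close> only asserts that some weak gradient is in the Lebesgue space;
  uniqueness transfers this to the given one.\<close>

lemma in_W1p_weak_gradient:
 assumes G: "open G" and f: "in_W1p r G f" and w: "weak_gradient G f g"
 shows "in_Lp r G g"
proof -
 obtain g' where g': "weak_gradient G f g'" "in_Lp r G g'" using f by (auto simp: in_W1p_def)
 show ?thesis by (rule in_Lp_cong_AE[OF open_sets_lebesgue[OF G] weak_gradient_unique[OF G g'(1) w] g'(2)])
qed

lemma in_W1p_loc_weak_gradient:
 assumes G: "open G" and f: "in_W1p_loc r G f" and w: "weak_gradient G f g"
 shows "in_Lp_loc r G g"
proof -
 obtain g' where g': "weak_gradient G f g'" "in_Lp_loc r G g'" using f by (auto simp: in_W1p_loc_def)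
 show ?thesis by (rule in_Lp_loc_cong_AE[OF weak_gradient_unique[OF G g'(1) w] g'(2)])
qed

lemma in_W1p_cutoff:
 assumes G: "open G" "open \<Omega>" "G \<subseteq> \<Omega>" and r: "0 < r" and f: "in_W1p r \<Omega> f" and w: "weak_gradient \<Omega> f g"
  and \<eta>: "test_fun UNIV \<eta>" "\<And>x. 0 \<le> \<eta> x" "\<And>x. \<eta> x \<le> 1"
 shows "in_W1p r G (\<lambda>x. f x * (1 - \<eta> x))" "weak_gradient G (\<lambda>x. f x * (1 - \<eta> x)) (\<lambda>x. (1 - \<eta> x) *\<^sub>R g x - f x *\<^sub>R grad \<eta> x)"
proof -
 note Gl = open_sets_lebesgue[OF G(1)]
 note Ol = open_sets_lebesgue[OF G(2)]
 have sm: "smooth \<eta>" using \<eta>(1) by (rule test_fun_smooth)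
 have "smooth (\<lambda>x. 1 - \<eta> x)" by (intro smooth_diff smooth_const sm)
 from weak_gradient_mult_smooth[OF G(1) weak_gradient_mono[OF G(2,1,3) w] this]
 have "weak_gradient G (\<lambda>x. f x * (1 - \<eta> x)) (\<lambda>x. (1 - \<eta> x) *\<^sub>R g x + f x *\<^sub>R grad (\<lambda>x. 1 - \<eta> x) x)" .
 moreover have "grad (\<lambda>x. 1 - \<eta> x) x = - grad \<eta> x" for x using sm by (simp add: grad_diff smooth_const grad_const)
 ultimately show wg: "weak_gradient G (\<lambda>x. f x * (1 - \<eta> x)) (\<lambda>x. (1 - \<eta> x) *\<^sub>R g x - f x *\<^sub>R grad \<eta> x)" by simp
 have fL: "in_Lp r G f" using f by (intro in_Lp_mono[OF Ol Gl G(3)]) (simp add: in_W1p_def)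
 have gL: "in_Lp r G g" by (rule in_Lp_mono[OF Ol Gl G(3) in_W1p_weak_gradient[OF G(2) f w]])
 obtain B where "B > 0" "\<And>x. \<bar>\<eta> x\<bar> \<le> B" "\<And>x. norm (grad \<eta> x) \<le> B" using test_fun_bounds[OF \<eta>(1)] by blast
 note B = this(1,3)
 have "in_Lp r G (\<lambda>x. f x * (1 - \<eta> x))"
 proof (rule in_Lp_dominated[OF Gl r fL fL, of _ 1])
  show "(\<lambda>x. indicator G x *\<^sub>R (f x * (1 - \<eta> x))) \<in> lmeas"
   by (rule loc_int_measurable[OF G(1) weak_gradient_loc_int(1)[OF G(1) wg]])
  fix x
  have "\<bar>f x\<bar> * \<bar>1 - \<eta> x\<bar> \<le> \<bar>f x\<bar> * 1" using \<eta>(2,3)[of x] by (intro mult_left_mono) auto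
  then show "norm (f x * (1 - \<eta> x)) \<le> 1 * (norm (f x) + norm (f x))" by (simp add: abs_mult)
 qed simp
 moreover have "in_Lp r G (\<lambda>x. (1 - \<eta> x) *\<^sub>R g x - f x *\<^sub>R grad \<eta> x)"
 proof (rule in_Lp_dominated[OF Gl r gL fL, of _ "1 + B"])
  show "(\<lambda>x. indicator G x *\<^sub>R ((1 - \<eta> x) *\<^sub>R g x - f x *\<^sub>R grad \<eta> x)) \<in> lmeas"
   by (rule loc_int_measurable[OF G(1) weak_gradient_loc_int(2)[OF G(1) wg]])
  fix x
  have 1: "\<bar>1 - \<eta> x\<bar> * norm (g x) \<le> (1 + B) * norm (g x)" using \<eta>(2,3)[of x] B(1) by (intro mult_right_mono) auto
  have 2: "\<bar>f x\<bar> * norm (grad \<eta> x) \<le> \<bar>f x\<bar> * (1 + B)" using B(2)[of x] by (intro mult_left_mono) auto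
  have "norm ((1 - \<eta> x) *\<^sub>R g x - f x *\<^sub>R grad \<eta> x) \<le> \<bar>1 - \<eta> x\<bar> * norm (g x) + \<bar>f x\<bar> * norm (grad \<eta> x)"
   by (rule order_trans[OF norm_triangle_ineq4]) simp
  with 1 2 show "norm ((1 - \<eta> x) *\<^sub>R g x - f x *\<^sub>R grad \<eta> x) \<le> (1 + B) * (norm (g x) + norm (f x))" by (simp add: algebra_simps)
 qed (use B(1) in simp)
 ultimately show "in_W1p r G (\<lambda>x. f x * (1 - \<eta> x))" using wg by (auto simp: in_W1p_def)
qed

lemma test_fun_in_W1p:
 assumes G: "open G" and t: "test_fun G \<phi>" and r: "0 < r"
 shows "in_W1p r G \<phi>" "weak_gradient G \<phi> (grad \<phi>)"
proof -
 obtain B where B: "B > 0" "\<And>x. \<bar>\<phi> x\<bar> \<le> B" "\<And>x. norm (grad \<phi> x) \<le> B" using test_fun_bounds[OF t] by blast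
 have K: "compact (supp \<phi>)" using t by (simp add: test_fun_iff)
 have m: "\<phi> \<in> lmeas" "grad \<phi> \<in> lmeas"
  using test_fun_borel[OF t] by (auto intro!: measurable_completion)
 show w: "weak_gradient G \<phi> (grad \<phi>)" by (rule weak_gradient_mono[OF open_UNIV G subset_UNIV test_fun_weak_gradient[OF t]])
 have "in_Lp r G \<phi>"
  by (rule bounded_compact_in_Lp[OF open_sets_lebesgue[OF G] K m(1) r, of B]) (use B(2) supp_mem[of \<phi>] in auto)
 moreover have "in_Lp r G (grad \<phi>)"
  by (rule bounded_compact_in_Lp[OF open_sets_lebesgue[OF G] K m(2) r B(3) grad_zero_outside])
 ultimately show "in_W1p r G \<phi>" using w by (auto simp: in_W1p_def)
qed

text \<open>The directional bound is used for each basis vector and its negative; the factor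
  \<open>DIM('a)\<close> comes from estimating the norm by the sum of the components.\<close>

lemma weak_gradient_lipschitz_norm:
 fixes f v \<phi> :: "'a::euclidean_space \<Rightarrow> real"
 assumes G: "open G" and w: "weak_gradient G f w" "weak_gradient G v gv" "weak_gradient G \<phi> g\<phi>"
  and C: "0 \<le> C" and lip: "\<And>x y. x \<in> G \<Longrightarrow> y \<in> G \<Longrightarrow> \<bar>f x - f y\<bar> \<le> C * (\<bar>v x - v y\<bar> + \<bar>\<phi> x - \<phi> y\<bar>)"
 shows "ae_on G (\<lambda>x. norm (w x) \<le> real DIM('a) * (C * (norm (gv x) + norm (g\<phi> x))))"
proof -
 have "AE x in lebesgue. \<forall>b\<in>Basis. x \<in> G \<longrightarrow> w x \<bullet> b \<le> C * (norm (gv x) + norm (g\<phi> x))"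
 proof (rule AE_finite_allI[OF finite_Basis])
  fix b :: 'a assume "b \<in> Basis"
  then have b: "norm b \<le> 1" by simp
  show "ae_on G (\<lambda>x. w x \<bullet> b \<le> C * (norm (gv x) + norm (g\<phi> x)))"
   by (rule weak_gradient_lipschitz_bound[OF G w C lip b])
 qed
 moreover have "AE x in lebesgue. \<forall>b\<in>Basis. x \<in> G \<longrightarrow> w x \<bullet> (- b) \<le> C * (norm (gv x) + norm (g\<phi> x))"
 proof (rule AE_finite_allI[OF finite_Basis])
  fix b :: 'a assume "b \<in> Basis"
  then have b: "norm (- b) \<le> 1" by simp
  show "ae_on G (\<lambda>x. w x \<bullet> (- b) \<le> C * (norm (gv x) + norm (g\<phi> x)))"
   by (rule weak_gradient_lipschitz_bound[OF G w C lip b])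
 qed
 ultimately show ?thesis
 proof eventually_elim
  case (elim x)
  show ?case
  proof
   assume x: "x \<in> G"
   have "\<bar>w x \<bullet> b\<bar> \<le> C * (norm (gv x) + norm (g\<phi> x))" if "b \<in> Basis" for b
   proof -
    have "w x \<bullet> b \<le> C * (norm (gv x) + norm (g\<phi> x))" "- (w x \<bullet> b) \<le> C * (norm (gv x) + norm (g\<phi> x))"
     using elim x that by (auto simp: inner_minus_right)
    then show ?thesis by linarith
   qed
   then have "(\<Sum>b\<in>Basis. \<bar>w x \<bullet> b\<bar>) \<le> real DIM('a) * (C * (norm (gv x) + norm (g\<phi> x)))" by (rule sum_bounded_above)
   then show "norm (w x) \<le> real DIM('a) * (C * (norm (gv x) + norm (g\<phi> x)))" using norm_le_l1 order_trans by blast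
  qed
 qed
qed

text \<open>\<open>h\<close> is constant beyond \<open>R\<close> on either side, so the limits in
  \<open>ext_fun\<close> are the values of \<open>h\<close> at \<open>R\<close> and
  \<open>- R\<close>, which are the truncations of the infinite points.\<close>

lemma ext_fun_trunc:
 assumes R: "0 < R" "\<And>x. R \<le> x \<Longrightarrow> h x = h R" "\<And>x. x \<le> - R \<Longrightarrow> h x = h (- R)"
 shows "ext_fun h s = h (trunc R s)"
proof (cases s)
 case (real t)
 then show ?thesis using R(2)[of t] R(3)[of t] R(1) by (cases "R \<le> t"; cases "t \<le> - R") (auto simp: ext_fun_def trunc_simps clip_def)
next
 case PInf
 have "\<forall>\<^sub>F t in at_top. h t = h R" using eventually_ge_at_top[of R] by eventually_elim (rule R(2))
 then have "(h \<longlongrightarrow> h R) at_top" by (rule tendsto_eventually)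
 then have "Lim at_top h = h R" by (intro tendsto_Lim) auto
 then show ?thesis using PInf R(1) by (simp add: ext_fun_def trunc_simps)
next
 case MInf
 have "\<forall>\<^sub>F t in at_bot. h t = h (- R)" using eventually_le_at_bot[of "- R"] by eventually_elim (rule R(3))
 then have "(h \<longlongrightarrow> h (- R)) at_bot" by (rule tendsto_eventually)
 then have "Lim at_bot h = h (- R)" by (intro tendsto_Lim) auto
 then show ?thesis using MInf R(1) by (simp add: ext_fun_def trunc_simps)
qed

lemma renormalized_equation_cong:
 assumes "\<And>x. x \<in> G \<Longrightarrow> g x = g' x" and e: "renormalized_equation p q G u g v \<mu>0 \<sigma>p \<sigma>m"
 shows "renormalized_equation p q G u g' v \<mu>0 \<sigma>p \<sigma>m"
proof -
 have "(\<integral>x. eqint p q (g' x) (w x) (f x) \<partial>lebesgue_on G)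
  = (\<integral>x. eqint p q (g x) (w x) (f x) \<partial>lebesgue_on G)" for w f
  by (rule Bochner_Integration.integral_cong) (auto simp: assms(1))
 then show ?thesis using e unfolding renormalized_equation_def by simp
qed

lemma cap_mono: "E \<subseteq> E' \<Longrightarrow> cap r E \<le> cap r E'"
 unfolding cap_def by (intro INF_superset_mono) auto

text \<open>The extension may be discontinuous at \<open>F\<close>, so the exceptional set is
  enlarged by an open neighbourhood of \<open>F\<close>; its capacity stays small because
  \<open>cap p F = 0\<close>. Off the enlarged set the extension coincides with
  \<open>v\<close>.\<close>

lemma quasicont_rep_extend:
 assumes p: "0 < p" and \<Omega>: "open \<Omega>" and G: "open (\<Omega> - F)" and F: "F \<subseteq> \<Omega>" "cap p F = 0" "AE x in lebesgue. x \<notin> F"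
  and v: "quasicont_rep p (\<Omega> - F) u v"
 shows "quasicont_rep p \<Omega> u (\<lambda>x. if x \<in> \<Omega> - F then v x else 0)" (is "quasicont_rep p \<Omega> u ?v")
 unfolding quasicont_rep_def
proof (intro conjI allI impI)
 have "v \<in> borel_measurable (restrict_space borel (\<Omega> - F))" using v by (simp add: quasicont_rep_def)
 then have "?v \<in> bmeas" using G by (subst (asm) measurable_restrict_space_iff[of _ _ 0]) auto
 then show "?v \<in> borel_measurable (restrict_space borel \<Omega>)" by (rule measurable_restrict_space1)
 have "ae_on (\<Omega> - F) (\<lambda>x. v x = u x)" using v by (simp add: quasicont_rep_def AE_lebesgue_on open_sets_lebesgue G)
 with F(3) have "ae_on \<Omega> (\<lambda>x. ?v x = u x)" by eventually_elim auto
 then show "AE x in lebesgue_on \<Omega>. ?v x = u x" by (simp add: AE_lebesgue_on open_sets_lebesgue \<Omega>)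
 fix \<epsilon> :: ennreal assume "0 < \<epsilon>"
 then obtain e' where e': "0 < e'" "e' < \<epsilon>" using dense by blast
 then obtain e where e: "e' = ennreal e" by (cases e') auto
 with e' have e0: "0 < e" by simp
 then have d: "0 < ennreal (e / (4 * 2 powr p))" by simp
 obtain U where U: "open U" "U \<subseteq> \<Omega> - F" "cap p U < ennreal (e / (4 * 2 powr p))" "continuous_on (\<Omega> - F - U) v"
  using v d unfolding quasicont_rep_def by blast
 have "cap p F < ennreal (e / (4 * 2 powr p))" using F(2) d by simp
 from cap_open_Un_less[OF p U(1) e0 U(3) this] obtain V where V: "open V" "F \<subseteq> V" "cap p (U \<union> V) < ennreal e" by blast
 show "\<exists>U. open U \<and> U \<subseteq> \<Omega> \<and> cap p U < \<epsilon> \<and> continuous_on (\<Omega> - U) ?v"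
 proof (intro exI conjI)
  show "open (U \<union> V \<inter> \<Omega>)" "U \<union> V \<inter> \<Omega> \<subseteq> \<Omega>" using U V \<Omega> by auto
  have "cap p (U \<union> V \<inter> \<Omega>) \<le> cap p (U \<union> V)" by (rule cap_mono) auto
  also have "\<dots> < \<epsilon>" using V(3) e' e by simp
  finally show "cap p (U \<union> V \<inter> \<Omega>) < \<epsilon>" .
  have "continuous_on (\<Omega> - (U \<union> V \<inter> \<Omega>)) v" by (rule continuous_on_subset[OF U(4)]) (use V(2) in auto)
  then show "continuous_on (\<Omega> - (U \<union> V \<inter> \<Omega>)) ?v" by (rule continuous_on_eq) (use V(2) in auto)
 qed
qed

text \<open>The mass is measured by the extension, which is finite on compact subsets of
  \<open>\<Omega>\<close>; thus the bound does not deteriorate when the support of \<open>f\<close>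
  approaches the boundary of \<open>G\<close> inside \<open>\<Omega>\<close>.\<close>

lemma integral_bound_zero_ext:
 assumes G: "open G" "open \<Omega>" "G \<subseteq> \<Omega>" and M: "pos_radon G M" "pos_radon \<Omega> (zero_ext \<Omega> M)" and S: "compact S" "S \<subseteq> \<Omega>"
  and k: "0 \<le> k" and f: "\<And>x. x \<in> S \<Longrightarrow> \<bar>f x\<bar> \<le> k" "\<And>x. x \<notin> S \<Longrightarrow> f x = 0"
 shows "\<bar>\<integral>x. f x \<partial>M\<bar> \<le> k * measure (zero_ext \<Omega> M) S"
proof -
 have Sb: "S \<in> sets borel" using S(1) by (rule borel_compact)
 have SM: "S \<inter> G \<in> sets M" using pos_radon_sets[OF G(1) M(1)] Sb G(1) by auto
 have fin: "emeasure M (S \<inter> G) < \<infinity>"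
  using pos_radon_compact[OF M(2) S] emeasure_zero_ext(1)[OF G M(1) Sb S(2)] by simp
 have "ennreal (norm (\<integral>x. f x \<partial>M)) \<le> (\<integral>\<^sup>+x. ennreal (norm (f x)) \<partial>M)" by (rule norm_integral_le_nn_integral)
 also have "\<dots> \<le> (\<integral>\<^sup>+x. ennreal k * indicator (S \<inter> G) x \<partial>M)"
 proof (rule nn_integral_mono)
  fix x assume "x \<in> space M"
  then have "x \<in> G" using pos_radon_space[OF M(1)] by simp
  then show "ennreal (norm (f x)) \<le> ennreal k * indicator (S \<inter> G) x"
   using f[of x] by (cases "x \<in> S") (auto intro: ennreal_leI)
 qed
 also have "\<dots> = ennreal k * emeasure M (S \<inter> G)" by (rule nn_integral_cmult_indicator[OF SM])
 also have "\<dots> = ennreal (k * measure M (S \<inter> G))"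
  using fin k by (simp add: emeasure_eq_ennreal_measure ennreal_mult)
 finally show ?thesis using k emeasure_zero_ext(2)[OF G M(1) Sb S(2)] by (simp add: ennreal_le_iff)
qed


section \<open>Locally renormalized solutions across a set of zero capacity\<close>

context removable
begin

text \<open>After clearing denominators, \<open>p \<le> qs\<close> reads
  \<open>(p - 1) q \<le> (p - 1) p\<close>.\<close>

lemma exponent_order: "q \<le> p \<Longrightarrow> p \<le> qs"
proof -
 assume qp: "q \<le> p"
 have "p * (q + 1 - p) \<le> q"
 proof -
  have "(p - 1) * q \<le> (p - 1) * p" using qp p by (intro mult_left_mono) auto
  then show ?thesis by (simp add: algebra_simps)
 qed
 then show "p \<le> qs" using q unfolding qs by (simp add: le_divide_eq)
qed

theorem locally_renormalized_solution_extend: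
 fixes u :: "'a \<Rightarrow> ereal"
 assumes pN: "p \<le> real DIM('a)" and qp: "q \<le> p" and \<mu>: "radon_cap qs \<Omega> \<mu>"
  and u: "locally_renormalized_solution p q (\<Omega> - F) (srestrict \<mu> (\<Omega> - F)) u"
  and um: "u \<in> lmeas"
 shows "locally_renormalized_solution p q \<Omega> \<mu> u"
proof -
 let ?N = "real DIM('a)"
 define G where "G = \<Omega> - F"
 note Go = G_open[folded G_def]
 note Gl = open_sets_lebesgue[OF Go]
 note \<Omega>l = open_sets_lebesgue[OF \<Omega>]
 have G\<Omega>: "G \<subseteq> \<Omega>" by (auto simp: G_def)
 have p0: "0 < p" using p by simp
 have N1: "1 < ?N" using p pN by linarith
 have capF: "cap p F = 0" by (rule cap_zero_exponent[OF cap p0 exponent_order[OF qp]])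
 have \<mu>s: "signed_radon \<Omega> \<mu>" using \<mu> by (simp add: radon_cap_def)
 obtain g0 v \<mu>0 \<sigma>p \<sigma>m where g0: "trunc_gradient G u g0" "quasicont_rep p G u v" "cap_decomposition p G (srestrict \<mu> G) \<mu>0 \<sigma>p \<sigma>m"
   "in_Lp_loc 1 G (\<lambda>x. norm (g0 x) powr q)"
   "\<forall>t\<ge>1. t < ?N / (?N - 1) \<longrightarrow> in_Lp_loc t G (\<lambda>x. norm (g0 x) powr (p - 1))"
   "renormalized_equation p q G u g0 v \<mu>0 \<sigma>p \<sigma>m"
  using u unfolding locally_renormalized_solution_iff G_def by blast
 define g where "g x = (if x \<in> G then g0 x else 0)" for x
 have gm[measurable]: "g \<in> lmeas" and tg: "trunc_gradient G u g"
  using zero_extension[OF g0(1)[unfolded G_def]] by (simp_all add: g_def[abs_def] G_def)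
 note [measurable] = um
 have g_out: "g x = 0" if "x \<notin> G" for x using that by (simp add: g_def)
 have gl: "loc_int G (\<lambda>x. norm (g x) powr q)"
  by (rule loc_int_cong_AE[OF g0(4)[unfolded in_Lp_loc_1_iff]]) (auto simp: g_def)
 have eqn: "renormalized_equation p q G u g v \<mu>0 \<sigma>p \<sigma>m"
  by (rule renormalized_equation_cong[OF _ g0(6)]) (simp add: g_def)
 define gk where "gk k x = (if \<bar>u x\<bar> \<le> ereal k then g x else 0)" for k x
 have gkm[measurable]: "gk k \<in> lmeas" for k unfolding gk_def by measurable
 have Tm[measurable]: "(\<lambda>x. trunc k (u x)) \<in> lmeas" for k unfolding trunc_def by measurable
 have wk: "weak_gradient G (\<lambda>x. trunc k (u x)) (gk k)" if "0 < k" for k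
  using tg that by (simp add: trunc_gradient_def gk_def[abs_def])
 have gkl: "loc_int G (\<lambda>x. norm (gk k x) powr p)" if k: "0 < k" for k
 proof -
  have "in_W1p_loc p G (\<lambda>x. trunc k (u x))" using u k by (simp add: locally_renormalized_solution_iff G_def)
  from in_Lp_loc_powr[OF in_W1p_loc_weak_gradient[OF Go this wk[OF k]]] show ?thesis .
 qed
 define \<mu>0' where "\<mu>0' = (zero_ext \<Omega> (fst \<mu>0), zero_ext \<Omega> (snd \<mu>0))"
 define \<sigma>p' where "\<sigma>p' = zero_ext \<Omega> \<sigma>p"
 define \<sigma>m' where "\<sigma>m' = zero_ext \<Omega> \<sigma>m"
 have dec: "cap_decomposition p \<Omega> \<mu> \<mu>0' \<sigma>p' \<sigma>m'"
  unfolding \<mu>0'_def \<sigma>p'_def \<sigma>m'_def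
  by (rule cap_decomposition_extend[OF \<Omega> Go G_def F_subset F_borel \<mu>s capacity_null_F[OF \<mu>] g0(3)])
 have r: "pos_radon G (fst \<mu>0)" "pos_radon G (snd \<mu>0)" "pos_radon G \<sigma>p" "pos_radon G \<sigma>m"
  using g0(3) by (auto simp: cap_decomposition_def radon_cap_def signed_radon_def)
 have r': "pos_radon \<Omega> (zero_ext \<Omega> (fst \<mu>0))" "pos_radon \<Omega> (zero_ext \<Omega> (snd \<mu>0))" "pos_radon \<Omega> (zero_ext \<Omega> \<sigma>p)" "pos_radon \<Omega> (zero_ext \<Omega> \<sigma>m)"
  using dec by (auto simp: cap_decomposition_def radon_cap_def signed_radon_def \<mu>0'_def \<sigma>p'_def \<sigma>m'_def)
 have nullF: "emeasure (zero_ext \<Omega> M) F = 0" if "pos_radon G M" for M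
 proof -
  have "F \<inter> G = {}" by (auto simp: G_def)
  then show ?thesis using emeasure_zero_ext(1)[OF Go \<Omega> G\<Omega> that F_borel F_subset] by simp
 qed
 \<comment> \<open>The total mass of \<open>S\<close> for the four extended measures bounds the
   right side of the equation for all test functions between 0 and 1 supported in \<open>S\<close>,
   linearly in the bound of \<open>h\<close>. This relies on the extensions being Radon measures on
   \<open>\<Omega>\<close>.\<close>
 define mass where "mass S = measure (zero_ext \<Omega> (fst \<mu>0)) S + measure (zero_ext \<Omega> (snd \<mu>0)) S + measure (zero_ext \<Omega> \<sigma>p) S + measure (zero_ext \<Omega> \<sigma>m) S" for S
 have rhs: "sintegral \<mu>0 (\<lambda>x. ext_fun h (v x) * \<phi> x) + ext_fun h \<infinity> * (\<integral>x. \<phi> x \<partial>\<sigma>p) - ext_fun h (-\<infinity>) * (\<integral>x. \<phi> x \<partial>\<sigma>m) \<le> k * mass S"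
  if S: "compact S" "S \<subseteq> \<Omega>" and k: "0 \<le> k" and h: "\<And>s. \<bar>ext_fun h s\<bar> \<le> k" and \<phi>: "supp \<phi> \<subseteq> S" "\<And>x. 0 \<le> \<phi> x \<and> \<phi> x \<le> 1" for S k h and \<phi> :: "'a \<Rightarrow> real"
 proof -
  have \<phi>0: "\<phi> x = 0" if "x \<notin> S" for x using that \<phi>(1) supp_mem[of \<phi> x] by auto
  have b1: "\<bar>ext_fun h (v x) * \<phi> x\<bar> \<le> k" for x
  proof -
   have "\<bar>ext_fun h (v x)\<bar> * \<bar>\<phi> x\<bar> \<le> k * 1" using h[of "v x"] \<phi>(2)[of x] k by (intro mult_mono) auto
   then show ?thesis by (simp add: abs_mult)
  qed
  note bd = integral_bound_zero_ext[OF Go \<Omega> G\<Omega> _ _ S]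
  have 1: "\<bar>\<integral>x. ext_fun h (v x) * \<phi> x \<partial>fst \<mu>0\<bar> \<le> k * measure (zero_ext \<Omega> (fst \<mu>0)) S"
   by (rule bd[OF r(1) r'(1) k b1]) (simp add: \<phi>0)
  have 2: "\<bar>\<integral>x. ext_fun h (v x) * \<phi> x \<partial>snd \<mu>0\<bar> \<le> k * measure (zero_ext \<Omega> (snd \<mu>0)) S"
   by (rule bd[OF r(2) r'(2) k b1]) (simp add: \<phi>0)
  have \<phi>1: "\<bar>\<phi> x\<bar> \<le> 1" for x using \<phi>(2)[of x] by auto
  have i: "\<bar>\<integral>x. \<phi> x \<partial>M\<bar> \<le> measure (zero_ext \<Omega> M) S" if "pos_radon G M" "pos_radon \<Omega> (zero_ext \<Omega> M)" for M
   using bd[OF that zero_le_one \<phi>1 \<phi>0] by simp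
  have "\<bar>ext_fun h \<infinity> * (\<integral>x. \<phi> x \<partial>\<sigma>p)\<bar> \<le> k * measure (zero_ext \<Omega> \<sigma>p) S"
   unfolding abs_mult by (intro mult_mono h i r r' k) auto
  moreover have "\<bar>ext_fun h (-\<infinity>) * (\<integral>x. \<phi> x \<partial>\<sigma>m)\<bar> \<le> k * measure (zero_ext \<Omega> \<sigma>m) S"
   unfolding abs_mult by (intro mult_mono h i r r' k) auto
  ultimately show ?thesis using 1 2 unfolding sintegral_def mass_def distrib_left by linarith
 qed
 have ext_const: "ext_fun (\<lambda>t. c) s = c" for c s by (rule ext_fun_trunc[of 1]) auto
 \<comment> \<open>The constant function 1 is an admissible \<open>h\<close>, which turns the
   renormalized equation into the distributional one for smooth test functions.\<close>
 have gl': "loc_int \<Omega> (\<lambda>x. norm (g x) powr q)"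
 proof (rule gradient_power_loc_int[OF gm gl[unfolded G_def]])
  fix S :: "'a set" assume S: "compact S" "S \<subseteq> \<Omega>"
  show "\<exists>M. \<forall>\<phi>. test_fun (\<Omega> - F) \<phi> \<and> supp \<phi> \<subseteq> S \<and> (\<forall>x. 0 \<le> \<phi> x \<and> \<phi> x \<le> 1) \<longrightarrow>
   (Leb x. eqint p q (g x) (grad \<phi> x) (\<phi> x)) \<le> M"
  proof (intro exI allI impI, elim conjE)
   fix \<phi> assume \<phi>: "test_fun (\<Omega> - F) \<phi>" "supp \<phi> \<subseteq> S" "\<forall>x. 0 \<le> \<phi> x \<and> \<phi> x \<le> 1"
   have t: "test_fun G \<phi>" using \<phi>(1) by (simp add: G_def)
   have t': "continuous_on UNIV \<phi>" "compact (supp \<phi>)" "supp \<phi> \<subseteq> G" using t by (auto simp: test_fun_iff smooth_continuous)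
   have "(\<integral>x. eqint p q (g x) (grad \<phi> x) (ext_fun (\<lambda>t. 1) (u x) * \<phi> x) \<partial>lebesgue_on G)
    = sintegral \<mu>0 (\<lambda>x. ext_fun (\<lambda>t. 1) (v x) * \<phi> x) + ext_fun (\<lambda>t. 1) \<infinity> * (\<integral>x. \<phi> x \<partial>\<sigma>p) - ext_fun (\<lambda>t. 1) (-\<infinity>) * (\<integral>x. \<phi> x \<partial>\<sigma>m)"
   proof (rule renormalized_equationD[OF eqn renorm_fun_const _ t', of "?N + 1"])
    show "in_W1p (?N + 1) G \<phi>" by (rule test_fun_in_W1p(1)[OF Go t]) simp
    show "in_W1p p G (\<lambda>x. ext_fun (\<lambda>t. 1) (u x) * \<phi> x)" using test_fun_in_W1p(1)[OF Go t p0] by (simp add: ext_const)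
    show "weak_gradient G (\<lambda>x. ext_fun (\<lambda>t. 1) (u x) * \<phi> x) (grad \<phi>)" using test_fun_in_W1p(2)[OF Go t p0] by (simp add: ext_const)
   qed simp
   also have "\<dots> \<le> 1 * mass S" by (rule rhs[OF S _ _ \<phi>(2)]) (use \<phi>(3) in \<open>auto simp: ext_const\<close>)
   also have "(\<integral>x. eqint p q (g x) (grad \<phi> x) (ext_fun (\<lambda>t. 1) (u x) * \<phi> x) \<partial>lebesgue_on G)
    = (Leb x. eqint p q (g x) (grad \<phi> x) (\<phi> x))"
    unfolding ext_const mult_1 by (rule integral_lebesgue_on[OF Gl]) (simp add: g_out)
   finally show "(Leb x. eqint p q (g x) (grad \<phi> x) (\<phi> x)) \<le> 1 * mass S" .
  qed
 qed
 \<comment> \<open>Now \<open>h\<close> is the truncation at level \<open>k\<close>, and the linear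
   dependence of the right side on the bound of \<open>h\<close> becomes the factor \<open>k\<close>
   of the energy.\<close>
 have energy: "\<exists>C\<ge>0. \<forall>k>0. (Leb+ x. ennreal (indicator K x * norm (gk k x) powr p)) \<le> ennreal (C * k)"
  if K: "compact K" "K \<subseteq> \<Omega>" for K
  unfolding gk_def
 proof (rule truncation_energy[OF gm gl' gkm[unfolded gk_def[abs_def]] gkl[unfolded gk_def G_def] Tm _ K])
  fix S :: "'a set" assume S: "compact S" "S \<subseteq> \<Omega>"
  show "\<exists>M. \<forall>k \<phi>. 0 < k \<and> test_fun (\<Omega> - F) \<phi> \<and> supp \<phi> \<subseteq> S \<and> (\<forall>x. 0 \<le> \<phi> x \<and> \<phi> x \<le> 1) \<longrightarrow>
   (Leb x. eqint p q (g x) (\<phi> x *\<^sub>R (if \<bar>u x\<bar> \<le> ereal k then g x else 0) + trunc k (u x) *\<^sub>R grad \<phi> x) (trunc k (u x) * \<phi> x)) \<le> k * M"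
  proof (intro exI allI impI, elim conjE)
   fix k :: real and \<phi> assume k: "0 < k" and \<phi>: "test_fun (\<Omega> - F) \<phi>" "supp \<phi> \<subseteq> S" "\<forall>x. 0 \<le> \<phi> x \<and> \<phi> x \<le> 1"
   have t: "test_fun G \<phi>" using \<phi>(1) by (simp add: G_def)
   have t': "continuous_on UNIV \<phi>" "compact (supp \<phi>)" "supp \<phi> \<subseteq> G" and sm: "smooth \<phi>" using t by (auto simp: test_fun_iff smooth_continuous)
   have ek: "ext_fun (clip k) s = trunc k s" for s by (rule trunc_ext_fun[OF k])
   define w where "w x = \<phi> x *\<^sub>R gk k x + trunc k (u x) *\<^sub>R grad \<phi> x" for x
   have ww: "weak_gradient G (\<lambda>x. trunc k (u x) * \<phi> x) w"
    unfolding w_def by (rule weak_gradient_mult_smooth[OF Go wk[OF k] sm])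
   have \<phi>m[measurable]: "\<phi> \<in> lmeas" "grad \<phi> \<in> lmeas"
    using test_fun_borel[OF t] by (auto intro!: measurable_completion)
   obtain B where "B > 0" "\<And>x. \<bar>\<phi> x\<bar> \<le> B" "\<And>x. norm (grad \<phi> x) \<le> B" using test_fun_bounds[OF t] by blast
   note B = this
   \<comment> \<open>The equation may be tested only if the product with \<open>\<phi>\<close> is in
     the Sobolev space on all of \<open>G\<close>; the compact support of \<open>\<phi>\<close> in
     \<open>G\<close> turns the local integrability of the gradient of the truncation into a global
     one.\<close>
   have Wp: "in_W1p p G (\<lambda>x. trunc k (u x) * \<phi> x)"
   proof -
    have "in_Lp p G (\<lambda>x. trunc k (u x) * \<phi> x)"
    proof (rule bounded_compact_in_Lp[OF Gl t'(2) _ p0])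
     show "norm (trunc k (u x) * \<phi> x) \<le> k * B" for x
      unfolding real_norm_def abs_mult using trunc_bound[OF k, of "u x"] B(2)[of x] k by (intro mult_mono) auto
     show "trunc k (u x) * \<phi> x = 0" if "x \<notin> supp \<phi>" for x using that supp_mem[of \<phi> x] by auto
    qed measurable
    moreover have "in_Lp p G w"
    proof (rule in_Lp_dominated[OF Gl p0, of "\<lambda>x. indicator (supp \<phi>) x *\<^sub>R gk k x" "\<lambda>x. k * indicator (supp \<phi>) x :: real" _ B])
     have sl[measurable]: "supp \<phi> \<in> sets lebesgue" by (rule compact_sets_lebesgue[OF t'(2)])
     have "integrable lebesgue (\<lambda>x. indicator (supp \<phi>) x *\<^sub>R norm (gk k x) powr p)"
      using gkl[OF k] t' by (simp add: loc_int_def set_integrable_def)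
     moreover have "indicator G x *\<^sub>R norm (indicator (supp \<phi>) x *\<^sub>R gk k x) powr p = indicator (supp \<phi>) x *\<^sub>R norm (gk k x) powr p" for x
      using t'(3) by (auto simp: indicator_def)
     moreover have "(\<lambda>x. indicator G x *\<^sub>R (indicator (supp \<phi>) x *\<^sub>R gk k x)) \<in> lmeas" using Gl by measurable
     ultimately show "in_Lp p G (\<lambda>x. indicator (supp \<phi>) x *\<^sub>R gk k x)" unfolding in_Lp_iff[OF Gl] by presburger
     show "in_Lp p G (\<lambda>x. k * indicator (supp \<phi>) x :: real)"
      by (rule bounded_compact_in_Lp[OF Gl t'(2) _ p0, of _ k]) (use k in \<open>auto simp: indicator_def intro!: borel_measurable_times borel_measurable_indicator sl\<close>)
     show "(\<lambda>x. indicator G x *\<^sub>R w x) \<in> lmeas" by (rule loc_int_measurable[OF Go weak_gradient_loc_int(2)[OF Go ww]])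
     show "0 \<le> B" using B(1) by simp
     fix x
     show "norm (w x) \<le> B * (norm (indicator (supp \<phi>) x *\<^sub>R gk k x) + norm (k * indicator (supp \<phi>) x :: real))"
     proof (cases "x \<in> supp \<phi>")
      case True
      have "norm (w x) \<le> \<bar>\<phi> x\<bar> * norm (gk k x) + \<bar>trunc k (u x)\<bar> * norm (grad \<phi> x)"
       unfolding w_def by (rule order_trans[OF norm_triangle_ineq]) simp
      also have "\<dots> \<le> B * norm (gk k x) + k * B"
       using B(2,3)[of x] trunc_bound[OF k, of "u x"] k by (intro add_mono mult_mono) auto
      finally show ?thesis using True k by (simp add: algebra_simps)
     next
      case False
      then have "\<phi> x = 0" "grad \<phi> x = 0" using supp_mem[of \<phi> x] grad_zero_outside[of x \<phi>] by auto
      then show ?thesis using B(1) by (simp add: w_def)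
     qed
    qed
    ultimately show ?thesis using ww by (auto simp: in_W1p_def)
   qed
   have "(\<integral>x. eqint p q (g x) (w x) (ext_fun (clip k) (u x) * \<phi> x) \<partial>lebesgue_on G)
    = sintegral \<mu>0 (\<lambda>x. ext_fun (clip k) (v x) * \<phi> x) + ext_fun (clip k) \<infinity> * (\<integral>x. \<phi> x \<partial>\<sigma>p) - ext_fun (clip k) (-\<infinity>) * (\<integral>x. \<phi> x \<partial>\<sigma>m)"
   proof (rule renormalized_equationD[OF eqn renorm_fun_clip[OF k] _ t', of "?N + 1"])
    show "in_W1p (?N + 1) G \<phi>" by (rule test_fun_in_W1p(1)[OF Go t]) simp
    show "in_W1p p G (\<lambda>x. ext_fun (clip k) (u x) * \<phi> x)" unfolding ek by (rule Wp)
    show "weak_gradient G (\<lambda>x. ext_fun (clip k) (u x) * \<phi> x) w" unfolding ek by (rule ww)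
   qed simp
   also have "\<dots> \<le> k * mass S" by (rule rhs[OF S _ _ \<phi>(2)]) (use \<phi>(3) k trunc_bound[OF k] in \<open>auto simp: ek\<close>)
   also have "(\<integral>x. eqint p q (g x) (w x) (ext_fun (clip k) (u x) * \<phi> x) \<partial>lebesgue_on G)
    = (Leb x. eqint p q (g x) (w x) (trunc k (u x) * \<phi> x))"
    unfolding ek by (rule integral_lebesgue_on[OF Gl]) (simp add: g_out)
   finally show "(Leb x. eqint p q (g x) (\<phi> x *\<^sub>R (if \<bar>u x\<bar> \<le> ereal k then g x else 0) + trunc k (u x) *\<^sub>R grad \<phi> x) (trunc k (u x) * \<phi> x)) \<le> k * mass S"
    by (simp only: w_def gk_def)
  qed
 qed
 have efin: "(Leb+ x. ennreal (indicator K x * norm (gk k x) powr p)) < \<infinity>" if k: "0 < k" and K: "compact K" "K \<subseteq> \<Omega>" for k K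
 proof -
  obtain C where "(Leb+ x. ennreal (indicator K x * norm (gk k x) powr p)) \<le> ennreal (C * k)" using energy[OF K] k by blast
  then show ?thesis by (rule order_le_less_trans) simp
 qed
 note ext = trunc_gradient_extend[OF um gm tg[unfolded G_def] efin[unfolded gk_def]]
 have wk': "weak_gradient \<Omega> (\<lambda>x. trunc k (u x)) (gk k)" if "0 < k" for k
  using ext(1) that by (simp add: trunc_gradient_def gk_def[abs_def])
 have mf: "meas_finite_ae (\<Omega> - F) u" using u by (simp add: locally_renormalized_solution_iff)
 note finite_AE = meas_finite_ae_extend(2)[OF mf]
 have mf': "meas_finite_ae \<Omega> u"
  using um finite_AE by (simp add: meas_finite_ae_def AE_lebesgue_on[OF \<Omega>l] measurable_restrict_space1)
 have Lsig: "in_Lp_loc t \<Omega> (\<lambda>x. real_of_ereal \<bar>u x\<bar> powr (p - 1))" if "1 \<le> t" "p < ?N \<longrightarrow> t < ?N / (?N - p)" for t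
  by (rule energy_integrability(1)[OF \<Omega> um finite_AE gm wk'[unfolded gk_def[abs_def]] energy[unfolded gk_def] p pN that])
 have Ltau: "in_Lp_loc t \<Omega> (\<lambda>x. norm (g x) powr (p - 1))" if "1 \<le> t" "t < ?N / (?N - 1)" for t
  by (rule energy_integrability(2)[OF \<Omega> um finite_AE gm wk'[unfolded gk_def[abs_def]] energy[unfolded gk_def] p pN that])
 define v' where "v' x = (if x \<in> G then v x else 0)" for x
 have qv: "quasicont_rep p \<Omega> u v'"
  unfolding v'_def G_def by (rule quasicont_rep_extend[OF p0 \<Omega> G_open F_subset capF F_AE g0(2)[unfolded G_def]])
 have v'm: "v' \<in> borel_measurable (restrict_space borel \<Omega>)" using qv by (simp add: quasicont_rep_def)
 have equation: "(\<integral>x. eqint p q (g x) (w x) (ext_fun h (u x) * \<phi> x) \<partial>lebesgue_on \<Omega>)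
   = sintegral \<mu>0' (\<lambda>x. ext_fun h (v' x) * \<phi> x) + ext_fun h \<infinity> * (\<integral>x. \<phi> x \<partial>\<sigma>p') - ext_fun h (-\<infinity>) * (\<integral>x. \<phi> x \<partial>\<sigma>m')"
  if h: "renorm_fun h" and m: "?N < m" and \<phi>: "continuous_on UNIV \<phi>" "compact (supp \<phi>)" "supp \<phi> \<subseteq> \<Omega>" "in_W1p m \<Omega> \<phi>"
   and fW: "in_W1p p \<Omega> (\<lambda>x. ext_fun h (u x) * \<phi> x)" and w: "weak_gradient \<Omega> (\<lambda>x. ext_fun h (u x) * \<phi> x) w" for h \<phi> m w
 proof -
  define S where "S = supp \<phi>"
  have S: "compact S" "S \<subseteq> \<Omega>" using \<phi> by (auto simp: S_def)
  have m1: "1 < m" "0 < m" using m N1 by auto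
  obtain L M R where L: "0 \<le> L" "\<And>x y. \<bar>h x - h y\<bar> \<le> L * \<bar>x - y\<bar>" and M: "0 \<le> M" "\<And>x. \<bar>h x\<bar> \<le> M"
   and R: "0 < R" "\<And>x. R \<le> x \<Longrightarrow> h x = h R" "\<And>x. x \<le> - R \<Longrightarrow> h x = h (- R)"
   using renorm_fun_properties[OF h] by metis
  have eh: "ext_fun h t = h (trunc R t)" for t by (rule ext_fun_trunc[OF R])
  define f where "f x = ext_fun h (u x) * \<phi> x" for x
  have hm[measurable]: "h \<in> bmeas" using h by (intro borel_measurable_continuous_onI) (simp add: renorm_fun_def)
  have \<phi>b[measurable]: "\<phi> \<in> bmeas" using \<phi>(1) by (rule borel_measurable_continuous_onI)
  have \<phi>m[measurable]: "\<phi> \<in> lmeas" by (rule measurable_completion) simp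
  have fm[measurable]: "f \<in> lmeas" unfolding f_def eh by measurable
  have \<phi>0: "\<phi> x = 0" if "x \<notin> S" for x using that supp_mem[of \<phi> x] by (auto simp: S_def)
  obtain B where B: "B > 0" "\<And>x. norm (\<phi> x) \<le> B" using bounded_on_supp[OF \<phi>(1) S(1) \<phi>0] by blast
  have ehb: "\<bar>ext_fun h t\<bar> \<le> M" for t unfolding eh by (rule M(2))
  have fb: "\<bar>f x\<bar> \<le> M * B" for x
   unfolding f_def abs_mult using ehb[of "u x"] B(2)[of x] M(1) by (intro mult_mono) auto
  have f0: "f x = 0" if "x \<notin> S" for x using \<phi>0[OF that] by (simp add: f_def)
  obtain g\<phi> where g\<phi>: "weak_gradient \<Omega> \<phi> g\<phi>" "in_Lp m \<Omega> g\<phi>" using \<phi>(4) by (auto simp: in_W1p_def)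
  have wf: "weak_gradient \<Omega> f w" using w by (simp add: f_def[abs_def])
  obtain \<eta> where \<eta>: "cutoffs S \<eta>" using cutoffs_exist[OF S] by blast
  have Sl[measurable]: "S \<in> sets lebesgue" using S(1) by (rule compact_sets_lebesgue)
  have wm: "(\<lambda>x. indicator \<Omega> x *\<^sub>R w x) \<in> lmeas" by (rule loc_int_measurable[OF \<Omega> weak_gradient_loc_int(2)[OF \<Omega> wf]])
  define H where "H x = eqint p q (g x) (w x) (f x)" for x
  have H0: "H x = 0" if "x \<notin> G" for x using g_out[OF that] by (simp add: H_def)
  have Hm: "H \<in> lmeas"
  proof -
   note [measurable] = wm
   have "(\<lambda>x. eqint p q (g x) (indicator \<Omega> x *\<^sub>R w x) (f x)) \<in> lmeas" by measurable
   moreover have "eqint p q (g x) (indicator \<Omega> x *\<^sub>R w x) (f x) = H x" for x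
    using g_out[of x] G\<Omega> by (cases "x \<in> \<Omega>") (auto simp: H_def)
   ultimately show ?thesis by simp
  qed
  \<comment> \<open>The increments of a product: \<open>M\<close> bounds the factor at the increment
    of \<open>\<phi>\<close>, \<open>L * B\<close> the one at the increment of the
    truncation.\<close>
  define C where "C = max M (L * B)"
  have C: "0 \<le> C" "M \<le> C" "L * B \<le> C" using M(1) by (auto simp: C_def)
  have lip: "\<bar>f x - f y\<bar> \<le> C * (\<bar>trunc R (u x) - trunc R (u y)\<bar> + \<bar>\<phi> x - \<phi> y\<bar>)" for x y
  proof -
   have "f x - f y = h (trunc R (u x)) * (\<phi> x - \<phi> y) + \<phi> y * (h (trunc R (u x)) - h (trunc R (u y)))"
    by (simp add: f_def eh algebra_simps)
   then have "\<bar>f x - f y\<bar> \<le> \<bar>h (trunc R (u x))\<bar> * \<bar>\<phi> x - \<phi> y\<bar> + \<bar>\<phi> y\<bar> * \<bar>h (trunc R (u x)) - h (trunc R (u y))\<bar>"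
    by (simp add: abs_mult[symmetric] abs_triangle_ineq)
   also have "\<dots> \<le> C * \<bar>\<phi> x - \<phi> y\<bar> + C * \<bar>trunc R (u x) - trunc R (u y)\<bar>"
   proof (rule add_mono)
    show "\<bar>h (trunc R (u x))\<bar> * \<bar>\<phi> x - \<phi> y\<bar> \<le> C * \<bar>\<phi> x - \<phi> y\<bar>"
     using order_trans[OF M(2) C(2)] by (intro mult_right_mono) auto
    have "\<bar>\<phi> y\<bar> * \<bar>h (trunc R (u x)) - h (trunc R (u y))\<bar> \<le> B * (L * \<bar>trunc R (u x) - trunc R (u y)\<bar>)"
     using B(1) B(2)[of y] by (intro mult_mono L(2)) auto
    also have "\<dots> = (L * B) * \<bar>trunc R (u x) - trunc R (u y)\<bar>" by simp
    also have "\<dots> \<le> C * \<bar>trunc R (u x) - trunc R (u y)\<bar>" by (rule mult_right_mono[OF C(3)]) simp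
    finally show "\<bar>\<phi> y\<bar> * \<bar>h (trunc R (u x)) - h (trunc R (u y))\<bar> \<le> C * \<bar>trunc R (u x) - trunc R (u y)\<bar>" .
   qed
   finally show ?thesis by (simp add: distrib_left add.commute)
  qed
  have wb: "ae_on \<Omega> (\<lambda>x. norm (w x) \<le> ?N * (C * (norm (gk R x) + norm (g\<phi> x))))"
   by (rule weak_gradient_lipschitz_norm[OF \<Omega> wf wk'[OF R(1)] g\<phi>(1) C(1) lip])
  \<comment> \<open>\<open>w\<close> is an arbitrary weak gradient, so its vanishing where
    \<open>f\<close> does has to be deduced: on the open set off \<open>S\<close> the increments of
    \<open>f\<close> are 0, and the Lipschitz bound is used with constant 0.\<close>
  have w0: "ae_on (\<Omega> - S) (\<lambda>x. w x = 0)"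
  proof -
   have o: "open (\<Omega> - S)" using \<Omega> S(1) by (intro open_Diff compact_imp_closed)
   have ws: "weak_gradient (\<Omega> - S) f w" by (rule weak_gradient_mono[OF \<Omega> o _ wf]) auto
   have "ae_on (\<Omega> - S) (\<lambda>x. norm (w x) \<le> ?N * (0 * (norm (w x) + norm (w x))))"
    by (rule weak_gradient_lipschitz_norm[OF o ws ws ws]) (auto simp: f0)
   then show ?thesis by eventually_elim auto
  qed
  \<comment> \<open>The conjugate exponent of \<open>m\<close>. The condition \<open>m > N\<close>
    is the same as \<open>t < N / (N - 1)\<close>, so the power \<open>p - 1\<close> of the gradient
    is locally in \<open>L^t\<close> and can be paired with the gradient of \<open>\<phi>\<close> in
    \<open>L^m\<close>.\<close>
  define t where "t = m / (m - 1)"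
  have t: "1 < t" "t < ?N / (?N - 1)" "1 / t + 1 / m = 1"
  proof -
   show "1 < t" using m1 by (simp add: t_def less_divide_eq)
   show "t < ?N / (?N - 1)" unfolding t_def using m m1 N1 by (simp add: divide_simps algebra_simps)
   show "1 / t + 1 / m = 1" using m1 by (simp add: t_def divide_simps)
  qed
  define E where "E x = indicator S x * norm (gk R x) powr p" for x
  define P where "P x = indicator S x * norm (g x) powr ((p - 1) * t)" for x
  define Q where "Q x = indicator S x * norm (g\<phi> x) powr m" for x
  define Y where "Y x = indicator S x * norm (g x) powr q" for x
  have iE: "integrable lebesgue E"
   unfolding E_def by (rule integrableI_nonneg) (use efin[OF R(1) S] in auto)
  have iP: "integrable lebesgue P"
   using in_Lp_loc_powr[OF Ltau[OF less_imp_le[OF t(1)] t(2)]] S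
   by (simp add: loc_int_def set_integrable_def P_def[abs_def] powr_powr)
  have iY: "integrable lebesgue Y" using gl' S by (simp add: loc_int_def set_integrable_def Y_def[abs_def])
  have iQ: "integrable lebesgue Q"
  proof -
   have "integrable lebesgue (\<lambda>x. indicator \<Omega> x *\<^sub>R norm (g\<phi> x) powr m)" using g\<phi>(2) by (simp add: in_Lp_iff[OF \<Omega>l])
   from integrable_mult_indicator[OF Sl this]
   have "integrable lebesgue (\<lambda>x. indicator S x *\<^sub>R (indicator \<Omega> x *\<^sub>R norm (g\<phi> x) powr m))" .
   moreover have "indicator S x *\<^sub>R (indicator \<Omega> x *\<^sub>R norm (g\<phi> x) powr m) = Q x" for x
    using S(2) by (auto simp: Q_def indicator_def)
   ultimately show ?thesis by simp
  qed
  \<comment> \<open>In the bound for \<open>w\<close>, the part from the truncation, multiplied by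
    the power \<open>p - 1\<close> of the gradient, gives the energy density \<open>E\<close>; the
    part from \<open>\<phi>\<close> is estimated by \<open>P\<close> and \<open>Q\<close>, and the
    lower order term by \<open>Y\<close>.\<close>
  have iH: "integrable lebesgue H"
  proof (rule integrable_le[OF _ Hm])
   show "integrable lebesgue (\<lambda>x. ?N * C * (E x + (P x + Q x)) + M * B * Y x)" using iE iP iQ iY by auto
   show "AE x in lebesgue. norm (H x) \<le> norm (?N * C * (E x + (P x + Q x)) + M * B * Y x)"
    using wb w0
   proof eventually_elim
    case (elim x)
    have bound: "norm (H x) \<le> ?N * C * (E x + (P x + Q x)) + M * B * Y x"
    proof (cases "x \<in> S")
     case False
     have "H x = 0"
     proof (cases "x \<in> G")
      case True
      then have "w x = 0" using elim False G\<Omega> by auto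
      then show ?thesis using f0[OF False] by (simp add: H_def)
     qed (rule H0)
     then show ?thesis using False by (simp add: E_def P_def Q_def Y_def)
    next
     case True
     then have x\<Omega>: "x \<in> \<Omega>" using S(2) by auto
     have wx: "norm (w x) \<le> ?N * (C * (norm (gk R x) + norm (g\<phi> x)))" using elim x\<Omega> by blast
     have "norm (g x) powr (p - 2) * \<bar>g x \<bullet> w x\<bar> \<le> norm (g x) powr (p - 2) * (norm (g x) * norm (w x))"
      by (intro mult_left_mono Cauchy_Schwarz_ineq2) simp
     also have "\<dots> = norm (g x) powr (p - 1) * norm (w x)" unfolding powr_mult_norm[symmetric] by simp
     also have "\<dots> \<le> norm (g x) powr (p - 1) * (?N * (C * (norm (gk R x) + norm (g\<phi> x))))" by (intro mult_left_mono wx) simp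
     also have "\<dots> = ?N * C * (norm (g x) powr (p - 1) * norm (gk R x) + norm (g x) powr (p - 1) * norm (g\<phi> x))"
      by (simp add: algebra_simps)
     also have "\<dots> \<le> ?N * C * (E x + (P x + Q x))"
     proof (intro mult_left_mono add_mono)
      show "norm (g x) powr (p - 1) * norm (gk R x) \<le> E x"
      proof (cases "\<bar>u x\<bar> \<le> ereal R")
       case r1: True
       have "norm (g x) powr (p - 1) * norm (g x) = norm (g x) powr p" using powr_mult_norm[of "g x" "p + 1"] by simp
       then show ?thesis using r1 True by (simp add: E_def gk_def)
      qed (simp add: E_def gk_def)
      have "norm (g x) powr (p - 1) * norm (g\<phi> x) \<le> 1 powr t * (norm (g x) powr (p - 1)) powr t + 1 powr (- m) * norm (g\<phi> x) powr m"
       by (rule young_scaled[OF t(1) m1(1) t(3)]) auto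
      then show "norm (g x) powr (p - 1) * norm (g\<phi> x) \<le> P x + Q x" using True by (simp add: P_def Q_def powr_powr)
     qed (use C(1) in auto)
     finally have 1: "norm (g x) powr (p - 2) * \<bar>g x \<bullet> w x\<bar> \<le> ?N * C * (E x + (P x + Q x))" .
     have "norm (g x) powr q * \<bar>f x\<bar> \<le> norm (g x) powr q * (M * B)" by (intro mult_left_mono fb) simp
     then have 2: "norm (g x) powr q * \<bar>f x\<bar> \<le> M * B * Y x" using True by (simp add: Y_def mult.commute)
     have "norm (H x) \<le> norm (g x) powr (p - 2) * \<bar>g x \<bullet> w x\<bar> + norm (g x) powr q * \<bar>f x\<bar>"
      unfolding H_def real_norm_def by (rule order_trans[OF abs_triangle_ineq]) (simp add: abs_mult)
     then show ?thesis using 1 2 by linarith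
    qed
    also have "\<dots> \<le> norm (?N * C * (E x + (P x + Q x)) + M * B * Y x)" by simp
    finally show ?case .
   qed
  qed
  have l1: "(\<lambda>n. (Leb x. (1 - \<eta> n x) * H x - f x * (norm (g x) powr (p - 2) * (g x \<bullet> grad (\<eta> n) x)))) \<longlonglongrightarrow> (Leb x. H x)"
   by (rule cutoff_equation_limit[OF \<eta> S gm gl' fm fb f0 iH])
  define fv where "fv x = ext_fun h (v' x) * \<phi> x" for x
  have fvm: "fv \<in> borel_measurable (restrict_space borel \<Omega>)"
  proof -
   have "\<phi> \<in> borel_measurable (restrict_space borel \<Omega>)" using \<phi>b by (rule measurable_restrict_space1)
   with v'm show ?thesis unfolding fv_def eh trunc_def by measurable
  qed
  have \<phi>r: "\<phi> \<in> borel_measurable (restrict_space borel \<Omega>)" using \<phi>b by (rule measurable_restrict_space1)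
  have fvb: "\<bar>fv x\<bar> \<le> M * B" for x
   unfolding fv_def abs_mult using ehb[of "v' x"] B(2)[of x] M(1) by (intro mult_mono) auto
  have fv0: "fv x = 0" if "x \<notin> S" for x using \<phi>0[OF that] by (simp add: fv_def)
  have \<phi>B: "\<bar>\<phi> x\<bar> \<le> B" for x using B(2)[of x] by simp
  define rhsn where "rhsn n = ((\<integral>x. fv x * (1 - \<eta> n x) \<partial>zero_ext \<Omega> (fst \<mu>0)) - (\<integral>x. fv x * (1 - \<eta> n x) \<partial>zero_ext \<Omega> (snd \<mu>0)))
    + ext_fun h \<infinity> * (\<integral>x. \<phi> x * (1 - \<eta> n x) \<partial>zero_ext \<Omega> \<sigma>p) - ext_fun h (-\<infinity>) * (\<integral>x. \<phi> x * (1 - \<eta> n x) \<partial>zero_ext \<Omega> \<sigma>m)" for n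
  have l2: "rhsn \<longlonglongrightarrow> sintegral \<mu>0' fv + ext_fun h \<infinity> * (\<integral>x. \<phi> x \<partial>\<sigma>p') - ext_fun h (-\<infinity>) * (\<integral>x. \<phi> x \<partial>\<sigma>m')"
   unfolding rhsn_def sintegral_def \<mu>0'_def \<sigma>p'_def \<sigma>m'_def fst_conv snd_conv
   by (intro tendsto_diff tendsto_add tendsto_mult tendsto_const
    cutoff_measure_limit[OF \<eta> r'(1) nullF[OF r(1)] S fvm fvb fv0] cutoff_measure_limit[OF \<eta> r'(2) nullF[OF r(2)] S fvm fvb fv0]
    cutoff_measure_limit[OF \<eta> r'(3) nullF[OF r(3)] S \<phi>r \<phi>B \<phi>0] cutoff_measure_limit[OF \<eta> r'(4) nullF[OF r(4)] S \<phi>r \<phi>B \<phi>0])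
  \<comment> \<open>The product \<open>\<phi> (1 - \<eta> n)\<close> is admissible on the smaller
    set: it is continuous with compact support in \<open>G\<close>, and multiplication by
    \<open>1 - \<eta> n\<close>, smooth with bounded gradient, preserves both Sobolev conditions.
    The integrals over the given measures are rewritten for their extensions.\<close>
  have eqn_n: "(Leb x. (1 - \<eta> n x) * H x - f x * (norm (g x) powr (p - 2) * (g x \<bullet> grad (\<eta> n) x))) = rhsn n" for n
  proof -
   note \<eta>n = cutoffsD(1,3,4)[OF \<eta>, of n]
   define \<phi>n where "\<phi>n x = \<phi> x * (1 - \<eta> n x)" for x
   define wn where "wn x = (1 - \<eta> n x) *\<^sub>R w x - f x *\<^sub>R grad (\<eta> n) x" for x
   have \<eta>c: "continuous_on UNIV (\<eta> n)" by (rule smooth_continuous[OF cutoffsD(2)[OF \<eta>]])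
   have c: "continuous_on UNIV \<phi>n" unfolding \<phi>n_def by (intro continuous_intros \<phi>(1) \<eta>c)
   obtain W where W: "open W" "F \<inter> supp \<phi> \<subseteq> W" "\<And>x. x \<in> W \<Longrightarrow> \<eta> n x = 1" using cutoffsD(5)[OF \<eta>, of n] by (auto simp: S_def)
   have sn: "compact (supp \<phi>n)" "supp \<phi>n \<subseteq> G" unfolding \<phi>n_def G_def using supp_cutoff[OF \<phi>(2,3) W] by auto
   have fn: "(\<lambda>x. ext_fun h (u x) * \<phi>n x) = (\<lambda>x. (ext_fun h (u x) * \<phi> x) * (1 - \<eta> n x))" by (simp add: \<phi>n_def mult.assoc)
   have "(\<integral>x. eqint p q (g x) (wn x) (ext_fun h (u x) * \<phi>n x) \<partial>lebesgue_on G)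
    = sintegral \<mu>0 (\<lambda>x. ext_fun h (v x) * \<phi>n x) + ext_fun h \<infinity> * (\<integral>x. \<phi>n x \<partial>\<sigma>p) - ext_fun h (-\<infinity>) * (\<integral>x. \<phi>n x \<partial>\<sigma>m)"
   proof (rule renormalized_equationD[OF eqn h m c sn])
    show "in_W1p m G \<phi>n" unfolding \<phi>n_def by (rule in_W1p_cutoff(1)[OF Go \<Omega> G\<Omega> m1(2) \<phi>(4) g\<phi>(1) \<eta>n(1) cutoffsD(3,4)[OF \<eta>]])
    show "in_W1p p G (\<lambda>x. ext_fun h (u x) * \<phi>n x)"
     unfolding fn by (rule in_W1p_cutoff(1)[OF Go \<Omega> G\<Omega> p0 fW w \<eta>n(1) cutoffsD(3,4)[OF \<eta>]])
    show "weak_gradient G (\<lambda>x. ext_fun h (u x) * \<phi>n x) wn"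
     unfolding fn wn_def f_def by (rule in_W1p_cutoff(2)[OF Go \<Omega> G\<Omega> p0 fW w \<eta>n(1) cutoffsD(3,4)[OF \<eta>]])
   qed
   also have "(\<integral>x. eqint p q (g x) (wn x) (ext_fun h (u x) * \<phi>n x) \<partial>lebesgue_on G)
    = (Leb x. eqint p q (g x) (wn x) (ext_fun h (u x) * \<phi>n x))"
    by (rule integral_lebesgue_on[OF Gl]) (simp add: g_out)
   also have "\<dots> = (Leb x. (1 - \<eta> n x) * H x - f x * (norm (g x) powr (p - 2) * (g x \<bullet> grad (\<eta> n) x)))"
    by (rule Bochner_Integration.integral_cong) (auto simp: wn_def H_def \<phi>n_def f_def inner_diff_right algebra_simps)
   finally have lhs: "(Leb x. (1 - \<eta> n x) * H x - f x * (norm (g x) powr (p - 2) * (g x \<bullet> grad (\<eta> n) x)))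
    = sintegral \<mu>0 (\<lambda>x. ext_fun h (v x) * \<phi>n x) + ext_fun h \<infinity> * (\<integral>x. \<phi>n x \<partial>\<sigma>p) - ext_fun h (-\<infinity>) * (\<integral>x. \<phi>n x \<partial>\<sigma>m)" .
   have \<eta>r: "\<eta> n \<in> borel_measurable (restrict_space borel \<Omega>)" by (rule measurable_restrict_space1[OF cutoffsD(8)[OF \<eta>]])
   have z1: "(\<integral>x. fv x * (1 - \<eta> n x) \<partial>zero_ext \<Omega> M) = (\<integral>x. ext_fun h (v x) * \<phi>n x \<partial>M)" if M: "pos_radon G M" for M
   proof -
    have "(\<lambda>x. fv x * (1 - \<eta> n x)) \<in> borel_measurable (restrict_space borel \<Omega>)" using fvm \<eta>r by measurable
    then have "(\<integral>x. fv x * (1 - \<eta> n x) \<partial>zero_ext \<Omega> M) = (\<integral>x. fv x * (1 - \<eta> n x) \<partial>M)" by (rule integral_zero_ext[OF Go \<Omega> G\<Omega> M])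
    also have "\<dots> = (\<integral>x. ext_fun h (v x) * \<phi>n x \<partial>M)"
     by (rule Bochner_Integration.integral_cong) (auto simp: pos_radon_space[OF M] fv_def v'_def \<phi>n_def)
    finally show ?thesis .
   qed
   have z2: "(\<integral>x. \<phi> x * (1 - \<eta> n x) \<partial>zero_ext \<Omega> M) = (\<integral>x. \<phi>n x \<partial>M)" if M: "pos_radon G M" for M
   proof -
    have "(\<lambda>x. \<phi> x * (1 - \<eta> n x)) \<in> borel_measurable (restrict_space borel \<Omega>)" using \<phi>r \<eta>r by measurable
    from integral_zero_ext[OF Go \<Omega> G\<Omega> M this] show ?thesis by (simp add: \<phi>n_def)
   qed
   show ?thesis unfolding lhs rhsn_def sintegral_def z1[OF r(1)] z1[OF r(2)] z2[OF r(3)] z2[OF r(4)] ..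
  qed
  from l1 have "rhsn \<longlonglongrightarrow> (Leb x. H x)" unfolding eqn_n .
  from LIMSEQ_unique[OF this l2]
  have "(Leb x. H x) = sintegral \<mu>0' fv + ext_fun h \<infinity> * (\<integral>x. \<phi> x \<partial>\<sigma>p') - ext_fun h (-\<infinity>) * (\<integral>x. \<phi> x \<partial>\<sigma>m')" .
  moreover have "(\<integral>x. H x \<partial>lebesgue_on \<Omega>) = (Leb x. H x)"
   by (rule integral_lebesgue_on[OF \<Omega>l H0]) (use G\<Omega> in auto)
  ultimately show ?thesis by (simp add: H_def f_def fv_def[abs_def])
 qed
 have eqn': "renormalized_equation p q \<Omega> u g v' \<mu>0' \<sigma>p' \<sigma>m'"
  unfolding renormalized_equation_def using equation by blast
 show ?thesis
  unfolding locally_renormalized_solution_iff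
  using mf' ext Lsig Ltau qv dec gl'[folded in_Lp_loc_1_iff] eqn' by blast
qed

end

theorem theorem3p5:
  fixes p q qs :: real
    and \<Omega> F :: "'a::euclidean_space set"
    and \<mu> :: "'a signed"
  assumes "DIM('a) \<ge> 2"
    and "1 < p" and "p \<le> real DIM('a)"
    and "q > p - 1"
    and "qs = q / (q + 1 - p)"
    and "open \<Omega>" and "connected \<Omega>"
    and "closedin (top_of_set \<Omega>) F"
    and "cap qs F = 0"
    and "radon_cap qs \<Omega> \<mu>"
  shows "(q \<le> p \<longrightarrow>
           (\<forall>u. locally_renormalized_solution p q (\<Omega> - F) (srestrict \<mu> (\<Omega> - F)) u \<longrightarrow>
                locally_renormalized_solution p q \<Omega> \<mu> u))
       \<and> (p < q \<longrightarrow>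
           (\<forall>u. weak_solution p q (\<Omega> - F) (srestrict \<mu> (\<Omega> - F)) u \<longrightarrow>
                weak_solution p q \<Omega> \<mu> u))"
proof -
 interpret removable p q qs \<Omega> F by unfold_locales (fact assms)+
 \<comment> \<open>The values of \<open>u\<close> on \<open>F\<close> are arbitrary and may spoil
   measurability. \<open>u\<close> is first replaced by its extension by 0, which does not change
   the solution off \<open>F\<close>; since \<open>F\<close> is null, the conclusion then returns to
   \<open>u\<close>.\<close>
 define z where "z u x = (if x \<in> \<Omega> - F then u x else 0)" for u :: "'a \<Rightarrow> ereal" and x
 have inner: "AE x in lebesgue. x \<in> \<Omega> - F \<longrightarrow> u x = z u x" for u by (simp add: z_def)
 have outer: "AE x in lebesgue. x \<in> \<Omega> \<longrightarrow> z u x = u x" for u using F_AE by eventually_elim (simp add: z_def)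
 have zm: "z u \<in> borel_measurable lebesgue" if "meas_finite_ae (\<Omega> - F) u" for u
  unfolding z_def[abs_def] by (rule meas_finite_ae_extend(1)[OF that])
 show ?thesis
 proof (intro conjI impI allI)
  fix u assume qp: "q \<le> p" and u: "locally_renormalized_solution p q (\<Omega> - F) (srestrict \<mu> (\<Omega> - F)) u"
  have "meas_finite_ae (\<Omega> - F) u" using u by (simp add: locally_renormalized_solution_iff)
  then have "locally_renormalized_solution p q \<Omega> \<mu> (z u)"
   by (intro locally_renormalized_solution_extend assms qp locally_renormalized_solution_cong[OF G_open inner u] zm)
  then show "locally_renormalized_solution p q \<Omega> \<mu> u" by (rule locally_renormalized_solution_cong[OF assms(6) outer])
 next
  fix u assume pq: "p < q" and u: "weak_solution p q (\<Omega> - F) (srestrict \<mu> (\<Omega> - F)) u"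
  have "meas_finite_ae (\<Omega> - F) u" using u by (simp add: weak_solution_def)
  then have "weak_solution p q \<Omega> \<mu> (z u)"
   by (intro weak_solution_extend assms pq weak_solution_cong[OF G_open inner u] zm)
  then show "weak_solution p q \<Omega> \<mu> u" by (rule weak_solution_cong[OF assms(6) outer])
 qed
qed

end
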